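(* Let $K$ be a commutative ring and $f=a_0x^d+\cdots+a_d\in K[x]$ a polynomial whose content ideal $\mathfrak c=(a_0,\dots,a_d)\subseteq K$ is of depth at least two. Let $A=K[x]/(f)$, $A^{\mathrm{ev}}=A\otimes_KA$, $A'=K[x]/(f,\partial_xf)$, and let $\theta\subseteq A$ be the annihilator of $\partial_xf$ in $A$. Then the Yoneda Ext-algebra of $A$ as an $A^{\mathrm{ev}}$-module is graded commutative and satisfies $$\operatorname{Ext}^{\bullet}_{A^{\mathrm{ev}}}(A,A)\cong A\times_{A'}\frac{(A'\oplus\theta t)[s]}{\big((at)(bt)-abf^{(2)}s;\ a,b\in\theta\big)},$$ where $A,A'$ and $\theta$ are in degree zero, $t$ is of degree $1$, $s$ is central of degree $2$, and $f^{(2)}$ denotes the residue class of the second divided derivative of $f$ in $A'$. In particular, the even Yoneda Ext-algebra $\operatorname{Ext}^{\mathrm{even}}_{A^{\mathrm{ev}}}(A,A)=\bigoplus_{i\ge0}\operatorname{Ext}^{2i}_{A^{\mathrm{ev}}}(A,A)$ is the fibre product of the ring $A$ over $A'$ with the polynomial ring $A'[s]$ in one variable of degree $2$: $$\operatorname{Ext}^{\mathrm{even}}_{A^{\mathrm{ev}}}(A,A)\cong A\times_{A'}A'[s].$$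
   Context: Depth at least two for the content ideal means $\operatorname{Hom}_K(K/\mathfrak c,K)=0=\operatorname{Ext}^1_K(K/\mathfrak c,K)$. $\partial_xf$ is the ordinary derivative. The second divided derivative of $f$ is the coefficient of $(dx)^2$ in the Taylor expansion of $f(x+dx)\in K[x,dx]$ (twice it is the ordinary second derivative). The annihilator is $\theta=\big((f):_{K[x]}\partial_xf\big)/(f)$; since $\theta\cdot\partial_xf=0$ in $A$, it is naturally an $A'$-module. $A$ is an $A^{\mathrm{ev}}$-module via multiplication. The algebra $\frac{(A'\oplus\theta t)[s]}{((at)(bt)-abf^{(2)}s;\,a,b\in\theta)}$ is the graded $A'$-algebra generated by the $A'$-module $\theta t\cong\theta$ in degree $1$ and a central element $s$ of degree $2$, with multiplication given by $(at)(bt)=abf^{(2)}s$ for $a,b\in\theta$ (with $abf^{(2)}$ taken in $A'$): it is $A's^i$ in degree $2i$ and $\theta t\,s^i$ in degree $2i+1$. The fibre product is over the projection $A\to A'$ and the projection of the displayed graded algebras (resp. of $A'[s]$) onto their degree zero part $A'$. Thus the Ext-algebra has $A$ in degree $0$, $A's^i$ in degree $2i$ for $i\ge1$, and $\theta ts^i$ in degree $2i+1$ for $i\ge0$. *)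

theory Defs
  imports "HOL-Algebra.Algebra"
begin

section \<open>Linear algebra over a commutative ring\<close>

text \<open>
  A \<open>K\<close>-algebra, commutative or not, is represented by the record type \<open>module\<close> of HOL-Algebra,
  which carries both a ring structure and a scalar multiplication. For plain modules the fields
  \<open>mult\<close> and \<open>one\<close> are irrelevant.
\<close>

definition reg_module :: "('r, 'x) ring_scheme \<Rightarrow> ('r, 'r) module" where
  "reg_module R = \<lparr>carrier = carrier R, monoid.mult = monoid.mult R, one = one R,
     ring.zero = ring.zero R, ring.add = ring.add R, smult = monoid.mult R\<rparr>"

definition restrict_scalars ::
    "('k \<Rightarrow> 'r) \<Rightarrow> ('r, 'm, 'y) module_scheme \<Rightarrow> ('k, 'm) module" where
  "restrict_scalars \<phi> M = \<lparr>carrier = carrier M, monoid.mult = monoid.mult M, one = one M,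
     ring.zero = ring.zero M, ring.add = ring.add M, smult = (\<lambda>c x. \<phi> c \<odot>\<^bsub>M\<^esub> x)\<rparr>"

text \<open>The quotient by a submodule (or, as an algebra, by an ideal): \<open>FactRing\<close> together with the
  induced scalar multiplication.\<close>

definition lin_quot :: "('r, 'm, 'y) module_scheme \<Rightarrow> 'm set \<Rightarrow> ('r, 'm set) module" where
  "lin_quot M N = \<lparr>carrier = carrier (M Quot N), monoid.mult = monoid.mult (M Quot N),
     one = one (M Quot N), ring.zero = ring.zero (M Quot N), ring.add = ring.add (M Quot N),
     smult = (\<lambda>r U. \<Union>x\<in>U. N +>\<^bsub>M\<^esub> (r \<odot>\<^bsub>M\<^esub> x))\<rparr>"

text \<open>Homomorphisms are extensional, so that they form a module under pointwise operations.\<close>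

definition mod_hom :: "('r, 'x) ring_scheme \<Rightarrow> ('r, 'm, 'y) module_scheme \<Rightarrow>
    ('r, 'n, 'z) module_scheme \<Rightarrow> ('m \<Rightarrow> 'n) set" where
  "mod_hom R M N = {h \<in> carrier M \<rightarrow>\<^sub>E carrier N.
     (\<forall>x\<in>carrier M. \<forall>y\<in>carrier M. h (x \<oplus>\<^bsub>M\<^esub> y) = h x \<oplus>\<^bsub>N\<^esub> h y) \<and>
     (\<forall>r\<in>carrier R. \<forall>x\<in>carrier M. h (r \<odot>\<^bsub>M\<^esub> x) = r \<odot>\<^bsub>N\<^esub> h x)}"

text \<open>The free module on a set \<open>S\<close>: finitely supported functions, extended by zero outside \<open>S\<close>.\<close>

definition free_module :: "('r, 'x) ring_scheme \<Rightarrow> 'b set \<Rightarrow> ('r, 'b \<Rightarrow> 'r) module" where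
  "free_module R S = \<lparr>
     carrier = {v. range v \<subseteq> carrier R \<and> {b. v b \<noteq> \<zero>\<^bsub>R\<^esub>} \<subseteq> S \<and> finite {b. v b \<noteq> \<zero>\<^bsub>R\<^esub>}},
     monoid.mult = undefined, one = undefined,
     ring.zero = (\<lambda>b. \<zero>\<^bsub>R\<^esub>), ring.add = (\<lambda>v w b. v b \<oplus>\<^bsub>R\<^esub> w b), smult = (\<lambda>r v b. r \<otimes>\<^bsub>R\<^esub> v b)\<rparr>"

definition lin_ext :: "('r, 'x) ring_scheme \<Rightarrow> ('r, 'm, 'y) module_scheme \<Rightarrow> ('b \<Rightarrow> 'm) \<Rightarrow>
    ('b \<Rightarrow> 'r) \<Rightarrow> 'm" where
  "lin_ext R M g v = (\<Oplus>\<^bsub>M\<^esub>b\<in>{b. v b \<noteq> \<zero>\<^bsub>R\<^esub>}. v b \<odot>\<^bsub>M\<^esub> g b)"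


section \<open>The standard free resolution\<close>

text \<open>
  Every module \<open>M\<close> over a commutative ring \<open>R\<close> has a standard free resolution: the basis in degree
  \<open>0\<close> is \<open>M\<close> itself, and the basis in degree \<open>n + 1\<close> consists of all formal linear combinations
  of basis elements of degree \<open>n\<close> which represent cycles of the augmented complex. Representing
  formal linear combinations by lists of pairs makes all the bases inhabit a single type.
\<close>

datatype ('r, 'm) cell = Gen 'm | Syz "(('r, 'm) cell \<times> 'r) list"

primrec syz_vec :: "('r, 'x) ring_scheme \<Rightarrow> ('b \<times> 'r) list \<Rightarrow> 'b \<Rightarrow> 'r" where
  "syz_vec R [] = (\<lambda>b. \<zero>\<^bsub>R\<^esub>)"
| "syz_vec R (p # l) = (\<lambda>b. (if b = fst p then snd p else \<zero>\<^bsub>R\<^esub>) \<oplus>\<^bsub>R\<^esub> syz_vec R l b)"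

primrec cell_bd :: "('r, 'x) ring_scheme \<Rightarrow> ('r, 'm) cell \<Rightarrow> ('r, 'm) cell \<Rightarrow> 'r" where
  "cell_bd R (Gen m) = (\<lambda>b. \<zero>\<^bsub>R\<^esub>)"
| "cell_bd R (Syz l) = syz_vec R l"

primrec cell_aug :: "('r, 'm) cell \<Rightarrow> 'm" where
  "cell_aug (Gen m) = m"
| "cell_aug (Syz l) = undefined"

definition res_bd ::
    "('r, 'x) ring_scheme \<Rightarrow> (('r, 'm) cell \<Rightarrow> 'r) \<Rightarrow> (('r, 'm) cell \<Rightarrow> 'r)" where
  "res_bd R = lin_ext R (free_module R UNIV) (cell_bd R)"

definition res_aug :: "('r, 'x) ring_scheme \<Rightarrow> ('r, 'm, 'y) module_scheme \<Rightarrow>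
    (('r, 'm) cell \<Rightarrow> 'r) \<Rightarrow> 'm" where
  "res_aug R M = lin_ext R M cell_aug"

fun cells :: "('r, 'x) ring_scheme \<Rightarrow> ('r, 'm, 'y) module_scheme \<Rightarrow> nat \<Rightarrow> ('r, 'm) cell set" where
  "cells R M 0 = Gen ` carrier M"
| "cells R M (Suc n) = {Syz l | l. set l \<subseteq> cells R M n \<times> carrier R \<and>
     (if n = 0 then res_aug R M (syz_vec R l) = \<zero>\<^bsub>M\<^esub>
      else res_bd R (syz_vec R l) = (\<lambda>b. \<zero>\<^bsub>R\<^esub>))}"

record ('r, 'p) chain_complex =
  obj :: "int \<Rightarrow> ('r, 'p) module"
  bd :: "int \<Rightarrow> 'p \<Rightarrow> 'p"  \<comment> \<open>\<open>bd P i\<close> maps \<open>obj P i\<close> to \<open>obj P (i - 1)\<close>\<close>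

definition std_res :: "('r, 'x) ring_scheme \<Rightarrow> ('r, 'm, 'y) module_scheme \<Rightarrow>
    ('r, ('r, 'm) cell \<Rightarrow> 'r) chain_complex" where
  "std_res R M = \<lparr>obj = (\<lambda>i. free_module R (if i < 0 then {} else cells R M (nat i))),
     bd = (\<lambda>i. res_bd R)\<rparr>"

lemma free_module_module:
  assumes "cring R"
  shows "module R (free_module R S)"
proof -
  interpret R: cring R by (fact assms)
  have fin: "finite {b. v b \<oplus>\<^bsub>R\<^esub> w b \<noteq> \<zero>\<^bsub>R\<^esub>}"
    if "finite {b. v b \<noteq> \<zero>\<^bsub>R\<^esub>}" "finite {b. w b \<noteq> \<zero>\<^bsub>R\<^esub>}" for v w :: "_ \<Rightarrow> 'a"
    by (rule finite_subset[OF _ finite_UnI[OF that]]) auto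
  have nz: "a \<noteq> \<zero>\<^bsub>R\<^esub> \<or> b \<noteq> \<zero>\<^bsub>R\<^esub>" if "a \<oplus>\<^bsub>R\<^esub> b \<noteq> \<zero>\<^bsub>R\<^esub>" for a b
    using that by auto
  have nz': "b \<noteq> \<zero>\<^bsub>R\<^esub>" if "a \<otimes>\<^bsub>R\<^esub> b \<noteq> \<zero>\<^bsub>R\<^esub>" "a \<in> carrier R" for a b
    using that by auto
  have fin': "finite {b. r \<otimes>\<^bsub>R\<^esub> v b \<noteq> \<zero>\<^bsub>R\<^esub>}"
    if "finite {b. v b \<noteq> \<zero>\<^bsub>R\<^esub>}" "r \<in> carrier R" for v :: "_ \<Rightarrow> 'a" and r
    by (rule finite_subset[OF _ that(1)]) (use that in auto)
  show ?thesis
  proof (rule moduleI)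
    show "abelian_group (free_module R S)"
    proof (rule abelian_groupI)
      fix v assume v: "v \<in> carrier (free_module R S)"
      have "(\<lambda>b. \<ominus>\<^bsub>R\<^esub> v b) \<in> carrier (free_module R S)"
      proof -
        have "{b. \<ominus>\<^bsub>R\<^esub> v b \<noteq> \<zero>\<^bsub>R\<^esub>} \<subseteq> {b. v b \<noteq> \<zero>\<^bsub>R\<^esub>}" by auto
        then show ?thesis using v
          by (auto simp: free_module_def image_subset_iff intro: finite_subset)
      qed
      moreover have "(\<lambda>b. \<ominus>\<^bsub>R\<^esub> v b) \<oplus>\<^bsub>free_module R S\<^esub> v = \<zero>\<^bsub>free_module R S\<^esub>"
        using v by (auto simp: free_module_def image_subset_iff R.l_neg)
      ultimately show "\<exists>w\<in>carrier (free_module R S). w \<oplus>\<^bsub>free_module R S\<^esub> v = \<zero>\<^bsub>free_module R S\<^esub>"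
        by blast
    qed (auto simp: free_module_def image_subset_iff fin R.a_ac subset_iff dest!: nz)

  qed (auto simp: free_module_def image_subset_iff fin' assms subset_iff R.l_distr R.r_distr R.m_assoc dest: nz')
qed

context module begin

lemma lin_ext_superset:
  assumes "finite T" "{b. v b \<noteq> \<zero>} \<subseteq> T" "range v \<subseteq> carrier R" "g ` T \<subseteq> carrier M"
  shows "lin_ext R M g v = (\<Oplus>\<^bsub>M\<^esub>b\<in>T. v b \<odot>\<^bsub>M\<^esub> g b)"
  unfolding lin_ext_def
proof (rule M.add.finprod_mono_neutral_cong_left)
  show "\<And>i. i \<in> T - {b. v b \<noteq> \<zero>} \<Longrightarrow> v i \<odot>\<^bsub>M\<^esub> g i = \<zero>\<^bsub>M\<^esub>"
    using assms by (auto simp: image_subset_iff)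
qed (use assms in \<open>auto simp: image_subset_iff\<close>)

lemma lin_ext_hom:
  assumes "g ` S \<subseteq> carrier M"
  shows "v \<in> carrier (free_module R S) \<Longrightarrow> lin_ext R M g v \<in> carrier M"
    and "v \<in> carrier (free_module R S) \<Longrightarrow> w \<in> carrier (free_module R S) \<Longrightarrow>
      lin_ext R M g (v \<oplus>\<^bsub>free_module R S\<^esub> w) = lin_ext R M g v \<oplus>\<^bsub>M\<^esub> lin_ext R M g w"
    and "r \<in> carrier R \<Longrightarrow> v \<in> carrier (free_module R S) \<Longrightarrow>
      lin_ext R M g (r \<odot>\<^bsub>free_module R S\<^esub> v) = r \<odot>\<^bsub>M\<^esub> lin_ext R M g v"
    and "b \<in> S \<Longrightarrow> lin_ext R M g (\<lambda>x. if x = b then \<one> else \<zero>) = g b"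
proof -
  assume v: "v \<in> carrier (free_module R S)"
  show "lin_ext R M g v \<in> carrier M"
    unfolding lin_ext_def using v assms
    by (intro M.finsum_closed) (auto simp: free_module_def image_subset_iff)
next
  assume v: "v \<in> carrier (free_module R S)" and w: "w \<in> carrier (free_module R S)"
  let ?T = "{b. v b \<noteq> \<zero>} \<union> {b. w b \<noteq> \<zero>}"
  have T: "finite ?T" "g ` ?T \<subseteq> carrier M" "range v \<subseteq> carrier R" "range w \<subseteq> carrier R"
    using v w assms by (simp_all add: free_module_def image_subset_iff subset_iff, blast)
  have "lin_ext R M g (v \<oplus>\<^bsub>free_module R S\<^esub> w) = (\<Oplus>\<^bsub>M\<^esub>b\<in>?T. (v b \<oplus> w b) \<odot>\<^bsub>M\<^esub> g b)"
    using T by (subst lin_ext_superset[of ?T]) (auto simp: free_module_def image_subset_iff)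
  also have "\<dots> = (\<Oplus>\<^bsub>M\<^esub>b\<in>?T. v b \<odot>\<^bsub>M\<^esub> g b \<oplus>\<^bsub>M\<^esub> w b \<odot>\<^bsub>M\<^esub> g b)"
    by (rule M.finsum_cong') (use T in \<open>auto simp: image_subset_iff smult_l_distr\<close>)
  also have "\<dots> = (\<Oplus>\<^bsub>M\<^esub>b\<in>?T. v b \<odot>\<^bsub>M\<^esub> g b) \<oplus>\<^bsub>M\<^esub> (\<Oplus>\<^bsub>M\<^esub>b\<in>?T. w b \<odot>\<^bsub>M\<^esub> g b)"
    by (rule M.finsum_addf) (use T in \<open>auto simp: image_subset_iff\<close>)
  also have "\<dots> = lin_ext R M g v \<oplus>\<^bsub>M\<^esub> lin_ext R M g w"
    using T by (simp add: lin_ext_superset[of ?T])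
  finally show "lin_ext R M g (v \<oplus>\<^bsub>free_module R S\<^esub> w) = lin_ext R M g v \<oplus>\<^bsub>M\<^esub> lin_ext R M g w" .
next
  assume r: "r \<in> carrier R" and v: "v \<in> carrier (free_module R S)"
  let ?T = "{b. v b \<noteq> \<zero>}"
  have T: "finite ?T" "g ` ?T \<subseteq> carrier M" "range v \<subseteq> carrier R"
    using v assms by (simp_all add: free_module_def image_subset_iff subset_iff, blast)
  have "lin_ext R M g (r \<odot>\<^bsub>free_module R S\<^esub> v) = (\<Oplus>\<^bsub>M\<^esub>b\<in>?T. (r \<otimes> v b) \<odot>\<^bsub>M\<^esub> g b)"
    using T r by (subst lin_ext_superset[of ?T]) (auto simp: free_module_def)
  also have "\<dots> = (\<Oplus>\<^bsub>M\<^esub>b\<in>?T. r \<odot>\<^bsub>M\<^esub> (v b \<odot>\<^bsub>M\<^esub> g b))"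
    by (rule M.finsum_cong') (use T r in \<open>auto simp: image_subset_iff smult_assoc1\<close>)
  also have "\<dots> = r \<odot>\<^bsub>M\<^esub> lin_ext R M g v"
    unfolding lin_ext_def
    by (rule finsum_smult_ldistr[symmetric]) (use T r in \<open>auto simp: image_subset_iff\<close>)
  finally show "lin_ext R M g (r \<odot>\<^bsub>free_module R S\<^esub> v) = r \<odot>\<^bsub>M\<^esub> lin_ext R M g v" .
next
  assume b: "b \<in> S"
  show "lin_ext R M g (\<lambda>x. if x = b then \<one> else \<zero>) = g b"
    using b assms by (subst lin_ext_superset[of "{b}"]) auto
qed

end

lemma free_module_delta:
  assumes "cring R" "b \<in> S"
  shows "(\<lambda>x. if x = b then \<one>\<^bsub>R\<^esub> else \<zero>\<^bsub>R\<^esub>) \<in> carrier (free_module R S)"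
proof -
  interpret cring R by fact
  have "{x. (if x = b then \<one>\<^bsub>R\<^esub> else \<zero>\<^bsub>R\<^esub>) \<noteq> \<zero>\<^bsub>R\<^esub>} \<subseteq> {b}" by auto
  then show ?thesis using assms(2)
    by (auto simp: free_module_def intro: finite_subset split: if_splits)
qed

lemma syz_vec_closed:
  assumes "cring R" "set l \<subseteq> S \<times> carrier R"
  shows "syz_vec R l \<in> carrier (free_module R S)"
proof -
  interpret cring R by fact
  show ?thesis using assms(2)
  proof (induction l)
    case Nil
    then show ?case by (auto simp: free_module_def)
  next
    case (Cons p l)
    let ?v = "syz_vec R (p # l)"
    have IH: "syz_vec R l \<in> carrier (free_module R S)" using Cons by simp
    have sub: "{b. ?v b \<noteq> \<zero>\<^bsub>R\<^esub>} \<subseteq> insert (fst p) {b. syz_vec R l b \<noteq> \<zero>\<^bsub>R\<^esub>}"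
      using IH by (auto simp: free_module_def image_subset_iff split: if_splits)
    have p: "fst p \<in> S" "snd p \<in> carrier R" using Cons.prems by auto
    have "finite {b. ?v b \<noteq> \<zero>\<^bsub>R\<^esub>}"
      by (rule finite_subset[OF sub]) (use IH in \<open>auto simp: free_module_def\<close>)
    moreover have "{b. ?v b \<noteq> \<zero>\<^bsub>R\<^esub>} \<subseteq> S"
      using sub IH p by (auto simp: free_module_def simp del: syz_vec.simps)
    moreover have "range ?v \<subseteq> carrier R"
      using IH p by (auto simp: free_module_def image_subset_iff)
    ultimately show ?case by (simp add: free_module_def del: syz_vec.simps)
  qed
qed

lemma syz_vec_surj:
  assumes "cring R" "v \<in> carrier (free_module R S)"
  obtains l where "set l \<subseteq> S \<times> carrier R" "syz_vec R l = v"
proof -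
  interpret cring R by fact
  have v: "range v \<subseteq> carrier R" "{b. v b \<noteq> \<zero>\<^bsub>R\<^esub>} \<subseteq> S" "finite {b. v b \<noteq> \<zero>\<^bsub>R\<^esub>}"
    using assms(2) by (auto simp: free_module_def)
  obtain bs where bs: "set bs = {b. v b \<noteq> \<zero>\<^bsub>R\<^esub>}" "distinct bs"
    using finite_distinct_list[OF v(3)] by blast
  have *: "syz_vec R (map (\<lambda>b. (b, v b)) cs) = (\<lambda>b. if b \<in> set cs then v b else \<zero>\<^bsub>R\<^esub>)"
    if "distinct cs" for cs
    using that v(1) by (induction cs) (auto simp: image_subset_iff)
  show ?thesis
  proof
    show "set (map (\<lambda>b. (b, v b)) bs) \<subseteq> S \<times> carrier R" using bs v by auto
    show "syz_vec R (map (\<lambda>b. (b, v b)) bs) = v" using bs by (auto simp: *)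
  qed
qed

lemma cell_bd_closed:
  assumes "cring R" "b \<in> cells R M (Suc n)"
  shows "cell_bd R b \<in> carrier (free_module R (cells R M n))"
  using assms by (auto intro: syz_vec_closed)

lemma cell_bd_carrier:
  assumes "cring R"
  shows "cell_bd R ` cells R M n \<subseteq> carrier (free_module R UNIV)"
proof (cases n)
  case 0
  interpret cring R by fact
  show ?thesis using 0 by (auto simp: free_module_def)
next
  case (Suc m)
  have "carrier (free_module R (cells R M m)) \<subseteq> carrier (free_module R UNIV)"
    by (auto simp: free_module_def)
  then show ?thesis using cell_bd_closed[OF assms] Suc by blast
qed

text \<open>The standard resolution is indeed a resolution: the augmentation is onto, cycles are
  boundaries, and boundaries are cycles.\<close>

lemma res_aug_surj:
  assumes "module R M" "m \<in> carrier M"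
  shows "\<exists>v\<in>carrier (free_module R (cells R M 0)). res_aug R M v = m"
proof -
  interpret module R M by fact
  have "cell_aug ` cells R M 0 \<subseteq> carrier M" by auto
  from lin_ext_hom(4)[OF this, of "Gen m"] assms(2) show ?thesis
    unfolding res_aug_def
    by (intro bexI[of _ "\<lambda>x. if x = Gen m then \<one>\<^bsub>R\<^esub> else \<zero>\<^bsub>R\<^esub>"])
       (auto intro!: free_module_delta R.cring_axioms)
qed

lemma std_res_exact:
  assumes "module R M" "v \<in> carrier (free_module R (cells R M n))"
    and "if n = 0 then res_aug R M v = \<zero>\<^bsub>M\<^esub> else res_bd R v = (\<lambda>b. \<zero>\<^bsub>R\<^esub>)"
  shows "\<exists>w\<in>carrier (free_module R (cells R M (Suc n))). res_bd R w = v"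
proof -
  interpret module R M by fact
  interpret F: module R "free_module R UNIV :: ('a, ('a, 'c) cell \<Rightarrow> 'a) module"
    by (intro free_module_module R.cring_axioms)
  obtain l where l: "set l \<subseteq> cells R M n \<times> carrier R" "syz_vec R l = v"
    using syz_vec_surj[OF R.cring_axioms assms(2)] by blast
  have S: "Syz l \<in> cells R M (Suc n)" using l assms(3) by auto
  have "res_bd R (\<lambda>x. if x = Syz l then \<one>\<^bsub>R\<^esub> else \<zero>\<^bsub>R\<^esub>) = v"
    unfolding res_bd_def using F.lin_ext_hom(4)[OF cell_bd_carrier[OF R.cring_axioms] S] l(2) by simp
  then show ?thesis using free_module_delta[OF R.cring_axioms S] by blast
qed

lemma lin_ext_comp_zero:
  fixes R :: "('a, 'x) ring_scheme" and M :: "('a, 'c, 'y) module_scheme"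
  assumes R: "cring R" and N: "module R N" and g: "g ` cells R M n \<subseteq> carrier N"
    and z: "\<And>b. b \<in> cells R M (Suc n) \<Longrightarrow> lin_ext R N g (cell_bd R b) = \<zero>\<^bsub>N\<^esub>"
    and w: "w \<in> carrier (free_module R (cells R M (Suc n)))"
  shows "res_bd R w \<in> carrier (free_module R (cells R M n))" "lin_ext R N g (res_bd R w) = \<zero>\<^bsub>N\<^esub>"
proof -
  let ?F = "free_module R (cells R M n)" and ?U = "free_module R UNIV"
  interpret N: module R N by fact
  interpret F: module R ?F by (intro free_module_module R)
  interpret U: module R "free_module R UNIV :: ('a, ('a, 'c) cell \<Rightarrow> 'a) module"
    by (intro free_module_module R)
  have w': "finite {b. w b \<noteq> \<zero>\<^bsub>R\<^esub>}" "{b. w b \<noteq> \<zero>\<^bsub>R\<^esub>} \<subseteq> cells R M (Suc n)" "range w \<subseteq> carrier R"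
    using w by (auto simp: free_module_def)
  have sub: "carrier ?F \<subseteq> carrier ?U" by (auto simp: free_module_def)
  have *: "(\<Oplus>\<^bsub>?U\<^esub>b\<in>T. w b \<odot>\<^bsub>?U\<^esub> cell_bd R b) \<in> carrier ?F \<and>
      lin_ext R N g (\<Oplus>\<^bsub>?U\<^esub>b\<in>T. w b \<odot>\<^bsub>?U\<^esub> cell_bd R b) = \<zero>\<^bsub>N\<^esub>"
    if "finite T" "T \<subseteq> cells R M (Suc n)" for T
    using that
  proof (induction T)
    case empty
    have "\<zero>\<^bsub>?U\<^esub> = \<zero>\<^bsub>?F\<^esub>" by (simp add: free_module_def)
    moreover have "lin_ext R N g \<zero>\<^bsub>?F\<^esub> = \<zero>\<^bsub>N\<^esub>"
      by (simp add: lin_ext_def free_module_def)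
    ultimately show ?case
      using F.zero_closed by (simp only: U.M.finsum_empty)
  next
    case (insert b T)
    let ?s = "\<Oplus>\<^bsub>?U\<^esub>b\<in>T. w b \<odot>\<^bsub>?U\<^esub> cell_bd R b" and ?t = "w b \<odot>\<^bsub>?F\<^esub> cell_bd R b"
    have b: "cell_bd R b \<in> carrier ?F" "w b \<in> carrier R"
      using insert.prems cell_bd_closed[OF R] w'(3) by auto
    have cl: "(\<lambda>b. w b \<odot>\<^bsub>?U\<^esub> cell_bd R b) \<in> insert b T \<rightarrow> carrier ?U"
    proof (intro Pi_I U.smult_closed)
      fix c assume "c \<in> insert b T"
      then have "c \<in> cells R M (Suc n)" using insert.prems by blast
      then show "cell_bd R c \<in> carrier ?U" using cell_bd_closed[OF R] sub by blast
      show "w c \<in> carrier R" using w'(3) by auto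
    qed
    have "(\<Oplus>\<^bsub>?U\<^esub>b\<in>insert b T. w b \<odot>\<^bsub>?U\<^esub> cell_bd R b) = w b \<odot>\<^bsub>?U\<^esub> cell_bd R b \<oplus>\<^bsub>?U\<^esub> ?s"
      using insert.hyps cl by (intro U.M.finsum_insert) auto
    also have "\<dots> = ?t \<oplus>\<^bsub>?F\<^esub> ?s" by (simp add: free_module_def)
    finally have eq: "(\<Oplus>\<^bsub>?U\<^esub>b\<in>insert b T. w b \<odot>\<^bsub>?U\<^esub> cell_bd R b) = ?t \<oplus>\<^bsub>?F\<^esub> ?s" .
    have s: "?s \<in> carrier ?F" "lin_ext R N g ?s = \<zero>\<^bsub>N\<^esub>" using insert by auto
    have t: "?t \<in> carrier ?F" using b by simp
    have "lin_ext R N g ?t = \<zero>\<^bsub>N\<^esub>"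
      using N.lin_ext_hom(3)[OF g b(2,1)] z[of b] insert.prems b by simp
    then show ?case
      unfolding eq using s t N.lin_ext_hom(2)[OF g t s(1)] by simp
  qed
  show "res_bd R w \<in> carrier (free_module R (cells R M n))" "lin_ext R N g (res_bd R w) = \<zero>\<^bsub>N\<^esub>"
    using *[OF w'(1,2)] by (simp_all add: res_bd_def lin_ext_def[of R ?U])
qed

lemma std_res_complex:
  assumes "module R M" "w \<in> carrier (free_module R (cells R M (Suc n)))"
  shows "res_bd R w \<in> carrier (free_module R (cells R M n))"
    and "if n = 0 then res_aug R M (res_bd R w) = \<zero>\<^bsub>M\<^esub> else res_bd R (res_bd R w) = (\<lambda>b. \<zero>\<^bsub>R\<^esub>)"
proof -
  interpret module R M by fact
  interpret U: module R "free_module R UNIV :: ('a, ('a, 'c) cell \<Rightarrow> 'a) module"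
    by (intro free_module_module R.cring_axioms)
  let ?U = "free_module R UNIV :: ('a, ('a, 'c) cell \<Rightarrow> 'a) module"
  have 0: "\<zero>\<^bsub>?U\<^esub> = (\<lambda>b. \<zero>\<^bsub>R\<^esub>)" by (simp add: free_module_def)
  show "res_bd R w \<in> carrier (free_module R (cells R M n))"
  proof (rule lin_ext_comp_zero(1)[OF R.cring_axioms module_axioms, of "\<lambda>_. \<zero>\<^bsub>M\<^esub>"])
    fix b assume "b \<in> cells R M (Suc n)"
    from cell_bd_closed[OF R.cring_axioms this]
    have "range (cell_bd R b) \<subseteq> carrier R" by (auto simp: free_module_def)
    then show "lin_ext R M (\<lambda>_. \<zero>\<^bsub>M\<^esub>) (cell_bd R b) = \<zero>\<^bsub>M\<^esub>"
      unfolding lin_ext_def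
      by (intro M.add.finprod_one_eqI) (auto simp: image_subset_iff)
  qed (use assms(2) in auto)
  show "if n = 0 then res_aug R M (res_bd R w) = \<zero>\<^bsub>M\<^esub> else res_bd R (res_bd R w) = (\<lambda>b. \<zero>\<^bsub>R\<^esub>)"
  proof (cases n)
    case 0
    have "lin_ext R M cell_aug (res_bd R w) = \<zero>\<^bsub>M\<^esub>"
      by (rule lin_ext_comp_zero(2)[OF R.cring_axioms module_axioms _ _ assms(2)])
         (auto simp: 0 res_aug_def)
    then show ?thesis using 0 by (simp add: res_aug_def)
  next
    case (Suc m)
    have "lin_ext R ?U (cell_bd R) (res_bd R w) = \<zero>\<^bsub>?U\<^esub>"
      by (rule lin_ext_comp_zero(2)[OF R.cring_axioms U.module_axioms cell_bd_carrier[OF R.cring_axioms] _ assms(2)])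
         (use Suc in \<open>auto simp: 0 res_bd_def\<close>)
    then show ?thesis using Suc by (simp add: res_bd_def 0)
  qed
qed



section \<open>Ext and the Yoneda product\<close>

text \<open>
  The Hom complex in cohomological grading: a cochain of degree \<open>n\<close> is a family of linear maps from
  \<open>obj P i\<close> to \<open>obj Q (i - n)\<close>, and the differential is \<open>\<phi> \<mapsto> d \<phi> - (-1)\<^sup>n \<phi> d\<close>.
\<close>

definition hom_cpx :: "('r, 'x) ring_scheme \<Rightarrow> ('r, 'p) chain_complex \<Rightarrow>
    ('r, 'q) chain_complex \<Rightarrow> int \<Rightarrow> ('r, int \<Rightarrow> 'p \<Rightarrow> 'q) module" where
  "hom_cpx R P Q n = \<lparr>
     carrier = {\<phi>. \<forall>i. \<phi> i \<in> mod_hom R (obj P i) (obj Q (i - n))},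
     monoid.mult = undefined, one = undefined,
     ring.zero = (\<lambda>i. \<lambda>x\<in>carrier (obj P i). \<zero>\<^bsub>obj Q (i - n)\<^esub>),
     ring.add = (\<lambda>\<phi> \<psi> i. \<lambda>x\<in>carrier (obj P i). \<phi> i x \<oplus>\<^bsub>obj Q (i - n)\<^esub> \<psi> i x),
     smult = (\<lambda>r \<phi> i. \<lambda>x\<in>carrier (obj P i). r \<odot>\<^bsub>obj Q (i - n)\<^esub> \<phi> i x)\<rparr>"

definition hom_bd :: "('r, 'p) chain_complex \<Rightarrow> ('r, 'q) chain_complex \<Rightarrow> int \<Rightarrow>
    (int \<Rightarrow> 'p \<Rightarrow> 'q) \<Rightarrow> (int \<Rightarrow> 'p \<Rightarrow> 'q)" where
  "hom_bd P Q n \<phi> = (\<lambda>i. \<lambda>x\<in>carrier (obj P i).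
     let u = bd Q (i - n) (\<phi> i x); v = \<phi> (i - 1) (bd P i x)
     in if even n then u \<ominus>\<^bsub>obj Q (i - (n + 1))\<^esub> v else u \<oplus>\<^bsub>obj Q (i - (n + 1))\<^esub> v)"

definition cocycles where
  "cocycles R P Q n = {\<phi> \<in> carrier (hom_cpx R P Q n). hom_bd P Q n \<phi> = \<zero>\<^bsub>hom_cpx R P Q (n + 1)\<^esub>}"

definition coboundaries where
  "coboundaries R P Q n = hom_bd P Q (n - 1) ` carrier (hom_cpx R P Q (n - 1))"

text \<open>\<open>Ext\<^sup>n(M, N)\<close> is the group of homotopy classes of chain maps of degree \<open>n\<close> between free
  resolutions of \<open>M\<close> and \<open>N\<close>.\<close>

definition Ext :: "('r, 'x) ring_scheme \<Rightarrow> ('r, 'm, 'y) module_scheme \<Rightarrow>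
    ('r, 'n, 'z) module_scheme \<Rightarrow> nat \<Rightarrow>
    ('r, (int \<Rightarrow> (('r, 'm) cell \<Rightarrow> 'r) \<Rightarrow> (('r, 'n) cell \<Rightarrow> 'r)) set) module" where
  "Ext R M N n =
     lin_quot
       (hom_cpx R (std_res R M) (std_res R N) (int n)
          \<lparr>carrier := cocycles R (std_res R M) (std_res R N) (int n)\<rparr>)
       (coboundaries R (std_res R M) (std_res R N) (int n))"

definition cochain_comp :: "('r, 'p) chain_complex \<Rightarrow> int \<Rightarrow> (int \<Rightarrow> 'q \<Rightarrow> 's) \<Rightarrow>
    (int \<Rightarrow> 'p \<Rightarrow> 'q) \<Rightarrow> (int \<Rightarrow> 'p \<Rightarrow> 's)" where
  "cochain_comp P j \<phi> \<psi> = (\<lambda>i. compose (carrier (obj P i)) (\<phi> (i - j)) (\<psi> i))"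
  \<comment> \<open>\<open>j\<close> is the degree of \<open>\<psi>\<close>\<close>

definition yoneda_mult where
  "yoneda_mult R M i j U V =
     (\<Union>\<phi>\<in>U. \<Union>\<psi>\<in>V. coboundaries R (std_res R M) (std_res R M) (int (i + j))
        +>\<^bsub>hom_cpx R (std_res R M) (std_res R M) (int (i + j))\<^esub>
        cochain_comp (std_res R M) (int j) \<phi> \<psi>)"

definition yoneda_one where
  "yoneda_one R M = coboundaries R (std_res R M) (std_res R M) 0
     +>\<^bsub>hom_cpx R (std_res R M) (std_res R M) 0\<^esub> (\<lambda>i. \<lambda>x\<in>carrier (obj (std_res R M) i). x)"

text \<open>The direct sum of modules \<open>G n\<close>, made into a graded algebra by multiplications
  \<open>\<mu> i j :: G i \<times> G j \<rightarrow> G (i + j)\<close> and a unit \<open>u \<in> G 0\<close>.\<close>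

definition graded_sum :: "(nat \<Rightarrow> ('r, 'g) module) \<Rightarrow> (nat \<Rightarrow> nat \<Rightarrow> 'g \<Rightarrow> 'g \<Rightarrow> 'g) \<Rightarrow> 'g \<Rightarrow>
    ('r, nat \<Rightarrow> 'g) module" where
  "graded_sum G \<mu> u = \<lparr>
     carrier = {x. (\<forall>n. x n \<in> carrier (G n)) \<and> finite {n. x n \<noteq> \<zero>\<^bsub>G n\<^esub>}},
     monoid.mult = (\<lambda>x y n. \<Oplus>\<^bsub>G n\<^esub>i\<in>{..n}. \<mu> i (n - i) (x i) (y (n - i))),
     one = (\<lambda>n. if n = 0 then u else \<zero>\<^bsub>G n\<^esub>),
     ring.zero = (\<lambda>n. \<zero>\<^bsub>G n\<^esub>),
     ring.add = (\<lambda>x y n. x n \<oplus>\<^bsub>G n\<^esub> y n),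
     smult = (\<lambda>r x n. r \<odot>\<^bsub>G n\<^esub> x n)\<rparr>"

definition graded_part :: "(nat \<Rightarrow> ('r, 'g) module) \<Rightarrow> nat \<Rightarrow> (nat \<Rightarrow> 'g) set" where
  "graded_part G n = {x. x n \<in> carrier (G n) \<and> (\<forall>m. m \<noteq> n \<longrightarrow> x m = \<zero>\<^bsub>G m\<^esub>)}"

definition Ext_algebra where
  "Ext_algebra R M = graded_sum (Ext R M M) (yoneda_mult R M) (yoneda_one R M)"

definition Ext_part where
  "Ext_part R M n = graded_part (Ext R M M) n"

definition Ext_even_algebra where
  "Ext_even_algebra R M = (Ext_algebra R M)
     \<lparr>carrier := {x \<in> carrier (Ext_algebra R M). \<forall>n. odd n \<longrightarrow> x n = \<zero>\<^bsub>Ext R M M n\<^esub>}\<rparr>"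

definition graded_commutative :: "('a, 'x) ring_scheme \<Rightarrow> (nat \<Rightarrow> 'a set) \<Rightarrow> bool" where
  "graded_commutative E part \<longleftrightarrow> (\<forall>m n. \<forall>x\<in>part m. \<forall>y\<in>part n.
     x \<otimes>\<^bsub>E\<^esub> y = (if odd m \<and> odd n then \<ominus>\<^bsub>E\<^esub> (y \<otimes>\<^bsub>E\<^esub> x) else y \<otimes>\<^bsub>E\<^esub> x))"

definition graded_algebra_iso :: "('k, 'x) ring_scheme \<Rightarrow>
    ('k, 'a, 'y) module_scheme \<Rightarrow> (nat \<Rightarrow> 'a set) \<Rightarrow>
    ('k, 'b, 'z) module_scheme \<Rightarrow> (nat \<Rightarrow> 'b set) \<Rightarrow> ('a \<Rightarrow> 'b) \<Rightarrow> bool" where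
  "graded_algebra_iso K E E_part F F_part h \<longleftrightarrow>
     h \<in> ring_iso E F \<and>
     (\<forall>c\<in>carrier K. \<forall>x\<in>carrier E. h (c \<odot>\<^bsub>E\<^esub> x) = c \<odot>\<^bsub>F\<^esub> h x) \<and>
     (\<forall>n. h ` E_part n = F_part n)"


section \<open>Tensor products and enveloping algebras of commutative algebras\<close>

text \<open>\<open>A \<otimes>\<^sub>K B\<close> is the integral monoid ring on the multiplicative monoid \<open>A \<times> B\<close>, modulo the ideal
  generated by the bilinearity relations (additively this ideal is already spanned by them).\<close>

definition pre_tensor :: "('k, 'a, 'x) module_scheme \<Rightarrow> ('k, 'b, 'y) module_scheme \<Rightarrow>
    ('k, 'a \<times> 'b \<Rightarrow>\<^sub>0 int) module" where
  "pre_tensor A B =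
     (let mul = (\<lambda>x y. frag_extend (\<lambda>p. frag_extend (\<lambda>q. frag_of (p \<otimes>\<^bsub>A \<times>\<times> B\<^esub> q)) y) x)
      in \<lparr>carrier = {x. Poly_Mapping.keys x \<subseteq> carrier A \<times> carrier B},
          monoid.mult = mul, one = frag_of (\<one>\<^bsub>A\<^esub>, \<one>\<^bsub>B\<^esub>), ring.zero = 0, ring.add = (+),
          smult = (\<lambda>c. mul (frag_of (c \<odot>\<^bsub>A\<^esub> \<one>\<^bsub>A\<^esub>, \<one>\<^bsub>B\<^esub>)))\<rparr>)"

definition tensor_rels :: "('k, 'z) ring_scheme \<Rightarrow> ('k, 'a, 'x) module_scheme \<Rightarrow>
    ('k, 'b, 'y) module_scheme \<Rightarrow> ('a \<times> 'b \<Rightarrow>\<^sub>0 int) set" where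
  "tensor_rels K A B =
     {frag_of (a \<oplus>\<^bsub>A\<^esub> a', b) - frag_of (a, b) - frag_of (a', b) | a a' b.
        a \<in> carrier A \<and> a' \<in> carrier A \<and> b \<in> carrier B} \<union>
     {frag_of (a, b \<oplus>\<^bsub>B\<^esub> b') - frag_of (a, b) - frag_of (a, b') | a b b'.
        a \<in> carrier A \<and> b \<in> carrier B \<and> b' \<in> carrier B} \<union>
     {frag_of (c \<odot>\<^bsub>A\<^esub> a, b) - frag_of (a, c \<odot>\<^bsub>B\<^esub> b) | c a b.
        c \<in> carrier K \<and> a \<in> carrier A \<and> b \<in> carrier B}"

definition tensor :: "('k, 'z) ring_scheme \<Rightarrow> ('k, 'a, 'x) module_scheme \<Rightarrow>
    ('k, 'b, 'y) module_scheme \<Rightarrow> ('k, ('a \<times> 'b \<Rightarrow>\<^sub>0 int) set) module" where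
  "tensor K A B = lin_quot (pre_tensor A B) (Idl\<^bsub>pre_tensor A B\<^esub> (tensor_rels K A B))"

definition unit_map :: "('k, 'a, 'x) module_scheme \<Rightarrow> 'k \<Rightarrow> 'a" where
  "unit_map A c = c \<odot>\<^bsub>A\<^esub> \<one>\<^bsub>A\<^esub>"

text \<open>The multiplication map sends \<open>\<Sum> n\<^sub>i (a\<^sub>i, b\<^sub>i)\<close> to \<open>\<Sum> n\<^sub>i a\<^sub>i b\<^sub>i\<close>; being constant on the
  classes making up \<open>A \<otimes> A\<close>, it induces the \<open>A \<otimes> A\<close>-module structure on \<open>A\<close>.\<close>

definition mult_map :: "('a, 'x) ring_scheme \<Rightarrow> ('a \<times> 'a \<Rightarrow>\<^sub>0 int) \<Rightarrow> 'a" where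
  "mult_map A x = (\<Oplus>\<^bsub>A\<^esub>p\<in>Poly_Mapping.keys x.
     [Poly_Mapping.lookup x p] \<cdot>\<^bsub>A\<^esub> (fst p \<otimes>\<^bsub>A\<^esub> snd p))"

definition diag_module ::
    "('a, 'x) ring_scheme \<Rightarrow> (('a \<times> 'a \<Rightarrow>\<^sub>0 int) set, 'a) module" where
  "diag_module A = \<lparr>carrier = carrier A, monoid.mult = monoid.mult A, one = one A,
     ring.zero = ring.zero A, ring.add = ring.add A,
     smult = (\<lambda>U a. the_elem (mult_map A ` U) \<otimes>\<^bsub>A\<^esub> a)\<rparr>"


section \<open>Fibre products\<close>

definition fibre_product :: "('k, 'a, 'x) module_scheme \<Rightarrow> ('k, 'b, 'y) module_scheme \<Rightarrow>
    ('a \<Rightarrow> 'c) \<Rightarrow> ('b \<Rightarrow> 'c) \<Rightarrow> ('k, 'a \<times> 'b) module" where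
  "fibre_product A B p q = \<lparr>
     carrier = {z \<in> carrier (RDirProd A B). p (fst z) = q (snd z)},
     monoid.mult = monoid.mult (RDirProd A B), one = one (RDirProd A B),
     ring.zero = ring.zero (RDirProd A B), ring.add = ring.add (RDirProd A B),
     smult = (\<lambda>c z. (c \<odot>\<^bsub>A\<^esub> fst z, c \<odot>\<^bsub>B\<^esub> snd z))\<rparr>"

text \<open>Here \<open>A\<close> is concentrated in degree zero, and \<open>B\<close> is graded by \<open>B_part\<close>.\<close>

definition fibre_part :: "('k, 'a, 'x) module_scheme \<Rightarrow> ('k, 'b, 'y) module_scheme \<Rightarrow>
    ('a \<Rightarrow> 'c) \<Rightarrow> ('b \<Rightarrow> 'c) \<Rightarrow> (nat \<Rightarrow> 'b set) \<Rightarrow> nat \<Rightarrow> ('a \<times> 'b) set" where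
  "fibre_part A B p q B_part n = {z \<in> carrier (fibre_product A B p q).
     snd z \<in> B_part n \<and> (n \<noteq> 0 \<longrightarrow> fst z = \<zero>\<^bsub>A\<^esub>)}"


section \<open>Depth and derivatives\<close>

definition content_ideal :: "('k, 'z) ring_scheme \<Rightarrow> (nat \<Rightarrow> 'k) \<Rightarrow> 'k set" where
  "content_ideal K f = Idl\<^bsub>K\<^esub> (range (coeff (UP K) f))"

definition depth_ge_two :: "('k, 'z) ring_scheme \<Rightarrow> 'k set \<Rightarrow> bool" where
  "depth_ge_two K c \<longleftrightarrow>
     mod_hom K (lin_quot (reg_module K) c) (reg_module K)
       = {\<lambda>x\<in>carrier (lin_quot (reg_module K) c). \<zero>\<^bsub>K\<^esub>} \<and>
     carrier (Ext K (lin_quot (reg_module K) c) (reg_module K) 1)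
       = {\<zero>\<^bsub>Ext K (lin_quot (reg_module K) c) (reg_module K) 1\<^esub>}"

definition poly_deriv :: "('k, 'z) ring_scheme \<Rightarrow> (nat \<Rightarrow> 'k) \<Rightarrow> (nat \<Rightarrow> 'k)" where
  "poly_deriv K f = (\<lambda>i. [Suc i] \<cdot>\<^bsub>K\<^esub> coeff (UP K) f (Suc i))"

text \<open>\<open>f(x + dx)\<close>, as a polynomial in \<open>dx\<close> with coefficients in \<open>K[x]\<close>.\<close>

definition taylor :: "('k, 'z) ring_scheme \<Rightarrow> (nat \<Rightarrow> 'k) \<Rightarrow> nat \<Rightarrow> nat \<Rightarrow> 'k" where
  "taylor K f =
     eval K (UP (UP K))
       (\<lambda>c. monom (UP (UP K)) (monom (UP K) c 0) 0)
       (monom (UP (UP K)) (monom (UP K) \<one>\<^bsub>K\<^esub> 1) 0 \<oplus>\<^bsub>UP (UP K)\<^esub> monom (UP (UP K)) \<one>\<^bsub>UP K\<^esub> 1)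
       f"

definition second_divided_deriv :: "('k, 'z) ring_scheme \<Rightarrow> (nat \<Rightarrow> 'k) \<Rightarrow> (nat \<Rightarrow> 'k)" where
  "second_divided_deriv K f = coeff (UP (UP K)) (taylor K f) 2"


section \<open>The algebras attached to a polynomial\<close>

abbreviation ideal_A :: "('k, 'z) ring_scheme \<Rightarrow> (nat \<Rightarrow> 'k) \<Rightarrow> (nat \<Rightarrow> 'k) set" where
  "ideal_A K f \<equiv> Idl\<^bsub>UP K\<^esub> {f}"

abbreviation ideal_A' :: "('k, 'z) ring_scheme \<Rightarrow> (nat \<Rightarrow> 'k) \<Rightarrow> (nat \<Rightarrow> 'k) set" where
  "ideal_A' K f \<equiv> Idl\<^bsub>UP K\<^esub> {f, poly_deriv K f}"

definition alg_A :: "('k, 'z) ring_scheme \<Rightarrow> (nat \<Rightarrow> 'k) \<Rightarrow> ('k, (nat \<Rightarrow> 'k) set) module" where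
  "alg_A K f = lin_quot (UP K) (ideal_A K f)"

definition alg_A' :: "('k, 'z) ring_scheme \<Rightarrow> (nat \<Rightarrow> 'k) \<Rightarrow> ('k, (nat \<Rightarrow> 'k) set) module" where
  "alg_A' K f = lin_quot (UP K) (ideal_A' K f)"

definition proj_A' ::
    "('k, 'z) ring_scheme \<Rightarrow> (nat \<Rightarrow> 'k) \<Rightarrow> (nat \<Rightarrow> 'k) set \<Rightarrow> (nat \<Rightarrow> 'k) set" where
  "proj_A' K f U = (\<Union>p\<in>U. ideal_A' K f +>\<^bsub>UP K\<^esub> p)"

definition theta :: "('k, 'z) ring_scheme \<Rightarrow> (nat \<Rightarrow> 'k) \<Rightarrow> (nat \<Rightarrow> 'k) set set" where
  "theta K f = {a \<in> carrier (alg_A K f).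
     a \<otimes>\<^bsub>alg_A K f\<^esub> (ideal_A K f +>\<^bsub>UP K\<^esub> poly_deriv K f) = \<zero>\<^bsub>alg_A K f\<^esub>}"

definition theta_act :: "('k, 'z) ring_scheme \<Rightarrow> (nat \<Rightarrow> 'k) \<Rightarrow>
    (nat \<Rightarrow> 'k) set \<Rightarrow> (nat \<Rightarrow> 'k) set \<Rightarrow> (nat \<Rightarrow> 'k) set" where
  "theta_act K f U a = (\<Union>p\<in>U. (ideal_A K f +>\<^bsub>UP K\<^esub> p) \<otimes>\<^bsub>alg_A K f\<^esub> a)"
  \<comment> \<open>the action of \<open>A'\<close> on \<open>\<theta>\<close>: all \<open>p \<in> U\<close> give the same product with \<open>a \<in> \<theta>\<close>\<close>

definition f2 :: "('k, 'z) ring_scheme \<Rightarrow> (nat \<Rightarrow> 'k) \<Rightarrow> (nat \<Rightarrow> 'k) set" where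
  "f2 K f = ideal_A' K f +>\<^bsub>UP K\<^esub> second_divided_deriv K f"

text \<open>
  The graded algebra \<open>(A' \<oplus> \<theta>t)[s] / ((at)(bt) - a b f\<^sup>(\<^sup>2\<^sup>) s)\<close>. An element \<open>a \<in> A'\<close> in degree \<open>2i\<close>
  stands for \<open>a s\<^sup>i\<close>, an element \<open>a \<in> \<theta>\<close> in degree \<open>2i + 1\<close> for \<open>a t s\<^sup>i\<close>.
\<close>

definition theta_comp ::
    "('k, 'z) ring_scheme \<Rightarrow> (nat \<Rightarrow> 'k) \<Rightarrow> nat \<Rightarrow> ('k, (nat \<Rightarrow> 'k) set) module" where
  "theta_comp K f n = (if even n then alg_A' K f else (alg_A K f)\<lparr>carrier := theta K f\<rparr>)"

definition theta_mult :: "('k, 'z) ring_scheme \<Rightarrow> (nat \<Rightarrow> 'k) \<Rightarrow> nat \<Rightarrow> nat \<Rightarrow>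
    (nat \<Rightarrow> 'k) set \<Rightarrow> (nat \<Rightarrow> 'k) set \<Rightarrow> (nat \<Rightarrow> 'k) set" where
  "theta_mult K f i j a b =
     (if even i \<and> even j then a \<otimes>\<^bsub>alg_A' K f\<^esub> b
      else if even i then theta_act K f a b
      else if even j then theta_act K f b a
      else proj_A' K f (a \<otimes>\<^bsub>alg_A K f\<^esub> b) \<otimes>\<^bsub>alg_A' K f\<^esub> f2 K f)"

definition theta_alg ::
    "('k, 'z) ring_scheme \<Rightarrow> (nat \<Rightarrow> 'k) \<Rightarrow> ('k, nat \<Rightarrow> (nat \<Rightarrow> 'k) set) module" where
  "theta_alg K f = graded_sum (theta_comp K f) (theta_mult K f) \<one>\<^bsub>alg_A' K f\<^esub>"

definition theta_part ::
    "('k, 'z) ring_scheme \<Rightarrow> (nat \<Rightarrow> 'k) \<Rightarrow> nat \<Rightarrow> (nat \<Rightarrow> (nat \<Rightarrow> 'k) set) set" where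
  "theta_part K f n = graded_part (theta_comp K f) n"

text \<open>\<open>A'[s]\<close> as a \<open>K\<close>-algebra, and its piece \<open>A' s\<^sup>i\<close>.\<close>

definition poly_A' ::
    "('k, 'z) ring_scheme \<Rightarrow> (nat \<Rightarrow> 'k) \<Rightarrow> ('k, nat \<Rightarrow> (nat \<Rightarrow> 'k) set) module" where
  "poly_A' K f = restrict_scalars (unit_map (alg_A' K f)) (UP (alg_A' K f))"

definition poly_A'_part ::
    "('k, 'z) ring_scheme \<Rightarrow> (nat \<Rightarrow> 'k) \<Rightarrow> nat \<Rightarrow> (nat \<Rightarrow> (nat \<Rightarrow> 'k) set) set" where
  "poly_A'_part K f i = {monom (UP (alg_A' K f)) a i | a. a \<in> carrier (alg_A' K f)}"

end

theory Submission
  imports Defs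
begin

text \<open>
  Since the content ideal has depth at least two, \<open>f(x), f(y)\<close> is a regular sequence in \<open>K[x, y]\<close>:
  McCoy's theorem reduces this to annihilators of the content ideal in \<open>K\<close> and in \<open>A\<close>. Writing
  \<open>f(y) = (y - x) \<Delta>\<close> in \<open>A[y]\<close>, both factors are nonzerodivisors, so that in
  \<open>A \<otimes> A = A[y]/(f(y))\<close> each of \<open>h = y - x\<close> and \<open>\<Delta>\<close> generates the annihilator of the other, and
  \<open>A\<close> has the two-periodic resolution with differentials \<open>h, \<Delta>, h, \<dots>\<close>. Comparing it with the standard
  resolution, a cocycle \<open>\<phi>\<close> of degree \<open>n\<close> is determined up to coboundaries by the value of
  \<open>\<phi>\<close> on the \<open>n\<close>-th basis element, an element of \<open>A\<close> for \<open>n = 0\<close>, of \<open>\<theta>\<close> for odd \<open>n\<close>, and of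
  \<open>A'\<close> for even \<open>n > 0\<close>. Composition of cocycles multiplies these values, except that for two odd
  degrees the Taylor expansion \<open>\<Delta> = f' + h f\<^sup>(\<^sup>2\<^sup>) + \<dots>\<close> contributes a factor \<open>- f\<^sup>(\<^sup>2\<^sup>)\<close>; the sign is
  irrelevant because \<open>2 a f\<^sup>(\<^sup>2\<^sup>)\<close> vanishes in \<open>A'\<close> for \<open>a \<in> \<theta>\<close>.
\<close>

section \<open>Linear maps and projectivity of free modules\<close>

text \<open>A class in Ext is represented by a self-map of the standard resolution, whose bases are
  far too large to describe such a map directly. Augmenting the target and evaluating at one chosen
  element \<open>z n\<close> reduces a cocycle to an element of \<open>A\<close>. That no
  information is lost rests on the homotopy \<kappa>; the opposite composite of \<beta> and
  \<open>z\<close> is only computed up to multiples of the two differentials. The product is the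
  harder point: evaluating a composite involves components of the inner factor in degrees above its
  own. These are recovered from the lowest component by dividing repeatedly by the differentials,
  and this division is where the expansion of \<Delta> enters. The two halves of the depth condition
  act separately. Vanishing of Hom makes \<open>f(x)\<close> a nonzerodivisor in
  \<open>K[x]\<close>. Vanishing of Ext in degree one makes every homomorphism from the content
  ideal to \<open>K\<close> a multiplication; from this, a polynomial whose multiples by the content
  ideal are all divisible by \<open>f\<close> is itself divisible by \<open>f\<close>, which is the
  statement about annihilators in \<open>A\<close>.\<close>

definition lin_map :: "('r, 'x) ring_scheme \<Rightarrow> ('r, 'm, 'y) module_scheme \<Rightarrow>
    ('r, 'n, 'z) module_scheme \<Rightarrow> ('m \<Rightarrow> 'n) \<Rightarrow> bool" where
  "lin_map R M N h \<longleftrightarrow> (\<forall>x\<in>carrier M. h x \<in> carrier N) \<and>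
     (\<forall>x\<in>carrier M. \<forall>y\<in>carrier M. h (x \<oplus>\<^bsub>M\<^esub> y) = h x \<oplus>\<^bsub>N\<^esub> h y) \<and>
     (\<forall>r\<in>carrier R. \<forall>x\<in>carrier M. h (r \<odot>\<^bsub>M\<^esub> x) = r \<odot>\<^bsub>N\<^esub> h x)"

lemma lin_mapI:
  assumes "\<And>x. x \<in> carrier M \<Longrightarrow> h x \<in> carrier N"
    and "\<And>x y. x \<in> carrier M \<Longrightarrow> y \<in> carrier M \<Longrightarrow> h (x \<oplus>\<^bsub>M\<^esub> y) = h x \<oplus>\<^bsub>N\<^esub> h y"
    and "\<And>r x. r \<in> carrier R \<Longrightarrow> x \<in> carrier M \<Longrightarrow> h (r \<odot>\<^bsub>M\<^esub> x) = r \<odot>\<^bsub>N\<^esub> h x"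
  shows "lin_map R M N h"
  using assms by (auto simp: lin_map_def)

lemma lin_mapD:
  assumes "lin_map R M N h"
  shows lin_map_closed: "x \<in> carrier M \<Longrightarrow> h x \<in> carrier N"
    and lin_map_add: "x \<in> carrier M \<Longrightarrow> y \<in> carrier M \<Longrightarrow> h (x \<oplus>\<^bsub>M\<^esub> y) = h x \<oplus>\<^bsub>N\<^esub> h y"
    and lin_map_smult: "r \<in> carrier R \<Longrightarrow> x \<in> carrier M \<Longrightarrow> h (r \<odot>\<^bsub>M\<^esub> x) = r \<odot>\<^bsub>N\<^esub> h x"
  using assms by (auto simp: lin_map_def)

text \<open>Without the extensionality of \<open>mod_hom\<close>, composites and pointwise sums of
  linear maps can be formed as they stand, and are restricted to the carrier only at the
  end.\<close>

lemma mod_hom_lin_map: "mod_hom R M N = {h \<in> extensional (carrier M). lin_map R M N h}"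
  by (auto simp: mod_hom_def lin_map_def PiE_def)

lemma restrict_mod_hom:
  assumes "module R M" "lin_map R M N h"
  shows "restrict h (carrier M) \<in> mod_hom R M N"
proof -
  interpret module R M by fact
  show ?thesis using assms(2) by (auto simp: mod_hom_def lin_map_def)
qed

lemma lin_map_zero:
  assumes "module R M" "module R N" "lin_map R M N h"
  shows "h \<zero>\<^bsub>M\<^esub> = \<zero>\<^bsub>N\<^esub>"
proof -
  interpret M: module R M by fact
  interpret N: module R N by fact
  have "h (\<zero>\<^bsub>R\<^esub> \<odot>\<^bsub>M\<^esub> \<zero>\<^bsub>M\<^esub>) = \<zero>\<^bsub>R\<^esub> \<odot>\<^bsub>N\<^esub> h \<zero>\<^bsub>M\<^esub>"
    by (rule lin_map_smult[OF assms(3)]) auto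
  then show ?thesis using lin_map_closed[OF assms(3)] by simp
qed

lemma lin_map_minus:
  assumes "module R M" "module R N" "lin_map R M N h" "x \<in> carrier M" "y \<in> carrier M"
  shows "h (\<ominus>\<^bsub>M\<^esub> x) = \<ominus>\<^bsub>N\<^esub> h x" "h (x \<ominus>\<^bsub>M\<^esub> y) = h x \<ominus>\<^bsub>N\<^esub> h y"
proof -
  interpret M: module R M by fact
  interpret N: module R N by fact
  have *: "h (\<ominus>\<^bsub>M\<^esub> x) = \<ominus>\<^bsub>N\<^esub> h x" if "x \<in> carrier M" for x
  proof -
    have "h (\<ominus>\<^bsub>R\<^esub> \<one>\<^bsub>R\<^esub> \<odot>\<^bsub>M\<^esub> x) = \<ominus>\<^bsub>R\<^esub> \<one>\<^bsub>R\<^esub> \<odot>\<^bsub>N\<^esub> h x"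
      by (rule lin_map_smult[OF assms(3)]) (use that in auto)
    then show ?thesis using lin_map_closed[OF assms(3)] that
      by (simp add: M.smult_l_minus N.smult_l_minus)
  qed
  show "h (\<ominus>\<^bsub>M\<^esub> x) = \<ominus>\<^bsub>N\<^esub> h x" using * assms by simp
  show "h (x \<ominus>\<^bsub>M\<^esub> y) = h x \<ominus>\<^bsub>N\<^esub> h y"
    using * assms(4,5) lin_map_add[OF assms(3)] by (simp add: a_minus_def)
qed

lemma lin_map_compose:
  assumes "lin_map R M N h" "lin_map R N P g"
  shows "lin_map R M P (\<lambda>x. g (h x))"
  using assms by (auto simp: lin_map_def)

lemma lin_map_const_zero:
  assumes "module R N"
  shows "lin_map R M N (\<lambda>x. \<zero>\<^bsub>N\<^esub>)"
proof -
  interpret module R N by fact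
  show ?thesis by (auto simp: lin_map_def)
qed

lemma lin_map_sum:
  assumes "module R N" "lin_map R M N h" "lin_map R M N g"
  shows "lin_map R M N (\<lambda>x. h x \<oplus>\<^bsub>N\<^esub> g x)"
proof -
  interpret module R N by fact
  show ?thesis using assms(2,3)
    by (auto simp: lin_map_def smult_r_distr M.add.m_ac)
qed

lemma lin_map_scale:
  assumes "module R N" "lin_map R M N h" "c \<in> carrier R"
  shows "lin_map R M N (\<lambda>x. c \<odot>\<^bsub>N\<^esub> h x)"
proof -
  interpret module R N by fact
  show ?thesis using assms(2,3)
    by (auto simp: lin_map_def smult_r_distr smult_assoc1[symmetric] R.m_comm)
qed

lemma lin_map_cong:
  assumes "module R M" "lin_map R M N h" "\<And>x. x \<in> carrier M \<Longrightarrow> h x = g x"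
  shows "lin_map R M N g"
proof -
  interpret module R M by fact
  show ?thesis using assms(2,3) by (simp add: lin_map_def)
qed

lemma lin_map_diff:
  assumes "module R M" "module R N" "lin_map R M N h" "lin_map R M N g"
  shows "lin_map R M N (\<lambda>x. h x \<ominus>\<^bsub>N\<^esub> g x)"
proof (rule lin_map_cong[OF assms(1)])
  interpret module R N by fact
  show "lin_map R M N (\<lambda>x. h x \<oplus>\<^bsub>N\<^esub> (\<ominus>\<^bsub>R\<^esub> \<one>\<^bsub>R\<^esub>) \<odot>\<^bsub>N\<^esub> g x)"
    by (intro lin_map_sum lin_map_scale assms) simp
  show "h x \<oplus>\<^bsub>N\<^esub> (\<ominus>\<^bsub>R\<^esub> \<one>\<^bsub>R\<^esub>) \<odot>\<^bsub>N\<^esub> g x = h x \<ominus>\<^bsub>N\<^esub> g x" if "x \<in> carrier M" for x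
    using lin_map_closed[OF assms(4) that] by (simp add: a_minus_def smult_l_minus)
qed

lemma free_module_sel [simp]:
  "\<zero>\<^bsub>free_module R S\<^esub> = (\<lambda>b. \<zero>\<^bsub>R\<^esub>)"
  "ring.add (free_module R S) = (\<lambda>v w b. v b \<oplus>\<^bsub>R\<^esub> w b)"
  "smult (free_module R S) = (\<lambda>r v b. r \<otimes>\<^bsub>R\<^esub> v b)"
  by (simp_all add: free_module_def)

text \<open>Every element of a free module is \<open>syz_vec\<close> of some list, so agreement on
  basis vectors spreads by induction on that list.\<close>

lemma free_lin_map_eqI:
  assumes "cring R" "module R N" "lin_map R (free_module R S) N f" "lin_map R (free_module R S) N g"
    and eq: "\<And>b. b \<in> S \<Longrightarrow> f (\<lambda>x. if x = b then \<one>\<^bsub>R\<^esub> else \<zero>\<^bsub>R\<^esub>) = g (\<lambda>x. if x = b then \<one>\<^bsub>R\<^esub> else \<zero>\<^bsub>R\<^esub>)"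
    and w: "w \<in> carrier (free_module R S)"
  shows "f w = g w"
proof -
  interpret R: cring R by fact
  interpret N: module R N by fact
  let ?F = "free_module R S"
  interpret F: module R ?F by (rule free_module_module) fact
  obtain l where l: "set l \<subseteq> S \<times> carrier R" "syz_vec R l = w"
    using syz_vec_surj[OF assms(1) w] by blast
  have "f (syz_vec R l) = g (syz_vec R l)" using l(1)
  proof (induction l)
    case Nil
    have "syz_vec R [] = \<zero>\<^bsub>?F\<^esub>" by simp
    then show ?case
      using lin_map_zero[OF F.module_axioms N.module_axioms] assms(3,4) by metis
  next
    case (Cons p l)
    let ?d = "\<lambda>x. if x = fst p then \<one>\<^bsub>R\<^esub> else \<zero>\<^bsub>R\<^esub>"
    have p: "fst p \<in> S" "snd p \<in> carrier R" "set l \<subseteq> S \<times> carrier R" using Cons.prems by auto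
    have d: "?d \<in> carrier ?F" using free_module_delta[OF assms(1) p(1)] .
    have s: "syz_vec R l \<in> carrier ?F" using syz_vec_closed[OF assms(1) p(3)] .
    have e: "syz_vec R (p # l) = (snd p \<odot>\<^bsub>?F\<^esub> ?d) \<oplus>\<^bsub>?F\<^esub> syz_vec R l"
      using p(2) by (auto simp: fun_eq_iff)
    have "h ((snd p \<odot>\<^bsub>?F\<^esub> ?d) \<oplus>\<^bsub>?F\<^esub> syz_vec R l) = snd p \<odot>\<^bsub>N\<^esub> h ?d \<oplus>\<^bsub>N\<^esub> h (syz_vec R l)"
      if "lin_map R ?F N h" for h
      using lin_map_add[OF that F.smult_closed[OF p(2) d] s] lin_map_smult[OF that p(2) d] by metis
    then show ?case unfolding e using assms(3,4) eq[OF p(1)] Cons.IH[OF p(3)] by metis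
  qed
  then show ?thesis using l by simp
qed

text \<open>A preimage is chosen for the image of each basis vector and extended linearly. Only the
  image of \<psi> has to be covered by \<open>p\<close>, which is exactly what exactness of a
  complex supplies.\<close>

lemma free_module_projective:
  assumes "cring R" "module R N" "module R P" "lin_map R N P p" "lin_map R (free_module R S) P \<psi>"
    and im: "\<And>w. w \<in> carrier (free_module R S) \<Longrightarrow> \<psi> w \<in> p ` carrier N"
  shows "\<exists>\<eta>\<in>mod_hom R (free_module R S) N. \<forall>w\<in>carrier (free_module R S). p (\<eta> w) = \<psi> w"
proof -
  interpret N: module R N by fact
  let ?F = "free_module R S" and ?\<delta> = "\<lambda>b x. if x = b then \<one>\<^bsub>R\<^esub> else \<zero>\<^bsub>R\<^esub>"
  interpret F: module R ?F by (rule free_module_module) fact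
  have "\<forall>b\<in>S. \<exists>y\<in>carrier N. p y = \<psi> (?\<delta> b)"
  proof
    fix b assume "b \<in> S"
    from im[OF free_module_delta[OF assms(1) this]] show "\<exists>y\<in>carrier N. p y = \<psi> (?\<delta> b)"
      by (auto simp: image_iff)
  qed
  then obtain g where g: "\<And>b. b \<in> S \<Longrightarrow> g b \<in> carrier N \<and> p (g b) = \<psi> (?\<delta> b)" by metis
  have gS: "g ` S \<subseteq> carrier N" using g by auto
  have lin: "lin_map R ?F N (lin_ext R N g)"
    by (rule lin_mapI) (use N.lin_ext_hom[OF gS] in auto)
  have "p (lin_ext R N g w) = \<psi> w" if w: "w \<in> carrier ?F" for w
    by (rule free_lin_map_eqI[OF assms(1,3) lin_map_compose[OF lin assms(4)] assms(5) _ w])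
       (use g N.lin_ext_hom(4)[OF gS] in auto)
  then show ?thesis
    by (intro bexI[OF _ restrict_mod_hom[OF F.module_axioms lin]]) auto
qed


section \<open>Chain maps between standard resolutions\<close>

abbreviation sres :: "('r, 'x) ring_scheme \<Rightarrow> ('r, 'm, 'y) module_scheme \<Rightarrow> int \<Rightarrow>
    ('r, ('r, 'm) cell \<Rightarrow> 'r) module" where
  "sres R M i \<equiv> obj (std_res R M) i"

abbreviation Fall :: "('r, 'x) ring_scheme \<Rightarrow> ('r, 'b \<Rightarrow> 'r) module" where
  "Fall R \<equiv> free_module R UNIV"

lemma bd_std_res [simp]: "bd (std_res R M) i = res_bd R"
  by (simp add: std_res_def)

lemma sres_free: "sres R M i = free_module R (if i < 0 then {} else cells R M (nat i))"
  by (simp add: std_res_def)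

text \<open>The modules in the various degrees differ only in their carriers, so all equations can
  be written in the single module \<open>Fall R\<close>. Negation is defined through the carrier and
  needs \<open>sres_minus\<close> instead.\<close>

lemma sres_sel [simp]:
  "\<zero>\<^bsub>sres R M i\<^esub> = \<zero>\<^bsub>Fall R\<^esub>"
  "ring.add (sres R M i) = ring.add (Fall R)"
  "smult (sres R M i) = smult (Fall R)"
  by (simp_all add: sres_free)

lemma sres_sub: "carrier (sres R M i) \<subseteq> carrier (Fall R)"
  by (auto simp: sres_free free_module_def)

text \<open>Merges the two parity cases of \<open>hom_bd\<close> into one formula.\<close>

definition sgn_ring :: "('r, 'x) ring_scheme \<Rightarrow> int \<Rightarrow> 'r" where
  "sgn_ring R n = (if even n then \<one>\<^bsub>R\<^esub> else \<ominus>\<^bsub>R\<^esub> \<one>\<^bsub>R\<^esub>)"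

context module
begin

abbreviation F where "F \<equiv> Fall R :: ('a, ('a, 'c) cell \<Rightarrow> 'a) module"

lemma F_module: "module R F"
  by (rule free_module_module) (rule R.cring_axioms)

lemma sres_module: "module R (sres R M i)"
  unfolding sres_free by (rule free_module_module) (rule R.cring_axioms)

lemma sres_minus:
  assumes "x \<in> carrier (sres R M i)" "y \<in> carrier (sres R M i)"
  shows "\<ominus>\<^bsub>sres R M i\<^esub> x = \<ominus>\<^bsub>F\<^esub> x" "x \<ominus>\<^bsub>sres R M i\<^esub> y = x \<ominus>\<^bsub>F\<^esub> y"
proof -
  interpret F: module R F by (rule F_module)
  interpret S: module R "sres R M i" by (rule sres_module)
  have *: "\<ominus>\<^bsub>sres R M i\<^esub> x = \<ominus>\<^bsub>F\<^esub> x" if x: "x \<in> carrier (sres R M i)" for x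
  proof -
    have "\<ominus>\<^bsub>sres R M i\<^esub> x = (\<ominus>\<^bsub>R\<^esub> \<one>\<^bsub>R\<^esub>) \<odot>\<^bsub>sres R M i\<^esub> x"
      using x by (simp add: S.smult_l_minus del: sres_sel)
    also have "\<dots> = (\<ominus>\<^bsub>R\<^esub> \<one>\<^bsub>R\<^esub>) \<odot>\<^bsub>F\<^esub> x" by simp
    also have "\<dots> = \<ominus>\<^bsub>F\<^esub> x"
      using subsetD[OF sres_sub x] by (simp add: F.smult_l_minus del: free_module_sel)
    finally show ?thesis .
  qed
  show "\<ominus>\<^bsub>sres R M i\<^esub> x = \<ominus>\<^bsub>F\<^esub> x" "x \<ominus>\<^bsub>sres R M i\<^esub> y = x \<ominus>\<^bsub>F\<^esub> y"
    using *[OF assms(1)] *[OF assms(2)] by (simp_all only: a_minus_def sres_sel)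
qed

lemma sres_neg:
  assumes "i < 0" "w \<in> carrier (sres R M i)"
  shows "w = \<zero>\<^bsub>F\<^esub>"
  using assms by (auto simp: sres_free free_module_def fun_eq_iff)

lemma bd_lin: "lin_map R (sres R M i) (sres R M (i - 1)) (res_bd R)"
proof -
  interpret F: module R F by (rule F_module)
  have c: "cell_bd R ` (if i < 0 then {} else cells R M (nat i)) \<subseteq> carrier F"
    using cell_bd_carrier[OF R.cring_axioms] by auto
  show ?thesis
  proof (rule lin_mapI)
    fix w assume w: "w \<in> carrier (sres R M i)"
    show "res_bd R w \<in> carrier (sres R M (i - 1))"
    proof (cases "i \<le> 0")
      case True
      have "finite {b. w b \<noteq> \<zero>}" "range w \<subseteq> carrier R" "{b. w b \<noteq> \<zero>} \<subseteq> cells R M 0"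
        using w True by (auto simp: sres_free free_module_def split: if_splits)
      \<comment> \<open>In degree 0 the boundary of every \<open>Gen\<close> cell is zero, and in
        negative degrees there are no cells.\<close>
      then have "res_bd R w = \<zero>\<^bsub>F\<^esub>"
        unfolding res_bd_def lin_ext_def
        by (intro F.M.add.finprod_one_eqI) (auto simp: image_subset_iff)
      then show ?thesis
        using module.axioms(2)[OF sres_module, of "i - 1", THEN abelian_group.axioms(1), THEN abelian_monoid.zero_closed]
        by simp
    next
      case False
      then have "nat i = Suc (nat (i - 1))" by auto
      then show ?thesis using std_res_complex(1)[OF module_axioms, of w "nat (i - 1)"] w False
        by (auto simp: sres_free)
    qed
  next
    fix v w assume "v \<in> carrier (sres R M i)" "w \<in> carrier (sres R M i)"
    then show "res_bd R (v \<oplus>\<^bsub>sres R M i\<^esub> w) = res_bd R v \<oplus>\<^bsub>sres R M (i - 1)\<^esub> res_bd R w"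
      using F.lin_ext_hom(2)[OF c] by (simp add: res_bd_def sres_free)
  next
    fix r w assume "r \<in> carrier R" "w \<in> carrier (sres R M i)"
    then show "res_bd R (r \<odot>\<^bsub>sres R M i\<^esub> w) = r \<odot>\<^bsub>sres R M (i - 1)\<^esub> res_bd R w"
      using F.lin_ext_hom(3)[OF c] by (simp add: res_bd_def sres_free)
  qed
qed

lemma aug_lin: "lin_map R (sres R M 0) M (res_aug R M)"
proof -
  have c: "cell_aug ` cells R M 0 \<subseteq> carrier M" by auto
  show ?thesis
    by (rule lin_mapI) (use lin_ext_hom[OF c] in \<open>auto simp: res_aug_def sres_free\<close>)
qed

text \<open>Cycles of the augmented complex: the boundary out of degree 0 vanishes identically, so
  there the augmentation takes its place, and exactness holds in all degrees
  \<open>i \<ge> 0\<close>.\<close>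

definition cyc :: "int \<Rightarrow> (('a, 'c) cell \<Rightarrow> 'a) \<Rightarrow> bool" where
  "cyc i w \<longleftrightarrow> (if i = 0 then res_aug R M w = \<zero>\<^bsub>M\<^esub> else res_bd R w = \<zero>\<^bsub>F\<^esub>)"

lemma bd_cyc:
  assumes "w \<in> carrier (sres R M (i + 1))"
  shows "cyc i (res_bd R w)"
proof -
  consider "i < 0" | "i \<ge> 0" by linarith
  then show ?thesis
  proof cases
    case 1
    have "res_bd R w \<in> carrier (sres R M i)" using lin_map_closed[OF bd_lin assms] by simp
    then have "res_bd R (res_bd R w) \<in> carrier (sres R M (i - 1))"
      using lin_map_closed[OF bd_lin] by blast
    then show ?thesis using 1 sres_neg[of "i - 1"] by (simp add: cyc_def)
  next
    case 2
    then have "nat (i + 1) = Suc (nat i)" by simp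
    then show ?thesis
      using 2 assms std_res_complex(2)[OF module_axioms, of w "nat i"]
      by (auto simp: cyc_def sres_free split: if_splits)
  qed
qed

lemma bd_bd:
  assumes "w \<in> carrier (sres R M i)"
  shows "res_bd R (res_bd R w) = \<zero>\<^bsub>F\<^esub>"
proof -
  have m: "res_bd R w \<in> carrier (sres R M (i - 1))" using lin_map_closed[OF bd_lin assms] .
  show ?thesis
  proof (cases "i = 1")
    \<comment> \<open>\<open>cyc 0\<close> speaks of the augmentation, so it cannot be used here;
      the double boundary lies in degree -1, which is zero.\<close>
    case True
    then have "res_bd R (res_bd R w) \<in> carrier (sres R M (- 1))"
      using lin_map_closed[OF bd_lin m] by simp
    then show ?thesis using sres_neg[of "-1"] by simp
  next
    case False
    then show ?thesis using bd_cyc[of w "i - 1"] assms by (simp add: cyc_def)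
  qed
qed

lemma aug_bd:
  assumes "w \<in> carrier (sres R M 1)"
  shows "res_aug R M (res_bd R w) = \<zero>\<^bsub>M\<^esub>"
  using bd_cyc[of w 0] assms by (simp add: cyc_def)

lemma sres_exact:
  assumes "w \<in> carrier (sres R M i)" "i \<ge> 0" "cyc i w"
  shows "w \<in> res_bd R ` carrier (sres R M (i + 1))"
proof -
  have "nat (i + 1) = Suc (nat i)" using assms(2) by simp
  then show ?thesis
    using std_res_exact[OF module_axioms, of w "nat i"] assms
    by (force simp: cyc_def sres_free split: if_splits)
qed

lemma aug_surj: "m \<in> carrier M \<Longrightarrow> m \<in> res_aug R M ` carrier (sres R M 0)"
  using res_aug_surj[OF module_axioms, of m] by (auto simp: sres_free)

lemma sres_projective:
  assumes "module R N" "module R P" "lin_map R N P p" "lin_map R (sres R M i) P \<psi>"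
    and "\<And>w. w \<in> carrier (sres R M i) \<Longrightarrow> \<psi> w \<in> p ` carrier N"
  shows "\<exists>\<eta>\<in>mod_hom R (sres R M i) N. \<forall>w\<in>carrier (sres R M i). p (\<eta> w) = \<psi> w"
  using free_module_projective[OF R.cring_axioms assms(1-3)] assms(4,5) unfolding sres_free by blast

lemma sgn_ring_closed [simp]: "sgn_ring R n \<in> carrier R"
  by (simp add: sgn_ring_def)

lemma sgn_ring_sq [simp]: "sgn_ring R n \<otimes> sgn_ring R n = \<one>"
  by (simp add: sgn_ring_def R.l_minus R.r_minus)

lemma sgn_ring_pred: "sgn_ring R (n - 1) = \<ominus> sgn_ring R n"
  by (simp add: sgn_ring_def)

end

text \<open>From here on elements of \<open>Fall R\<close> are handled by the module laws rather
  than as functions.\<close>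

declare free_module_sel [simp del]

lemma (in abelian_group) minus_eq_zero_iff:
  assumes "x \<in> carrier G" "y \<in> carrier G"
  shows "x \<ominus> y = \<zero> \<longleftrightarrow> x = y"
  using assms by (metis a_minus_def add.inv_closed add.inv_equality minus_equality minus_minus r_neg)

section \<open>Cochains and cocycles between standard resolutions\<close>

abbreviation hcpx where "hcpx R M N \<equiv> hom_cpx R (std_res R M) (std_res R N)"
abbreviation cocyc where "cocyc R M N \<equiv> cocycles R (std_res R M) (std_res R N)"
abbreviation cobd where "cobd R M N \<equiv> coboundaries R (std_res R M) (std_res R N)"

lemma hom_cpx_carrier:
  "\<phi> \<in> carrier (hcpx R M N n) \<longleftrightarrow> (\<forall>i. \<phi> i \<in> mod_hom R (sres R M i) (sres R N (i - n)))"
  by (simp add: hom_cpx_def)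

lemma hom_cpx_lin:
  assumes "\<phi> \<in> carrier (hcpx R M N n)"
  shows "lin_map R (sres R M i) (sres R N (i - n)) (\<phi> i)"
  using assms by (simp add: hom_cpx_carrier mod_hom_lin_map)

lemma hom_bd_apply:
  assumes "module R M" "module R N" "\<eta> \<in> carrier (hcpx R M N n)" "w \<in> carrier (sres R M i)"
  shows "hom_bd (std_res R M) (std_res R N) n \<eta> i w =
    res_bd R (\<eta> i w) \<ominus>\<^bsub>Fall R\<^esub> sgn_ring R n \<odot>\<^bsub>Fall R\<^esub> \<eta> (i - 1) (res_bd R w)"
proof -
  interpret M: module R M by fact
  interpret N: module R N by fact
  interpret F: module R N.F by (rule N.F_module)
  have u: "res_bd R (\<eta> i w) \<in> carrier (sres R N (i - (n + 1)))"
    using lin_map_closed[OF N.bd_lin lin_map_closed[OF hom_cpx_lin[OF assms(3)] assms(4)]]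
    by (simp add: algebra_simps)
  have v: "\<eta> (i - 1) (res_bd R w) \<in> carrier (sres R N (i - (n + 1)))"
    using lin_map_closed[OF hom_cpx_lin[OF assms(3)] lin_map_closed[OF M.bd_lin assms(4)]]
    by (simp add: algebra_simps)
  have vF: "\<eta> (i - 1) (res_bd R w) \<in> carrier N.F" using sres_sub v by blast
  show ?thesis using assms(4) N.sres_minus(2)[OF u v] vF
    by (simp add: hom_bd_def sgn_ring_def Let_def a_minus_def F.smult_l_minus F.M.minus_minus)
qed

lemma cocycles_iff:
  assumes "module R M" "module R N"
  shows "\<phi> \<in> cocyc R M N n \<longleftrightarrow> \<phi> \<in> carrier (hcpx R M N n) \<and>
    (\<forall>i. \<forall>w\<in>carrier (sres R M i).
      res_bd R (\<phi> i w) = sgn_ring R n \<odot>\<^bsub>Fall R\<^esub> \<phi> (i - 1) (res_bd R w))"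
proof -
  interpret M: module R M by fact
  interpret N: module R N by fact
  interpret F: module R N.F by (rule N.F_module)
  have z: "\<zero>\<^bsub>hcpx R M N (n + 1)\<^esub> = (\<lambda>i. \<lambda>x\<in>carrier (sres R M i). \<zero>\<^bsub>N.F\<^esub>)"
    by (simp add: hom_cpx_def)
  have ext: "hom_bd (std_res R M) (std_res R N) n \<phi> i w = undefined" if "w \<notin> carrier (sres R M i)" for i w
    using that by (simp add: hom_bd_def)
  show ?thesis
  proof (cases "\<phi> \<in> carrier (hcpx R M N n)")
    case True
    have cl: "res_bd R (\<phi> i w) \<in> carrier N.F" "sgn_ring R n \<odot>\<^bsub>Fall R\<^esub> \<phi> (i - 1) (res_bd R w) \<in> carrier N.F"
      if "w \<in> carrier (sres R M i)" for i w
    proof -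
      show "res_bd R (\<phi> i w) \<in> carrier N.F"
        using lin_map_closed[OF N.bd_lin lin_map_closed[OF hom_cpx_lin[OF True] that]] sres_sub by blast
      have "\<phi> (i - 1) (res_bd R w) \<in> carrier N.F"
        using lin_map_closed[OF hom_cpx_lin[OF True] lin_map_closed[OF M.bd_lin that]] sres_sub by blast
      then show "sgn_ring R n \<odot>\<^bsub>Fall R\<^esub> \<phi> (i - 1) (res_bd R w) \<in> carrier N.F" by simp
    qed
    have "hom_bd (std_res R M) (std_res R N) n \<phi> = \<zero>\<^bsub>hcpx R M N (n + 1)\<^esub> \<longleftrightarrow>
      (\<forall>i. \<forall>w\<in>carrier (sres R M i). hom_bd (std_res R M) (std_res R N) n \<phi> i w = \<zero>\<^bsub>N.F\<^esub>)"
      unfolding z fun_eq_iff using ext by (auto simp: restrict_def)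
    also have "\<dots> \<longleftrightarrow> (\<forall>i. \<forall>w\<in>carrier (sres R M i).
      res_bd R (\<phi> i w) = sgn_ring R n \<odot>\<^bsub>Fall R\<^esub> \<phi> (i - 1) (res_bd R w))"
      using hom_bd_apply[OF assms True] cl by (simp add: F.M.minus_eq_zero_iff)
    finally show ?thesis using True by (simp add: cocycles_def)
  qed (simp add: cocycles_def)
qed

lemma cocycleD:
  assumes "module R M" "module R N" "\<phi> \<in> cocyc R M N n"
  shows cocycle_lin: "lin_map R (sres R M i) (sres R N (i - n)) (\<phi> i)"
    and cocycle_bd: "w \<in> carrier (sres R M i) \<Longrightarrow>
      res_bd R (\<phi> i w) = sgn_ring R n \<odot>\<^bsub>Fall R\<^esub> \<phi> (i - 1) (res_bd R w)"
  using assms(3) cocycles_iff[OF assms(1,2)] hom_cpx_lin by blast+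

section \<open>Extending functionals to cocycles and recognising coboundaries\<close>

lemma (in module) smult_cyc:
  assumes "w \<in> carrier (sres R M i)" "cyc i w" "c \<in> carrier R"
  shows "cyc i (c \<odot>\<^bsub>F\<^esub> w)"
proof -
  interpret F: module R F by (rule F_module)
  show ?thesis using lin_map_smult[OF bd_lin assms(3,1)] lin_map_smult[OF aug_lin assms(3), of w] assms
    by (auto simp: cyc_def)
qed

text \<open>The comparison theorem: projectivity lifts \<open>g\<close> through the augmentation,
  and each further component is lifted through the boundary, because exactness puts the required
  values in its image.\<close>

lemma cocycle_lift:
  fixes n :: int
  assumes M: "module R M" and N: "module R N" and n: "n \<ge> 0"
    and g: "lin_map R (sres R M n) N g"
    and gd: "\<And>w. w \<in> carrier (sres R M (n + 1)) \<Longrightarrow> g (res_bd R w) = \<zero>\<^bsub>N\<^esub>"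
  shows "\<exists>\<phi>\<in>cocyc R M N n. \<forall>w\<in>carrier (sres R M n). res_aug R N (\<phi> n w) = g w"
proof -
  interpret M: module R M by fact
  interpret N: module R N by fact
  interpret F: module R N.F by (rule N.F_module)
  \<comment> \<open>\<open>P k\<close> says that \<phi> is a candidate for source degree
    \<open>n + k\<close> whose values on boundaries are cycles, which is what the next lifting
    needs; \<open>Q\<close> is the cocycle equation between consecutive components.\<close>
  define P where "P k \<phi> \<longleftrightarrow> \<phi> \<in> mod_hom R (sres R M (n + int k)) (sres R N (int k)) \<and>
    (\<forall>w\<in>carrier (sres R M (n + int k + 1)). N.cyc (int k) (\<phi> (res_bd R w))) \<and>
    (k = 0 \<longrightarrow> (\<forall>w\<in>carrier (sres R M n). res_aug R N (\<phi> w) = g w))" for k \<phi>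
  define Q where "Q k \<phi> \<phi>' \<longleftrightarrow> (\<forall>w\<in>carrier (sres R M (n + int k + 1)).
      res_bd R (\<phi>' w) = sgn_ring R n \<odot>\<^bsub>N.F\<^esub> \<phi> (res_bd R w))" for k :: nat and \<phi> \<phi>'
  have "\<exists>f. \<forall>k. P k (f k) \<and> Q k (f k) (f (Suc k))"
  proof (rule dependent_nat_choice)
    have "\<exists>\<eta>\<in>mod_hom R (sres R M n) (sres R N 0). \<forall>w\<in>carrier (sres R M n). res_aug R N (\<eta> w) = g w"
      by (rule M.sres_projective[OF N.sres_module N N.aug_lin g])
         (use N.aug_surj lin_map_closed[OF g] in blast)
    then obtain \<eta> where \<eta>: "\<eta> \<in> mod_hom R (sres R M n) (sres R N 0)"
      "\<And>w. w \<in> carrier (sres R M n) \<Longrightarrow> res_aug R N (\<eta> w) = g w" by blast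
    have "P 0 \<eta>" using \<eta> gd lin_map_closed[OF M.bd_lin, of _ "n + 1"] by (simp add: P_def N.cyc_def)
    then show "\<exists>\<eta>. P 0 \<eta>" by blast
  next
    fix \<phi> k assume P: "P k \<phi>"
    have lin: "lin_map R (sres R M (n + int k)) (sres R N (int k)) \<phi>"
      using P by (simp add: P_def mod_hom_lin_map)
    have cl: "\<phi> (res_bd R w) \<in> carrier (sres R N (int k))" if "w \<in> carrier (sres R M (n + int k + 1))" for w
      using lin_map_closed[OF lin] lin_map_closed[OF M.bd_lin that] by simp
    have "\<exists>\<eta>\<in>mod_hom R (sres R M (n + int k + 1)) (sres R N (int k + 1)).
        \<forall>w\<in>carrier (sres R M (n + int k + 1)).
          res_bd R (\<eta> w) = sgn_ring R n \<odot>\<^bsub>sres R N (int k)\<^esub> \<phi> (res_bd R w)"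
    proof (rule M.sres_projective[OF N.sres_module N.sres_module])
      show "lin_map R (sres R N (int k + 1)) (sres R N (int k)) (res_bd R)"
        using N.bd_lin[of "int k + 1"] by simp
      have bd: "lin_map R (sres R M (n + int k + 1)) (sres R M (n + int k)) (res_bd R)"
        using M.bd_lin[of "n + int k + 1"] by simp
      show "lin_map R (sres R M (n + int k + 1)) (sres R N (int k))
         (\<lambda>w. sgn_ring R n \<odot>\<^bsub>sres R N (int k)\<^esub> \<phi> (res_bd R w))"
        by (intro lin_map_scale N.sres_module M.sgn_ring_closed lin_map_compose[OF bd lin])
      fix w assume w: "w \<in> carrier (sres R M (n + int k + 1))"
      show "sgn_ring R n \<odot>\<^bsub>sres R N (int k)\<^esub> \<phi> (res_bd R w) \<in> res_bd R ` carrier (sres R N (int k + 1))"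
      proof (rule N.sres_exact)
        show "sgn_ring R n \<odot>\<^bsub>sres R N (int k)\<^esub> \<phi> (res_bd R w) \<in> carrier (sres R N (int k))"
          by (rule module.smult_closed[OF N.sres_module M.sgn_ring_closed cl[OF w]])
        show "N.cyc (int k) (sgn_ring R n \<odot>\<^bsub>sres R N (int k)\<^esub> \<phi> (res_bd R w))"
          using N.smult_cyc[OF cl[OF w] _ M.sgn_ring_closed] P w by (simp add: P_def)
      qed simp
    qed
    then obtain \<eta> where \<eta>: "\<eta> \<in> mod_hom R (sres R M (n + int k + 1)) (sres R N (int k + 1))"
      "\<And>w. w \<in> carrier (sres R M (n + int k + 1)) \<Longrightarrow>
          res_bd R (\<eta> w) = sgn_ring R n \<odot>\<^bsub>N.F\<^esub> \<phi> (res_bd R w)" by auto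
    have "res_bd R (\<eta> (res_bd R w)) = \<zero>\<^bsub>N.F\<^esub>" if w: "w \<in> carrier (sres R M (n + int k + 1 + 1))" for w
    proof -
      have "res_bd R w \<in> carrier (sres R M (n + int k + 1))"
        using lin_map_closed[OF M.bd_lin w] by (simp add: add.commute)
      moreover have "\<phi> \<zero>\<^bsub>M.F\<^esub> = \<zero>\<^bsub>N.F\<^esub>"
        using lin_map_zero[OF M.sres_module N.sres_module lin] by simp
      ultimately show ?thesis using \<eta>(2) M.bd_bd[OF w] by simp
    qed
    then have "P (Suc k) \<eta>" using \<eta>(1) by (simp add: P_def N.cyc_def algebra_simps)
    then show "\<exists>\<eta>. P (Suc k) \<eta> \<and> Q k \<phi> \<eta>" using \<eta>(2) by (auto simp: Q_def)
  qed
  then obtain f where f: "\<And>k. P k (f k)" "\<And>k. Q k (f k) (f (Suc k))" by blast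
  \<comment> \<open>\<open>f k\<close> is the component in source degree \<open>n + k\<close>; below
    degree \<open>n\<close> the target has negative degree, so the component must be zero.\<close>
  define \<phi> where "\<phi> i = (if i < n then \<lambda>w\<in>carrier (sres R M i). \<zero>\<^bsub>N.F\<^esub> else f (nat (i - n)))" for i
  have hom: "\<phi> i \<in> mod_hom R (sres R M i) (sres R N (i - n))" for i
  proof (cases "i < n")
    case True
    have "restrict (\<lambda>w. \<zero>\<^bsub>sres R N (i - n)\<^esub>) (carrier (sres R M i)) \<in> mod_hom R (sres R M i) (sres R N (i - n))"
      by (intro restrict_mod_hom M.sres_module lin_map_const_zero N.sres_module)
    then show ?thesis using True by (simp add: \<phi>_def)
  next
    case False
    then show ?thesis using f(1)[of "nat (i - n)"] by (simp add: \<phi>_def P_def)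
  qed
  then have carr: "\<phi> \<in> carrier (hcpx R M N n)" by (simp add: hom_cpx_carrier)
  have bd: "res_bd R (\<phi> i w) = sgn_ring R n \<odot>\<^bsub>N.F\<^esub> \<phi> (i - 1) (res_bd R w)"
    if w: "w \<in> carrier (sres R M i)" for i w
  proof (cases "i \<le> n")
    \<comment> \<open>Both sides lie in a negative degree.\<close>
    case True
    have l: "res_bd R (\<phi> i w) \<in> carrier (sres R N (i - n - 1))"
      using lin_map_closed[OF N.bd_lin lin_map_closed[OF hom_cpx_lin[OF carr] w]] .
    have r: "\<phi> (i - 1) (res_bd R w) \<in> carrier (sres R N (i - 1 - n))"
      using lin_map_closed[OF hom_cpx_lin[OF carr] lin_map_closed[OF M.bd_lin w]] .
    show ?thesis using N.sres_neg[OF _ l] N.sres_neg[OF _ r] True by simp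
  next
    case False
    then have e: "nat (i - n) = Suc (nat (i - 1 - n))" "n + int (nat (i - 1 - n)) + 1 = i" by auto
    show ?thesis using f(2)[of "nat (i - 1 - n)"] w False
      unfolding \<phi>_def Q_def e by simp
  qed
  have "\<phi> \<in> cocyc R M N n" using carr bd cocycles_iff[OF M N] by blast
  moreover have "res_aug R N (\<phi> n w) = g w" if "w \<in> carrier (sres R M n)" for w
    using f(1)[of 0] that by (simp add: \<phi>_def P_def)
  ultimately show ?thesis by blast
qed

text \<open>A cocycle whose augmented lowest component factors through the boundary induces nothing
  up to homotopy. The factorisation \<open>g\<close> starts the homotopy in degree
  \<open>n - 1\<close>, and exactness continues it.\<close>

lemma coboundary_criterion:
  fixes n :: int
  assumes M: "module R M" and N: "module R N" and n: "n \<ge> 0" and \<phi>: "\<phi> \<in> cocyc R M N n"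
    and g: "lin_map R (sres R M (n - 1)) N g"
    and gd: "\<And>w. w \<in> carrier (sres R M n) \<Longrightarrow> res_aug R N (\<phi> n w) = g (res_bd R w)"
  shows "\<phi> \<in> cobd R M N n"
proof -
  interpret M: module R M by fact
  interpret N: module R N by fact
  interpret F: module R N.F by (rule N.F_module)
  let ?s = "sgn_ring R n"
  note \<phi>lin = cocycle_lin[OF M N \<phi>] and \<phi>bd = cocycle_bd[OF M N \<phi>]
  \<comment> \<open>A primitive \<eta> of degree \<open>n - 1\<close> has to satisfy
    \<open>d \<eta> + ?s \<eta> d = \<phi>\<close>, the sign of degree \<open>n - 1\<close> being
    opposite to \<open>?s\<close>. So \<open>?D\<close> is what the boundary of the next component
    must equal, and \<open>P\<close> asks that it be a cycle.\<close>
  let ?D = "\<lambda>k \<eta> w. \<phi> (n + int k) w \<ominus>\<^bsub>N.F\<^esub> ?s \<odot>\<^bsub>N.F\<^esub> \<eta> (res_bd R w)"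
  define P where "P k \<eta> \<longleftrightarrow> \<eta> \<in> mod_hom R (sres R M (n - 1 + int k)) (sres R N (int k)) \<and>
    (\<forall>w\<in>carrier (sres R M (n + int k)). N.cyc (int k) (?D k \<eta> w))" for k \<eta>
  define Q where "Q k \<eta> \<eta>' \<longleftrightarrow> (\<forall>w\<in>carrier (sres R M (n + int k)). res_bd R (\<eta>' w) = ?D k \<eta> w)"
    for k and \<eta> \<eta>'
  have bdM: "lin_map R (sres R M (n + int k)) (sres R M (n - 1 + int k)) (res_bd R)" for k
    using M.bd_lin[of "n + int k"] by (simp add: algebra_simps)
  have \<phi>l: "lin_map R (sres R M (n + int k)) (sres R N (int k)) (\<phi> (n + int k))" for k
    using \<phi>lin[of "n + int k"] by simp
  have D_lin: "lin_map R (sres R M (n + int k)) (sres R N (int k)) (?D k \<eta>)"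
    if "lin_map R (sres R M (n - 1 + int k)) (sres R N (int k)) \<eta>" for k \<eta>
  proof (rule lin_map_cong[OF M.sres_module lin_map_diff[OF M.sres_module N.sres_module \<phi>l]])
    show 1: "lin_map R (sres R M (n + int k)) (sres R N (int k)) (\<lambda>w. ?s \<odot>\<^bsub>sres R N (int k)\<^esub> \<eta> (res_bd R w))"
      by (intro lin_map_scale N.sres_module M.sgn_ring_closed lin_map_compose[OF bdM that])
    fix w assume w: "w \<in> carrier (sres R M (n + int k))"
    show "\<phi> (n + int k) w \<ominus>\<^bsub>sres R N (int k)\<^esub> ?s \<odot>\<^bsub>sres R N (int k)\<^esub> \<eta> (res_bd R w) = ?D k \<eta> w"
      using N.sres_minus(2)[OF lin_map_closed[OF \<phi>l w] lin_map_closed[OF 1 w]] by simp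
  qed
  have "\<exists>f. \<forall>k. P k (f k) \<and> Q k (f k) (f (Suc k))"
  proof (rule dependent_nat_choice)
    \<comment> \<open>Since \<open>?s\<close> squares to one, this choice makes the augmentation of
      \<open>?D 0 \<eta>\<close> cancel.\<close>
    have "\<exists>\<eta>\<in>mod_hom R (sres R M (n - 1)) (sres R N 0).
        \<forall>w\<in>carrier (sres R M (n - 1)). res_aug R N (\<eta> w) = ?s \<odot>\<^bsub>N\<^esub> g w"
      by (rule M.sres_projective[OF N.sres_module N N.aug_lin lin_map_scale[OF N g M.sgn_ring_closed]])
         (use N.aug_surj lin_map_closed[OF lin_map_scale[OF N g M.sgn_ring_closed]] in blast)
    then obtain \<eta> where \<eta>: "\<eta> \<in> mod_hom R (sres R M (n - 1)) (sres R N 0)"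
      "\<And>w. w \<in> carrier (sres R M (n - 1)) \<Longrightarrow> res_aug R N (\<eta> w) = ?s \<odot>\<^bsub>N\<^esub> g w" by blast
    have l\<eta>: "lin_map R (sres R M (n - 1)) (sres R N 0) \<eta>" using \<eta>(1) by (simp add: mod_hom_lin_map)
    have "res_aug R N (?D 0 \<eta> w) = \<zero>\<^bsub>N\<^esub>" if w: "w \<in> carrier (sres R M n)" for w
    proof -
      have dw: "res_bd R w \<in> carrier (sres R M (n - 1))" using lin_map_closed[OF M.bd_lin w] .
      have e: "\<eta> (res_bd R w) \<in> carrier (sres R N 0)" using lin_map_closed[OF l\<eta> dw] .
      have p: "\<phi> n w \<in> carrier (sres R N 0)" using lin_map_closed[OF \<phi>lin w] by simp
      have se: "?s \<odot>\<^bsub>sres R N 0\<^esub> \<eta> (res_bd R w) \<in> carrier (sres R N 0)"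
        by (rule module.smult_closed[OF N.sres_module M.sgn_ring_closed e])
      have gc: "g (res_bd R w) \<in> carrier N" using lin_map_closed[OF g dw] .
      have "res_aug R N (\<phi> n w \<ominus>\<^bsub>sres R N 0\<^esub> ?s \<odot>\<^bsub>sres R N 0\<^esub> \<eta> (res_bd R w)) =
          g (res_bd R w) \<ominus>\<^bsub>N\<^esub> ?s \<odot>\<^bsub>N\<^esub> (?s \<odot>\<^bsub>N\<^esub> g (res_bd R w))"
        using lin_map_minus(2)[OF N.sres_module N N.aug_lin p se]
          lin_map_smult[OF N.aug_lin M.sgn_ring_closed e] \<eta>(2)[OF dw] gd[OF w] by simp
      also have "\<dots> = \<zero>\<^bsub>N\<^esub>" using gc by (simp add: N.smult_assoc1[symmetric] N.M.minus_eq_zero_iff)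
      finally show ?thesis using N.sres_minus(2)[OF p se] by simp
    qed
    then have "P 0 \<eta>" using \<eta>(1) by (simp add: P_def N.cyc_def)
    then show "\<exists>\<eta>. P 0 \<eta>" by blast
  next
    fix \<eta> k assume P: "P k \<eta>"
    have lin: "lin_map R (sres R M (n - 1 + int k)) (sres R N (int k)) \<eta>"
      using P by (simp add: P_def mod_hom_lin_map)
    have "\<exists>\<eta>'\<in>mod_hom R (sres R M (n + int k)) (sres R N (int k + 1)).
        \<forall>w\<in>carrier (sres R M (n + int k)). res_bd R (\<eta>' w) = ?D k \<eta> w"
    proof (rule M.sres_projective[OF N.sres_module N.sres_module _ D_lin[OF lin]])
      show "lin_map R (sres R N (int k + 1)) (sres R N (int k)) (res_bd R)"
        using N.bd_lin[of "int k + 1"] by simp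
      fix w assume w: "w \<in> carrier (sres R M (n + int k))"
      show "?D k \<eta> w \<in> res_bd R ` carrier (sres R N (int k + 1))"
        using P w by (intro N.sres_exact lin_map_closed[OF D_lin[OF lin]]) (auto simp: P_def)
    qed
    then obtain \<eta>' where \<eta>': "\<eta>' \<in> mod_hom R (sres R M (n + int k)) (sres R N (int k + 1))"
      "\<And>w. w \<in> carrier (sres R M (n + int k)) \<Longrightarrow> res_bd R (\<eta>' w) = ?D k \<eta> w" by blast
    have l': "lin_map R (sres R M (n + int k)) (sres R N (int k + 1)) \<eta>'"
      using \<eta>' by (simp add: mod_hom_lin_map)
    have "res_bd R (?D (Suc k) \<eta>' w) = \<zero>\<^bsub>N.F\<^esub>" if w: "w \<in> carrier (sres R M (n + int k + 1))" for w
    proof -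
      have dw: "res_bd R w \<in> carrier (sres R M (n + int k))"
        using lin_map_closed[OF M.bd_lin w] by simp
      have p: "\<phi> (n + int k + 1) w \<in> carrier (sres R N (int k + 1))"
        using lin_map_closed[OF \<phi>lin w] by (simp add: algebra_simps)
      have e: "\<eta>' (res_bd R w) \<in> carrier (sres R N (int k + 1))" using lin_map_closed[OF l' dw] .
      have se: "?s \<odot>\<^bsub>sres R N (int k + 1)\<^esub> \<eta>' (res_bd R w) \<in> carrier (sres R N (int k + 1))"
        by (rule module.smult_closed[OF N.sres_module M.sgn_ring_closed e])
      have q: "\<phi> (n + int k) (res_bd R w) \<in> carrier N.F"
        using lin_map_closed[OF \<phi>l dw] sres_sub by blast
      have D: "?D k \<eta> (res_bd R w) = \<phi> (n + int k) (res_bd R w)"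
        using M.bd_bd[OF w] lin_map_zero[OF M.sres_module N.sres_module lin] q by (simp add: a_minus_def)
      have "res_bd R (\<phi> (n + int k + 1) w \<ominus>\<^bsub>sres R N (int k + 1)\<^esub> ?s \<odot>\<^bsub>sres R N (int k + 1)\<^esub> \<eta>' (res_bd R w)) =
          res_bd R (\<phi> (n + int k + 1) w) \<ominus>\<^bsub>sres R N (int k)\<^esub> ?s \<odot>\<^bsub>N.F\<^esub> ?D k \<eta> (res_bd R w)"
        using lin_map_minus(2)[OF N.sres_module N.sres_module N.bd_lin p se]
          lin_map_smult[OF N.bd_lin M.sgn_ring_closed e] \<eta>'(2)[OF dw] by simp
      also have "\<dots> = res_bd R (\<phi> (n + int k + 1) w) \<ominus>\<^bsub>sres R N (int k)\<^esub> res_bd R (\<phi> (n + int k + 1) w)"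
        unfolding D using \<phi>bd[OF w] by simp
      also have "\<dots> = \<zero>\<^bsub>N.F\<^esub>"
      proof -
        interpret T: module R "sres R N (int k)" by (rule N.sres_module)
        show ?thesis using lin_map_closed[OF N.bd_lin p] T.M.minus_eq_zero_iff by simp
      qed
      finally show ?thesis using N.sres_minus(2)[OF p se] by (simp add: algebra_simps)
    qed
    then have "P (Suc k) \<eta>'" using \<eta>'(1) by (simp add: P_def N.cyc_def algebra_simps)
    then show "\<exists>\<eta>'. P (Suc k) \<eta>' \<and> Q k \<eta> \<eta>'" using \<eta>'(2) by (auto simp: Q_def)
  qed
  then obtain f where f: "\<And>k. P k (f k)" "\<And>k. Q k (f k) (f (Suc k))" by blast
  \<comment> \<open>\<open>f k\<close> lives in source degree \<open>n - 1 + k\<close>; lower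
    components have a target of negative degree.\<close>
  define \<eta> where "\<eta> i = (if i < n - 1 then \<lambda>w\<in>carrier (sres R M i). \<zero>\<^bsub>N.F\<^esub> else f (nat (i - (n - 1))))" for i
  have hom: "\<eta> i \<in> mod_hom R (sres R M i) (sres R N (i - (n - 1)))" for i
  proof (cases "i < n - 1")
    case True
    have "restrict (\<lambda>w. \<zero>\<^bsub>sres R N (i - (n - 1))\<^esub>) (carrier (sres R M i)) \<in> mod_hom R (sres R M i) (sres R N (i - (n - 1)))"
      by (intro restrict_mod_hom M.sres_module lin_map_const_zero N.sres_module)
    then show ?thesis using True by (simp add: \<eta>_def)
  next
    case False
    then show ?thesis using f(1)[of "nat (i - (n - 1))"] by (simp add: \<eta>_def P_def)
  qed
  then have carr: "\<eta> \<in> carrier (hcpx R M N (n - 1))" by (simp add: hom_cpx_carrier)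
  have "hom_bd (std_res R M) (std_res R N) (n - 1) \<eta> i w = \<phi> i w" for i w
  proof (cases "w \<in> carrier (sres R M i)")
    case False
    moreover have "\<phi> i \<in> extensional (carrier (sres R M i))"
      using \<phi> unfolding cocycles_def by (auto simp: hom_cpx_carrier mod_hom_lin_map)
    ultimately show ?thesis by (simp add: hom_bd_def extensional_def)
  next
    case w: True
    have p: "\<phi> i w \<in> carrier (sres R N (i - n))" using lin_map_closed[OF \<phi>lin w] .
    have pF: "\<phi> i w \<in> carrier N.F" using p sres_sub by blast
    have r: "\<eta> (i - 1) (res_bd R w) \<in> carrier (sres R N (i - n))"
      using lin_map_closed[OF hom_cpx_lin[OF carr] lin_map_closed[OF M.bd_lin w]] by simp
    have rF: "\<eta> (i - 1) (res_bd R w) \<in> carrier N.F" using r sres_sub by blast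
    have l: "res_bd R (\<eta> i w) \<in> carrier (sres R N (i - n))"
      using lin_map_closed[OF N.bd_lin lin_map_closed[OF hom_cpx_lin[OF carr] w]] by simp
    have eq: "res_bd R (\<eta> i w) \<oplus>\<^bsub>N.F\<^esub> ?s \<odot>\<^bsub>N.F\<^esub> \<eta> (i - 1) (res_bd R w) = \<phi> i w"
    proof (cases "i < n")
      case True
      then show ?thesis using N.sres_neg[OF _ l] N.sres_neg[OF _ r] N.sres_neg[OF _ p] by simp
    next
      case False
      then have e: "nat (i - (n - 1)) = Suc (nat (i - n))" "n + int (nat (i - n)) = i" by auto
      have "res_bd R (\<eta> i w) = \<phi> i w \<ominus>\<^bsub>N.F\<^esub> ?s \<odot>\<^bsub>N.F\<^esub> \<eta> (i - 1) (res_bd R w)"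
        using f(2)[of "nat (i - n)"] w False unfolding \<eta>_def Q_def e by simp
      then show ?thesis using pF rF
        by (simp add: a_minus_def F.M.add.m_assoc F.M.l_neg)
    qed
    show ?thesis
      using hom_bd_apply[OF M N carr w] eq rF M.sgn_ring_pred[of n]
      by (simp add: a_minus_def F.smult_l_minus)
  qed
  then have "hom_bd (std_res R M) (std_res R N) (n - 1) \<eta> = \<phi>" by (simp add: fun_eq_iff)
  then show ?thesis using carr by (auto simp: coboundaries_def)
qed

lemma reg_module_sel [simp]:
  "carrier (reg_module R) = carrier R" "\<zero>\<^bsub>reg_module R\<^esub> = \<zero>\<^bsub>R\<^esub>"
  "ring.add (reg_module R) = ring.add R" "smult (reg_module R) = monoid.mult R"
  by (simp_all add: reg_module_def)

lemma reg_module_module: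
  assumes "cring R"
  shows "module R (reg_module R)"
proof -
  interpret cring R by fact
  have "abelian_group (reg_module R)"
    by (rule abelian_groupI) (auto simp: a_ac intro: l_neg)
  then show ?thesis
    by (intro moduleI) (auto simp: assms l_distr r_distr m_assoc)
qed

text \<open>Moving the boundary past \<phi> and then past \<psi> multiplies the two signs.\<close>

lemma cochain_comp_cocycle:
  assumes M: "module R M" and \<phi>: "\<phi> \<in> cocyc R M M i" and \<psi>: "\<psi> \<in> cocyc R M M j"
  shows "cochain_comp (std_res R M) j \<phi> \<psi> \<in> cocyc R M M (i + j)"
proof -
  interpret M: module R M by fact
  interpret F: module R M.F by (rule M.F_module)
  note l = cocycle_lin[OF M M]
  let ?\<chi> = "cochain_comp (std_res R M) j \<phi> \<psi>"
  have "?\<chi> k \<in> mod_hom R (sres R M k) (sres R M (k - (i + j)))" for k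
    using restrict_mod_hom[OF M.sres_module lin_map_compose[OF l[OF \<psi>, of k] l[OF \<phi>, of "k - j"]]]
    by (simp add: cochain_comp_def compose_def algebra_simps)
  then have c: "?\<chi> \<in> carrier (hcpx R M M (i + j))" by (simp add: hom_cpx_carrier)
  have "res_bd R (?\<chi> k w) = sgn_ring R (i + j) \<odot>\<^bsub>M.F\<^esub> ?\<chi> (k - 1) (res_bd R w)"
    if w: "w \<in> carrier (sres R M k)" for k w
  proof -
    have dw: "res_bd R w \<in> carrier (sres R M (k - 1))" using lin_map_closed[OF M.bd_lin w] .
    have p: "\<psi> k w \<in> carrier (sres R M (k - j))" using lin_map_closed[OF l[OF \<psi>] w] .
    have q: "\<psi> (k - 1) (res_bd R w) \<in> carrier (sres R M (k - j - 1))"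
      using lin_map_closed[OF l[OF \<psi>] dw] by (simp add: algebra_simps)
    have r: "\<phi> (k - j - 1) (\<psi> (k - 1) (res_bd R w)) \<in> carrier M.F"
      using lin_map_closed[OF l[OF \<phi>] q] sres_sub by blast
    have "res_bd R (?\<chi> k w) = sgn_ring R i \<odot>\<^bsub>M.F\<^esub> \<phi> (k - j - 1) (res_bd R (\<psi> k w))"
      using w cocycle_bd[OF M M \<phi> p] by (simp add: cochain_comp_def compose_def)
    also have "\<dots> = sgn_ring R i \<odot>\<^bsub>M.F\<^esub> (sgn_ring R j \<odot>\<^bsub>M.F\<^esub> \<phi> (k - j - 1) (\<psi> (k - 1) (res_bd R w)))"
      using cocycle_bd[OF M M \<psi> w] lin_map_smult[OF l[OF \<phi>] M.sgn_ring_closed q] by simp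
    also have "\<dots> = sgn_ring R (i + j) \<odot>\<^bsub>M.F\<^esub> \<phi> (k - j - 1) (\<psi> (k - 1) (res_bd R w))"
      using r by (simp add: F.smult_assoc1[symmetric] sgn_ring_def M.R.l_minus M.R.r_minus)
    finally show ?thesis using dw by (simp add: cochain_comp_def compose_def algebra_simps)
  qed
  then show ?thesis using c cocycles_iff[OF M M] by blast
qed

section \<open>Algebras with a two-periodic resolution\<close>

text \<open>Isolates what is used of \<open>A\<close> over its enveloping algebra: multiplication by
  \<open>h\<close>, \<open>D\<close>, \<open>h\<close>, ... on copies of \<open>R\<close>, augmented
  by acting on the unit of \<open>M\<close>, is an exact complex. \<open>M\<close> is an algebra so
  that values in \<open>M\<close> can be multiplied.\<close>

locale periodic_algebra = algebra R M for R (structure) and M (structure) +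
  fixes h D
  assumes h_closed [simp]: "h \<in> carrier R" and D_closed [simp]: "D \<in> carrier R"
    and one_gen: "m \<in> carrier M \<Longrightarrow> \<exists>r\<in>carrier R. m = r \<odot>\<^bsub>M\<^esub> \<one>\<^bsub>M\<^esub>"
    and h_one [simp]: "h \<odot>\<^bsub>M\<^esub> \<one>\<^bsub>M\<^esub> = \<zero>\<^bsub>M\<^esub>"
    and ann_one: "r \<in> carrier R \<Longrightarrow> r \<odot>\<^bsub>M\<^esub> \<one>\<^bsub>M\<^esub> = \<zero>\<^bsub>M\<^esub> \<Longrightarrow> \<exists>s\<in>carrier R. r = h \<otimes> s"
    and h_D: "h \<otimes> D = \<zero>"
    and ann_h: "r \<in> carrier R \<Longrightarrow> h \<otimes> r = \<zero> \<Longrightarrow> \<exists>s\<in>carrier R. r = D \<otimes> s"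
    and ann_D: "r \<in> carrier R \<Longrightarrow> D \<otimes> r = \<zero> \<Longrightarrow> \<exists>s\<in>carrier R. r = h \<otimes> s"
begin

lemmas MC = cring.cring_simprules[OF M_cring]

lemma M_one [simp]: "\<one>\<^bsub>M\<^esub> \<in> carrier M" by (rule MC)

text \<open>The differential of the periodic complex from degree \<open>i\<close> to \<open>i - 1\<close>.\<close>

definition x :: "int \<Rightarrow> 'a" where "x i = (if odd i then h else D)"

lemma x_closed [simp]: "x i \<in> carrier R" by (simp add: x_def)

lemma x_x: "x (i + 1) \<otimes> x i = \<zero>"
  using h_D by (simp add: x_def R.m_comm)

lemma ann_x: "r \<in> carrier R \<Longrightarrow> x i \<otimes> r = \<zero> \<Longrightarrow> \<exists>s\<in>carrier R. r = x (i + 1) \<otimes> s"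
  using ann_h ann_D by (auto simp: x_def split: if_splits)

lemma h_smult [simp]:
  assumes "m \<in> carrier M"
  shows "h \<odot>\<^bsub>M\<^esub> m = \<zero>\<^bsub>M\<^esub>"
proof -
  obtain r where r: "r \<in> carrier R" "m = r \<odot>\<^bsub>M\<^esub> \<one>\<^bsub>M\<^esub>" using one_gen[OF assms] by blast
  then have "h \<odot>\<^bsub>M\<^esub> m = r \<odot>\<^bsub>M\<^esub> (h \<odot>\<^bsub>M\<^esub> \<one>\<^bsub>M\<^esub>)"
    by (metis M_one R.m_comm h_closed smult_assoc1)
  then show ?thesis using r by simp
qed

interpretation F: module R F by (rule F_module)

lemma M_module: "module R M" by (rule module_axioms)

lemma R_module: "module R (reg_module R)" by (rule reg_module_module) (rule R.cring_axioms)

lemma SF: "w \<in> carrier (sres R M i) \<Longrightarrow> w \<in> carrier F"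
  using sres_sub by blast

lemma sres_zero_closed [simp]: "\<zero>\<^bsub>F\<^esub> \<in> carrier (sres R M i)"
proof -
  interpret S: module R "sres R M i" by (rule sres_module)
  show ?thesis using S.M.zero_closed by simp
qed

lemma sres_smult_closed:
  "r \<in> carrier R \<Longrightarrow> w \<in> carrier (sres R M i) \<Longrightarrow> r \<odot>\<^bsub>F\<^esub> w \<in> carrier (sres R M i)"
  using module.smult_closed[OF sres_module, of r w i] by simp

text \<open>\<open>z\<close> and \<open>\<beta>\<close> are the comparison maps between the periodic complex and the standard resolution, and
  \<open>\<kappa>\<close> is the homotopy from the identity of the latter to their composite.\<close>

lemma z_exists:
  "\<exists>z :: int \<Rightarrow> ('a, 'c) cell \<Rightarrow> 'a. (\<forall>i. z i \<in> carrier (sres R M i)) \<and> res_aug R M (z 0) = \<one>\<^bsub>M\<^esub> \<and>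
     (\<forall>i. res_bd R (z i) = x i \<odot>\<^bsub>F\<^esub> z (i - 1))"
proof -
  define P where "P k z \<longleftrightarrow> z \<in> carrier (sres R M (int k)) \<and> cyc (int k) (x (int k + 1) \<odot>\<^bsub>F\<^esub> z) \<and>
    (k = 0 \<longrightarrow> res_aug R M z = \<one>\<^bsub>M\<^esub>)" for k z
  define Q where "Q k z z' \<longleftrightarrow> res_bd R z' = x (int k + 1) \<odot>\<^bsub>F\<^esub> z" for k :: nat and z z' :: "('a, 'c) cell \<Rightarrow> 'a"
  have "\<exists>f. \<forall>k. P k (f k) \<and> Q k (f k) (f (Suc k))"
  proof (rule dependent_nat_choice)
    obtain z where z: "z \<in> carrier (sres R M 0)" "res_aug R M z = \<one>\<^bsub>M\<^esub>"
      using aug_surj[OF M_one] by (metis imageE)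
    have "res_aug R M (x 1 \<odot>\<^bsub>F\<^esub> z) = \<zero>\<^bsub>M\<^esub>"
      using lin_map_smult[OF aug_lin h_closed z(1)] z(2) by (simp add: x_def)
    then show "\<exists>z. P 0 z" using z by (intro exI[of _ z]) (simp add: P_def cyc_def)
  next
    fix z k assume P: "P k z"
    have xz: "x (int k + 1) \<odot>\<^bsub>F\<^esub> z \<in> carrier (sres R M (int k))"
      using sres_smult_closed P by (simp add: P_def)
    obtain z' where z': "z' \<in> carrier (sres R M (int k + 1))" "res_bd R z' = x (int k + 1) \<odot>\<^bsub>F\<^esub> z"
      using sres_exact[OF xz] P by (auto simp: P_def image_iff)
    have zF: "z \<in> carrier F" using P SF by (auto simp: P_def)
    have "res_bd R (x (int k + 2) \<odot>\<^bsub>F\<^esub> z') = (x (int k + 2) \<otimes> x (int k + 1)) \<odot>\<^bsub>F\<^esub> z"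
      using lin_map_smult[OF bd_lin x_closed z'(1), of "int k + 2"] z'(2) zF
      by (simp only: sres_sel F.smult_assoc1 x_closed)
    moreover have "x (int k + 2) \<otimes> x (int k + 1) = \<zero>" using x_x[of "int k + 1"] by (simp only: add.assoc one_add_one)
    ultimately have "res_bd R (x (int k + 2) \<odot>\<^bsub>F\<^esub> z') = \<zero>\<^bsub>F\<^esub>" using zF by simp
    moreover have "int (Suc k) = int k + 1" "int (Suc k) + 1 = int k + 2" by auto
    ultimately have "P (Suc k) z'" using z'(1) unfolding P_def cyc_def by (simp add: add.commute)
    then show "\<exists>z'. P (Suc k) z' \<and> Q k z z'" using z' by (auto simp: Q_def)
  qed
  then obtain f where f: "\<And>k. P k (f k)" "\<And>k. Q k (f k) (f (Suc k))" by blast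
  \<comment> \<open>With zero in negative degrees the boundary equation holds for every
    \<open>i\<close>; for \<open>i \<le> 0\<close> both sides vanish.\<close>
  define z where "z i = (if i < 0 then \<zero>\<^bsub>F\<^esub> else f (nat i))" for i :: int
  have zc: "z i \<in> carrier (sres R M i)" for i
    using f(1)[of "nat i"] by (auto simp: z_def P_def)
  have "res_bd R (z i) = x i \<odot>\<^bsub>F\<^esub> z (i - 1)" for i
  proof (cases "i \<le> 0")
    case True
    have "res_bd R (z i) = \<zero>\<^bsub>F\<^esub>"
      using sres_neg[OF _ lin_map_closed[OF bd_lin zc]] True by simp
    then show ?thesis using True by (simp add: z_def)
  next
    case False
    then have "nat i = Suc (nat (i - 1))" "int (nat (i - 1)) + 1 = i" by auto
    then show ?thesis using f(2)[of "nat (i - 1)"] False by (simp add: z_def Q_def)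
  qed
  moreover have "res_aug R M (z 0) = \<one>\<^bsub>M\<^esub>" using f(1)[of 0] by (simp add: z_def P_def)
  ultimately show ?thesis using zc by blast
qed

definition z :: "int \<Rightarrow> ('a, 'c) cell \<Rightarrow> 'a" where
  "z = (SOME z. (\<forall>i. z i \<in> carrier (sres R M i)) \<and> res_aug R M (z 0) = \<one>\<^bsub>M\<^esub> \<and>
     (\<forall>i. res_bd R (z i) = x i \<odot>\<^bsub>F\<^esub> z (i - 1)))"

lemma z_closed [simp]: "z i \<in> carrier (sres R M i)"
  and z_aug [simp]: "res_aug R M (z 0) = \<one>\<^bsub>M\<^esub>"
  and z_bd: "res_bd R (z i) = x i \<odot>\<^bsub>F\<^esub> z (i - 1)"
  using someI_ex[OF z_exists, folded z_def] by blast+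

lemma mult_lin: "r \<in> carrier R \<Longrightarrow> lin_map R (reg_module R) (reg_module R) (\<lambda>s. r \<otimes> s)"
  by (auto simp: lin_map_def R.r_distr R.m_lcomm)

lemma one_lin: "m \<in> carrier M \<Longrightarrow> lin_map R (reg_module R) M (\<lambda>s. s \<odot>\<^bsub>M\<^esub> m)"
  by (auto simp: lin_map_def smult_l_distr smult_assoc1)

text \<open>The comparison from the standard resolution to the periodic complex, whose exactness
  enters as \<open>ann_one\<close> at the augmentation and as \<open>ann_x\<close> above it. The
  last equation starts at \<open>i = 1\<close>, because \<open>x 0\<close> is \<open>D\<close> and
  not zero.\<close>

lemma \<beta>_exists:
  "\<exists>\<beta> :: int \<Rightarrow> (('a, 'c) cell \<Rightarrow> 'a) \<Rightarrow> 'a. (\<forall>i. lin_map R (sres R M i) (reg_module R) (\<beta> i)) \<and>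
     (\<forall>w\<in>carrier (sres R M 0). \<beta> 0 w \<odot>\<^bsub>M\<^esub> \<one>\<^bsub>M\<^esub> = res_aug R M w) \<and>
     (\<forall>i\<ge>1. \<forall>w\<in>carrier (sres R M i). \<beta> (i - 1) (res_bd R w) = x i \<otimes> \<beta> i w)"
proof -
  define P where "P k \<beta> \<longleftrightarrow> \<beta> \<in> mod_hom R (sres R M (int k)) (reg_module R) \<and>
    (\<forall>w\<in>carrier (sres R M (int k + 1)). \<exists>s\<in>carrier R. \<beta> (res_bd R w) = x (int k + 1) \<otimes> s) \<and>
    (k = 0 \<longrightarrow> (\<forall>w\<in>carrier (sres R M 0). \<beta> w \<odot>\<^bsub>M\<^esub> \<one>\<^bsub>M\<^esub> = res_aug R M w))" for k \<beta>
  define Q where "Q k \<beta> \<beta>' \<longleftrightarrow> (\<forall>w\<in>carrier (sres R M (int k + 1)).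
    \<beta> (res_bd R w) = x (int k + 1) \<otimes> \<beta>' w)" for k :: nat and \<beta> \<beta>'
  have "\<exists>f. \<forall>k. P k (f k) \<and> Q k (f k) (f (Suc k))"
  proof (rule dependent_nat_choice)
    have "\<exists>\<eta>\<in>mod_hom R (sres R M 0) (reg_module R). \<forall>w\<in>carrier (sres R M 0). \<eta> w \<odot>\<^bsub>M\<^esub> \<one>\<^bsub>M\<^esub> = res_aug R M w"
    proof (rule sres_projective[OF R_module M_module one_lin aug_lin])
      fix w assume "w \<in> carrier (sres R M 0)"
      then have "res_aug R M w \<in> carrier M" using lin_map_closed[OF aug_lin] by blast
      then show "res_aug R M w \<in> (\<lambda>s. s \<odot>\<^bsub>M\<^esub> \<one>\<^bsub>M\<^esub>) ` carrier (reg_module R)"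
        using one_gen by auto
    qed simp
    then obtain \<beta> where \<beta>: "\<beta> \<in> mod_hom R (sres R M 0) (reg_module R)"
      "\<And>w. w \<in> carrier (sres R M 0) \<Longrightarrow> \<beta> w \<odot>\<^bsub>M\<^esub> \<one>\<^bsub>M\<^esub> = res_aug R M w" by blast
    have "\<exists>s\<in>carrier R. \<beta> (res_bd R w) = h \<otimes> s" if w: "w \<in> carrier (sres R M 1)" for w
    proof (rule ann_one)
      have dw: "res_bd R w \<in> carrier (sres R M 0)" using lin_map_closed[OF bd_lin w] by simp
      then show "\<beta> (res_bd R w) \<in> carrier R"
        using \<beta>(1) lin_map_closed[of R "sres R M 0" "reg_module R" \<beta>] by (simp add: mod_hom_lin_map)
      show "\<beta> (res_bd R w) \<odot>\<^bsub>M\<^esub> \<one>\<^bsub>M\<^esub> = \<zero>\<^bsub>M\<^esub>" using \<beta>(2)[OF dw] aug_bd[OF w] by simp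
    qed
    then show "\<exists>\<beta>. P 0 \<beta>" using \<beta> by (intro exI[of _ \<beta>]) (simp add: P_def x_def)
  next
    fix \<beta> k assume P: "P k \<beta>"
    have lin: "lin_map R (sres R M (int k)) (reg_module R) \<beta>"
      using P by (simp add: P_def mod_hom_lin_map)
    have "lin_map R (sres R M (int k + 1)) (sres R M (int k)) (res_bd R)"
      using bd_lin[of "int k + 1"] by simp
    from lin_map_compose[OF this lin]
    have "\<exists>\<eta>\<in>mod_hom R (sres R M (int k + 1)) (reg_module R).
        \<forall>w\<in>carrier (sres R M (int k + 1)). x (int k + 1) \<otimes> \<eta> w = \<beta> (res_bd R w)"
      by (rule sres_projective[OF R_module R_module mult_lin[OF x_closed]])
         (use P in \<open>auto simp: P_def\<close>)
    then obtain \<beta>' where \<beta>': "\<beta>' \<in> mod_hom R (sres R M (int k + 1)) (reg_module R)"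
      "\<And>w. w \<in> carrier (sres R M (int k + 1)) \<Longrightarrow> x (int k + 1) \<otimes> \<beta>' w = \<beta> (res_bd R w)" by blast
    have l': "lin_map R (sres R M (int k + 1)) (reg_module R) \<beta>'" using \<beta>' by (simp add: mod_hom_lin_map)
    have "\<exists>s\<in>carrier R. \<beta>' (res_bd R w) = x (int k + 1 + 1) \<otimes> s" if w: "w \<in> carrier (sres R M (int k + 1 + 1))" for w
    proof (rule ann_x)
      have dw: "res_bd R w \<in> carrier (sres R M (int k + 1))" using lin_map_closed[OF bd_lin w] by (simp add: add.commute)
      then show "\<beta>' (res_bd R w) \<in> carrier R" using lin_map_closed[OF l'] by simp
      show "x (int k + 1) \<otimes> \<beta>' (res_bd R w) = \<zero>"
        using \<beta>'(2)[OF dw] bd_bd[OF w] lin_map_zero[OF sres_module R_module lin] by simp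
    qed
    then have "P (Suc k) \<beta>'" using \<beta>'(1) by (simp add: P_def algebra_simps)
    then show "\<exists>\<beta>'. P (Suc k) \<beta>' \<and> Q k \<beta> \<beta>'" using \<beta>'(2) by (auto simp: Q_def)
  qed
  then obtain f where f: "\<And>k. P k (f k)" "\<And>k. Q k (f k) (f (Suc k))" by blast
  define \<beta> where "\<beta> i = (if i < 0 then \<lambda>w. \<zero> else f (nat i))" for i :: int
  have "lin_map R (sres R M i) (reg_module R) (\<beta> i)" for i
    using f(1)[of "nat i"] lin_map_const_zero[OF R_module, of "sres R M i"]
    by (cases "i < 0") (simp_all add: \<beta>_def P_def mod_hom_lin_map)
  moreover have "\<forall>w\<in>carrier (sres R M 0). \<beta> 0 w \<odot>\<^bsub>M\<^esub> \<one>\<^bsub>M\<^esub> = res_aug R M w"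
    using f(1)[of 0] by (simp add: \<beta>_def P_def)
  moreover have "\<beta> (i - 1) (res_bd R w) = x i \<otimes> \<beta> i w" if "i \<ge> 1" "w \<in> carrier (sres R M i)" for i w
  proof -
    have "nat i = Suc (nat (i - 1))" "int (nat (i - 1)) + 1 = i" using that(1) by auto
    then show ?thesis using f(2)[of "nat (i - 1)"] that by (simp add: \<beta>_def Q_def)
  qed
  ultimately show ?thesis by blast
qed

definition \<beta> :: "int \<Rightarrow> (('a, 'c) cell \<Rightarrow> 'a) \<Rightarrow> 'a" where
  "\<beta> = (SOME \<beta>. (\<forall>i. lin_map R (sres R M i) (reg_module R) (\<beta> i)) \<and>
     (\<forall>w\<in>carrier (sres R M 0). \<beta> 0 w \<odot>\<^bsub>M\<^esub> \<one>\<^bsub>M\<^esub> = res_aug R M w) \<and>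
     (\<forall>i\<ge>1. \<forall>w\<in>carrier (sres R M i). \<beta> (i - 1) (res_bd R w) = x i \<otimes> \<beta> i w))"

lemma \<beta>_lin: "lin_map R (sres R M i) (reg_module R) (\<beta> i)"
  and \<beta>_aug: "w \<in> carrier (sres R M 0) \<Longrightarrow> \<beta> 0 w \<odot>\<^bsub>M\<^esub> \<one>\<^bsub>M\<^esub> = res_aug R M w"
  and \<beta>_bd: "i \<ge> 1 \<Longrightarrow> w \<in> carrier (sres R M i) \<Longrightarrow> \<beta> (i - 1) (res_bd R w) = x i \<otimes> \<beta> i w"
  using someI_ex[OF \<beta>_exists, folded \<beta>_def] by blast+

lemma \<beta>_closed [simp]: "w \<in> carrier (sres R M i) \<Longrightarrow> \<beta> i w \<in> carrier R"
  using lin_map_closed[OF \<beta>_lin] by simp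

lemma \<beta>z_lin: "lin_map R (sres R M i) (sres R M i) (\<lambda>w. \<beta> i w \<odot>\<^bsub>F\<^esub> z i)"
proof -
  have "lin_map R (reg_module R) (sres R M i) (\<lambda>r. r \<odot>\<^bsub>F\<^esub> z i)"
    using sres_smult_closed[OF _ z_closed, of _ i] SF[OF z_closed, of i]
    by (auto simp: lin_map_def F.smult_l_distr F.smult_assoc1)
  from lin_map_compose[OF \<beta>_lin this] show ?thesis .
qed

text \<open>The identity minus the composite of the two comparison maps. It induces zero on
  \<open>M\<close>, hence is null-homotopic.\<close>

definition \<tau> :: "int \<Rightarrow> (('a, 'c) cell \<Rightarrow> 'a) \<Rightarrow> ('a, 'c) cell \<Rightarrow> 'a" where
  "\<tau> i w = w \<ominus>\<^bsub>F\<^esub> \<beta> i w \<odot>\<^bsub>F\<^esub> z i"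

lemma sres_diff_lin:
  assumes "lin_map R (sres R M i) (sres R M j) f" "lin_map R (sres R M i) (sres R M j) g"
  shows "lin_map R (sres R M i) (sres R M j) (\<lambda>w. f w \<ominus>\<^bsub>F\<^esub> g w)"
  by (rule lin_map_cong[OF sres_module lin_map_diff[OF sres_module sres_module assms]])
     (use sres_minus(2) lin_map_closed[OF assms(1)] lin_map_closed[OF assms(2)] in blast)

lemma id_lin: "lin_map R N N (\<lambda>w. w)"
  by (simp add: lin_map_def)

lemma \<tau>_lin: "lin_map R (sres R M i) (sres R M i) (\<tau> i)"
  unfolding \<tau>_def by (intro sres_diff_lin \<beta>z_lin id_lin)

lemma sres_bd_diff:
  assumes "v \<in> carrier (sres R M i)" "w \<in> carrier (sres R M i)"
  shows "res_bd R (v \<ominus>\<^bsub>F\<^esub> w) = res_bd R v \<ominus>\<^bsub>F\<^esub> res_bd R w"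
  using lin_map_minus(2)[OF sres_module sres_module bd_lin assms] sres_minus(2)[OF assms]
    sres_minus(2)[OF lin_map_closed[OF bd_lin assms(1)] lin_map_closed[OF bd_lin assms(2)]]
  by simp

lemma \<tau>_bd:
  assumes "i \<ge> 1" "w \<in> carrier (sres R M i)"
  shows "res_bd R (\<tau> i w) = \<tau> (i - 1) (res_bd R w)"
proof -
  have zF: "z (i - 1) \<in> carrier F" using SF z_closed by blast
  have "res_bd R (\<tau> i w) = res_bd R w \<ominus>\<^bsub>F\<^esub> res_bd R (\<beta> i w \<odot>\<^bsub>F\<^esub> z i)"
    unfolding \<tau>_def using assms sres_bd_diff sres_smult_closed by simp
  also have "res_bd R (\<beta> i w \<odot>\<^bsub>F\<^esub> z i) = \<beta> i w \<odot>\<^bsub>F\<^esub> (x i \<odot>\<^bsub>F\<^esub> z (i - 1))"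
    using lin_map_smult[OF bd_lin \<beta>_closed[OF assms(2)] z_closed] z_bd by simp
  also have "\<dots> = \<beta> (i - 1) (res_bd R w) \<odot>\<^bsub>F\<^esub> z (i - 1)"
    using \<beta>_bd[OF assms] assms zF by (simp add: F.smult_assoc1[symmetric] R.m_comm)
  finally show ?thesis by (simp add: \<tau>_def)
qed

text \<open>By \<open>\<tau>_bd\<close> the right-hand side is always a cycle, so it can be lifted
  through the boundary; in degree 0 this holds because \<beta> is compatible with the
  augmentations.\<close>

lemma \<kappa>_exists:
  "\<exists>\<kappa> :: int \<Rightarrow> (('a, 'c) cell \<Rightarrow> 'a) \<Rightarrow> (('a, 'c) cell \<Rightarrow> 'a).
     (\<forall>i. lin_map R (sres R M i) (sres R M (i + 1)) (\<kappa> i)) \<and>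
     (\<forall>i\<ge>0. \<forall>w\<in>carrier (sres R M i). res_bd R (\<kappa> i w) = \<tau> i w \<ominus>\<^bsub>F\<^esub> \<kappa> (i - 1) (res_bd R w))"
proof -
  define P where "P k \<kappa> \<longleftrightarrow> \<kappa> \<in> mod_hom R (sres R M (int k)) (sres R M (int k + 1)) \<and>
    (\<forall>w\<in>carrier (sres R M (int k + 1)). res_bd R (\<kappa> (res_bd R w)) = \<tau> (int k) (res_bd R w)) \<and>
    (k = 0 \<longrightarrow> (\<forall>w\<in>carrier (sres R M 0). res_bd R (\<kappa> w) = \<tau> 0 w))" for k \<kappa>
  define Q where "Q k \<kappa> \<kappa>' \<longleftrightarrow> (\<forall>w\<in>carrier (sres R M (int k + 1)).
    res_bd R (\<kappa>' w) = \<tau> (int k + 1) w \<ominus>\<^bsub>F\<^esub> \<kappa> (res_bd R w))" for k :: nat and \<kappa> \<kappa>'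
  have "\<exists>f. \<forall>k. P k (f k) \<and> Q k (f k) (f (Suc k))"
  proof (rule dependent_nat_choice)
    have "\<exists>\<eta>\<in>mod_hom R (sres R M 0) (sres R M 1). \<forall>w\<in>carrier (sres R M 0). res_bd R (\<eta> w) = \<tau> 0 w"
    proof (rule sres_projective[OF sres_module sres_module _ \<tau>_lin])
      show "lin_map R (sres R M 1) (sres R M 0) (res_bd R)" using bd_lin[of 1] by simp
      fix w assume w: "w \<in> carrier (sres R M 0)"
      have bz: "\<beta> 0 w \<odot>\<^bsub>F\<^esub> z 0 \<in> carrier (sres R M 0)" using w by (simp add: sres_smult_closed)
      have "res_aug R M (\<tau> 0 w) = res_aug R M w \<ominus>\<^bsub>M\<^esub> \<beta> 0 w \<odot>\<^bsub>M\<^esub> res_aug R M (z 0)"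
        unfolding \<tau>_def using lin_map_minus(2)[OF sres_module M_module aug_lin w bz]
          sres_minus(2)[OF w bz] lin_map_smult[OF aug_lin \<beta>_closed[OF w] z_closed] by simp
      also have "\<dots> = \<zero>\<^bsub>M\<^esub>"
        using \<beta>_aug[OF w] lin_map_closed[OF aug_lin w] by (simp add: M.minus_eq_zero_iff)
      finally show "\<tau> 0 w \<in> res_bd R ` carrier (sres R M 1)"
        using sres_exact[OF lin_map_closed[OF \<tau>_lin w]] by (simp add: cyc_def)
    qed
    then obtain \<eta> where \<eta>: "\<eta> \<in> mod_hom R (sres R M 0) (sres R M 1)"
      "\<And>w. w \<in> carrier (sres R M 0) \<Longrightarrow> res_bd R (\<eta> w) = \<tau> 0 w" by blast
    moreover have "res_bd R w \<in> carrier (sres R M 0)" if "w \<in> carrier (sres R M 1)" for w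
      using lin_map_closed[OF bd_lin that] by simp
    ultimately show "\<exists>\<eta>. P 0 \<eta>" by (intro exI[of _ \<eta>]) (simp add: P_def)
  next
    fix \<kappa> k assume P: "P k \<kappa>"
    have lin: "lin_map R (sres R M (int k)) (sres R M (int k + 1)) \<kappa>"
      using P by (simp add: P_def mod_hom_lin_map)
    have bd: "lin_map R (sres R M (int k + 1)) (sres R M (int k)) (res_bd R)"
      using bd_lin[of "int k + 1"] by simp
    have "\<exists>\<eta>\<in>mod_hom R (sres R M (int k + 1)) (sres R M (int k + 1 + 1)).
        \<forall>w\<in>carrier (sres R M (int k + 1)). res_bd R (\<eta> w) = \<tau> (int k + 1) w \<ominus>\<^bsub>F\<^esub> \<kappa> (res_bd R w)"
    proof (rule sres_projective[OF sres_module sres_module])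
      show "lin_map R (sres R M (int k + 1 + 1)) (sres R M (int k + 1)) (res_bd R)"
        using bd_lin[of "int k + 1 + 1"] by (simp add: algebra_simps)
      show l: "lin_map R (sres R M (int k + 1)) (sres R M (int k + 1)) (\<lambda>w. \<tau> (int k + 1) w \<ominus>\<^bsub>F\<^esub> \<kappa> (res_bd R w))"
        by (intro sres_diff_lin \<tau>_lin lin_map_compose[OF bd lin])
      fix w assume w: "w \<in> carrier (sres R M (int k + 1))"
      have t: "\<tau> (int k) (res_bd R w) \<in> carrier F"
        using SF lin_map_closed[OF \<tau>_lin] lin_map_closed[OF bd w] by blast
      have "res_bd R (\<tau> (int k + 1) w \<ominus>\<^bsub>F\<^esub> \<kappa> (res_bd R w)) =
          res_bd R (\<tau> (int k + 1) w) \<ominus>\<^bsub>F\<^esub> res_bd R (\<kappa> (res_bd R w))"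
        by (rule sres_bd_diff[OF lin_map_closed[OF \<tau>_lin w] lin_map_closed[OF lin lin_map_closed[OF bd w]]])
      also have "\<dots> = \<zero>\<^bsub>F\<^esub>"
        using \<tau>_bd[OF _ w] P w t by (simp add: P_def F.M.minus_eq_zero_iff)
      finally show "\<tau> (int k + 1) w \<ominus>\<^bsub>F\<^esub> \<kappa> (res_bd R w) \<in> res_bd R ` carrier (sres R M (int k + 1 + 1))"
        by (intro sres_exact lin_map_closed[OF l] w) (auto simp: cyc_def)
    qed
    then obtain \<kappa>' where \<kappa>': "\<kappa>' \<in> mod_hom R (sres R M (int k + 1)) (sres R M (int k + 1 + 1))"
      "\<And>w. w \<in> carrier (sres R M (int k + 1)) \<Longrightarrow> res_bd R (\<kappa>' w) = \<tau> (int k + 1) w \<ominus>\<^bsub>F\<^esub> \<kappa> (res_bd R w)" by blast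
    have "res_bd R (\<kappa>' (res_bd R w)) = \<tau> (int k + 1) (res_bd R w)" if w: "w \<in> carrier (sres R M (int k + 1 + 1))" for w
    proof -
      have dw: "res_bd R w \<in> carrier (sres R M (int k + 1))" using lin_map_closed[OF bd_lin w] by (simp add: add.commute)
      show ?thesis
        using \<kappa>'(2)[OF dw] bd_bd[OF w] lin_map_zero[OF sres_module sres_module lin]
          SF[OF lin_map_closed[OF \<tau>_lin dw]] by (simp add: a_minus_def)
    qed
    then have "P (Suc k) \<kappa>'" using \<kappa>'(1) by (simp add: P_def algebra_simps)
    then show "\<exists>\<kappa>'. P (Suc k) \<kappa>' \<and> Q k \<kappa> \<kappa>'" using \<kappa>'(2) by (auto simp: Q_def)
  qed
  then obtain f where f: "\<And>k. P k (f k)" "\<And>k. Q k (f k) (f (Suc k))" by blast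
  define \<kappa> where "\<kappa> i = (if i < 0 then \<lambda>w. \<zero>\<^bsub>F\<^esub> else f (nat i))" for i :: int
  have "lin_map R (sres R M i) (sres R M (i + 1)) (\<kappa> i)" for i
    using f(1)[of "nat i"] lin_map_const_zero[OF sres_module, of "sres R M i" "i + 1"]
    by (cases "i < 0") (simp_all add: \<kappa>_def P_def mod_hom_lin_map)
  moreover have "res_bd R (\<kappa> i w) = \<tau> i w \<ominus>\<^bsub>F\<^esub> \<kappa> (i - 1) (res_bd R w)"
    if "i \<ge> 0" and w: "w \<in> carrier (sres R M i)" for i w
  proof (cases "i = 0")
    case True
    then show ?thesis using f(1)[of 0] w SF[OF lin_map_closed[OF \<tau>_lin w]]
      by (simp add: \<kappa>_def P_def a_minus_def)
  next
    case False
    then have "nat i = Suc (nat (i - 1))" "int (nat (i - 1)) + 1 = i" using that(1) by auto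
    then show ?thesis using f(2)[of "nat (i - 1)"] that False by (simp add: \<kappa>_def Q_def)
  qed
  ultimately show ?thesis by blast
qed

definition \<kappa> :: "int \<Rightarrow> (('a, 'c) cell \<Rightarrow> 'a) \<Rightarrow> (('a, 'c) cell \<Rightarrow> 'a)" where
  "\<kappa> = (SOME \<kappa>. (\<forall>i. lin_map R (sres R M i) (sres R M (i + 1)) (\<kappa> i)) \<and>
     (\<forall>i\<ge>0. \<forall>w\<in>carrier (sres R M i). res_bd R (\<kappa> i w) = \<tau> i w \<ominus>\<^bsub>F\<^esub> \<kappa> (i - 1) (res_bd R w)))"

lemma \<kappa>_lin: "lin_map R (sres R M i) (sres R M (i + 1)) (\<kappa> i)"
  and \<kappa>_bd: "i \<ge> 0 \<Longrightarrow> w \<in> carrier (sres R M i) \<Longrightarrow>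
    res_bd R (\<kappa> i w) = \<tau> i w \<ominus>\<^bsub>F\<^esub> \<kappa> (i - 1) (res_bd R w)"
  using someI_ex[OF \<kappa>_exists, folded \<kappa>_def] by blast+

end

lemma (in abelian_group) minus_eq_iff:
  assumes "x \<in> carrier G" "y \<in> carrier G" "w \<in> carrier G"
  shows "x \<ominus> y = w \<longleftrightarrow> x = y \<oplus> w"
  using assms by (auto simp: a_minus_def a_ac r_neg r_neg1 r_neg2)

section \<open>Evaluation of cocycles: kernel and image\<close>

context periodic_algebra
begin

interpretation F: module R F by (rule F_module)

text \<open>Composing with the augmentation and restricting along \<open>z\<close> maps the Hom
  complex to the complex of homomorphisms from the periodic resolution to \<open>M\<close>, all of
  whose terms are copies of \<open>M\<close>.\<close>

definition ev :: "int \<Rightarrow> (int \<Rightarrow> (('a, 'c) cell \<Rightarrow> 'a) \<Rightarrow> (('a, 'c) cell \<Rightarrow> 'a)) \<Rightarrow> 'c" where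
  "ev n \<phi> = res_aug R M (\<phi> n (z n))"

text \<open>The values at \<open>z n\<close> of coboundaries of degree \<open>n\<close>.\<close>

definition null :: "int \<Rightarrow> 'c \<Rightarrow> bool" where
  "null n m \<longleftrightarrow> (if n = 0 then m = \<zero>\<^bsub>M\<^esub> else \<exists>m'\<in>carrier M. m = x n \<odot>\<^bsub>M\<^esub> m')"

lemma null_zero: "null n \<zero>\<^bsub>M\<^esub>"
  unfolding null_def using M.zero_closed smult_r_null[OF x_closed] by metis

lemma x_smult: "m \<in> carrier M \<Longrightarrow> x n \<odot>\<^bsub>M\<^esub> m = (if odd n then \<zero>\<^bsub>M\<^esub> else D \<odot>\<^bsub>M\<^esub> m)"
  by (simp add: x_def)

lemma null_odd: "odd n \<Longrightarrow> null n m \<longleftrightarrow> m = \<zero>\<^bsub>M\<^esub>"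
  using null_zero[of n] by (auto simp: null_def x_smult)

lemma null_even: "even n \<Longrightarrow> n \<noteq> 0 \<Longrightarrow> null n m \<longleftrightarrow> (\<exists>m'\<in>carrier M. m = D \<odot>\<^bsub>M\<^esub> m')"
  by (simp add: null_def x_def)

lemma null_closed: "null n m \<Longrightarrow> m \<in> carrier M"
  by (auto simp: null_def split: if_splits)

lemma null_add: "null n a \<Longrightarrow> null n b \<Longrightarrow> null n (a \<oplus>\<^bsub>M\<^esub> b)"
  unfolding null_def by (auto split: if_splits simp: smult_r_distr[symmetric] intro!: bexI[of _ "_ \<oplus>\<^bsub>M\<^esub> _"])

lemma null_mult: 
  assumes "null n a" "b \<in> carrier M"
  shows "null n (a \<otimes>\<^bsub>M\<^esub> b)"
proof (cases "n = 0")
  case True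
  then show ?thesis using assms cring.cring_simprules(26)[OF M_cring] by (simp add: null_def)
next
  case False
  then obtain m where m: "m \<in> carrier M" "a = x n \<odot>\<^bsub>M\<^esub> m" using assms by (auto simp: null_def)
  then have "a \<otimes>\<^bsub>M\<^esub> b = x n \<odot>\<^bsub>M\<^esub> (m \<otimes>\<^bsub>M\<^esub> b)" "m \<otimes>\<^bsub>M\<^esub> b \<in> carrier M"
    using assms smult_assoc2[OF x_closed] by (auto intro: MC)
  then show ?thesis using False by (auto simp: null_def)
qed

lemma aug_cochain_lin:
  assumes "\<phi> \<in> carrier (hcpx R M M n)"
  shows "lin_map R (sres R M n) M (\<lambda>w. res_aug R M (\<phi> n w))"
proof -
  have "lin_map R (sres R M n) (sres R M 0) (\<phi> n)" using hom_cpx_lin[OF assms, of n] by simp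
  from lin_map_compose[OF this aug_lin] show ?thesis .
qed

text \<open>The cocycle equation turns the value on a boundary into plus or minus a boundary in
  degree 0, which the augmentation kills.\<close>

lemma aug_cocycle_bd:
  assumes "\<phi> \<in> cocyc R M M n" "w \<in> carrier (sres R M (n + 1))"
  shows "res_aug R M (\<phi> n (res_bd R w)) = \<zero>\<^bsub>M\<^esub>"
proof -
  have p: "\<phi> (n + 1) w \<in> carrier (sres R M 1)"
    using lin_map_closed[OF cocycle_lin[OF M_module M_module assms(1)] assms(2)] by simp
  have q: "\<phi> n (res_bd R w) \<in> carrier (sres R M 0)"
    using lin_map_closed[OF cocycle_lin[OF M_module M_module assms(1), of n]]
      lin_map_closed[OF bd_lin assms(2)] by simp
  have "sgn_ring R n \<odot>\<^bsub>F\<^esub> res_bd R (\<phi> (n + 1) w) = \<phi> n (res_bd R w)"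
    using cocycle_bd[OF M_module M_module assms] SF[OF q]
    by (simp add: F.smult_assoc1[symmetric])
  then have "res_aug R M (\<phi> n (res_bd R w)) = sgn_ring R n \<odot>\<^bsub>M\<^esub> res_aug R M (res_bd R (\<phi> (n + 1) w))"
    using lin_map_smult[OF aug_lin sgn_ring_closed[of n], of "res_bd R (\<phi> (n + 1) w)"]
      lin_map_closed[OF bd_lin p] by simp
  then show ?thesis using aug_bd[OF p] by simp
qed

text \<open>\<open>g\<close> vanishes on the boundary of \<open>\<kappa> n w\<close>; expanding that
  boundary by \<open>\<kappa>_bd\<close> gives the formula. Thus such a functional is determined by
  its value at \<open>z n\<close>, up to a term that factors through the boundary.\<close>

lemma functional_homotopy:
  assumes n: "n \<ge> 0" and g: "lin_map R (sres R M n) M g"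
    and gd: "\<And>w. w \<in> carrier (sres R M (n + 1)) \<Longrightarrow> g (res_bd R w) = \<zero>\<^bsub>M\<^esub>"
    and w: "w \<in> carrier (sres R M n)"
  shows "g w = \<beta> n w \<odot>\<^bsub>M\<^esub> g (z n) \<oplus>\<^bsub>M\<^esub> g (\<kappa> (n - 1) (res_bd R w))"
proof -
  interpret S: module R "sres R M n" by (rule sres_module)
  have k: "\<kappa> (n - 1) (res_bd R w) \<in> carrier (sres R M n)"
    using lin_map_closed[OF \<kappa>_lin lin_map_closed[OF bd_lin w]] by simp
  have t: "\<tau> n w \<in> carrier (sres R M n)" using lin_map_closed[OF \<tau>_lin w] .
  have bz: "\<beta> n w \<odot>\<^bsub>F\<^esub> z n \<in> carrier (sres R M n)" using w by (simp add: sres_smult_closed)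
  have gk: "g (\<kappa> (n - 1) (res_bd R w)) \<in> carrier M" "g w \<in> carrier M" "g (z n) \<in> carrier M"
    using lin_map_closed[OF g] k w z_closed by auto
  have "\<zero>\<^bsub>M\<^esub> = g (res_bd R (\<kappa> n w))" using gd lin_map_closed[OF \<kappa>_lin w] by simp
  also have "\<dots> = g (\<tau> n w) \<ominus>\<^bsub>M\<^esub> g (\<kappa> (n - 1) (res_bd R w))"
    using \<kappa>_bd[OF n w] sres_minus(2)[OF t k] lin_map_minus(2)[OF sres_module M_module g t k] by simp
  also have "g (\<tau> n w) = g w \<ominus>\<^bsub>M\<^esub> \<beta> n w \<odot>\<^bsub>M\<^esub> g (z n)"
    using sres_minus(2)[OF w bz] lin_map_minus(2)[OF sres_module M_module g w bz]
      lin_map_smult[OF g \<beta>_closed[OF w] z_closed] by (simp add: \<tau>_def)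
  finally have "g w \<ominus>\<^bsub>M\<^esub> \<beta> n w \<odot>\<^bsub>M\<^esub> g (z n) = g (\<kappa> (n - 1) (res_bd R w))"
    using gk w by (metis M.minus_closed M.minus_eq_zero_iff \<beta>_closed smult_closed)
  then show ?thesis using gk w M.minus_eq_iff by simp
qed

lemma ev_closed:
  assumes "\<phi> \<in> carrier (hcpx R M M n)"
  shows "ev n \<phi> \<in> carrier M"
  unfolding ev_def by (rule lin_map_closed[OF aug_cochain_lin[OF assms] z_closed])

lemma ev_add:
  assumes "\<phi> \<in> carrier (hcpx R M M n)" "\<psi> \<in> carrier (hcpx R M M n)"
  shows "ev n (\<phi> \<oplus>\<^bsub>hcpx R M M n\<^esub> \<psi>) = ev n \<phi> \<oplus>\<^bsub>M\<^esub> ev n \<psi>"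
proof -
  have "\<phi> n (z n) \<in> carrier (sres R M 0)" "\<psi> n (z n) \<in> carrier (sres R M 0)"
    using lin_map_closed[OF hom_cpx_lin[OF assms(1)] z_closed[of n]]
      lin_map_closed[OF hom_cpx_lin[OF assms(2)] z_closed[of n]] by simp_all
  then show ?thesis using lin_map_add[OF aug_lin] by (simp add: ev_def hom_cpx_def)
qed

lemma ev_smult:
  assumes "\<phi> \<in> carrier (hcpx R M M n)" "r \<in> carrier R"
  shows "ev n (r \<odot>\<^bsub>hcpx R M M n\<^esub> \<phi>) = r \<odot>\<^bsub>M\<^esub> ev n \<phi>"
proof -
  have "\<phi> n (z n) \<in> carrier (sres R M 0)"
    using lin_map_closed[OF hom_cpx_lin[OF assms(1)] z_closed[of n]] by simp
  then show ?thesis using lin_map_smult[OF aug_lin assms(2)] by (simp add: ev_def hom_cpx_def)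
qed

text \<open>\<open>x (n + 1)\<close> times \<open>z n\<close> is the boundary of
  \<open>z (n + 1)\<close>.\<close>

lemma ev_cocycle:
  assumes "\<phi> \<in> cocyc R M M n"
  shows "x (n + 1) \<odot>\<^bsub>M\<^esub> ev n \<phi> = \<zero>\<^bsub>M\<^esub>"
proof -
  have c: "\<phi> \<in> carrier (hcpx R M M n)" using assms by (simp add: cocycles_def)
  have "x (n + 1) \<odot>\<^bsub>M\<^esub> ev n \<phi> = res_aug R M (\<phi> n (res_bd R (z (n + 1))))"
    using lin_map_smult[OF aug_cochain_lin[OF c] x_closed z_closed] by (simp add: ev_def z_bd)
  then show ?thesis using aug_cocycle_bd[OF assms z_closed] by simp
qed

text \<open>For a primitive \<eta>, the term \<open>d \<eta>\<close> dies under the augmentation,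
  and \<open>\<eta> d\<close> at \<open>z n\<close> gives \<open>x n\<close> times the value of
  \<eta> at \<open>z (n - 1)\<close>. For \<open>n = 0\<close> that element lies in degree -1 and is
  zero.\<close>

lemma ev_coboundary:
  assumes "\<phi> \<in> cobd R M M n"
  shows "null n (ev n \<phi>)"
proof -
  obtain \<eta> where \<eta>: "\<eta> \<in> carrier (hcpx R M M (n - 1))" "\<phi> = hom_bd (std_res R M) (std_res R M) (n - 1) \<eta>"
    using assms by (auto simp: coboundaries_def)
  let ?s = "sgn_ring R (n - 1)"
  have e: "\<eta> n (z n) \<in> carrier (sres R M 1)"
    using lin_map_closed[OF hom_cpx_lin[OF \<eta>(1)] z_closed, of n] by simp
  have l: "lin_map R (sres R M (n - 1)) M (\<lambda>w. res_aug R M (\<eta> (n - 1) w))"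
    by (rule aug_cochain_lin[OF \<eta>(1)])
  have q: "\<eta> (n - 1) (res_bd R (z n)) \<in> carrier (sres R M 0)"
    using lin_map_closed[OF hom_cpx_lin[OF \<eta>(1)] lin_map_closed[OF bd_lin z_closed], of n] by simp
  have sq: "?s \<odot>\<^bsub>F\<^esub> \<eta> (n - 1) (res_bd R (z n)) \<in> carrier (sres R M 0)"
    using q by (simp add: sres_smult_closed)
  have de: "res_bd R (\<eta> n (z n)) \<in> carrier (sres R M 0)" using lin_map_closed[OF bd_lin e] by simp
  let ?m = "res_aug R M (\<eta> (n - 1) (z (n - 1)))"
  have m: "?m \<in> carrier M" using lin_map_closed[OF l z_closed] .
  have "ev n \<phi> = res_aug R M (res_bd R (\<eta> n (z n))) \<ominus>\<^bsub>M\<^esub> ?s \<odot>\<^bsub>M\<^esub> res_aug R M (\<eta> (n - 1) (res_bd R (z n)))"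
    unfolding ev_def \<eta>(2) using hom_bd_apply[OF M_module M_module \<eta>(1) z_closed]
      sres_minus(2)[OF de sq] lin_map_minus(2)[OF sres_module M_module aug_lin de sq]
      lin_map_smult[OF aug_lin sgn_ring_closed q] by simp
  also have "\<dots> = \<ominus>\<^bsub>M\<^esub> (?s \<odot>\<^bsub>M\<^esub> (x n \<odot>\<^bsub>M\<^esub> ?m))"
    using aug_bd[OF e] lin_map_smult[OF l x_closed z_closed] m by (simp add: z_bd a_minus_def)
  also have "\<dots> = x n \<odot>\<^bsub>M\<^esub> (\<ominus>\<^bsub>M\<^esub> (?s \<odot>\<^bsub>M\<^esub> ?m))"
    using m by (simp add: smult_r_minus smult_assoc1[symmetric] R.m_comm)
  finally have eq: "ev n \<phi> = x n \<odot>\<^bsub>M\<^esub> (\<ominus>\<^bsub>M\<^esub> (?s \<odot>\<^bsub>M\<^esub> ?m))" .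
  have "?m = \<zero>\<^bsub>M\<^esub>" if "n = 0"
    using sres_neg[OF _ z_closed, of "- 1"] that lin_map_zero[OF sres_module M_module l] by simp
  then show ?thesis using eq m by (auto simp: null_def)
qed

text \<open>In \<open>functional_homotopy\<close> the second term already factors through the
  boundary; if the value at \<open>z n\<close> is \<open>x n\<close> times some \<open>m\<close>,
  then \<open>\<beta>_bd\<close> makes the first term factor as well, and
  \<open>coboundary_criterion\<close> applies.\<close>

lemma coboundary_if_null:
  assumes n: "n \<ge> 0" and \<phi>: "\<phi> \<in> cocyc R M M n" and nl: "null n (ev n \<phi>)"
  shows "\<phi> \<in> cobd R M M n"
proof -
  let ?g = "\<lambda>w. res_aug R M (\<phi> n w)"
  have c: "\<phi> \<in> carrier (hcpx R M M n)" using \<phi> by (simp add: cocycles_def)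
  note gl = aug_cochain_lin[OF c]
  note hom = functional_homotopy[OF n gl aug_cocycle_bd[OF \<phi>]]
  have kl: "lin_map R (sres R M (n - 1)) M (\<lambda>v. ?g (\<kappa> (n - 1) v))"
    using lin_map_compose[OF \<kappa>_lin[of "n - 1"], of M ?g] gl by simp
  \<comment> \<open>In degree 0 the witness is taken to be zero, since \<open>\<beta>_bd\<close> is
    available only from degree 1 on.\<close>
  obtain m where m: "m \<in> carrier M" "ev n \<phi> = x n \<odot>\<^bsub>M\<^esub> m" "n = 0 \<Longrightarrow> m = \<zero>\<^bsub>M\<^esub>"
    using nl by (auto simp: null_def split: if_splits)
  have bl: "lin_map R (sres R M (n - 1)) M (\<lambda>v. \<beta> (n - 1) v \<odot>\<^bsub>M\<^esub> m)"
    using lin_map_compose[OF \<beta>_lin one_lin[OF m(1)]] .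
  show ?thesis
  proof (rule coboundary_criterion[OF M_module M_module n \<phi> lin_map_sum[OF M_module bl kl]])
    fix w assume w: "w \<in> carrier (sres R M n)"
    have "\<beta> n w \<odot>\<^bsub>M\<^esub> (x n \<odot>\<^bsub>M\<^esub> m) = \<beta> (n - 1) (res_bd R w) \<odot>\<^bsub>M\<^esub> m"
    proof (cases "n = 0")
      case True
      then show ?thesis using m(3) w lin_map_closed[OF bd_lin w] by simp
    next
      case False
      then show ?thesis using \<beta>_bd[OF _ w] n w m(1)
        by (simp add: smult_assoc1[symmetric] R.m_comm)
    qed
    then show "?g w = \<beta> (n - 1) (res_bd R w) \<odot>\<^bsub>M\<^esub> m \<oplus>\<^bsub>M\<^esub> ?g (\<kappa> (n - 1) (res_bd R w))"
      using hom[OF _ w] m(2) by (simp add: ev_def)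
  qed
qed

text \<open>\<beta> after \<open>z\<close> lifts the identity of \<open>M\<close>, so in degree 0 it
  is one modulo \<open>h\<close>. Passing to the next degree changes the scalar by an element
  annihilated by \<open>x (n + 1)\<close>, alternately a multiple of \<open>D\<close> and of
  \<open>h\<close>. The clause for \<open>n = 0\<close> is needed because in degree 0 multiples of
  \<open>D\<close> are not null.\<close>

lemma \<beta>_z: "\<exists>s\<in>carrier R. \<exists>t\<in>carrier R. \<beta> (int n) (z (int n)) = \<one> \<oplus> h \<otimes> s \<oplus> D \<otimes> t \<and> (n = 0 \<longrightarrow> t = \<zero>)"
proof (induction n)
  case 0
  have "(\<beta> 0 (z 0) \<ominus> \<one>) \<odot>\<^bsub>M\<^esub> \<one>\<^bsub>M\<^esub> = \<zero>\<^bsub>M\<^esub>"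
    using \<beta>_aug[OF z_closed] by (simp add: a_minus_def smult_l_distr smult_l_minus M.r_neg)
  then obtain s where s: "s \<in> carrier R" "\<beta> 0 (z 0) \<ominus> \<one> = h \<otimes> s"
    using ann_one[of "\<beta> 0 (z 0) \<ominus> \<one>"] by auto
  then have "\<beta> 0 (z 0) = \<one> \<oplus> h \<otimes> s \<oplus> D \<otimes> \<zero>" by (simp add: R.minus_eq_iff)
  then show ?case using s by auto
next
  case (Suc n)
  then obtain s t where st: "s \<in> carrier R" "t \<in> carrier R" "\<beta> (int n) (z (int n)) = \<one> \<oplus> h \<otimes> s \<oplus> D \<otimes> t" by blast
  let ?u = "\<beta> (int n + 1) (z (int n + 1))"
  have "x (int n + 1) \<otimes> ?u = \<beta> (int n) (res_bd R (z (int n + 1)))"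
    using \<beta>_bd[of "int n + 1", OF _ z_closed] by simp
  also have "\<dots> = x (int n + 1) \<otimes> \<beta> (int n) (z (int n))"
    using lin_map_smult[OF \<beta>_lin x_closed z_closed] by (simp add: z_bd)
  finally have "x (int n + 1) \<otimes> (?u \<ominus> \<beta> (int n) (z (int n))) = \<zero>"
    by (simp add: a_minus_def R.r_distr R.r_minus R.r_neg)
  then obtain r where r: "r \<in> carrier R" "?u \<ominus> \<beta> (int n) (z (int n)) = x (int n + 1 + 1) \<otimes> r"
    using ann_x[of "?u \<ominus> \<beta> (int n) (z (int n))" "int n + 1"] by auto
  then have "?u = \<beta> (int n) (z (int n)) \<oplus> x (int n + 1 + 1) \<otimes> r"
    using R.minus_eq_iff[of ?u "\<beta> (int n) (z (int n))" "x (int n + 1 + 1) \<otimes> r"] by simp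
  then have u: "?u = \<one> \<oplus> h \<otimes> s \<oplus> D \<otimes> t \<oplus> x (int n + 1 + 1) \<otimes> r" unfolding st(3) .
  show ?case
  proof (cases "even n")
    case True
    then have "?u = \<one> \<oplus> h \<otimes> s \<oplus> D \<otimes> (t \<oplus> r)" using u st r by (simp add: x_def R.r_distr R.a_assoc)
    then show ?thesis using st r by (auto simp: add.commute)
  next
    case False
    then have "?u = \<one> \<oplus> h \<otimes> (s \<oplus> r) \<oplus> D \<otimes> t" using u st r by (simp add: x_def R.r_distr R.a_ac)
    then show ?thesis using st r by (auto simp: add.commute)
  qed
qed

text \<open>The functional \<open>w \<mapsto> \<beta> n w \<odot> a\<close> kills boundaries because
  \<open>x (n + 1)\<close> kills \<open>a\<close>, so it lifts to a cocycle. By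
  \<open>\<beta>_z\<close> the value of that cocycle is \<open>a\<close> up to a multiple of
  \<open>D\<close>.\<close>

lemma ev_surj:
  assumes n: "n \<ge> 0" and a: "a \<in> carrier M" "x (n + 1) \<odot>\<^bsub>M\<^esub> a = \<zero>\<^bsub>M\<^esub>"
  shows "\<exists>\<phi>\<in>cocyc R M M n. null n (ev n \<phi> \<ominus>\<^bsub>M\<^esub> a)"
proof -
  have gl: "lin_map R (sres R M n) M (\<lambda>w. \<beta> n w \<odot>\<^bsub>M\<^esub> a)"
    using lin_map_compose[OF \<beta>_lin one_lin[OF a(1)]] .
  have "\<beta> n (res_bd R w) \<odot>\<^bsub>M\<^esub> a = \<zero>\<^bsub>M\<^esub>" if w: "w \<in> carrier (sres R M (n + 1))" for w
  proof -
    have "\<beta> n (res_bd R w) \<odot>\<^bsub>M\<^esub> a = \<beta> (n + 1) w \<odot>\<^bsub>M\<^esub> (x (n + 1) \<odot>\<^bsub>M\<^esub> a)"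
      using \<beta>_bd[of "n + 1", OF _ w] n a(1) w by (simp add: smult_assoc1[symmetric] R.m_comm)
    then show ?thesis using a w by simp
  qed
  from cocycle_lift[OF M_module M_module n gl this]
  obtain \<phi> where \<phi>: "\<phi> \<in> cocyc R M M n" "\<And>w. w \<in> carrier (sres R M n) \<Longrightarrow> res_aug R M (\<phi> n w) = \<beta> n w \<odot>\<^bsub>M\<^esub> a"
    by blast
  obtain s t where st: "s \<in> carrier R" "t \<in> carrier R" "\<beta> n (z n) = \<one> \<oplus> h \<otimes> s \<oplus> D \<otimes> t" "n = 0 \<Longrightarrow> t = \<zero>"
    using \<beta>_z[of "nat n"] n by auto
  have "ev n \<phi> = (\<one> \<oplus> h \<otimes> s \<oplus> D \<otimes> t) \<odot>\<^bsub>M\<^esub> a" using \<phi>(2)[OF z_closed] st(3) by (simp add: ev_def)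
  also have "\<dots> = a \<oplus>\<^bsub>M\<^esub> D \<odot>\<^bsub>M\<^esub> (t \<odot>\<^bsub>M\<^esub> a)"
    using st a(1) by (simp add: smult_l_distr smult_assoc1)
  finally have "ev n \<phi> \<ominus>\<^bsub>M\<^esub> a = D \<odot>\<^bsub>M\<^esub> (t \<odot>\<^bsub>M\<^esub> a)"
    using st a(1) by (simp add: a_minus_def M.a_ac M.r_neg1 M.r_neg2 M.r_neg)
  \<comment> \<open>In odd degree \<open>D\<close> kills \<open>a\<close>, in positive even degree
    multiples of \<open>D\<close> are null, and in degree 0 the factor \<open>t\<close> is
    zero.\<close>
  moreover have "null n (D \<odot>\<^bsub>M\<^esub> (t \<odot>\<^bsub>M\<^esub> a))"
  proof (cases "odd n")
    case True
    then have "D \<odot>\<^bsub>M\<^esub> (t \<odot>\<^bsub>M\<^esub> a) = t \<odot>\<^bsub>M\<^esub> (D \<odot>\<^bsub>M\<^esub> a)"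
      using a st by (simp add: smult_assoc1[symmetric] R.m_comm)
    moreover have "D \<odot>\<^bsub>M\<^esub> a = \<zero>\<^bsub>M\<^esub>" using a True by (simp add: x_def)
    ultimately show ?thesis using null_zero st by simp
  next
    case False
    then show ?thesis using st a(1) by (cases "n = 0") (auto simp: null_even, simp add: null_def)
  qed
  ultimately show ?thesis using \<phi>(1) by (intro bexI[of _ \<phi>]) simp_all
qed

text \<open>The components of the chain map that \<open>\<psi>\<close> induces on the periodic complex.\<close>

definition coef :: "int \<Rightarrow> (int \<Rightarrow> (('a, 'c) cell \<Rightarrow> 'a) \<Rightarrow> (('a, 'c) cell \<Rightarrow> 'a)) \<Rightarrow> int \<Rightarrow> 'a" where
  "coef j \<psi> k = \<beta> (k - j) (\<psi> k (z k))"

section \<open>Products of values under composition of cocycles\<close>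

lemma coef_closed:
  assumes "\<psi> \<in> cocyc R M M j"
  shows "coef j \<psi> k \<in> carrier R"
  using lin_map_closed[OF cocycle_lin[OF M_module M_module assms] z_closed] by (simp add: coef_def)

lemma coef_base:
  assumes "\<psi> \<in> cocyc R M M j"
  shows "coef j \<psi> j \<odot>\<^bsub>M\<^esub> \<one>\<^bsub>M\<^esub> = ev j \<psi>"
  using lin_map_closed[OF cocycle_lin[OF M_module M_module assms] z_closed, of j] \<beta>_aug
  by (simp add: coef_def ev_def)

lemma cocycle_bd_z:
  assumes "\<psi> \<in> cocyc R M M j"
  shows "res_bd R (\<psi> k (z k)) = (sgn_ring R j \<otimes> x k) \<odot>\<^bsub>F\<^esub> \<psi> (k - 1) (z (k - 1))"
proof -
  note l = cocycle_lin[OF M_module M_module assms]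
  have "\<psi> (k - 1) (z (k - 1)) \<in> carrier F" using lin_map_closed[OF l z_closed] SF by blast
  then show ?thesis
    using cocycle_bd[OF M_module M_module assms z_closed, of k] lin_map_smult[OF l x_closed z_closed]
    by (simp add: z_bd F.smult_assoc1)
qed

text \<open>The scalars \<open>coef j \<psi> k\<close> commute with the periodic differentials up to
  the sign of \<open>j\<close>; the bound on \<open>k\<close> is the one of
  \<open>\<beta>_bd\<close>.\<close>

lemma coef_step:
  assumes "\<psi> \<in> cocyc R M M j" "k \<ge> j + 1"
  shows "x (k - j) \<otimes> coef j \<psi> k = sgn_ring R j \<otimes> x k \<otimes> coef j \<psi> (k - 1)"
proof -
  note l = cocycle_lin[OF M_module M_module assms(1)]
  have p: "\<psi> k (z k) \<in> carrier (sres R M (k - j))" using lin_map_closed[OF l z_closed] .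
  have q: "\<psi> (k - 1) (z (k - 1)) \<in> carrier (sres R M (k - j - 1))"
    using lin_map_closed[OF l z_closed, of "k - 1"] by (simp add: algebra_simps)
  have "x (k - j) \<otimes> coef j \<psi> k = \<beta> (k - j - 1) (res_bd R (\<psi> k (z k)))"
    using \<beta>_bd[OF _ p] assms(2) by (simp add: coef_def)
  also have "\<dots> = (sgn_ring R j \<otimes> x k) \<otimes> \<beta> (k - j - 1) (\<psi> (k - 1) (z (k - 1)))"
    using lin_map_smult[OF \<beta>_lin _ q, of "sgn_ring R j \<otimes> x k"] cocycle_bd_z[OF assms(1)] by simp
  finally show ?thesis by (simp add: coef_def algebra_simps)
qed

text \<open>For even \<open>j\<close> the same differential stands on both sides of
  \<open>coef_step\<close>, so consecutive scalars differ by a multiple of \<open>x (k + 1)\<close>.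
  Multiples of \<open>h\<close> act as zero on \<open>M\<close>, and those of \<open>D\<close> are
  collected in \<open>t\<close>.\<close>

lemma coef_even:
  assumes "\<psi> \<in> cocyc R M M j" "even j"
  shows "\<exists>t\<in>carrier M. coef j \<psi> (j + int k) \<odot>\<^bsub>M\<^esub> \<one>\<^bsub>M\<^esub> = ev j \<psi> \<oplus>\<^bsub>M\<^esub> D \<odot>\<^bsub>M\<^esub> t \<and> (k = 0 \<longrightarrow> t = \<zero>\<^bsub>M\<^esub>)"
proof (induction k)
  case 0
  have "ev j \<psi> \<in> carrier M" using assms ev_closed by (simp add: cocycles_def)
  then show ?case using coef_base[OF assms(1)] by (intro bexI[of _ "\<zero>\<^bsub>M\<^esub>"]) simp_all
next
  case (Suc k)
  then obtain t where t: "t \<in> carrier M" "coef j \<psi> (j + int k) \<odot>\<^bsub>M\<^esub> \<one>\<^bsub>M\<^esub> = ev j \<psi> \<oplus>\<^bsub>M\<^esub> D \<odot>\<^bsub>M\<^esub> t" by blast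
  let ?k = "j + int k + 1"
  note c = coef_closed[OF assms(1)]
  have e: "ev j \<psi> \<in> carrier M" using assms ev_closed by (simp add: cocycles_def)
  have "x (?k - j) = x ?k" using assms(2) by (simp add: x_def)
  then have "x ?k \<otimes> coef j \<psi> ?k = x ?k \<otimes> coef j \<psi> (j + int k)"
    using coef_step[OF assms(1), of ?k] assms(2) by (simp add: sgn_ring_def)
  then have "x ?k \<otimes> (coef j \<psi> ?k \<ominus> coef j \<psi> (j + int k)) = \<zero>"
    using c by (simp add: a_minus_def R.r_distr R.r_minus R.r_neg)
  then obtain s where s: "s \<in> carrier R" "coef j \<psi> ?k \<ominus> coef j \<psi> (j + int k) = x (?k + 1) \<otimes> s"
    using ann_x[of "coef j \<psi> ?k \<ominus> coef j \<psi> (j + int k)" ?k] c by auto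
  have "coef j \<psi> ?k = coef j \<psi> (j + int k) \<oplus> x (?k + 1) \<otimes> s"
    using s c R.minus_eq_iff by simp
  then have "coef j \<psi> ?k \<odot>\<^bsub>M\<^esub> \<one>\<^bsub>M\<^esub> = ev j \<psi> \<oplus>\<^bsub>M\<^esub> D \<odot>\<^bsub>M\<^esub> t \<oplus>\<^bsub>M\<^esub> x (?k + 1) \<odot>\<^bsub>M\<^esub> (s \<odot>\<^bsub>M\<^esub> \<one>\<^bsub>M\<^esub>)"
    using s c t by (simp add: smult_l_distr smult_assoc1)
  also have "\<exists>t'\<in>carrier M. \<dots> = ev j \<psi> \<oplus>\<^bsub>M\<^esub> D \<odot>\<^bsub>M\<^esub> t'"
  proof (cases "odd (?k + 1)")
    case True
    then show ?thesis using s t e by (intro bexI[of _ t]) (simp_all add: x_smult)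
  next
    case False
    then show ?thesis using s t e
      by (intro bexI[of _ "t \<oplus>\<^bsub>M\<^esub> s \<odot>\<^bsub>M\<^esub> \<one>\<^bsub>M\<^esub>"]) (simp_all add: x_smult smult_r_distr M.a_assoc)
  qed
  finally show ?case by (simp add: algebra_simps)
qed

text \<open>For odd \<open>j\<close> the two differentials are interchanged in
  \<open>coef_step\<close>. Two steps turn \<open>D\<close> times one scalar into \<open>D\<close>
  times the scalar two degrees higher, the signs cancelling, so these scalars differ by a multiple
  of \<open>h\<close>, which acts as zero.\<close>

lemma coef_odd:
  assumes "\<psi> \<in> cocyc R M M j" "odd j"
  shows "coef j \<psi> (j + 2 * int k) \<odot>\<^bsub>M\<^esub> \<one>\<^bsub>M\<^esub> = ev j \<psi>"
proof (induction k)
  case 0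
  then show ?case using coef_base[OF assms(1)] by simp
next
  case (Suc k)
  let ?k = "j + 2 * int k"
  note c = coef_closed[OF assms(1)]
  have x: "x (?k + 1) = D" "x (?k + 1 - j) = h" "x (?k + 1 + 1) = h" "x (?k + 1 + 1 - j) = D"
    using assms(2) by (auto simp: x_def)
  have 1: "h \<otimes> coef j \<psi> (?k + 1) = \<ominus> (D \<otimes> coef j \<psi> ?k)"
    using coef_step[OF assms(1), of "?k + 1"] assms(2) c x by (simp add: sgn_ring_def R.l_minus)
  have "D \<otimes> coef j \<psi> (?k + 1 + 1) = \<ominus> (h \<otimes> coef j \<psi> (?k + 1))"
    using coef_step[OF assms(1), of "?k + 1 + 1"] assms(2) c x unfolding x
    by (simp add: sgn_ring_def R.l_minus algebra_simps)
  also have "\<dots> = D \<otimes> coef j \<psi> ?k" unfolding 1 using c by simp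
  finally have "D \<otimes> (coef j \<psi> (?k + 1 + 1) \<ominus> coef j \<psi> ?k) = \<zero>"
    using c by (simp add: a_minus_def R.r_distr R.r_minus R.r_neg)
  then obtain s where s: "s \<in> carrier R" "coef j \<psi> (?k + 1 + 1) \<ominus> coef j \<psi> ?k = h \<otimes> s"
    using ann_D c by (meson R.minus_closed)
  then have "coef j \<psi> (?k + 1 + 1) = coef j \<psi> ?k \<oplus> h \<otimes> s" using c R.minus_eq_iff by simp
  then have "coef j \<psi> (?k + 1 + 1) \<odot>\<^bsub>M\<^esub> \<one>\<^bsub>M\<^esub> = coef j \<psi> ?k \<odot>\<^bsub>M\<^esub> \<one>\<^bsub>M\<^esub>"
    using s c by (simp add: smult_l_distr smult_assoc1)
  then show ?case using Suc by (simp add: algebra_simps)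
qed

text \<open>A single step gives \<open>h\<close> times the next scalar as minus \<open>D\<close>
  times \<open>a\<close>, that is minus \<open>h\<close> times \<open>b\<close>; hence the next
  scalar is minus \<open>b\<close> up to a multiple of \<open>D\<close>. This is the origin of the
  extra factor, and of its sign, in products of odd classes.\<close>

lemma coef_odd':
  assumes "\<psi> \<in> cocyc R M M j" "odd j"
    and a: "a \<in> carrier R" "a \<odot>\<^bsub>M\<^esub> \<one>\<^bsub>M\<^esub> = ev j \<psi>" and b: "b \<in> carrier R" "a \<otimes> D = h \<otimes> b"
  shows "\<exists>t\<in>carrier M. coef j \<psi> (j + 2 * int k + 1) \<odot>\<^bsub>M\<^esub> \<one>\<^bsub>M\<^esub> = \<ominus>\<^bsub>M\<^esub> (b \<odot>\<^bsub>M\<^esub> \<one>\<^bsub>M\<^esub>) \<oplus>\<^bsub>M\<^esub> D \<odot>\<^bsub>M\<^esub> t"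
proof -
  let ?k = "j + 2 * int k"
  let ?c = "coef j \<psi> ?k" and ?d = "coef j \<psi> (?k + 1)"
  note c = coef_closed[OF assms(1)]
  have "(?c \<ominus> a) \<odot>\<^bsub>M\<^esub> \<one>\<^bsub>M\<^esub> = \<zero>\<^bsub>M\<^esub>"
    using coef_odd[OF assms(1,2), of k] a c smult_closed[OF c M_one, of "?k"]
    by (simp add: a_minus_def smult_l_distr smult_l_minus M.r_neg)
  then obtain y where y: "y \<in> carrier R" "?c \<ominus> a = h \<otimes> y" using ann_one a c by (meson R.minus_closed)
  then have cy: "?c = a \<oplus> h \<otimes> y" using a c R.minus_eq_iff by simp
  have x: "x (?k + 1) = D" "x (?k + 1 - j) = h" using assms(2) by (auto simp: x_def)
  have "h \<otimes> ?d = \<ominus> (D \<otimes> ?c)"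
    using coef_step[OF assms(1), of "?k + 1"] assms(2) c x by (simp add: sgn_ring_def R.l_minus)
  also have "D \<otimes> ?c = a \<otimes> D \<oplus> (h \<otimes> D) \<otimes> y"
    unfolding cy using a y by (simp add: R.r_distr R.m_ac)
  also have "\<dots> = h \<otimes> b" using h_D b y by simp
  finally have "h \<otimes> (?d \<oplus> b) = \<zero>" using b c by (simp add: R.r_distr R.l_neg)
  then obtain s where s: "s \<in> carrier R" "?d \<oplus> b = D \<otimes> s" using ann_h b c by (meson R.add.m_closed)
  have "D \<otimes> s \<ominus> b = ?d"
    using s b c by (subst R.minus_eq_iff) (simp_all add: R.a_comm flip: s(2))
  then have "?d = \<ominus> b \<oplus> D \<otimes> s" using s b by (simp add: a_minus_def R.a_comm)
  then have "?d \<odot>\<^bsub>M\<^esub> \<one>\<^bsub>M\<^esub> = \<ominus>\<^bsub>M\<^esub> (b \<odot>\<^bsub>M\<^esub> \<one>\<^bsub>M\<^esub>) \<oplus>\<^bsub>M\<^esub> D \<odot>\<^bsub>M\<^esub> (s \<odot>\<^bsub>M\<^esub> \<one>\<^bsub>M\<^esub>)"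
    using b s by (simp add: smult_l_distr smult_l_minus smult_assoc1)
  then show ?thesis using s by auto
qed

text \<open>\<open>functional_homotopy\<close> is applied to the augmented \<open>\<phi> i\<close>
  at the element \<open>\<psi> (i + j) (z (i + j))\<close>, whose \<beta>-coordinate is the
  coefficient. The boundary of this element is a multiple of \<open>x (i + j)\<close>, so the
  remaining term is null.\<close>

lemma ev_comp_coef:
  assumes \<phi>: "\<phi> \<in> cocyc R M M i" and \<psi>: "\<psi> \<in> cocyc R M M j" and i: "i \<ge> 0" and j: "j \<ge> 0"
  shows "\<exists>m. null (i + j) m \<and> ev (i + j) (cochain_comp (std_res R M) j \<phi> \<psi>) =
    (coef j \<psi> (i + j) \<odot>\<^bsub>M\<^esub> \<one>\<^bsub>M\<^esub>) \<otimes>\<^bsub>M\<^esub> ev i \<phi> \<oplus>\<^bsub>M\<^esub> m"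
proof -
  let ?n = "i + j" and ?g = "\<lambda>w. res_aug R M (\<phi> i w)"
  let ?w = "\<psi> ?n (z ?n)" and ?v = "\<psi> (?n - 1) (z (?n - 1))" and ?s = "sgn_ring R j"
  note l = cocycle_lin[OF M_module M_module \<psi>]
  have c: "\<phi> \<in> carrier (hcpx R M M i)" using \<phi> by (simp add: cocycles_def)
  note gl = aug_cochain_lin[OF c]
  have w: "?w \<in> carrier (sres R M i)" using lin_map_closed[OF l z_closed, of ?n] by simp
  have v: "?v \<in> carrier (sres R M (i - 1))"
    using lin_map_closed[OF l z_closed, of "?n - 1"] by (simp add: algebra_simps)
  have gk: "lin_map R (sres R M (i - 1)) M (\<lambda>v. ?g (\<kappa> (i - 1) v))"
    using lin_map_compose[OF \<kappa>_lin[of "i - 1"], of M ?g] gl by simp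
  let ?m = "?g (\<kappa> (i - 1) ?v)"
  have m: "?m \<in> carrier M" using lin_map_closed[OF gk v] .
  have "ev ?n (cochain_comp (std_res R M) j \<phi> \<psi>) = ?g ?w"
    by (simp add: ev_def cochain_comp_def compose_def)
  also have "\<dots> = \<beta> i ?w \<odot>\<^bsub>M\<^esub> ev i \<phi> \<oplus>\<^bsub>M\<^esub> ?g (\<kappa> (i - 1) (res_bd R ?w))"
    using functional_homotopy[OF i gl aug_cocycle_bd[OF \<phi>] w] by (simp add: ev_def)
  also have "?g (\<kappa> (i - 1) (res_bd R ?w)) = (?s \<otimes> x ?n) \<odot>\<^bsub>M\<^esub> ?m"
    using lin_map_smult[OF gk _ v, of "?s \<otimes> x ?n"] cocycle_bd_z[OF \<psi>, of ?n] by simp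
  also have "\<beta> i ?w \<odot>\<^bsub>M\<^esub> ev i \<phi> = (coef j \<psi> ?n \<odot>\<^bsub>M\<^esub> \<one>\<^bsub>M\<^esub>) \<otimes>\<^bsub>M\<^esub> ev i \<phi>"
    using smult_assoc2[OF \<beta>_closed[OF w] M_one ev_closed[OF c]] ev_closed[OF c]
    by (simp add: coef_def MC)
  finally have e: "ev ?n (cochain_comp (std_res R M) j \<phi> \<psi>) =
    (coef j \<psi> ?n \<odot>\<^bsub>M\<^esub> \<one>\<^bsub>M\<^esub>) \<otimes>\<^bsub>M\<^esub> ev i \<phi> \<oplus>\<^bsub>M\<^esub> (?s \<otimes> x ?n) \<odot>\<^bsub>M\<^esub> ?m" .
  have "(?s \<otimes> x ?n) \<odot>\<^bsub>M\<^esub> ?m = x ?n \<odot>\<^bsub>M\<^esub> (?s \<odot>\<^bsub>M\<^esub> ?m)"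
    using m by (simp add: smult_assoc1[symmetric] R.m_comm)
  \<comment> \<open>If \<open>i + j = 0\<close>, then \<open>?v\<close> lies in degree -1.\<close>
  moreover have "?m = \<zero>\<^bsub>M\<^esub>" if "?n = 0"
    using sres_neg[OF _ v] that i j lin_map_zero[OF sres_module M_module gk] by simp
  ultimately have "null ?n ((?s \<otimes> x ?n) \<odot>\<^bsub>M\<^esub> ?m)" using m by (auto simp: null_def)
  then show ?thesis using e by blast
qed

lemma D_kills:
  assumes "\<phi> \<in> cocyc R M M i" "odd i"
  shows "D \<odot>\<^bsub>M\<^esub> ev i \<phi> = \<zero>\<^bsub>M\<^esub>"
  using ev_cocycle[OF assms(1)] assms(2) by (simp add: x_def)

text \<open>For even \<open>j\<close> the coefficient is the value of \<psi> plus a multiple of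
  \<open>D\<close>. That correction disappears: \<open>D\<close> kills the value of \<phi> if
  \<open>i\<close> is odd, the product is null if \<open>i\<close> is even and positive, and the
  correction is zero if \<open>i = 0\<close>. For odd \<open>j\<close> and even \<open>i\<close> the
  coefficient is exact by \<open>coef_odd\<close>.\<close>

lemma ev_comp:
  assumes \<phi>: "\<phi> \<in> cocyc R M M i" and \<psi>: "\<psi> \<in> cocyc R M M j" and i: "i \<ge> 0" and j: "j \<ge> 0"
    and ij: "even i \<or> even j"
  shows "\<exists>m. null (i + j) m \<and>
    ev (i + j) (cochain_comp (std_res R M) j \<phi> \<psi>) = ev i \<phi> \<otimes>\<^bsub>M\<^esub> ev j \<psi> \<oplus>\<^bsub>M\<^esub> m"
proof -
  obtain m where m: "null (i + j) m" "ev (i + j) (cochain_comp (std_res R M) j \<phi> \<psi>) =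
    (coef j \<psi> (i + j) \<odot>\<^bsub>M\<^esub> \<one>\<^bsub>M\<^esub>) \<otimes>\<^bsub>M\<^esub> ev i \<phi> \<oplus>\<^bsub>M\<^esub> m"
    using ev_comp_coef[OF \<phi> \<psi> i j] by blast
  have c: "ev i \<phi> \<in> carrier M" "ev j \<psi> \<in> carrier M" "m \<in> carrier M"
    using ev_closed \<phi> \<psi> null_closed[OF m(1)] by (auto simp: cocycles_def)
  show ?thesis
  proof (cases "even j")
    case True
    obtain t where t: "t \<in> carrier M"
      "coef j \<psi> (i + j) \<odot>\<^bsub>M\<^esub> \<one>\<^bsub>M\<^esub> = ev j \<psi> \<oplus>\<^bsub>M\<^esub> D \<odot>\<^bsub>M\<^esub> t" "i = 0 \<Longrightarrow> t = \<zero>\<^bsub>M\<^esub>"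
      using coef_even[OF \<psi> True, of "nat i"] i by (auto simp: add.commute)
    have "null (i + j) ((D \<odot>\<^bsub>M\<^esub> t) \<otimes>\<^bsub>M\<^esub> ev i \<phi>)"
    proof (cases "odd i")
      case True
      have "(D \<odot>\<^bsub>M\<^esub> t) \<otimes>\<^bsub>M\<^esub> ev i \<phi> = (D \<odot>\<^bsub>M\<^esub> ev i \<phi>) \<otimes>\<^bsub>M\<^esub> t"
        using smult_assoc2[OF D_closed t(1) c(1)] smult_assoc2[OF D_closed c(1) t(1)] t c by (simp add: MC)
      then show ?thesis using D_kills[OF \<phi> True] t null_zero by (simp add: MC)
    next
      case False
      show ?thesis
      proof (cases "i = 0")
        case True
        then show ?thesis using t c null_zero by (simp add: MC)
      next
        case i0: False
        have "null (i + j) (D \<odot>\<^bsub>M\<^esub> t)" using null_even[of "i + j"] False True i0 i j t by auto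
        then show ?thesis using null_mult c by blast
      qed
    qed
    then have "null (i + j) ((D \<odot>\<^bsub>M\<^esub> t) \<otimes>\<^bsub>M\<^esub> ev i \<phi> \<oplus>\<^bsub>M\<^esub> m)" using null_add m by blast
    moreover have "ev (i + j) (cochain_comp (std_res R M) j \<phi> \<psi>) =
        ev i \<phi> \<otimes>\<^bsub>M\<^esub> ev j \<psi> \<oplus>\<^bsub>M\<^esub> ((D \<odot>\<^bsub>M\<^esub> t) \<otimes>\<^bsub>M\<^esub> ev i \<phi> \<oplus>\<^bsub>M\<^esub> m)"
      unfolding m(2) t(2) using c t by (simp add: MC)
    ultimately show ?thesis by blast
  next
    case False
    then have "coef j \<psi> (i + j) \<odot>\<^bsub>M\<^esub> \<one>\<^bsub>M\<^esub> = ev j \<psi>"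
      using coef_odd[OF \<psi> False, of "nat i div 2"] ij i by (auto simp: add.commute zdiv_int)
    then show ?thesis using m c by (auto simp: MC)
  qed
qed

text \<open>As \<open>i\<close> is odd, the coefficient sits an odd number of steps above degree
  \<open>j\<close>, where \<open>coef_odd'\<close> describes it.\<close>

lemma ev_comp_odd:
  assumes \<phi>: "\<phi> \<in> cocyc R M M i" and \<psi>: "\<psi> \<in> cocyc R M M j" and i: "i \<ge> 0" and j: "j \<ge> 0"
    and ij: "odd i" "odd j"
    and a: "a \<in> carrier R" "a \<odot>\<^bsub>M\<^esub> \<one>\<^bsub>M\<^esub> = ev j \<psi>" and b: "b \<in> carrier R" "a \<otimes> D = h \<otimes> b"
  shows "\<exists>m. null (i + j) m \<and>
    ev (i + j) (cochain_comp (std_res R M) j \<phi> \<psi>) = ev i \<phi> \<otimes>\<^bsub>M\<^esub> (\<ominus>\<^bsub>M\<^esub> (b \<odot>\<^bsub>M\<^esub> \<one>\<^bsub>M\<^esub>)) \<oplus>\<^bsub>M\<^esub> m"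
proof -
  obtain m where m: "null (i + j) m" "ev (i + j) (cochain_comp (std_res R M) j \<phi> \<psi>) =
    (coef j \<psi> (i + j) \<odot>\<^bsub>M\<^esub> \<one>\<^bsub>M\<^esub>) \<otimes>\<^bsub>M\<^esub> ev i \<phi> \<oplus>\<^bsub>M\<^esub> m"
    using ev_comp_coef[OF \<phi> \<psi> i j] by blast
  have c: "ev i \<phi> \<in> carrier M" "m \<in> carrier M"
    using ev_closed \<phi> null_closed[OF m(1)] by (auto simp: cocycles_def)
  obtain k where k: "i = 2 * int k + 1" using ij(1) i by (auto elim!: oddE intro: that[of "nat (i div 2)"])
  obtain t where t: "t \<in> carrier M" "coef j \<psi> (i + j) \<odot>\<^bsub>M\<^esub> \<one>\<^bsub>M\<^esub> = \<ominus>\<^bsub>M\<^esub> (b \<odot>\<^bsub>M\<^esub> \<one>\<^bsub>M\<^esub>) \<oplus>\<^bsub>M\<^esub> D \<odot>\<^bsub>M\<^esub> t"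
    using coef_odd'[OF \<psi> ij(2) a b, of k] k by (auto simp: algebra_simps)
  have "null (i + j) (D \<odot>\<^bsub>M\<^esub> t)" 
    using null_even[of "i + j"] ij i j t by (cases "i = 0") auto
  then have "null (i + j) ((D \<odot>\<^bsub>M\<^esub> t) \<otimes>\<^bsub>M\<^esub> ev i \<phi> \<oplus>\<^bsub>M\<^esub> m)" using null_add null_mult m c by blast
  moreover have "ev (i + j) (cochain_comp (std_res R M) j \<phi> \<psi>) =
      ev i \<phi> \<otimes>\<^bsub>M\<^esub> (\<ominus>\<^bsub>M\<^esub> (b \<odot>\<^bsub>M\<^esub> \<one>\<^bsub>M\<^esub>)) \<oplus>\<^bsub>M\<^esub> ((D \<odot>\<^bsub>M\<^esub> t) \<otimes>\<^bsub>M\<^esub> ev i \<phi> \<oplus>\<^bsub>M\<^esub> m)"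
    unfolding m(2) t(2) using c t b by (simp add: MC)
  ultimately show ?thesis by blast
qed

end

section \<open>Quotients\<close>

lemma abelian_group_cong:
  assumes "abelian_group R" "carrier S = carrier R" "\<zero>\<^bsub>S\<^esub> = \<zero>\<^bsub>R\<^esub>" "ring.add S = ring.add R"
  shows "abelian_group S"
proof -
  interpret abelian_group R by fact
  show ?thesis by (rule abelian_groupI) (auto simp: assms a_ac intro: l_neg)
qed

lemma cring_cong:
  assumes "cring R" "carrier S = carrier R" "monoid.mult S = monoid.mult R" "\<one>\<^bsub>S\<^esub> = \<one>\<^bsub>R\<^esub>"
    "\<zero>\<^bsub>S\<^esub> = \<zero>\<^bsub>R\<^esub>" "ring.add S = ring.add R"
  shows "cring S"
proof -
  interpret cring R by fact
  show ?thesis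
    by (intro cringI comm_monoidI abelian_group_cong[OF abelian_group_axioms])
       (auto simp: assms l_distr m_assoc intro: m_comm)
qed

lemma lin_quot_sel:
  "carrier (lin_quot M N) = carrier (M Quot N)"
  "monoid.mult (lin_quot M N) = monoid.mult (M Quot N)"
  "\<one>\<^bsub>lin_quot M N\<^esub> = \<one>\<^bsub>M Quot N\<^esub>"
  "\<zero>\<^bsub>lin_quot M N\<^esub> = \<zero>\<^bsub>M Quot N\<^esub>"
  "ring.add (lin_quot M N) = ring.add (M Quot N)"
  by (simp_all add: lin_quot_def)

lemma lin_quot_zero: "\<zero>\<^bsub>lin_quot M N\<^esub> = N"
  by (simp add: lin_quot_def FactRing_def)

lemma lin_quot_carrier: "carrier (lin_quot M N) = (\<lambda>p. N +>\<^bsub>M\<^esub> p) ` carrier M"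
  by (auto simp: lin_quot_def FactRing_def A_RCOSETS_def RCOSETS_def a_r_coset_def)

text \<open>Only the additive structure is used, so that ideals of a ring and submodules of a module
  are served by the same lemmas about \<open>lin_quot\<close>.\<close>

locale lin_subgroup = abelian_subgroup H G for H and G :: "('k, 'a, 'y) module_scheme" (structure)
begin

lemma lin_quot_add:
  assumes "p \<in> carrier G" "q \<in> carrier G"
  shows "(H +> p) \<oplus>\<^bsub>lin_quot G H\<^esub> (H +> q) = H +> (p \<oplus> q)"
  using a_rcos_sum[OF assms] by (simp add: lin_quot_def FactRing_def)

lemma coset_eq_iff:
  assumes "p \<in> carrier G" "q \<in> carrier G"
  shows "H +> p = H +> q \<longleftrightarrow> p \<ominus> q \<in> H"
proof
  assume "H +> p = H +> q"
  then have "p \<in> H +> q" using a_rcos_self[OF assms(1)] by simp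
  then show "p \<ominus> q \<in> H" using a_rcos_module[OF assms(2,1)] by (simp add: minus_eq)
next
  assume "p \<ominus> q \<in> H"
  then have "p \<in> H +> q" using a_rcos_module[OF assms(2,1)] by (simp add: minus_eq)
  then show "H +> p = H +> q" using a_repr_independence[OF _ assms(2) a_subgroup] by simp
qed

lemma lin_quot_abelian_group: "abelian_group (lin_quot G H)"
proof (rule abelian_groupI)
  have z: "\<zero>\<^bsub>lin_quot G H\<^esub> = H +> \<zero>" using a_coset_add_zero a_subset by (simp add: lin_quot_zero)
  show "\<zero>\<^bsub>lin_quot G H\<^esub> \<in> carrier (lin_quot G H)" unfolding z by (auto simp: lin_quot_carrier)
  fix x assume "x \<in> carrier (lin_quot G H)"
  then obtain p where p: "p \<in> carrier G" "x = H +> p" by (auto simp: lin_quot_carrier)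
  show "\<zero>\<^bsub>lin_quot G H\<^esub> \<oplus>\<^bsub>lin_quot G H\<^esub> x = x" unfolding z using p by (simp add: lin_quot_add)
  show "\<exists>y\<in>carrier (lin_quot G H). y \<oplus>\<^bsub>lin_quot G H\<^esub> x = \<zero>\<^bsub>lin_quot G H\<^esub>" unfolding z
    using p by (intro bexI[of _ "H +> (\<ominus> p)"]) (auto simp: lin_quot_carrier lin_quot_add l_neg)
qed (auto simp: lin_quot_carrier lin_quot_add a_ac)

lemma lin_quot_eq_zero_iff:
  assumes "p \<in> carrier G"
  shows "H +> p = \<zero>\<^bsub>lin_quot G H\<^esub> \<longleftrightarrow> p \<in> H"
proof -
  have "p \<ominus> \<zero> = p" using assms minus_eq_iff by simp
  then show ?thesis
    using coset_eq_iff[OF assms, of \<zero>] assms a_coset_add_zero a_subset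
    by (simp add: lin_quot_zero)
qed

lemma lin_quot_smult:
  assumes "p \<in> carrier G" "\<And>x. x \<in> carrier G \<Longrightarrow> f x \<in> carrier G"
    and "\<And>x y. x \<in> carrier G \<Longrightarrow> y \<in> carrier G \<Longrightarrow> x \<ominus> y \<in> H \<Longrightarrow> f x \<ominus> f y \<in> H"
  shows "(\<Union>x\<in>H +> p. H +> f x) = H +> f p"
proof -
  have "H +> f x = H +> f p" if x: "x \<in> H +> p" for x
  proof -
    have xc: "x \<in> carrier G" using x a_elemrcos_carrier assms(1) by blast
    have "x \<ominus> p \<in> H" using a_rcos_module[OF assms(1) xc] x by (simp add: minus_eq)
    then show ?thesis using coset_eq_iff assms xc by blast
  qed
  then show ?thesis using a_rcos_self[OF assms(1)] by blast
qed

end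

lemma ideal_lin_subgroup: "ideal I R \<Longrightarrow> lin_subgroup I R"
  by (simp add: lin_subgroup_def abelian_subgroupI3 ideal.axioms(1) ideal.axioms(2) ring.is_abelian_group)

lemma lin_quot_cring:
  assumes "cring R" "ideal I R"
  shows "cring (lin_quot R I)"
  by (rule cring_cong[OF ideal.quotient_is_cring[OF assms(2,1)]]) (simp_all add: lin_quot_sel)

lemma lin_quot_proj:
  assumes "cring R" "ideal I R"
  shows "(+>\<^bsub>R\<^esub>) I \<in> ring_hom R (lin_quot R I)"
  using ideal.rcos_ring_hom[OF assms(2)] by (simp add: ring_hom_def lin_quot_sel)

text \<open>The form in which \<open>diag_module\<close> applies the multiplication map to classes;
  it is meaningful when \<open>h\<close> is constant on the coset.\<close>

definition quot_map :: "('a \<Rightarrow> 'b) \<Rightarrow> 'a set \<Rightarrow> 'b" where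
  "quot_map h U = the_elem (h ` U)"

lemma quot_map_coset:
  fixes R :: "('k, 'a, 'y) module_scheme"
  assumes "cring R" "ideal I R" "ring S" "h \<in> ring_hom R S" "\<And>x. x \<in> I \<Longrightarrow> h x = \<zero>\<^bsub>S\<^esub>" "p \<in> carrier R"
  shows "quot_map h (I +>\<^bsub>R\<^esub> p) = h p"
proof -
  interpret R: cring R by fact
  interpret I: lin_subgroup I R by (rule ideal_lin_subgroup) fact
  interpret h: ring_hom_ring R S h
    by (intro ring_hom_ringI2 R.ring_axioms assms)
  have "h x = h p" if x: "x \<in> I +>\<^bsub>R\<^esub> p" for x
  proof -
    obtain y where y: "y \<in> I" "x = y \<oplus>\<^bsub>R\<^esub> p" using x by (auto simp: a_r_coset_def r_coset_def)
    then have "y \<in> carrier R" using I.a_subset by blast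
    then show ?thesis using y assms(5)[OF y(1)] assms(6) by simp
  qed
  then have "h ` (I +>\<^bsub>R\<^esub> p) = {h p}" using I.a_rcos_self[OF assms(6)] by blast
  then show ?thesis by (simp add: quot_map_def)
qed

lemma quot_map_hom:
  assumes "cring R" "ideal I R" "ring S" "h \<in> ring_hom R S" "\<And>x. x \<in> I \<Longrightarrow> h x = \<zero>\<^bsub>S\<^esub>"
  shows "quot_map h \<in> ring_hom (lin_quot R I) S"
proof -
  interpret R: cring R by fact
  have q: "quot_map h (I +>\<^bsub>R\<^esub> p) = h p" if "p \<in> carrier R" for p
    by (rule quot_map_coset[OF assms(1-4) _ that]) (rule assms(5))
  note pr = lin_quot_proj[OF assms(1,2)]
  show ?thesis
  proof (rule ring_hom_memI)
    fix x assume "x \<in> carrier (lin_quot R I)"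
    then show "quot_map h x \<in> carrier S"
      using q ring_hom_closed[OF assms(4)] by (auto simp: lin_quot_carrier)
  next
    fix x y assume "x \<in> carrier (lin_quot R I)" "y \<in> carrier (lin_quot R I)"
    then obtain a b where ab: "a \<in> carrier R" "b \<in> carrier R" "x = I +>\<^bsub>R\<^esub> a" "y = I +>\<^bsub>R\<^esub> b"
      by (auto simp: lin_quot_carrier)
    show "quot_map h (x \<otimes>\<^bsub>lin_quot R I\<^esub> y) = quot_map h x \<otimes>\<^bsub>S\<^esub> quot_map h y"
      using ab q ring_hom_mult[OF pr, of a b] ring_hom_mult[OF assms(4), of a b] by (metis R.m_closed)
    show "quot_map h (x \<oplus>\<^bsub>lin_quot R I\<^esub> y) = quot_map h x \<oplus>\<^bsub>S\<^esub> quot_map h y"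
      using ab q ring_hom_add[OF pr, of a b] ring_hom_add[OF assms(4), of a b] by (metis R.a_closed)
  next
    show "quot_map h \<one>\<^bsub>lin_quot R I\<^esub> = \<one>\<^bsub>S\<^esub>"
      using q[OF R.one_closed] ring_hom_one[OF pr] ring_hom_one[OF assms(4)] by simp
  qed
qed

lemma ring_hom_minus:
  assumes "ring R" "ring S" "h \<in> ring_hom R S" "x \<in> carrier R" "y \<in> carrier R"
  shows "h (\<ominus>\<^bsub>R\<^esub> x) = \<ominus>\<^bsub>S\<^esub> h x" "h (x \<ominus>\<^bsub>R\<^esub> y) = h x \<ominus>\<^bsub>S\<^esub> h y"
proof -
  interpret h: ring_hom_ring R S h by (intro ring_hom_ringI2 assms)
  show "h (\<ominus>\<^bsub>R\<^esub> x) = \<ominus>\<^bsub>S\<^esub> h x" "h (x \<ominus>\<^bsub>R\<^esub> y) = h x \<ominus>\<^bsub>S\<^esub> h y"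
    using assms by (simp_all add: a_minus_def)
qed

lemma (in cring) mem_genideal_pair:
  assumes "a \<in> carrier R" "b \<in> carrier R" "x \<in> Idl {a, b}"
  shows "\<exists>u\<in>carrier R. \<exists>v\<in>carrier R. x = u \<otimes> a \<oplus> v \<otimes> b"
proof -
  let ?J = "{u \<otimes> a \<oplus> v \<otimes> b | u v. u \<in> carrier R \<and> v \<in> carrier R}"
  have "ideal ?J R"
  proof (rule idealI[OF ring_axioms])
    show "subgroup ?J (add_monoid R)"
    proof (rule add.subgroupI)
      show "?J \<subseteq> carrier R" using assms by auto
      show "?J \<noteq> {}" by blast
      fix y assume "y \<in> ?J"
      then obtain u v where uv: "u \<in> carrier R" "v \<in> carrier R" "y = u \<otimes> a \<oplus> v \<otimes> b" by blast
      have "\<ominus> y = (\<ominus> u) \<otimes> a \<oplus> (\<ominus> v) \<otimes> b" using uv assms by (simp add: l_minus minus_add)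
      then show "\<ominus> y \<in> ?J" using uv by blast
      fix y' assume "y' \<in> ?J"
      then obtain u' v' where uv': "u' \<in> carrier R" "v' \<in> carrier R" "y' = u' \<otimes> a \<oplus> v' \<otimes> b" by blast
      have "y \<oplus> y' = (u \<oplus> u') \<otimes> a \<oplus> (v \<oplus> v') \<otimes> b"
        using uv uv' assms by (simp add: l_distr a_ac)
      then show "y \<oplus> y' \<in> ?J" using uv uv' by blast
    qed
    fix y r assume "y \<in> ?J" and r: "r \<in> carrier R"
    then obtain u v where uv: "u \<in> carrier R" "v \<in> carrier R" "y = u \<otimes> a \<oplus> v \<otimes> b" by blast
    have "r \<otimes> y = (r \<otimes> u) \<otimes> a \<oplus> (r \<otimes> v) \<otimes> b" using uv r assms by (simp add: r_distr m_assoc)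
    then show "r \<otimes> y \<in> ?J" using uv r by blast
    moreover have "y \<otimes> r = r \<otimes> y" using uv r assms by (simp add: m_comm)
    ultimately show "y \<otimes> r \<in> ?J" by simp
  qed
  moreover have "{a, b} \<subseteq> ?J"
  proof -
    have "a = \<one> \<otimes> a \<oplus> \<zero> \<otimes> b" "b = \<zero> \<otimes> a \<oplus> \<one> \<otimes> b" using assms by simp_all
    then show ?thesis by blast
  qed
  ultimately have "Idl {a, b} \<subseteq> ?J" by (rule genideal_minimal)
  then show ?thesis using assms(3) by blast
qed

lemma (in cring) mem_genideal_single:
  assumes "a \<in> carrier R"
  shows "x \<in> Idl {a} \<longleftrightarrow> (\<exists>u\<in>carrier R. x = u \<otimes> a)"
  using cgenideal_eq_genideal[OF assms] by (auto simp: cgenideal_def)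

section \<open>Polynomials\<close>

lemma UP_cringI: "cring R \<Longrightarrow> UP_cring R"
  by (simp add: UP_cring_def)

lemma UP_carrier: "carrier (UP R) = up R"
  by (simp add: UP_def)

lemma UP_coeff: "f \<in> up R \<Longrightarrow> coeff (UP R) f = f"
  by (simp add: UP_def)

lemma UP_pre_univ_propI':
  assumes "cring R" "cring S" "\<phi> \<in> ring_hom R S"
  shows "UP_pre_univ_prop R S \<phi>"
  using assms by (intro UP_pre_univ_prop.intro ring_hom_cringI UP_cringI)

lemma UP_eval_hom:
  assumes "cring R" "cring S" "\<phi> \<in> ring_hom R S" "s \<in> carrier S"
  shows "eval R S \<phi> s \<in> ring_hom (UP R) S"
    and "r \<in> carrier R \<Longrightarrow> eval R S \<phi> s (monom (UP R) r 0) = \<phi> r"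
    and "eval R S \<phi> s (monom (UP R) \<one>\<^bsub>R\<^esub> 1) = s"
proof -
  note U = UP_pre_univ_propI'[OF assms(1-3)]
  show "eval R S \<phi> s \<in> ring_hom (UP R) S" by (rule UP_pre_univ_prop.eval_ring_hom[OF U assms(4)])
  show "r \<in> carrier R \<Longrightarrow> eval R S \<phi> s (monom (UP R) r 0) = \<phi> r"
    by (rule UP_pre_univ_prop.eval_const[OF U assms(4)])
  show "eval R S \<phi> s (monom (UP R) \<one>\<^bsub>R\<^esub> 1) = s" by (rule UP_pre_univ_prop.eval_monom1[OF U assms(4)])
qed

lemma UP_hom_eqI:
  assumes "cring R" "cring S" "\<phi> \<in> ring_hom (UP R) S" "\<psi> \<in> ring_hom (UP R) S"
    and "\<phi> (monom (UP R) \<one>\<^bsub>R\<^esub> 1) = \<psi> (monom (UP R) \<one>\<^bsub>R\<^esub> 1)"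
    and "\<And>r. r \<in> carrier R \<Longrightarrow> \<phi> (monom (UP R) r 0) = \<psi> (monom (UP R) r 0)"
    and "p \<in> carrier (UP R)"
  shows "\<phi> p = \<psi> p"
proof -
  interpret U: UP_cring R "UP R" by (rule UP_cringI) fact
  interpret S: cring S by fact
  have "(\<lambda>r. \<psi> (monom (UP R) r 0)) \<in> ring_hom R S"
    using ring_hom_trans[OF U.const_ring_hom assms(4)] by (simp add: comp_def)
  then interpret UP_pre_univ_prop R S "\<lambda>r. \<psi> (monom (UP R) r 0)" "UP R"
    by (rule UP_pre_univ_propI'[OF assms(1,2)])
  show ?thesis
    by (rule UP_hom_unique[OF ring_homD[OF assms(3)] _ _ ring_homD[OF assms(4)]])
       (use assms(5-7) ring_hom_closed[OF assms(4)] in auto)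
qed

context UP_cring
begin

lemma UP_induct:
  assumes p: "p \<in> carrier P"
    and add: "\<And>p q. p \<in> carrier P \<Longrightarrow> q \<in> carrier P \<Longrightarrow> T p \<Longrightarrow> T q \<Longrightarrow> T (p \<oplus>\<^bsub>P\<^esub> q)"
    and mon: "\<And>a n. a \<in> carrier R \<Longrightarrow> T (up_ring.monom P a n)"
  shows "T p"
proof -
  have "T (\<Oplus>\<^bsub>P\<^esub>i\<in>{..n}. up_ring.monom P (up_ring.coeff P p i) i) \<and> (\<Oplus>\<^bsub>P\<^esub>i\<in>{..n}. up_ring.monom P (up_ring.coeff P p i) i) \<in> carrier P" for n
  proof (induction n)
    case 0
    then show ?case using p mon by (simp add: Pi_def)
  next
    case (Suc n)
    then show ?case using p mon add by (simp add: Pi_def)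
  qed
  from this[of "deg R p"] show ?thesis using up_repr[OF p] by simp
qed

lemma coeff_X_mult:
  assumes "q \<in> carrier P"
  shows "up_ring.coeff P (up_ring.monom P \<one> 1 \<otimes>\<^bsub>P\<^esub> q) n = (case n of 0 \<Rightarrow> \<zero> | Suc m \<Rightarrow> up_ring.coeff P q m)"
proof (cases n)
  case 0
  then show ?thesis using assms by (simp add: Pi_def)
next
  case (Suc m)
  then show ?thesis using coeff_monom_mult[OF R.one_closed assms, of 1 m] assms by simp
qed

text \<open>Division by the variable. Repeated on the Taylor expansion, it splits off the first
  coefficients one at a time.\<close>

lemma UP_shift:
  assumes p: "p \<in> carrier P"
  obtains q where "q \<in> carrier P" "p = up_ring.monom P (up_ring.coeff P p 0) 0 \<oplus>\<^bsub>P\<^esub> up_ring.monom P \<one> 1 \<otimes>\<^bsub>P\<^esub> q"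
    "\<And>n. up_ring.coeff P q n = up_ring.coeff P p (Suc n)"
proof
  let ?q = "\<lambda>n. p (Suc n)"
  have carr: "carrier P = up R" unfolding P_def by (rule UP_carrier)
  have co: "up_ring.coeff P f = f" if "f \<in> up R" for f
    using that unfolding P_def by (rule UP_coeff)
  obtain n where "bound \<zero> n p" using p carr by blast
  then have "bound \<zero> n ?q" by (auto simp: bound_def)
  then have q': "?q \<in> up R" using p carr by (intro mem_upI) blast+
  then show q: "?q \<in> carrier P" using carr by simp
  show c: "up_ring.coeff P ?q n = up_ring.coeff P p (Suc n)" for n
    using co[OF q'] co[of p] p carr by simp
  show "p = up_ring.monom P (up_ring.coeff P p 0) 0 \<oplus>\<^bsub>P\<^esub> up_ring.monom P \<one> 1 \<otimes>\<^bsub>P\<^esub> ?q"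
  proof (rule up_eqI)
    fix n
    show "up_ring.coeff P p n = up_ring.coeff P (up_ring.monom P (up_ring.coeff P p 0) 0 \<oplus>\<^bsub>P\<^esub> up_ring.monom P \<one> 1 \<otimes>\<^bsub>P\<^esub> ?q) n"
      using p q coeff_X_mult[OF q, of n] c by (cases n) (simp_all del: coeff_mult)
  qed (use p q in auto)
qed

text \<open>McCoy's argument. If every coefficient of \<open>G\<close> kills \<open>g\<close>, each
  coefficient of \<open>g\<close> annihilates all coefficients of \<open>G\<close> and vanishes.
  Otherwise, for the last coefficient of \<open>G\<close> not killing \<open>g\<close>, its product
  with \<open>g\<close> is nonzero, still killed by \<open>G\<close> and of smaller degree, which
  the induction excludes.\<close>

lemma mccoy:
  assumes G: "G \<in> carrier P" and ann: "\<And>a. a \<in> carrier R \<Longrightarrow> (\<And>i. a \<otimes> up_ring.coeff P G i = \<zero>) \<Longrightarrow> a = \<zero>"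
    and g: "g \<in> carrier P" "G \<otimes>\<^bsub>P\<^esub> g = \<zero>\<^bsub>P\<^esub>"
  shows "g = \<zero>\<^bsub>P\<^esub>"
proof -
  \<comment> \<open>\<open>n\<close> is a strict bound on the indices of the nonzero coefficients of
    \<open>g\<close>, so that zero polynomials are covered at \<open>n = 0\<close>.\<close>
  have "\<forall>g\<in>carrier P. G \<otimes>\<^bsub>P\<^esub> g = \<zero>\<^bsub>P\<^esub> \<longrightarrow> (\<forall>k\<ge>n. up_ring.coeff P g k = \<zero>) \<longrightarrow> g = \<zero>\<^bsub>P\<^esub>" for n
  proof (induction n)
    case 0
    then show ?case by (auto intro: up_eqI)
  next
    case (Suc n)
    show ?case
    proof (intro ballI impI)
      fix g assume g: "g \<in> carrier P" "G \<otimes>\<^bsub>P\<^esub> g = \<zero>\<^bsub>P\<^esub>" "\<forall>k\<ge>Suc n. up_ring.coeff P g k = \<zero>"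
      let ?a = "up_ring.coeff P G"
      have a: "?a i \<in> carrier R" for i using G by simp
      have all: "?a i \<odot>\<^bsub>P\<^esub> g = \<zero>\<^bsub>P\<^esub>" for i
      proof (rule ccontr)
        let ?B = "{i. ?a i \<odot>\<^bsub>P\<^esub> g \<noteq> \<zero>\<^bsub>P\<^esub>}"
        assume "?a i \<odot>\<^bsub>P\<^esub> g \<noteq> \<zero>\<^bsub>P\<^esub>"
        then have ne: "?B \<noteq> {}" by blast
        have "?B \<subseteq> {..deg R G}"
        proof
          fix j assume "j \<in> ?B"
          then have "?a j \<noteq> \<zero>" using g by auto
          then show "j \<in> {..deg R G}" using deg_aboveD[of G j] G by (meson atMost_iff not_le)
        qed
        then have fin: "finite ?B" by (rule finite_subset) simp
        define j where "j = Max ?B"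
        have j: "?a j \<odot>\<^bsub>P\<^esub> g \<noteq> \<zero>\<^bsub>P\<^esub>" using Max_in[OF fin ne] by (simp add: j_def)
        have big: "?a k \<odot>\<^bsub>P\<^esub> g = \<zero>\<^bsub>P\<^esub>" if "k > j" for k
          using Max_ge[OF fin, of k] that by (fastforce simp: j_def)
        \<comment> \<open>In the coefficient of index \<open>j + n\<close> of the product, terms
          with \<open>k < j\<close> involve coefficients of \<open>g\<close> above \<open>n\<close>,
          and terms with \<open>k > j\<close> vanish by maximality of \<open>j\<close>.\<close>
        have t: "?a k \<otimes> up_ring.coeff P g (j + n - k) = (if j = k then ?a j \<otimes> up_ring.coeff P g n else \<zero>)" if "k \<le> j + n" for k
        proof -
          consider "k < j" | "k = j" | "k > j" by linarith
          then show ?thesis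
          proof cases
            case 1
            then show ?thesis using g(3) a by simp
          next
            case 3
            have "?a k \<otimes> up_ring.coeff P g (j + n - k) = up_ring.coeff P (?a k \<odot>\<^bsub>P\<^esub> g) (j + n - k)" using g a by simp
            then show ?thesis using big[OF 3] 3 by simp
          qed simp
        qed
        have "\<zero> = up_ring.coeff P (G \<otimes>\<^bsub>P\<^esub> g) (j + n)" using g by simp
        also have "\<dots> = (\<Oplus>k\<in>{..j + n}. ?a k \<otimes> up_ring.coeff P g (j + n - k))" by (rule coeff_mult[OF G g(1)])
        also have "\<dots> = (\<Oplus>k\<in>{..j + n}. if j = k then ?a j \<otimes> up_ring.coeff P g n else \<zero>)"
          by (rule R.finsum_cong') (use t a g in auto)
        also have "\<dots> = ?a j \<otimes> up_ring.coeff P g n"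
          using R.finsum_singleton[of j "{..j + n}" "\<lambda>_. ?a j \<otimes> up_ring.coeff P g n"] a g by simp
        finally have z: "?a j \<otimes> up_ring.coeff P g n = \<zero>" by simp
        have "up_ring.coeff P (?a j \<odot>\<^bsub>P\<^esub> g) k = \<zero>" if "k \<ge> n" for k
          using z g a that by (cases "k = n") simp_all
        moreover have "G \<otimes>\<^bsub>P\<^esub> (?a j \<odot>\<^bsub>P\<^esub> g) = \<zero>\<^bsub>P\<^esub>"
        proof -
          have "G \<otimes>\<^bsub>P\<^esub> (?a j \<odot>\<^bsub>P\<^esub> g) = ?a j \<odot>\<^bsub>P\<^esub> (G \<otimes>\<^bsub>P\<^esub> g)"
            using UP_smult_assoc2[OF a g(1) G, of j] G g a by (simp add: P.m_comm)
          then show ?thesis using g a by simp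
        qed
        ultimately show False using Suc j g a by simp
      qed
      show "g = \<zero>\<^bsub>P\<^esub>"
      proof (rule up_eqI)
        fix k
        have "up_ring.coeff P g k \<otimes> ?a i = \<zero>" for i
        proof -
          have "?a i \<otimes> up_ring.coeff P g k = up_ring.coeff P (?a i \<odot>\<^bsub>P\<^esub> g) k" using g a by simp
          then show ?thesis using all[of i] g a by (simp add: R.m_comm)
        qed
        then show "up_ring.coeff P g k = up_ring.coeff P \<zero>\<^bsub>P\<^esub> k" using ann[of "up_ring.coeff P g k"] g by simp
      qed (use g in auto)
    qed
  qed
  moreover have "\<forall>k\<ge>Suc (deg R g). up_ring.coeff P g k = \<zero>" using deg_aboveD[of g] g(1) by simp
  ultimately show ?thesis using g by blast
qed

end

section \<open>Quotients of modules by submodules\<close>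

lemma lin_subgroup_submodule:
  assumes "module R M" "submodule H R M"
  shows "lin_subgroup H M"
  unfolding lin_subgroup_def
  by (intro abelian_subgroupI3 additive_subgroup.intro)
     (use submodule.axioms(1)[OF assms(2)] module.axioms(2)[OF assms(1)] in auto)

lemma lin_quot_module_smult:
  assumes M: "module R M" and H: "submodule H R M" and r: "r \<in> carrier R" and p: "p \<in> carrier M"
  shows "r \<odot>\<^bsub>lin_quot M H\<^esub> (H +>\<^bsub>M\<^esub> p) = H +>\<^bsub>M\<^esub> (r \<odot>\<^bsub>M\<^esub> p)"
proof -
  interpret M: module R M by fact
  interpret H: lin_subgroup H M by (rule lin_subgroup_submodule[OF M H])
  have "r \<odot>\<^bsub>M\<^esub> x \<ominus>\<^bsub>M\<^esub> r \<odot>\<^bsub>M\<^esub> y \<in> H" if "x \<in> carrier M" "y \<in> carrier M" "x \<ominus>\<^bsub>M\<^esub> y \<in> H" for x y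
    using M.submoduleE(4)[OF H r that(3)] that r
    by (simp add: a_minus_def M.smult_r_distr M.smult_r_minus)
  then show ?thesis
    using H.lin_quot_smult[OF p, of "\<lambda>x. r \<odot>\<^bsub>M\<^esub> x"] r by (simp add: lin_quot_def)
qed

lemma lin_quot_module:
  assumes M: "module R M" and H: "submodule H R M"
  shows "module R (lin_quot M H)"
proof -
  interpret M: module R M by fact
  interpret H: lin_subgroup H M by (rule lin_subgroup_submodule[OF M H])
  note s = lin_quot_module_smult[OF M H]
  show ?thesis
    by (rule moduleI[OF M.R.cring_axioms H.lin_quot_abelian_group])
       (auto simp: lin_quot_carrier s H.lin_quot_add M.smult_l_distr M.smult_r_distr M.smult_assoc1)
qed

lemma lin_map_image_submodule:
  assumes "module R M" "module R N" "lin_map R M N h"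
  shows "submodule (h ` carrier M) R N"
proof -
  interpret M: module R M by fact
  interpret N: module R N by fact
  show ?thesis
  proof (rule N.submoduleI)
    show "h ` carrier M \<subseteq> carrier N" using lin_map_closed[OF assms(3)] by auto
    show "\<zero>\<^bsub>N\<^esub> \<in> h ` carrier M" using lin_map_zero[OF assms] by (metis M.zero_closed imageI)
    show "\<ominus>\<^bsub>N\<^esub> a \<in> h ` carrier M" if a: "a \<in> h ` carrier M" for a
    proof -
      from a obtain x where "x \<in> carrier M" "a = h x" by blast
      then show ?thesis using lin_map_minus(1)[OF assms, of x] by (intro image_eqI[of _ _ "\<ominus>\<^bsub>M\<^esub> x"]) auto
    qed
    show "a \<oplus>\<^bsub>N\<^esub> b \<in> h ` carrier M" if ab: "a \<in> h ` carrier M" "b \<in> h ` carrier M" for a b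
    proof -
      from ab obtain x y where "x \<in> carrier M" "a = h x" "y \<in> carrier M" "b = h y" by blast
      then show ?thesis using lin_map_add[OF assms(3), of x y] by (intro image_eqI[of _ _ "x \<oplus>\<^bsub>M\<^esub> y"]) auto
    qed
    show "a \<odot>\<^bsub>N\<^esub> x \<in> h ` carrier M" if ax: "a \<in> carrier R" "x \<in> h ` carrier M" for a x
    proof -
      from ax obtain y where "y \<in> carrier M" "x = h y" by blast
      then show ?thesis using lin_map_smult[OF assms(3), of a y] ax by (intro image_eqI[of _ _ "a \<odot>\<^bsub>M\<^esub> y"]) auto
    qed
  qed
qed

lemma lin_map_kernel_submodule:
  assumes "module R M" "module R N" "lin_map R M N h"
  shows "submodule {x \<in> carrier M. h x = \<zero>\<^bsub>N\<^esub>} R M"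
proof -
  interpret M: module R M by fact
  interpret N: module R N by fact
  show ?thesis
    by (rule M.submoduleI)
       (auto simp: lin_map_zero[OF assms] lin_map_minus(1)[OF assms] lin_map_add[OF assms(3)] lin_map_smult[OF assms(3)])
qed

lemma submodule_of_submodule:
  assumes M: "module R M" and "submodule H R M" "submodule J R M" "H \<subseteq> J"
  shows "submodule H R (M\<lparr>carrier := J\<rparr>)"
proof -
  interpret M: module R M by fact
  interpret J: module R "M\<lparr>carrier := J\<rparr>" by (rule submodule.submodule_is_module) fact+
  interpret H: module R "M\<lparr>carrier := H\<rparr>" by (rule submodule.submodule_is_module) fact+
  show ?thesis
    by (rule J.module_incl_imp_submodule) (use assms(4) H.module_axioms in auto)
qed

section \<open>The Hom complex as a complex of modules\<close>

lemma hom_cpx_sel: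
  "\<zero>\<^bsub>hcpx R M N n\<^esub> = (\<lambda>i. \<lambda>x\<in>carrier (sres R M i). \<zero>\<^bsub>Fall R\<^esub>)"
  "\<phi> \<oplus>\<^bsub>hcpx R M N n\<^esub> \<psi> = (\<lambda>i. \<lambda>x\<in>carrier (sres R M i). \<phi> i x \<oplus>\<^bsub>Fall R\<^esub> \<psi> i x)"
  "r \<odot>\<^bsub>hcpx R M N n\<^esub> \<phi> = (\<lambda>i. \<lambda>x\<in>carrier (sres R M i). r \<odot>\<^bsub>Fall R\<^esub> \<phi> i x)"
  by (simp_all add: hom_cpx_def)

lemma hom_cpx_ext:
  assumes "\<phi> \<in> carrier (hcpx R M N n)"
  shows "\<phi> i \<in> extensional (carrier (sres R M i))"
  using assms by (simp add: hom_cpx_carrier mod_hom_lin_map)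

lemma hom_cpx_eqI:
  assumes "\<phi> \<in> carrier (hcpx R M N n)" "\<psi> \<in> carrier (hcpx R M N n)"
    and "\<And>i w. w \<in> carrier (sres R M i) \<Longrightarrow> \<phi> i w = \<psi> i w"
  shows "\<phi> = \<psi>"
proof
  fix i show "\<phi> i = \<psi> i"
    by (rule extensionalityI[OF hom_cpx_ext[OF assms(1)] hom_cpx_ext[OF assms(2)] assms(3)])
qed

lemma hom_cpx_restrictI:
  assumes "module R M" "\<And>i. lin_map R (sres R M i) (sres R N (i - n)) (h i)"
  shows "(\<lambda>i. \<lambda>w\<in>carrier (sres R M i). h i w) \<in> carrier (hcpx R M N n)"
  using restrict_mod_hom[OF module.sres_module[OF assms(1)] assms(2)] by (simp add: hom_cpx_carrier)

lemma hom_cpx_module: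
  assumes M: "module R M" and N: "module R N"
  shows "module R (hcpx R M N n)"
proof -
  interpret M: module R M by fact
  interpret N: module R N by fact
  interpret F: module R N.F by (rule N.F_module)
  note lin = hom_cpx_lin[of _ R M N n]
  have clF: "\<phi> i w \<in> carrier N.F" if "\<phi> \<in> carrier (hcpx R M N n)" "w \<in> carrier (sres R M i)" for \<phi> i w
    using lin_map_closed[OF lin[OF that(1)] that(2)] sres_sub by blast
  have add: "\<phi> \<oplus>\<^bsub>hcpx R M N n\<^esub> \<psi> \<in> carrier (hcpx R M N n)"
    if "\<phi> \<in> carrier (hcpx R M N n)" "\<psi> \<in> carrier (hcpx R M N n)" for \<phi> \<psi>
    using hom_cpx_restrictI[OF M lin_map_sum[OF N.sres_module lin[OF that(1)] lin[OF that(2)]]]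
    by (simp add: hom_cpx_sel)
  have sm: "r \<odot>\<^bsub>hcpx R M N n\<^esub> \<phi> \<in> carrier (hcpx R M N n)"
    if "\<phi> \<in> carrier (hcpx R M N n)" "r \<in> carrier R" for \<phi> r
    using hom_cpx_restrictI[OF M lin_map_scale[OF N.sres_module lin[OF that(1)] that(2)]]
    by (simp add: hom_cpx_sel)
  have z: "\<zero>\<^bsub>hcpx R M N n\<^esub> \<in> carrier (hcpx R M N n)"
    using hom_cpx_restrictI[OF M lin_map_const_zero[OF N.sres_module]] by (simp add: hom_cpx_sel)
  show ?thesis
  proof (rule moduleI[OF M.R.cring_axioms])
    show "abelian_group (hcpx R M N n)"
    proof (rule abelian_groupI)
      fix \<phi> assume \<phi>: "\<phi> \<in> carrier (hcpx R M N n)"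
      show "\<zero>\<^bsub>hcpx R M N n\<^esub> \<oplus>\<^bsub>hcpx R M N n\<^esub> \<phi> = \<phi>"
        by (rule hom_cpx_eqI[OF add[OF z \<phi>] \<phi>]) (simp add: hom_cpx_sel clF[OF \<phi>])
      show "\<exists>\<psi>\<in>carrier (hcpx R M N n). \<psi> \<oplus>\<^bsub>hcpx R M N n\<^esub> \<phi> = \<zero>\<^bsub>hcpx R M N n\<^esub>"
      proof (rule bexI)
        let ?m = "(\<ominus>\<^bsub>R\<^esub> \<one>\<^bsub>R\<^esub>) \<odot>\<^bsub>hcpx R M N n\<^esub> \<phi>"
        show m: "?m \<in> carrier (hcpx R M N n)" using sm[OF \<phi>] by simp
        show "?m \<oplus>\<^bsub>hcpx R M N n\<^esub> \<phi> = \<zero>\<^bsub>hcpx R M N n\<^esub>"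
          by (rule hom_cpx_eqI[OF add[OF m \<phi>] z]) (simp add: hom_cpx_sel clF[OF \<phi>] F.smult_l_minus F.M.l_neg)
      qed
      fix \<psi> assume \<psi>: "\<psi> \<in> carrier (hcpx R M N n)"
      show "\<phi> \<oplus>\<^bsub>hcpx R M N n\<^esub> \<psi> = \<psi> \<oplus>\<^bsub>hcpx R M N n\<^esub> \<phi>"
        by (rule hom_cpx_eqI[OF add[OF \<phi> \<psi>] add[OF \<psi> \<phi>]]) (simp add: hom_cpx_sel clF[OF \<phi>] clF[OF \<psi>] F.M.a_comm)
      fix \<chi> assume \<chi>: "\<chi> \<in> carrier (hcpx R M N n)"
      show "\<phi> \<oplus>\<^bsub>hcpx R M N n\<^esub> \<psi> \<oplus>\<^bsub>hcpx R M N n\<^esub> \<chi> = \<phi> \<oplus>\<^bsub>hcpx R M N n\<^esub> (\<psi> \<oplus>\<^bsub>hcpx R M N n\<^esub> \<chi>)"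
        by (rule hom_cpx_eqI[OF add[OF add[OF \<phi> \<psi>] \<chi>] add[OF \<phi> add[OF \<psi> \<chi>]]])
           (simp add: hom_cpx_sel clF[OF \<phi>] clF[OF \<psi>] clF[OF \<chi>] F.M.a_assoc)
    qed (use add z in auto)
  next
    fix r s \<phi> assume r: "r \<in> carrier R" and s: "s \<in> carrier R" and \<phi>: "\<phi> \<in> carrier (hcpx R M N n)"
    show "(r \<oplus>\<^bsub>R\<^esub> s) \<odot>\<^bsub>hcpx R M N n\<^esub> \<phi> = r \<odot>\<^bsub>hcpx R M N n\<^esub> \<phi> \<oplus>\<^bsub>hcpx R M N n\<^esub> s \<odot>\<^bsub>hcpx R M N n\<^esub> \<phi>"
      by (rule hom_cpx_eqI[OF sm[OF \<phi>] add[OF sm[OF \<phi> r] sm[OF \<phi> s]]])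
         (use r s in \<open>simp_all add: hom_cpx_sel clF[OF \<phi>] F.smult_l_distr\<close>)
    show "(r \<otimes>\<^bsub>R\<^esub> s) \<odot>\<^bsub>hcpx R M N n\<^esub> \<phi> = r \<odot>\<^bsub>hcpx R M N n\<^esub> (s \<odot>\<^bsub>hcpx R M N n\<^esub> \<phi>)"
      by (rule hom_cpx_eqI[OF sm[OF \<phi>] sm[OF sm[OF \<phi> s] r]])
         (use r s in \<open>simp_all add: hom_cpx_sel clF[OF \<phi>] F.smult_assoc1\<close>)
  next
    fix r \<phi> \<psi> assume r: "r \<in> carrier R" and \<phi>: "\<phi> \<in> carrier (hcpx R M N n)" and \<psi>: "\<psi> \<in> carrier (hcpx R M N n)"
    show "r \<odot>\<^bsub>hcpx R M N n\<^esub> (\<phi> \<oplus>\<^bsub>hcpx R M N n\<^esub> \<psi>) = r \<odot>\<^bsub>hcpx R M N n\<^esub> \<phi> \<oplus>\<^bsub>hcpx R M N n\<^esub> r \<odot>\<^bsub>hcpx R M N n\<^esub> \<psi>"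
      by (rule hom_cpx_eqI[OF sm[OF add[OF \<phi> \<psi>] r] add[OF sm[OF \<phi> r] sm[OF \<psi> r]]])
         (use r in \<open>simp_all add: hom_cpx_sel clF[OF \<phi>] clF[OF \<psi>] F.smult_r_distr\<close>)
  next
    fix \<phi> assume \<phi>: "\<phi> \<in> carrier (hcpx R M N n)"
    show "\<one>\<^bsub>R\<^esub> \<odot>\<^bsub>hcpx R M N n\<^esub> \<phi> = \<phi>"
      by (rule hom_cpx_eqI[OF sm[OF \<phi>] \<phi>]) (simp_all add: hom_cpx_sel clF[OF \<phi>])
  qed (use sm in auto)
qed

lemma hom_bd_lin:
  assumes M: "module R M" and N: "module R N"
  shows "lin_map R (hcpx R M N n) (hcpx R M N (n + 1)) (hom_bd (std_res R M) (std_res R N) n)"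
proof -
  interpret M: module R M by fact
  interpret N: module R N by fact
  interpret F: module R N.F by (rule N.F_module)
  interpret H: module R "hcpx R M N n" by (rule hom_cpx_module[OF M N])
  interpret H': module R "hcpx R M N (n + 1)" by (rule hom_cpx_module[OF M N])
  let ?s = "sgn_ring R n" and ?b = "hom_bd (std_res R M) (std_res R N) n"
  note lin = hom_cpx_lin[of _ R M N n]
  have e: "i - 1 - n = i - (n + 1)" "i - n - 1 = i - (n + 1)" for i by auto
  have dlin: "lin_map R (sres R M i) (sres R N (i - (n + 1))) (\<lambda>w. res_bd R (\<phi> i w))"
    if "\<phi> \<in> carrier (hcpx R M N n)" for \<phi> i
    using lin_map_compose[OF lin[OF that] N.bd_lin] by (simp only: e)
  have pdlin: "lin_map R (sres R M i) (sres R N (i - (n + 1))) (\<lambda>w. \<phi> (i - 1) (res_bd R w))"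
    if "\<phi> \<in> carrier (hcpx R M N n)" for \<phi> i
    using lin_map_compose[OF M.bd_lin lin[OF that, of "i - 1"]] by (simp only: e)
  have closed: "?b \<phi> \<in> carrier (hcpx R M N (n + 1))" if \<phi>: "\<phi> \<in> carrier (hcpx R M N n)" for \<phi>
  proof -
    have 1: "lin_map R (sres R M i) (sres R N (i - (n + 1)))
       (\<lambda>w. res_bd R (\<phi> i w) \<ominus>\<^bsub>sres R N (i - (n + 1))\<^esub> ?s \<odot>\<^bsub>sres R N (i - (n + 1))\<^esub> \<phi> (i - 1) (res_bd R w))" for i
      by (intro lin_map_diff[OF M.sres_module N.sres_module] lin_map_scale[OF N.sres_module] dlin pdlin \<phi> M.sgn_ring_closed)
    have "(\<lambda>i. \<lambda>w\<in>carrier (sres R M i). res_bd R (\<phi> i w) \<ominus>\<^bsub>sres R N (i - (n + 1))\<^esub>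
        ?s \<odot>\<^bsub>sres R N (i - (n + 1))\<^esub> \<phi> (i - 1) (res_bd R w)) = ?b \<phi>"
    proof (rule ext, rule ext)
      fix i w
      show "(\<lambda>w\<in>carrier (sres R M i). res_bd R (\<phi> i w) \<ominus>\<^bsub>sres R N (i - (n + 1))\<^esub>
        ?s \<odot>\<^bsub>sres R N (i - (n + 1))\<^esub> \<phi> (i - 1) (res_bd R w)) w = ?b \<phi> i w"
      proof (cases "w \<in> carrier (sres R M i)")
        case True
        then show ?thesis
          using hom_bd_apply[OF M N \<phi> True] N.sres_minus(2)[OF lin_map_closed[OF dlin[OF \<phi>] True]
            lin_map_closed[OF lin_map_scale[OF N.sres_module pdlin[OF \<phi>] M.sgn_ring_closed] True]] by simp
      qed (simp add: hom_bd_def)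
    qed
    then show ?thesis using hom_cpx_restrictI[OF M 1] by simp
  qed
  have cl: "res_bd R (\<phi> i w) \<in> carrier N.F" "\<phi> (i - 1) (res_bd R w) \<in> carrier N.F"
    if "\<phi> \<in> carrier (hcpx R M N n)" "w \<in> carrier (sres R M i)" for \<phi> i w
    using subsetD[OF sres_sub lin_map_closed[OF dlin[OF that(1)] that(2)]]
      subsetD[OF sres_sub lin_map_closed[OF pdlin[OF that(1)] that(2)]] by simp_all
  have clS: "\<phi> i w \<in> carrier (sres R N (i - n))" "\<phi> (i - 1) (res_bd R w) \<in> carrier (sres R N (i - (n + 1)))"
    if "\<phi> \<in> carrier (hcpx R M N n)" "w \<in> carrier (sres R M i)" for \<phi> i w
    using lin_map_closed[OF lin[OF that(1)] that(2)] lin_map_closed[OF pdlin[OF that(1)] that(2)] by simp_all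
  have dw: "res_bd R w \<in> carrier (sres R M (i - 1))" if "w \<in> carrier (sres R M i)" for i w
    using lin_map_closed[OF M.bd_lin that] .
  show ?thesis
  proof (rule lin_mapI[OF closed])
    fix \<phi> \<psi> assume \<phi>: "\<phi> \<in> carrier (hcpx R M N n)" and \<psi>: "\<psi> \<in> carrier (hcpx R M N n)"
    show "?b (\<phi> \<oplus>\<^bsub>hcpx R M N n\<^esub> \<psi>) = ?b \<phi> \<oplus>\<^bsub>hcpx R M N (n + 1)\<^esub> ?b \<psi>"
    proof (rule hom_cpx_eqI[OF closed[OF H.M.a_closed[OF \<phi> \<psi>]] H'.M.a_closed[OF closed[OF \<phi>] closed[OF \<psi>]]])
      fix i w assume w: "w \<in> carrier (sres R M i)"
      have "res_bd R (\<phi> i w \<oplus>\<^bsub>N.F\<^esub> \<psi> i w) = res_bd R (\<phi> i w) \<oplus>\<^bsub>N.F\<^esub> res_bd R (\<psi> i w)"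
        using lin_map_add[OF N.bd_lin clS(1)[OF \<phi> w] clS(1)[OF \<psi> w]] by simp
      then show "?b (\<phi> \<oplus>\<^bsub>hcpx R M N n\<^esub> \<psi>) i w = (?b \<phi> \<oplus>\<^bsub>hcpx R M N (n + 1)\<^esub> ?b \<psi>) i w"
        using hom_bd_apply[OF M N H.M.a_closed[OF \<phi> \<psi>] w] hom_bd_apply[OF M N \<phi> w] hom_bd_apply[OF M N \<psi> w]
          w dw[OF w] cl[OF \<phi> w] cl[OF \<psi> w]
        by (simp add: hom_cpx_sel a_minus_def F.smult_r_distr F.M.minus_add F.M.a_ac)
    qed
  next
    fix r \<phi> assume r: "r \<in> carrier R" and \<phi>: "\<phi> \<in> carrier (hcpx R M N n)"
    show "?b (r \<odot>\<^bsub>hcpx R M N n\<^esub> \<phi>) = r \<odot>\<^bsub>hcpx R M N (n + 1)\<^esub> ?b \<phi>"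
    proof (rule hom_cpx_eqI[OF closed[OF H.smult_closed[OF r \<phi>]] H'.smult_closed[OF r closed[OF \<phi>]]])
      fix i w assume w: "w \<in> carrier (sres R M i)"
      have "res_bd R (r \<odot>\<^bsub>N.F\<^esub> \<phi> i w) = r \<odot>\<^bsub>N.F\<^esub> res_bd R (\<phi> i w)"
        using lin_map_smult[OF N.bd_lin r clS(1)[OF \<phi> w]] by simp
      then show "?b (r \<odot>\<^bsub>hcpx R M N n\<^esub> \<phi>) i w = (r \<odot>\<^bsub>hcpx R M N (n + 1)\<^esub> ?b \<phi>) i w"
        using hom_bd_apply[OF M N H.smult_closed[OF r \<phi>] w] hom_bd_apply[OF M N \<phi> w] w r
          dw[OF w] cl[OF \<phi> w]
        by (simp add: hom_cpx_sel a_minus_def F.smult_r_distr F.smult_r_minus F.smult_assoc1[symmetric] M.R.m_comm)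
    qed
  qed
qed

lemma cocycles_submodule:
  assumes M: "module R M" and N: "module R N"
  shows "submodule (cocyc R M N n) R (hcpx R M N n)"
  using lin_map_kernel_submodule[OF hom_cpx_module[OF assms] hom_cpx_module[OF assms] hom_bd_lin[OF assms]]
  by (simp add: cocycles_def)

lemma coboundaries_submodule:
  assumes M: "module R M" and N: "module R N"
  shows "submodule (cobd R M N n) R (hcpx R M N n)"
  using lin_map_image_submodule[OF hom_cpx_module[OF assms] hom_cpx_module[OF assms] hom_bd_lin[OF assms, of "n - 1"]]
  by (simp add: coboundaries_def)

text \<open>After another boundary only the mixed term survives; its sign, minus the sign of
  \<open>n - 1\<close>, is the sign of \<open>n\<close>, and in the lower component the mirrored
  term has a double boundary.\<close>

lemma coboundaries_cocycles:
  assumes M: "module R M" and N: "module R N"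
  shows "cobd R M N n \<subseteq> cocyc R M N n"
proof
  interpret M: module R M by fact
  interpret N: module R N by fact
  interpret F: module R N.F by (rule N.F_module)
  fix \<phi> assume "\<phi> \<in> cobd R M N n"
  then obtain \<eta> where \<eta>: "\<eta> \<in> carrier (hcpx R M N (n - 1))" "\<phi> = hom_bd (std_res R M) (std_res R N) (n - 1) \<eta>"
    by (auto simp: coboundaries_def)
  note lin = hom_cpx_lin[OF \<eta>(1)]
  let ?s = "sgn_ring R (n - 1)"
  have c: "\<phi> \<in> carrier (hcpx R M N n)" using lin_map_closed[OF hom_bd_lin[OF M N] \<eta>(1)] \<eta>(2) by simp
  have "res_bd R (\<phi> i w) = sgn_ring R n \<odot>\<^bsub>N.F\<^esub> \<phi> (i - 1) (res_bd R w)" if w: "w \<in> carrier (sres R M i)" for i w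
  proof -
    have dw: "res_bd R w \<in> carrier (sres R M (i - 1))" using lin_map_closed[OF M.bd_lin w] .
    have a: "res_bd R (\<eta> i w) \<in> carrier (sres R N (i - n))"
      using lin_map_closed[OF N.bd_lin lin_map_closed[OF lin w]] by simp
    have b: "\<eta> (i - 1) (res_bd R w) \<in> carrier (sres R N (i - n))"
      using lin_map_closed[OF lin dw] by simp
    have b': "?s \<odot>\<^bsub>sres R N (i - n)\<^esub> \<eta> (i - 1) (res_bd R w) \<in> carrier (sres R N (i - n))"
      by (rule module.smult_closed[OF N.sres_module M.sgn_ring_closed b])
    have d: "res_bd R (\<eta> (i - 1) (res_bd R w)) \<in> carrier N.F"
      using lin_map_closed[OF N.bd_lin b] sres_sub by blast
    have d0: "res_bd R (res_bd R (\<eta> i w)) = \<zero>\<^bsub>N.F\<^esub>" using N.bd_bd[OF lin_map_closed[OF lin w]] .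
    have z: "\<eta> (i - 1 - 1) \<zero>\<^bsub>M.F\<^esub> = \<zero>\<^bsub>N.F\<^esub>"
      using lin_map_zero[OF M.sres_module N.sres_module lin, of "i - 1 - 1"] by simp
    have "res_bd R (\<phi> i w) = res_bd R (res_bd R (\<eta> i w) \<ominus>\<^bsub>sres R N (i - n)\<^esub> ?s \<odot>\<^bsub>sres R N (i - n)\<^esub> \<eta> (i - 1) (res_bd R w))"
      unfolding \<eta>(2) using hom_bd_apply[OF M N \<eta>(1) w] N.sres_minus(2)[OF a b'] by simp
    also have "\<dots> = res_bd R (res_bd R (\<eta> i w)) \<ominus>\<^bsub>sres R N (i - n - 1)\<^esub> ?s \<odot>\<^bsub>N.F\<^esub> res_bd R (\<eta> (i - 1) (res_bd R w))"
      using lin_map_minus(2)[OF N.sres_module N.sres_module N.bd_lin a b']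
        lin_map_smult[OF N.bd_lin M.sgn_ring_closed b] by simp
    also have "\<dots> = res_bd R (res_bd R (\<eta> i w)) \<ominus>\<^bsub>N.F\<^esub> ?s \<odot>\<^bsub>N.F\<^esub> res_bd R (\<eta> (i - 1) (res_bd R w))"
    proof -
      have "?s \<odot>\<^bsub>sres R N (i - n - 1)\<^esub> res_bd R (\<eta> (i - 1) (res_bd R w)) \<in> carrier (sres R N (i - n - 1))"
        by (rule module.smult_closed[OF N.sres_module M.sgn_ring_closed lin_map_closed[OF N.bd_lin b]])
      then show ?thesis using N.sres_minus(2)[OF lin_map_closed[OF N.bd_lin a]] by simp
    qed
    also have "\<dots> = sgn_ring R n \<odot>\<^bsub>N.F\<^esub> res_bd R (\<eta> (i - 1) (res_bd R w))"
      unfolding d0 using d M.sgn_ring_pred[of n] by (simp add: a_minus_def F.smult_l_minus)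
    also have "res_bd R (\<eta> (i - 1) (res_bd R w)) = \<phi> (i - 1) (res_bd R w)"
      unfolding \<eta>(2) using hom_bd_apply[OF M N \<eta>(1) dw] M.bd_bd[OF w] z d by (simp add: a_minus_def)
    finally show ?thesis .
  qed
  then show "\<phi> \<in> cocyc R M N n" using c cocycles_iff[OF M N] by blast
qed

section \<open>The Ext modules\<close>

abbreviation "cocyc_mod R M N n \<equiv> (hcpx R M N n)\<lparr>carrier := cocyc R M N n\<rparr>"

text \<open>Uses cosets in the whole Hom complex, as \<open>yoneda_mult\<close> and
  \<open>yoneda_one\<close> do; \<open>ext_class_coset\<close> identifies them with cosets in the
  cocycle module.\<close>

definition ext_class where
  "ext_class R M N n \<phi> = cobd R M N (int n) +>\<^bsub>hcpx R M N (int n)\<^esub> \<phi>"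

lemma cocyc_module:
  assumes M: "module R M" and N: "module R N"
  shows "module R (cocyc_mod R M N n)"
  by (rule submodule.submodule_is_module[OF cocycles_submodule[OF assms] hom_cpx_module[OF assms]])

lemma cobd_submodule:
  assumes M: "module R M" and N: "module R N"
  shows "submodule (cobd R M N n) R (cocyc_mod R M N n)"
  by (intro submodule_of_submodule hom_cpx_module assms coboundaries_submodule cocycles_submodule coboundaries_cocycles)

lemma Ext_lin_quot: "Ext R M N n = lin_quot (cocyc_mod R M N (int n)) (cobd R M N (int n))"
  by (simp add: Ext_def)

lemma ext_class_coset: "ext_class R M N n \<phi> = cobd R M N (int n) +>\<^bsub>cocyc_mod R M N (int n)\<^esub> \<phi>"
  by (simp add: ext_class_def a_r_coset_def r_coset_def)

context
  fixes R M N
  assumes M: "module R M" and N: "module R N"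
begin

interpretation B: lin_subgroup "cobd R M N (int n)" "cocyc_mod R M N (int n)" for n
  by (rule lin_subgroup_submodule[OF cocyc_module[OF M N] cobd_submodule[OF M N]])

lemma Ext_module: "module R (Ext R M N n)"
  unfolding Ext_lin_quot by (rule lin_quot_module[OF cocyc_module[OF M N] cobd_submodule[OF M N]])

lemma Ext_carrier: "carrier (Ext R M N n) = ext_class R M N n ` cocyc R M N (int n)"
  unfolding Ext_lin_quot lin_quot_carrier ext_class_coset by simp

lemma Ext_add:
  assumes "\<phi> \<in> cocyc R M N (int n)" "\<psi> \<in> cocyc R M N (int n)"
  shows "ext_class R M N n \<phi> \<oplus>\<^bsub>Ext R M N n\<^esub> ext_class R M N n \<psi> =
    ext_class R M N n (\<phi> \<oplus>\<^bsub>hcpx R M N (int n)\<^esub> \<psi>)"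
  unfolding Ext_lin_quot ext_class_coset using B.lin_quot_add[of \<phi> n \<psi>] assms by simp

lemma Ext_smult:
  assumes "\<phi> \<in> cocyc R M N (int n)" "r \<in> carrier R"
  shows "r \<odot>\<^bsub>Ext R M N n\<^esub> ext_class R M N n \<phi> = ext_class R M N n (r \<odot>\<^bsub>hcpx R M N (int n)\<^esub> \<phi>)"
  unfolding Ext_lin_quot ext_class_coset
  using lin_quot_module_smult[OF cocyc_module[OF M N] cobd_submodule[OF M N], of r \<phi> "int n"] assms by simp

lemma ext_class_zero_iff:
  assumes "\<phi> \<in> cocyc R M N (int n)"
  shows "ext_class R M N n \<phi> = \<zero>\<^bsub>Ext R M N n\<^esub> \<longleftrightarrow> \<phi> \<in> cobd R M N (int n)"
  unfolding Ext_lin_quot ext_class_coset using B.lin_quot_eq_zero_iff[of \<phi> n] assms by simp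

lemma ext_class_eq_iff:
  assumes "\<phi> \<in> cocyc R M N (int n)" "\<psi> \<in> cocyc R M N (int n)"
  shows "ext_class R M N n \<phi> = ext_class R M N n \<psi> \<longleftrightarrow> \<phi> \<ominus>\<^bsub>cocyc_mod R M N (int n)\<^esub> \<psi> \<in> cobd R M N (int n)"
  unfolding Ext_lin_quot ext_class_coset using B.coset_eq_iff[of \<phi> n \<psi>] assms by simp

lemma ext_class_elem:
  assumes "\<phi> \<in> cocyc R M N (int n)" "\<psi> \<in> ext_class R M N n \<phi>"
  shows "\<psi> \<in> cocyc R M N (int n)" "ext_class R M N n \<psi> = ext_class R M N n \<phi>"
proof -
  have \<psi>: "\<psi> \<in> cobd R M N (int n) +>\<^bsub>cocyc_mod R M N (int n)\<^esub> \<phi>"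
    using assms(2) unfolding ext_class_coset .
  show c: "\<psi> \<in> cocyc R M N (int n)"
    using B.a_elemrcos_carrier[OF _ \<psi>] assms(1) by simp
  have "cobd R M N (int n) +>\<^bsub>cocyc_mod R M N (int n)\<^esub> \<phi> = cobd R M N (int n) +>\<^bsub>cocyc_mod R M N (int n)\<^esub> \<psi>"
    by (rule B.a_repr_independence[OF \<psi> _ B.a_subgroup]) (use assms(1) in simp)
  then show "ext_class R M N n \<psi> = ext_class R M N n \<phi>" unfolding ext_class_coset ..
qed

lemma ext_class_self: "\<phi> \<in> cocyc R M N (int n) \<Longrightarrow> \<phi> \<in> ext_class R M N n \<phi>"
  using B.a_rcos_self[of \<phi> n] by (simp add: ext_class_coset)

end

section \<open>Consequences of the depth condition\<close>

lemma lin_quot_map: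
  assumes M: "module R M" and N: "module R N" and H: "submodule H R M" and h: "lin_map R M N h"
    and h0: "\<And>x. x \<in> H \<Longrightarrow> h x = \<zero>\<^bsub>N\<^esub>"
  shows "p \<in> carrier M \<Longrightarrow> quot_map h (H +>\<^bsub>M\<^esub> p) = h p"
    and "lin_map R (lin_quot M H) N (quot_map h)"
proof -
  interpret M: module R M by fact
  interpret N: module R N by fact
  interpret H: lin_subgroup H M by (rule lin_subgroup_submodule[OF M H])
  have *: "quot_map h (H +>\<^bsub>M\<^esub> p) = h p" if p: "p \<in> carrier M" for p
  proof -
    have "h x = h p" if x: "x \<in> H +>\<^bsub>M\<^esub> p" for x
    proof -
      obtain y where y: "y \<in> H" "x = y \<oplus>\<^bsub>M\<^esub> p" using x by (auto simp: a_r_coset_def r_coset_def)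
      then have "y \<in> carrier M" using H.a_subset by blast
      then show ?thesis using y h0[OF y(1)] p lin_map_add[OF h] lin_map_closed[OF h p] by simp
    qed
    then have "h ` (H +>\<^bsub>M\<^esub> p) = {h p}" using H.a_rcos_self[OF p] by blast
    then show ?thesis by (simp add: quot_map_def)
  qed
  then show "p \<in> carrier M \<Longrightarrow> quot_map h (H +>\<^bsub>M\<^esub> p) = h p" .
  show "lin_map R (lin_quot M H) N (quot_map h)"
    by (rule lin_mapI)
       (auto simp: lin_quot_carrier H.lin_quot_add lin_quot_module_smult[OF M H] * lin_mapD[OF h])
qed

lemma (in cring) cring_idealI:
  assumes "I \<subseteq> carrier R" "\<zero> \<in> I" "\<And>x y. x \<in> I \<Longrightarrow> y \<in> I \<Longrightarrow> x \<oplus> y \<in> I"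
    and m: "\<And>r x. r \<in> carrier R \<Longrightarrow> x \<in> I \<Longrightarrow> r \<otimes> x \<in> I"
  shows "ideal I R"
proof (rule idealI[OF ring_axioms])
  have neg: "\<ominus> x \<in> I" if "x \<in> I" for x
  proof -
    have "\<ominus> x = (\<ominus> \<one>) \<otimes> x" using that assms(1) by (auto simp: l_minus)
    then show ?thesis using m[OF _ that] by simp
  qed
  show "subgroup I (add_monoid R)"
    by (rule add.subgroupI) (use assms neg in auto)
  fix a x assume "a \<in> I" "x \<in> carrier R"
  moreover from this have "a \<otimes> x = x \<otimes> a" using assms(1) m_comm by blast
  ultimately show "x \<otimes> a \<in> I" "a \<otimes> x \<in> I" using m by auto
qed

context
  fixes K :: "('k, 'z) ring_scheme" and c :: "'k set"
  assumes K: "cring K" and c: "ideal c K"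
begin

interpretation K: cring K by (rule K)

lemma reg_coset: "c +>\<^bsub>reg_module K\<^esub> p = c +>\<^bsub>K\<^esub> p"
  by (simp add: a_r_coset_def r_coset_def)

lemma ideal_reg_submodule: "submodule c K (reg_module K)"
proof -
  interpret N: module K "reg_module K" by (rule reg_module_module[OF K])
  have neg: "\<ominus>\<^bsub>reg_module K\<^esub> x \<in> c" if "x \<in> c" for x
  proof -
    have x: "x \<in> carrier K" using ideal.Icarr[OF c that] .
    have "\<ominus>\<^bsub>reg_module K\<^esub> x = (\<ominus>\<^bsub>K\<^esub> \<one>\<^bsub>K\<^esub>) \<otimes>\<^bsub>K\<^esub> x"
      using N.smult_l_minus[OF K.one_closed, of x] x by simp
    then show ?thesis using ideal.I_l_closed[OF c that, of "\<ominus>\<^bsub>K\<^esub> \<one>\<^bsub>K\<^esub>"] by simp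
  qed
  show ?thesis
    by (rule N.submoduleI)
       (use neg ideal.Icarr[OF c] ideal.I_l_closed[OF c] additive_subgroup.zero_closed[OF ideal.axioms(1)[OF c]]
         additive_subgroup.a_closed[OF ideal.axioms(1)[OF c]] in auto)
qed

context
  assumes depth: "depth_ge_two K c"
begin

text \<open>Multiplication by \<open>a\<close> descends to a homomorphism from \<open>K/c\<close> to
  \<open>K\<close>, which is zero by the Hom half of the depth condition; at the class of one its
  value is \<open>a\<close>.\<close>

lemma depth_annihilator:
  assumes a: "a \<in> carrier K" "\<And>x. x \<in> c \<Longrightarrow> a \<otimes>\<^bsub>K\<^esub> x = \<zero>\<^bsub>K\<^esub>"
  shows "a = \<zero>\<^bsub>K\<^esub>"
proof -
  let ?N = "reg_module K" and ?M = "lin_quot (reg_module K) c"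
  have N: "module K ?N" by (rule reg_module_module[OF K])
  have l: "lin_map K ?N ?N (\<lambda>x. x \<otimes>\<^bsub>K\<^esub> a)"
    using a by (auto simp: lin_map_def K.l_distr K.m_assoc)
  have z: "x \<otimes>\<^bsub>K\<^esub> a = \<zero>\<^bsub>?N\<^esub>" if "x \<in> c" for x
    using a(2)[OF that] ideal.Icarr[OF c that] a(1) by (simp add: K.m_comm)
  note q = lin_quot_map[OF N N ideal_reg_submodule l z]
  have "restrict (quot_map (\<lambda>x. x \<otimes>\<^bsub>K\<^esub> a)) (carrier ?M) \<in> mod_hom K ?M ?N"
    by (rule restrict_mod_hom[OF lin_quot_module[OF N ideal_reg_submodule] q(2)])
  then have eq: "restrict (quot_map (\<lambda>x. x \<otimes>\<^bsub>K\<^esub> a)) (carrier ?M) = (\<lambda>x\<in>carrier ?M. \<zero>\<^bsub>K\<^esub>)"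
    using depth by (simp add: depth_ge_two_def)
  have "c +>\<^bsub>?N\<^esub> \<one>\<^bsub>K\<^esub> \<in> carrier ?M" by (auto simp: lin_quot_carrier)
  then have "quot_map (\<lambda>x. x \<otimes>\<^bsub>K\<^esub> a) (c +>\<^bsub>?N\<^esub> \<one>\<^bsub>K\<^esub>) = \<zero>\<^bsub>K\<^esub>"
    using fun_cong[OF eq, of "c +>\<^bsub>?N\<^esub> \<one>\<^bsub>K\<^esub>"] by simp
  then show ?thesis using q(1)[of "\<one>\<^bsub>K\<^esub>"] a(1) by simp
qed

text \<open>Pulling \<open>\<psi>\<close> back along \<open>d\<^sub>1\<close> of the resolution of \<open>K/c\<close> gives a cocycle of degree one; a
  primitive of it, evaluated on a generator of degree zero, yields the multiplier.\<close>

lemma depth_hom_multiplication: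
  assumes \<psi>: "\<And>x. x \<in> c \<Longrightarrow> \<psi> x \<in> carrier K"
    "\<And>x y. x \<in> c \<Longrightarrow> y \<in> c \<Longrightarrow> \<psi> (x \<oplus>\<^bsub>K\<^esub> y) = \<psi> x \<oplus>\<^bsub>K\<^esub> \<psi> y"
    "\<And>r x. r \<in> carrier K \<Longrightarrow> x \<in> c \<Longrightarrow> \<psi> (r \<otimes>\<^bsub>K\<^esub> x) = r \<otimes>\<^bsub>K\<^esub> \<psi> x"
  shows "\<exists>u\<in>carrier K. \<forall>x\<in>c. \<psi> x = x \<otimes>\<^bsub>K\<^esub> u"
proof -
  let ?N = "reg_module K" and ?M = "lin_quot (reg_module K) c"
  have N: "module K ?N" by (rule reg_module_module[OF K])
  have M: "module K ?M" by (rule lin_quot_module[OF N ideal_reg_submodule])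
  interpret M: module K ?M by (rule M)
  interpret N: module K ?N by (rule N)
  interpret H: lin_subgroup c ?N by (rule lin_subgroup_submodule[OF N ideal_reg_submodule])
  let ?\<pi> = "\<lambda>a. c +>\<^bsub>?N\<^esub> a"
  have \<pi>l: "lin_map K ?N ?M ?\<pi>"
    by (rule lin_mapI)
       (auto simp: lin_quot_carrier H.lin_quot_add[simplified] lin_quot_module_smult[OF N ideal_reg_submodule, simplified])
  \<comment> \<open>The augmentation of the resolution of \<open>K/c\<close> is lifted to
    \<open>K\<close>. On boundaries the lift takes values in \<open>c\<close>, so \<psi> can be
    applied there.\<close>
  have "\<exists>\<beta>\<in>mod_hom K (sres K ?M 0) ?N. \<forall>w\<in>carrier (sres K ?M 0). ?\<pi> (\<beta> w) = res_aug K ?M w"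
    by (rule M.sres_projective[OF N M \<pi>l M.aug_lin])
       (use lin_map_closed[OF M.aug_lin] in \<open>auto simp: lin_quot_carrier\<close>)
  then obtain \<beta> where \<beta>: "lin_map K (sres K ?M 0) ?N \<beta>"
    "\<And>w. w \<in> carrier (sres K ?M 0) \<Longrightarrow> ?\<pi> (\<beta> w) = res_aug K ?M w" by (auto simp: mod_hom_lin_map)
  have bd0: "lin_map K (sres K ?M 1) (sres K ?M 0) (res_bd K)" using M.bd_lin[of 1] by simp
  have \<beta>c: "\<beta> w \<in> c" if w: "w \<in> carrier (sres K ?M 0)" "res_aug K ?M w = \<zero>\<^bsub>?M\<^esub>" for w
    using \<beta>(2)[OF w(1)] w H.lin_quot_eq_zero_iff[of "\<beta> w"] lin_map_closed[OF \<beta>(1) w(1)] by simp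
  have \<beta>d: "\<beta> (res_bd K w) \<in> c" if w: "w \<in> carrier (sres K ?M 1)" for w
    by (rule \<beta>c[OF lin_map_closed[OF bd0 w] M.aug_bd[OF w]])
  have gl: "lin_map K (sres K ?M 1) ?N (\<lambda>w. \<psi> (\<beta> (res_bd K w)))"
  proof (rule lin_mapI)
    note bl = lin_map_compose[OF bd0 \<beta>(1)]
    fix v w assume v: "v \<in> carrier (sres K ?M 1)" and w: "w \<in> carrier (sres K ?M 1)"
    show "\<psi> (\<beta> (res_bd K (v \<oplus>\<^bsub>sres K ?M 1\<^esub> w))) = \<psi> (\<beta> (res_bd K v)) \<oplus>\<^bsub>?N\<^esub> \<psi> (\<beta> (res_bd K w))"
      using lin_map_add[OF bl v w] \<psi>(2)[OF \<beta>d[OF v] \<beta>d[OF w]] by simp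
  next
    note bl = lin_map_compose[OF bd0 \<beta>(1)]
    fix r w assume r: "r \<in> carrier K" and w: "w \<in> carrier (sres K ?M 1)"
    show "\<psi> (\<beta> (res_bd K (r \<odot>\<^bsub>sres K ?M 1\<^esub> w))) = r \<odot>\<^bsub>?N\<^esub> \<psi> (\<beta> (res_bd K w))"
      using lin_map_smult[OF bl r w] \<psi>(3)[OF r \<beta>d[OF w]] by simp
  qed (use \<psi>(1) \<beta>d in auto)
  have c0: "\<zero>\<^bsub>K\<^esub> \<in> c" by (rule additive_subgroup.zero_closed[OF ideal.axioms(1)[OF c]])
  have \<psi>0: "\<psi> \<zero>\<^bsub>K\<^esub> = \<zero>\<^bsub>K\<^esub>" using \<psi>(3)[OF K.zero_closed c0] \<psi>(1)[OF c0] by simp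
  have "\<psi> (\<beta> (res_bd K (res_bd K w))) = \<zero>\<^bsub>?N\<^esub>" if "w \<in> carrier (sres K ?M (1 + 1))" for w
    using M.bd_bd[OF that] lin_map_zero[OF M.sres_module N \<beta>(1)] \<psi>0 by simp
  from cocycle_lift[OF M N _ gl this] obtain \<phi> where \<phi>: "\<phi> \<in> cocyc K ?M ?N 1"
    "\<And>w. w \<in> carrier (sres K ?M 1) \<Longrightarrow> res_aug K ?N (\<phi> 1 w) = \<psi> (\<beta> (res_bd K w))" by auto
  have "ext_class K ?M ?N 1 \<phi> \<in> carrier (Ext K ?M ?N 1)" using \<phi>(1) Ext_carrier[OF M N, of 1] by simp
  then have "ext_class K ?M ?N 1 \<phi> = \<zero>\<^bsub>Ext K ?M ?N 1\<^esub>" using depth by (simp add: depth_ge_two_def)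
  then have "\<phi> \<in> cobd K ?M ?N 1" using ext_class_zero_iff[OF M N, of \<phi> 1] \<phi>(1) by simp
  then obtain \<eta> where \<eta>: "\<eta> \<in> carrier (hcpx K ?M ?N 0)" "\<phi> = hom_bd (std_res K ?M) (std_res K ?N) 0 \<eta>"
    by (auto simp: coboundaries_def)
  \<comment> \<open>For a primitive \<eta> of degree 0, \<phi> is
    \<open>d \<eta> - \<eta> d\<close>. The augmentation kills the first term, which explains the
    sign.\<close>
  define g where "g w = \<ominus>\<^bsub>K\<^esub> res_aug K ?N (\<eta> 0 w)" for w
  have \<eta>l: "lin_map K (sres K ?M i) (sres K ?N i) (\<eta> i)" for i using hom_cpx_lin[OF \<eta>(1), of i] by simp
  have al: "lin_map K (sres K ?M 0) ?N (\<lambda>w. res_aug K ?N (\<eta> 0 w))"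
    using lin_map_compose[OF \<eta>l N.aug_lin] .
  have geq: "\<psi> (\<beta> (res_bd K w)) = g (res_bd K w)" if w: "w \<in> carrier (sres K ?M 1)" for w
  proof -
    have dw: "res_bd K w \<in> carrier (sres K ?M 0)" using lin_map_closed[OF bd0 w] .
    have a: "res_bd K (\<eta> 1 w) \<in> carrier (sres K ?N 0)"
      using lin_map_closed[OF N.bd_lin lin_map_closed[OF \<eta>l w]] by simp
    have b: "\<eta> 0 (res_bd K w) \<in> carrier (sres K ?N 0)" using lin_map_closed[OF \<eta>l dw] .
    interpret F: module K N.F by (rule N.F_module)
    have "\<phi> 1 w = res_bd K (\<eta> 1 w) \<ominus>\<^bsub>sres K ?N 0\<^esub> \<eta> 0 (res_bd K w)"
      unfolding \<eta>(2) using hom_bd_apply[OF M N \<eta>(1) w] N.sres_minus(2)[OF a b] subsetD[OF sres_sub b]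
      by (simp add: sgn_ring_def)
    then have "res_aug K ?N (\<phi> 1 w) = \<zero>\<^bsub>K\<^esub> \<ominus>\<^bsub>?N\<^esub> res_aug K ?N (\<eta> 0 (res_bd K w))"
      using lin_map_minus(2)[OF N.sres_module N N.aug_lin a b] N.aug_bd[OF lin_map_closed[OF \<eta>l w]] by simp
    also have "\<dots> = g (res_bd K w)"
      using N.smult_l_minus[OF K.one_closed, of "res_aug K ?N (\<eta> 0 (res_bd K w))", symmetric] lin_map_closed[OF al dw]
      by (simp add: g_def a_minus_def K.l_minus)
    finally show ?thesis using \<phi>(2)[OF w] by simp
  qed
  have gs: "g (r \<odot>\<^bsub>sres K ?M 0\<^esub> w) = r \<otimes>\<^bsub>K\<^esub> g w" "g w \<in> carrier K"
    if "w \<in> carrier (sres K ?M 0)" "r \<in> carrier K" for r w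
    using lin_map_smult[OF al that(2,1)] lin_map_closed[OF al that(1)] that by (simp_all add: g_def K.r_minus)
  \<comment> \<open>A generator over the class of one; \<open>\<beta> z\<close> is then congruent to
    one modulo \<open>c\<close>, but need not equal it.\<close>
  obtain z where z: "z \<in> carrier (sres K ?M 0)" "res_aug K ?M z = ?\<pi> \<one>\<^bsub>K\<^esub>"
    using M.aug_surj[of "?\<pi> \<one>\<^bsub>K\<^esub>"] lin_map_closed[OF \<pi>l, of "\<one>\<^bsub>K\<^esub>"] by auto
  have bz: "\<beta> z \<in> carrier K" using lin_map_closed[OF \<beta>(1) z(1)] by simp
  have e: "\<one>\<^bsub>K\<^esub> \<ominus>\<^bsub>K\<^esub> \<beta> z \<in> c"
  proof -
    interpret cK: abelian_subgroup c K
      by (rule abelian_subgroupI3[OF ideal.axioms(1)[OF c] K.abelian_group_axioms])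
    have "c +>\<^bsub>K\<^esub> \<one>\<^bsub>K\<^esub> = c +>\<^bsub>K\<^esub> \<beta> z" using \<beta>(2)[OF z(1)] z(2) by (simp add: reg_coset)
    then have "\<one>\<^bsub>K\<^esub> \<in> c +>\<^bsub>K\<^esub> \<beta> z" using cK.a_rcos_self[OF K.one_closed] by simp
    then show ?thesis using cK.a_rcos_module[OF bz K.one_closed] by (simp add: K.minus_eq)
  qed
  \<comment> \<open>The error of \<open>\<beta> z\<close> lies in \<open>c\<close>, so linearity of
    \<psi> accounts for it and contributes \<open>\<psi> ?e\<close> to the multiplier.\<close>
  let ?e = "\<one>\<^bsub>K\<^esub> \<ominus>\<^bsub>K\<^esub> \<beta> z"
  have "\<psi> x = x \<otimes>\<^bsub>K\<^esub> (g z \<oplus>\<^bsub>K\<^esub> \<psi> ?e)" if x: "x \<in> c" for x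
  proof -
    have xK: "x \<in> carrier K" using ideal.Icarr[OF c x] .
    let ?w = "x \<odot>\<^bsub>sres K ?M 0\<^esub> z"
    have w: "?w \<in> carrier (sres K ?M 0)" by (rule module.smult_closed[OF M.sres_module xK z(1)])
    have "res_aug K ?M ?w = ?\<pi> x"
      using lin_map_smult[OF M.aug_lin xK z(1)] z(2) lin_map_smult[OF \<pi>l xK, of "\<one>\<^bsub>K\<^esub>"] xK by simp
    \<comment> \<open>The augmentation of \<open>x\<close> times \<open>z\<close> is the class of
      \<open>x\<close>, which is zero; hence this element is a boundary and \<open>geq\<close>
      evaluates \<psi> on it.\<close>
    then have "M.cyc 0 ?w" using H.lin_quot_eq_zero_iff[of x] x xK by (simp add: M.cyc_def)
    then obtain v where v: "v \<in> carrier (sres K ?M 1)" "?w = res_bd K v"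
      using M.sres_exact[OF w] by auto
    have "\<psi> (x \<otimes>\<^bsub>K\<^esub> \<beta> z) = x \<otimes>\<^bsub>K\<^esub> g z"
      using geq[OF v(1)] gs(1)[OF z(1) xK] lin_map_smult[OF \<beta>(1) xK z(1)] unfolding v(2)[symmetric] by simp
    moreover have "\<psi> (x \<otimes>\<^bsub>K\<^esub> ?e) = x \<otimes>\<^bsub>K\<^esub> \<psi> ?e" using \<psi>(3)[OF xK e] .
    moreover have "x = x \<otimes>\<^bsub>K\<^esub> \<beta> z \<oplus>\<^bsub>K\<^esub> x \<otimes>\<^bsub>K\<^esub> ?e"
      using xK bz by (simp add: a_minus_def K.r_distr K.r_minus K.a_lcomm K.r_neg)
    moreover have "x \<otimes>\<^bsub>K\<^esub> \<beta> z \<in> c" "x \<otimes>\<^bsub>K\<^esub> ?e \<in> c"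
      using ideal.I_r_closed[OF c x bz] ideal.I_l_closed[OF c e xK] by auto
    ultimately have "\<psi> x = x \<otimes>\<^bsub>K\<^esub> g z \<oplus>\<^bsub>K\<^esub> x \<otimes>\<^bsub>K\<^esub> \<psi> ?e" using \<psi>(2) by metis
    then show ?thesis using xK gs(2)[OF z(1) K.one_closed] \<psi>(1)[OF e] by (simp add: K.r_distr)
  qed
  then show ?thesis using gs(2)[OF z(1) K.one_closed] \<psi>(1)[OF e] by (intro bexI[of _ "g z \<oplus>\<^bsub>K\<^esub> \<psi> ?e"]) auto
qed

end

end

section \<open>Divisibility by a polynomial whose content ideal has depth two\<close>

context UP_cring
begin

context
  fixes f
  assumes f: "f \<in> carrier P" and depth: "depth_ge_two R (content_ideal R f)"
begin

lemma content_ideal: "ideal (content_ideal R f) R"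
  unfolding content_ideal_def P_def[symmetric] by (rule R.genideal_ideal) (use f in auto)

lemma coeff_in_content: "up_ring.coeff P f i \<in> content_ideal R f"
  unfolding content_ideal_def P_def[symmetric]
  by (rule subsetD[OF R.genideal_self]) (use f in auto)

lemma content_minimal:
  assumes "ideal J R" "\<And>i. up_ring.coeff P f i \<in> J"
  shows "content_ideal R f \<subseteq> J"
  unfolding content_ideal_def P_def[symmetric] by (rule R.genideal_minimal[OF assms(1)]) (use assms(2) in auto)

text \<open>The elements killed by \<open>a\<close> form an ideal, so vanishing on the coefficients
  extends to the whole content ideal.\<close>

lemma content_annihilator:
  assumes a: "a \<in> carrier R" "\<And>i. a \<otimes> up_ring.coeff P f i = \<zero>"
  shows "a = \<zero>"
proof (rule depth_annihilator[OF R.cring_axioms content_ideal depth a(1)])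
  fix x assume x: "x \<in> content_ideal R f"
  have "ideal {x \<in> carrier R. a \<otimes> x = \<zero>} R"
    by (rule R.cring_idealI) (use a(1) in \<open>auto simp: R.r_distr R.m_lcomm\<close>)
  from content_minimal[OF this] show "a \<otimes> x = \<zero>" using x a(2) f by auto
qed

lemma f_regular: "g \<in> carrier P \<Longrightarrow> f \<otimes>\<^bsub>P\<^esub> g = \<zero>\<^bsub>P\<^esub> \<Longrightarrow> g = \<zero>\<^bsub>P\<^esub>"
  by (rule mccoy[OF f content_annihilator])

lemma f_cancel:
  assumes "g \<in> carrier P" "h \<in> carrier P" "f \<otimes>\<^bsub>P\<^esub> g = f \<otimes>\<^bsub>P\<^esub> h"
  shows "g = h"
proof -
  have "f \<otimes>\<^bsub>P\<^esub> (g \<ominus>\<^bsub>P\<^esub> h) = \<zero>\<^bsub>P\<^esub>"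
    using assms f by (simp add: a_minus_def P.r_distr P.r_minus P.r_neg)
  then show ?thesis using f_regular[of "g \<ominus>\<^bsub>P\<^esub> h"] assms P.minus_eq_zero_iff by simp
qed

text \<open>Multiplying \<open>g\<close> by the content ideal and dividing by \<open>f\<close> gives one homomorphism into the
  base ring for each coefficient; their multipliers are the coefficients of the quotient.\<close>

lemma quotient_annihilator:
  assumes g: "g \<in> carrier P" and dvd: "\<And>i. \<exists>u\<in>carrier P. up_ring.coeff P f i \<odot>\<^bsub>P\<^esub> g = f \<otimes>\<^bsub>P\<^esub> u"
  shows "\<exists>u\<in>carrier P. g = f \<otimes>\<^bsub>P\<^esub> u"
proof -
  let ?c = "content_ideal R f"
  have cc: "x \<in> carrier R" if "x \<in> ?c" for x using ideal.Icarr[OF content_ideal that] .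
  have sm: "x \<odot>\<^bsub>P\<^esub> (f \<otimes>\<^bsub>P\<^esub> u) = f \<otimes>\<^bsub>P\<^esub> (x \<odot>\<^bsub>P\<^esub> u)" if "x \<in> carrier R" "u \<in> carrier P" for x u
    using UP_smult_assoc2[OF that(1) that(2) f] f that by (simp add: P.m_comm)
  \<comment> \<open>The multipliers taking \<open>g\<close> into the multiples of \<open>f\<close>
    form an ideal, so \<open>dvd\<close> extends from the coefficients to the content ideal.\<close>
  have "ideal {x \<in> carrier R. \<exists>u\<in>carrier P. x \<odot>\<^bsub>P\<^esub> g = f \<otimes>\<^bsub>P\<^esub> u} R"
  proof (rule R.cring_idealI)
    show "\<zero> \<in> {x \<in> carrier R. \<exists>u\<in>carrier P. x \<odot>\<^bsub>P\<^esub> g = f \<otimes>\<^bsub>P\<^esub> u}"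
      using g f by (auto intro!: bexI[of _ "\<zero>\<^bsub>P\<^esub>"])
  next
    fix x y assume "x \<in> {x \<in> carrier R. \<exists>u\<in>carrier P. x \<odot>\<^bsub>P\<^esub> g = f \<otimes>\<^bsub>P\<^esub> u}"
      "y \<in> {x \<in> carrier R. \<exists>u\<in>carrier P. x \<odot>\<^bsub>P\<^esub> g = f \<otimes>\<^bsub>P\<^esub> u}"
    then obtain u v where "x \<in> carrier R" "y \<in> carrier R" "u \<in> carrier P" "x \<odot>\<^bsub>P\<^esub> g = f \<otimes>\<^bsub>P\<^esub> u"
      "v \<in> carrier P" "y \<odot>\<^bsub>P\<^esub> g = f \<otimes>\<^bsub>P\<^esub> v" by blast
    then show "x \<oplus> y \<in> {x \<in> carrier R. \<exists>u\<in>carrier P. x \<odot>\<^bsub>P\<^esub> g = f \<otimes>\<^bsub>P\<^esub> u}"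
      using f g by (auto intro!: bexI[of _ "u \<oplus>\<^bsub>P\<^esub> v"] simp: UP_smult_l_distr P.r_distr)
  next
    fix r x assume r: "r \<in> carrier R" and "x \<in> {x \<in> carrier R. \<exists>u\<in>carrier P. x \<odot>\<^bsub>P\<^esub> g = f \<otimes>\<^bsub>P\<^esub> u}"
    then obtain u where "x \<in> carrier R" "u \<in> carrier P" "x \<odot>\<^bsub>P\<^esub> g = f \<otimes>\<^bsub>P\<^esub> u" by blast
    then show "r \<otimes> x \<in> {x \<in> carrier R. \<exists>u\<in>carrier P. x \<odot>\<^bsub>P\<^esub> g = f \<otimes>\<^bsub>P\<^esub> u}"
      using f g r by (auto intro!: bexI[of _ "r \<odot>\<^bsub>P\<^esub> u"] simp: UP_smult_assoc1 sm)
  qed auto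
  from content_minimal[OF this] have "\<forall>x\<in>?c. \<exists>u\<in>carrier P. x \<odot>\<^bsub>P\<^esub> g = f \<otimes>\<^bsub>P\<^esub> u"
    using dvd f by auto
  then obtain q where q: "\<And>x. x \<in> ?c \<Longrightarrow> q x \<in> carrier P" "\<And>x. x \<in> ?c \<Longrightarrow> x \<odot>\<^bsub>P\<^esub> g = f \<otimes>\<^bsub>P\<^esub> q x" by metis
  have ca: "x \<oplus> y \<in> ?c" if "x \<in> ?c" "y \<in> ?c" for x y
    using additive_subgroup.a_closed[OF ideal.axioms(1)[OF content_ideal]] that .
  have cm: "r \<otimes> x \<in> ?c" if "r \<in> carrier R" "x \<in> ?c" for r x
    using ideal.I_l_closed[OF content_ideal] that by blast
  \<comment> \<open>Quotients by \<open>f\<close> are unique because \<open>f\<close> is a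
    nonzerodivisor; hence \<open>q\<close> is linear.\<close>
  have qa: "q (x \<oplus> y) = q x \<oplus>\<^bsub>P\<^esub> q y" if "x \<in> ?c" "y \<in> ?c" for x y
    by (rule f_cancel) (use q that f g ca cc in \<open>simp_all add: P.r_distr UP_smult_l_distr flip: q(2)\<close>)
  have qm: "q (r \<otimes> x) = r \<odot>\<^bsub>P\<^esub> q x" if "r \<in> carrier R" "x \<in> ?c" for r x
    by (rule f_cancel) (use q that f g cm cc in \<open>simp_all add: UP_smult_assoc1 flip: q(2) sm\<close>)
  \<comment> \<open>For fixed \<open>n\<close>, the coefficient of index \<open>n\<close> of
    \<open>q x\<close> is a linear function of \<open>x\<close> in the content ideal.\<close>
  have "\<exists>u\<in>carrier R. \<forall>x\<in>?c. up_ring.coeff P (q x) n = x \<otimes> u" for n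
    by (rule depth_hom_multiplication[OF R.cring_axioms content_ideal depth])
       (use q qa qm in simp_all)
  then obtain u where u: "\<And>n. u n \<in> carrier R" "\<And>n x. x \<in> ?c \<Longrightarrow> up_ring.coeff P (q x) n = x \<otimes> u n" by metis
  \<comment> \<open>A common degree bound for the quotients belonging to the finitely many
    coefficients of \<open>f\<close> of index at most its degree. Beyond it, \<open>u n\<close>
    kills every coefficient of \<open>f\<close> and so vanishes, which makes \<open>u\<close> a
    polynomial.\<close>
  define N where "N = Max ((\<lambda>i. deg R (q (up_ring.coeff P f i))) ` {..deg R f})"
  have "u n = \<zero>" if n: "n > N" for n
  proof (rule content_annihilator[OF u(1)])
    fix i
    show "u n \<otimes> up_ring.coeff P f i = \<zero>"
    proof (cases "i \<le> deg R f")
      case True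
      then have "deg R (q (up_ring.coeff P f i)) \<le> N" unfolding N_def by (intro Max_ge) auto
      then have "up_ring.coeff P (q (up_ring.coeff P f i)) n = \<zero>"
        using n q(1)[OF coeff_in_content] by (intro deg_aboveD) auto
      then show ?thesis using u f coeff_in_content by (simp add: R.m_comm)
    next
      case False
      then show ?thesis using deg_aboveD[of f i] f u by simp
    qed
  qed
  then have "u \<in> up R" by (intro mem_upI exI[of _ N] bound.intro) (use u in auto)
  then have uP: "u \<in> carrier P" "\<And>n. up_ring.coeff P u n = u n"
    unfolding P_def by (simp_all add: UP_carrier UP_coeff)
  have "q x = x \<odot>\<^bsub>P\<^esub> u" if "x \<in> ?c" for x
    by (rule up_eqI) (use that q u uP cc in simp_all)
  then have key: "x \<odot>\<^bsub>P\<^esub> g = x \<odot>\<^bsub>P\<^esub> (f \<otimes>\<^bsub>P\<^esub> u)" if "x \<in> ?c" for x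
    using q(2)[OF that] sm[OF cc[OF that] uP(1)] that by simp
  \<comment> \<open>The content ideal kills every coefficient of this difference.\<close>
  have "g \<ominus>\<^bsub>P\<^esub> f \<otimes>\<^bsub>P\<^esub> u = \<zero>\<^bsub>P\<^esub>"
  proof (rule up_eqI)
    fix n
    have "up_ring.coeff P (g \<ominus>\<^bsub>P\<^esub> f \<otimes>\<^bsub>P\<^esub> u) n = \<zero>"
    proof (rule content_annihilator)
      fix i
      let ?a = "up_ring.coeff P f i" and ?fu = "f \<otimes>\<^bsub>P\<^esub> u"
      have a: "?a \<in> carrier R" and fu: "?fu \<in> carrier P" using f uP by simp_all
      have "?a \<otimes> up_ring.coeff P g n = ?a \<otimes> up_ring.coeff P ?fu n"
        using arg_cong[OF key[OF coeff_in_content], of "\<lambda>p. up_ring.coeff P p n"] a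
          coeff_smult[OF a g, of n] coeff_smult[OF a fu, of n] by metis
      then have "?a \<otimes> (up_ring.coeff P g n \<ominus> up_ring.coeff P ?fu n) = \<zero>"
        using a g coeff_closed[OF fu, of n] by (simp add: a_minus_def R.r_distr R.r_minus R.r_neg del: coeff_mult)
      then show "up_ring.coeff P (g \<ominus>\<^bsub>P\<^esub> ?fu) n \<otimes> ?a = \<zero>"
        using coeff_minus[OF g fu, of n] a g coeff_closed[OF fu, of n] by (simp add: R.m_comm del: coeff_mult)
    qed (use f g uP in \<open>intro coeff_closed P.minus_closed P.m_closed\<close>)
    then show "up_ring.coeff P (g \<ominus>\<^bsub>P\<^esub> f \<otimes>\<^bsub>P\<^esub> u) n = up_ring.coeff P \<zero>\<^bsub>P\<^esub> n" by simp
  qed (use f g uP in auto)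
  then show ?thesis using P.minus_eq_zero_iff[of g "f \<otimes>\<^bsub>P\<^esub> u"] f g uP by auto
qed

end

end

section \<open>Tensor products\<close>

text \<open>\<open>frag_induction\<close> proceeds by differences, so additivity is recorded for
  differences throughout.\<close>

lemma frag_extend_diff_fun: "frag_extend (\<lambda>i. f i - g i) x = frag_extend f x - frag_extend g x"
proof -
  have "Poly_Mapping.keys x \<subseteq> UNIV" by simp
  then show ?thesis
    by (induction x rule: frag_induction) (simp_all add: frag_extend_diff)
qed

definition frag_mult :: "('p \<Rightarrow> 'q \<Rightarrow> 's) \<Rightarrow> ('p \<Rightarrow>\<^sub>0 int) \<Rightarrow> ('q \<Rightarrow>\<^sub>0 int) \<Rightarrow> ('s \<Rightarrow>\<^sub>0 int)" where
  "frag_mult m x y = frag_extend (\<lambda>p. frag_extend (\<lambda>q. frag_of (m p q)) y) x"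

lemma frag_mult_of [simp]: "frag_mult m (frag_of p) (frag_of q) = frag_of (m p q)"
  by (simp add: frag_mult_def)

lemma frag_mult_zero [simp]: "frag_mult m 0 y = 0" "frag_mult m x 0 = 0"
  by (simp_all add: frag_mult_def frag_extend_eq_0)

lemma frag_mult_diff [simp]:
  "frag_mult m (x - x') y = frag_mult m x y - frag_mult m x' y"
  "frag_mult m x (y - y') = frag_mult m x y - frag_mult m x y'"
  by (simp_all add: frag_mult_def frag_extend_diff frag_extend_diff_fun)

lemma frag_mult_keys:
  assumes "\<And>p q. p \<in> S \<Longrightarrow> q \<in> T \<Longrightarrow> m p q \<in> U" "Poly_Mapping.keys x \<subseteq> S" "Poly_Mapping.keys y \<subseteq> T"
  shows "Poly_Mapping.keys (frag_mult m x y) \<subseteq> U"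
proof -
  have "Poly_Mapping.keys (frag_extend (\<lambda>q. frag_of (m p q)) y) \<subseteq> U" if "p \<in> S" for p
    by (rule order_trans[OF keys_frag_extend]) (use assms that in auto)
  then show ?thesis unfolding frag_mult_def
    by (intro order_trans[OF keys_frag_extend]) (use assms in auto)
qed

lemma pre_tensor_sel [simp]:
  "carrier (pre_tensor A B) = {x. Poly_Mapping.keys x \<subseteq> carrier A \<times> carrier B}"
  "monoid.mult (pre_tensor A B) = frag_mult (monoid.mult (A \<times>\<times> B))"
  "\<one>\<^bsub>pre_tensor A B\<^esub> = frag_of (\<one>\<^bsub>A\<^esub>, \<one>\<^bsub>B\<^esub>)" "\<zero>\<^bsub>pre_tensor A B\<^esub> = 0"
  "ring.add (pre_tensor A B) = (+)"
  "smult (pre_tensor A B) = (\<lambda>c. frag_mult (monoid.mult (A \<times>\<times> B)) (frag_of (c \<odot>\<^bsub>A\<^esub> \<one>\<^bsub>A\<^esub>, \<one>\<^bsub>B\<^esub>)))"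
  by (simp_all add: pre_tensor_def Let_def frag_mult_def[abs_def])

context
  fixes A :: "('k, 'a, 'x) module_scheme" and B :: "('k, 'b, 'y) module_scheme"
  assumes A: "cring A" and B: "cring B"
begin

interpretation A: cring A by (rule A)
interpretation B: cring B by (rule B)

text \<open>The monoid-ring laws are additive in each argument, so induction reduces them to single
  pairs, where they are laws of \<open>A\<close> and \<open>B\<close>.\<close>

lemma pre_tensor_cring: "cring (pre_tensor A B)"
proof (intro cringI abelian_groupI comm_monoidI)
  let ?m = "monoid.mult (A \<times>\<times> B)"
  fix x assume "x \<in> carrier (pre_tensor A B)"
  then have x: "Poly_Mapping.keys x \<subseteq> carrier A \<times> carrier B" by simp
  show "\<one>\<^bsub>pre_tensor A B\<^esub> \<otimes>\<^bsub>pre_tensor A B\<^esub> x = x"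
    unfolding pre_tensor_sel using x by (induction x rule: frag_induction) (auto simp: DirProd_def)
  show "\<exists>y\<in>carrier (pre_tensor A B). y \<oplus>\<^bsub>pre_tensor A B\<^esub> x = \<zero>\<^bsub>pre_tensor A B\<^esub>"
    by (rule bexI[of _ "- x"]) (use x in auto)
  fix y assume "y \<in> carrier (pre_tensor A B)"
  then have y: "Poly_Mapping.keys y \<subseteq> carrier A \<times> carrier B" by simp
  show "x \<oplus>\<^bsub>pre_tensor A B\<^esub> y \<in> carrier (pre_tensor A B)"
    using x y Poly_Mapping.keys_add[of x y] by auto
  show "x \<otimes>\<^bsub>pre_tensor A B\<^esub> y \<in> carrier (pre_tensor A B)"
    using frag_mult_keys[OF _ x y, of ?m "carrier A \<times> carrier B"] by (auto simp: DirProd_def)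
  show "x \<otimes>\<^bsub>pre_tensor A B\<^esub> y = y \<otimes>\<^bsub>pre_tensor A B\<^esub> x"
    unfolding pre_tensor_sel using x
  proof (induction x rule: frag_induction)
    case (one p)
    show ?case using y one
      by (induction y rule: frag_induction) (auto simp: DirProd_def A.m_comm B.m_comm)
  qed simp_all
  fix w assume "w \<in> carrier (pre_tensor A B)"
  then have w: "Poly_Mapping.keys w \<subseteq> carrier A \<times> carrier B" by simp
  show "x \<otimes>\<^bsub>pre_tensor A B\<^esub> y \<otimes>\<^bsub>pre_tensor A B\<^esub> w = x \<otimes>\<^bsub>pre_tensor A B\<^esub> (y \<otimes>\<^bsub>pre_tensor A B\<^esub> w)"
    unfolding pre_tensor_sel using x
  proof (induction x rule: frag_induction)
    case (one p)
    note p = one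
    show ?case using y
    proof (induction y rule: frag_induction)
      case (one q)
      show ?case using w p one
        by (induction w rule: frag_induction) (auto simp: DirProd_def A.m_assoc B.m_assoc)
    qed simp_all
  qed simp_all
  show "(x \<oplus>\<^bsub>pre_tensor A B\<^esub> y) \<otimes>\<^bsub>pre_tensor A B\<^esub> w = x \<otimes>\<^bsub>pre_tensor A B\<^esub> w \<oplus>\<^bsub>pre_tensor A B\<^esub> y \<otimes>\<^bsub>pre_tensor A B\<^esub> w"
    by (simp add: frag_mult_def frag_extend_add)
  show "x \<oplus>\<^bsub>pre_tensor A B\<^esub> y \<oplus>\<^bsub>pre_tensor A B\<^esub> w = x \<oplus>\<^bsub>pre_tensor A B\<^esub> (y \<oplus>\<^bsub>pre_tensor A B\<^esub> w)"
    by simp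
qed (auto simp: add.commute)

end

text \<open>The additive extension of \<gamma> to the free abelian group; for the product of the two
  entries of a pair it is \<open>mult_map\<close>.\<close>

definition frag_lin :: "('c, 'z) ring_scheme \<Rightarrow> ('p \<Rightarrow> 'c) \<Rightarrow> ('p \<Rightarrow>\<^sub>0 int) \<Rightarrow> 'c" where
  "frag_lin C \<gamma> x = (\<Oplus>\<^bsub>C\<^esub>p\<in>Poly_Mapping.keys x. [Poly_Mapping.lookup x p] \<cdot>\<^bsub>C\<^esub> \<gamma> p)"

context abelian_group
begin

lemma int_zero_pow: "add_pow G (0 :: int) (x) = \<zero>"
  by (simp add: add_pow_def)

lemma frag_lin_superset:
  assumes "finite S" "Poly_Mapping.keys x \<subseteq> S" "\<gamma> ` S \<subseteq> carrier G"
  shows "frag_lin G \<gamma> x = (\<Oplus>p\<in>S. add_pow G (Poly_Mapping.lookup x p) (\<gamma> p))"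
  unfolding frag_lin_def
  by (rule add.finprod_mono_neutral_cong_left) (use assms in \<open>auto simp: in_keys_iff add.int_pow_closed int_zero_pow\<close>)

lemma frag_lin_closed:
  assumes "\<gamma> ` Poly_Mapping.keys x \<subseteq> carrier G"
  shows "frag_lin G \<gamma> x \<in> carrier G"
  unfolding frag_lin_def by (intro finsum_closed) (use assms in \<open>auto simp: add.int_pow_closed\<close>)

lemma frag_lin_add:
  assumes "\<gamma> ` Poly_Mapping.keys x \<subseteq> carrier G" "\<gamma> ` Poly_Mapping.keys y \<subseteq> carrier G"
  shows "frag_lin G \<gamma> (x + y) = frag_lin G \<gamma> x \<oplus> frag_lin G \<gamma> y"
proof -
  let ?S = "Poly_Mapping.keys x \<union> Poly_Mapping.keys y"
  have S: "finite ?S" "\<gamma> ` ?S \<subseteq> carrier G" "Poly_Mapping.keys (x + y) \<subseteq> ?S"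
    using assms Poly_Mapping.keys_add[of x y] by auto
  have "frag_lin G \<gamma> (x + y) = (\<Oplus>p\<in>?S. add_pow G (Poly_Mapping.lookup x p + Poly_Mapping.lookup y p) (\<gamma> p))"
    using frag_lin_superset[OF S(1,3,2)] by (simp add: lookup_add)
  also have "\<dots> = (\<Oplus>p\<in>?S. add_pow G (Poly_Mapping.lookup x p) (\<gamma> p) \<oplus> add_pow G (Poly_Mapping.lookup y p) (\<gamma> p))"
    by (rule finsum_cong') (use S(2) in \<open>auto simp: add.int_pow_mult add.int_pow_closed\<close>)
  also have "\<dots> = (\<Oplus>p\<in>?S. add_pow G (Poly_Mapping.lookup x p) (\<gamma> p)) \<oplus> (\<Oplus>p\<in>?S. add_pow G (Poly_Mapping.lookup y p) (\<gamma> p))"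
    by (rule finsum_addf) (use S(2) in \<open>auto simp: add.int_pow_closed\<close>)
  also have "\<dots> = frag_lin G \<gamma> x \<oplus> frag_lin G \<gamma> y"
    using frag_lin_superset[OF S(1) _ S(2)] by simp
  finally show ?thesis .
qed

lemma frag_lin_zero: "frag_lin G \<gamma> 0 = \<zero>"
  by (simp add: frag_lin_def)

lemma frag_lin_of:
  assumes "\<gamma> p \<in> carrier G"
  shows "frag_lin G \<gamma> (frag_of p) = \<gamma> p"
  using assms add.int_pow_1[OF assms] by (simp add: frag_lin_def)

lemma frag_lin_diff:
  assumes "\<gamma> ` Poly_Mapping.keys x \<subseteq> carrier G" "\<gamma> ` Poly_Mapping.keys y \<subseteq> carrier G"
  shows "frag_lin G \<gamma> (x - y) = frag_lin G \<gamma> x \<ominus> frag_lin G \<gamma> y"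
proof -
  have xy: "\<gamma> ` Poly_Mapping.keys (x - y) \<subseteq> carrier G"
    using assms keys_diff[of x y] by blast
  have "frag_lin G \<gamma> (x - y + y) = frag_lin G \<gamma> (x - y) \<oplus> frag_lin G \<gamma> y"
    by (rule frag_lin_add[OF xy assms(2)])
  then have "frag_lin G \<gamma> x = frag_lin G \<gamma> y \<oplus> frag_lin G \<gamma> (x - y)"
    using frag_lin_closed[OF xy] frag_lin_closed[OF assms(2)] a_comm by simp
  then show ?thesis using minus_eq_iff frag_lin_closed[OF xy] frag_lin_closed[OF assms(1)] frag_lin_closed[OF assms(2)]
    by metis
qed

end

lemma frag_lin_ring_hom:
  fixes A :: "('k, 'a, 'x) module_scheme" and B :: "('k, 'b, 'y) module_scheme"
  assumes A: "cring A" and B: "cring B" and C: "cring C"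
    and \<alpha>: "\<alpha> \<in> ring_hom A C" and \<beta>: "\<beta> \<in> ring_hom B C"
  shows "frag_lin C (\<lambda>p. \<alpha> (fst p) \<otimes>\<^bsub>C\<^esub> \<beta> (snd p)) \<in> ring_hom (pre_tensor A B) C"
    and "a \<in> carrier A \<Longrightarrow> b \<in> carrier B \<Longrightarrow>
      frag_lin C (\<lambda>p. \<alpha> (fst p) \<otimes>\<^bsub>C\<^esub> \<beta> (snd p)) (frag_of (a, b)) = \<alpha> a \<otimes>\<^bsub>C\<^esub> \<beta> b"
    and "x \<in> carrier (pre_tensor A B) \<Longrightarrow> y \<in> carrier (pre_tensor A B) \<Longrightarrow>
      frag_lin C (\<lambda>p. \<alpha> (fst p) \<otimes>\<^bsub>C\<^esub> \<beta> (snd p)) (x - y) =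
      frag_lin C (\<lambda>p. \<alpha> (fst p) \<otimes>\<^bsub>C\<^esub> \<beta> (snd p)) x \<ominus>\<^bsub>C\<^esub> frag_lin C (\<lambda>p. \<alpha> (fst p) \<otimes>\<^bsub>C\<^esub> \<beta> (snd p)) y"
proof -
  interpret A: cring A by fact
  interpret B: cring B by fact
  interpret C: cring C by fact
  let ?\<gamma> = "\<lambda>p. \<alpha> (fst p) \<otimes>\<^bsub>C\<^esub> \<beta> (snd p)" and ?m = "monoid.mult (A \<times>\<times> B)"
  let ?T = "frag_lin C ?\<gamma>" and ?AB = "carrier A \<times> carrier B"
  have g: "?\<gamma> p \<in> carrier C" if "p \<in> ?AB" for p
    using that ring_hom_closed[OF \<alpha>] ring_hom_closed[OF \<beta>] by auto
  have im: "?\<gamma> ` Poly_Mapping.keys x \<subseteq> carrier C" if "Poly_Mapping.keys x \<subseteq> ?AB" for x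
    using that g by blast
  have gm: "?\<gamma> (?m p q) = ?\<gamma> p \<otimes>\<^bsub>C\<^esub> ?\<gamma> q" if "p \<in> ?AB" "q \<in> ?AB" for p q
    using that ring_hom_mult[OF \<alpha>] ring_hom_mult[OF \<beta>] ring_hom_closed[OF \<alpha>] ring_hom_closed[OF \<beta>]
    by (auto simp: DirProd_def C.m_ac)
  have mc: "?m p q \<in> ?AB" if "p \<in> ?AB" "q \<in> ?AB" for p q using that by (auto simp: DirProd_def)
  have Tc: "?T x \<in> carrier C" if "Poly_Mapping.keys x \<subseteq> ?AB" for x
    by (rule C.frag_lin_closed[OF im[OF that]])
  have Td: "?T (x - y) = ?T x \<ominus>\<^bsub>C\<^esub> ?T y"
    if "Poly_Mapping.keys x \<subseteq> ?AB" "Poly_Mapping.keys y \<subseteq> ?AB" for x y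
    by (rule C.frag_lin_diff[OF im[OF that(1)] im[OF that(2)]])
  show "x \<in> carrier (pre_tensor A B) \<Longrightarrow> y \<in> carrier (pre_tensor A B) \<Longrightarrow> ?T (x - y) = ?T x \<ominus>\<^bsub>C\<^esub> ?T y"
    using Td by simp
  have mk: "Poly_Mapping.keys (frag_mult ?m x y) \<subseteq> ?AB"
    if "Poly_Mapping.keys x \<subseteq> ?AB" "Poly_Mapping.keys y \<subseteq> ?AB" for x y
    using frag_mult_keys[OF mc that] .
  show "a \<in> carrier A \<Longrightarrow> b \<in> carrier B \<Longrightarrow> ?T (frag_of (a, b)) = \<alpha> a \<otimes>\<^bsub>C\<^esub> \<beta> b"
    using C.frag_lin_of[of ?\<gamma> "(a, b)"] g[of "(a, b)"] by simp
  have dist: "(u \<ominus>\<^bsub>C\<^esub> v) \<otimes>\<^bsub>C\<^esub> w = u \<otimes>\<^bsub>C\<^esub> w \<ominus>\<^bsub>C\<^esub> v \<otimes>\<^bsub>C\<^esub> w" "w \<otimes>\<^bsub>C\<^esub> (u \<ominus>\<^bsub>C\<^esub> v) = w \<otimes>\<^bsub>C\<^esub> u \<ominus>\<^bsub>C\<^esub> w \<otimes>\<^bsub>C\<^esub> v"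
    if "u \<in> carrier C" "v \<in> carrier C" "w \<in> carrier C" for u v w
    using that by (simp_all add: a_minus_def C.l_distr C.r_distr C.l_minus C.r_minus)
  \<comment> \<open>The conditions on the keys are carried through the induction because the
    difference step needs both elements in the carrier.\<close>
  have onem: "Poly_Mapping.keys (frag_mult ?m (frag_of p) y) \<subseteq> ?AB \<and> Poly_Mapping.keys y \<subseteq> ?AB \<and>
      ?T (frag_mult ?m (frag_of p) y) = ?\<gamma> p \<otimes>\<^bsub>C\<^esub> ?T y"
    if p: "p \<in> ?AB" and y: "Poly_Mapping.keys y \<subseteq> ?AB" for p y
    using y
  proof (induction y rule: frag_induction)
    case zero
    then show ?case using g[OF p] by (simp add: C.frag_lin_zero)
  next
    case (one q)
    then show ?case using C.frag_lin_of[of ?\<gamma>] g gm[OF p one] mc[OF p one] p by simp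
  next
    case (diff a b)
    have "Poly_Mapping.keys (a - b) \<subseteq> ?AB" using diff keys_diff[of a b] by blast
    moreover have "Poly_Mapping.keys (frag_mult ?m (frag_of p) a - frag_mult ?m (frag_of p) b) \<subseteq> ?AB"
      using diff keys_diff[of "frag_mult ?m (frag_of p) a" "frag_mult ?m (frag_of p) b"] by blast
    ultimately show ?case using diff Td g[OF p] Tc dist by simp
  qed
  have mult: "Poly_Mapping.keys x \<subseteq> ?AB \<and> ?T (frag_mult ?m x y) = ?T x \<otimes>\<^bsub>C\<^esub> ?T y"
    if x: "Poly_Mapping.keys x \<subseteq> ?AB" and y: "Poly_Mapping.keys y \<subseteq> ?AB" for x y
    using x
  proof (induction x rule: frag_induction)
    case zero
    then show ?case using Tc[OF y] by (simp add: C.frag_lin_zero)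
  next
    case (one p)
    then show ?case using onem[OF one y] C.frag_lin_of[of ?\<gamma> p] g[of p] by simp
  next
    case (diff a b)
    have "Poly_Mapping.keys (a - b) \<subseteq> ?AB" using diff keys_diff[of a b] by blast
    then show ?case using diff Td mk y Tc dist by simp
  qed
  show "?T \<in> ring_hom (pre_tensor A B) C"
  proof (rule ring_hom_memI)
    show "?T \<one>\<^bsub>pre_tensor A B\<^esub> = \<one>\<^bsub>C\<^esub>"
      using C.frag_lin_of[of ?\<gamma> "(\<one>\<^bsub>A\<^esub>, \<one>\<^bsub>B\<^esub>)"] ring_hom_one[OF \<alpha>] ring_hom_one[OF \<beta>] by simp
    show "?T (x \<oplus>\<^bsub>pre_tensor A B\<^esub> y) = ?T x \<oplus>\<^bsub>C\<^esub> ?T y"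
      if "x \<in> carrier (pre_tensor A B)" "y \<in> carrier (pre_tensor A B)" for x y
      using C.frag_lin_add[OF im im] that by simp
  qed (use Tc mult in auto)
qed

section \<open>The tensor product of two algebras and its universal property\<close>

context
  fixes K :: "('k, 'z) ring_scheme" and A :: "('k, 'a, 'x) module_scheme" and B :: "('k, 'b, 'y) module_scheme"
  assumes A: "algebra K A" and B: "algebra K B"
begin

interpretation A: cring A by (rule algebra.M_cring[OF A])
interpretation B: cring B by (rule algebra.M_cring[OF B])
interpretation MA: module K A by (rule algebra.module[OF A])
interpretation MB: module K B by (rule algebra.module[OF B])
interpretation PT: cring "pre_tensor A B" by (rule pre_tensor_cring[OF A.cring_axioms B.cring_axioms])

abbreviation "TI \<equiv> Idl\<^bsub>pre_tensor A B\<^esub> (tensor_rels K A B)"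

lemma tensor_rels_closed: "tensor_rels K A B \<subseteq> carrier (pre_tensor A B)"
proof -
  have d2: "Poly_Mapping.keys (x - y) \<subseteq> S" if "Poly_Mapping.keys x \<subseteq> S" "Poly_Mapping.keys y \<subseteq> S"
    for x y :: "_ \<Rightarrow>\<^sub>0 int" and S
    using that keys_diff[of x y] by blast
  show ?thesis
  proof
    fix r assume "r \<in> tensor_rels K A B"
    then show "r \<in> carrier (pre_tensor A B)"
      unfolding tensor_rels_def pre_tensor_sel mem_Collect_eq
      by (elim UnE CollectE exE conjE; hypsubst; intro d2; simp)
  qed
qed

lemma tensor_ideal: "ideal TI (pre_tensor A B)"
  by (rule PT.genideal_ideal[OF tensor_rels_closed])

lemma tensor_cring: "cring (tensor K A B)"
  unfolding tensor_def by (rule lin_quot_cring[OF PT.cring_axioms tensor_ideal])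

definition tensor_class where
  "tensor_class x = TI +>\<^bsub>pre_tensor A B\<^esub> x"

lemma tensor_class_hom: "tensor_class \<in> ring_hom (pre_tensor A B) (tensor K A B)"
  using lin_quot_proj[OF PT.cring_axioms tensor_ideal] unfolding tensor_def tensor_class_def[abs_def] .

lemma tensor_class_rel:
  assumes "r \<in> tensor_rels K A B"
  shows "tensor_class r = \<zero>\<^bsub>tensor K A B\<^esub>"
proof -
  interpret L: lin_subgroup TI "pre_tensor A B" by (rule ideal_lin_subgroup[OF tensor_ideal])
  have "r \<in> TI" "r \<in> carrier (pre_tensor A B)"
    using PT.genideal_self[OF tensor_rels_closed] tensor_rels_closed assms by auto
  then show ?thesis using L.lin_quot_eq_zero_iff by (simp add: tensor_def tensor_class_def)
qed

definition inl where "inl a = tensor_class (frag_of (a, \<one>\<^bsub>B\<^esub>))"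
definition inr where "inr b = tensor_class (frag_of (\<one>\<^bsub>A\<^esub>, b))"

interpretation T: cring "tensor K A B" by (rule tensor_cring)

lemma tensor_class_diff:
  assumes "x \<in> carrier (pre_tensor A B)" "y \<in> carrier (pre_tensor A B)"
  shows "tensor_class (x - y) = tensor_class x \<ominus>\<^bsub>tensor K A B\<^esub> tensor_class y"
proof -
  have xy: "x - y \<in> carrier (pre_tensor A B)" using assms keys_diff[of x y] by auto
  have "tensor_class ((x - y) \<oplus>\<^bsub>pre_tensor A B\<^esub> y) = tensor_class (x - y) \<oplus>\<^bsub>tensor K A B\<^esub> tensor_class y"
    by (rule ring_hom_add[OF tensor_class_hom xy assms(2)])
  then have "tensor_class x = tensor_class y \<oplus>\<^bsub>tensor K A B\<^esub> tensor_class (x - y)"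
    using ring_hom_closed[OF tensor_class_hom xy] ring_hom_closed[OF tensor_class_hom assms(2)]
    by (simp add: T.a_comm)
  then show ?thesis
    using T.minus_eq_iff ring_hom_closed[OF tensor_class_hom xy] ring_hom_closed[OF tensor_class_hom assms(1)]
      ring_hom_closed[OF tensor_class_hom assms(2)] by metis
qed

lemma tensor_class_of:
  assumes "a \<in> carrier A" "b \<in> carrier B"
  shows "tensor_class (frag_of (a, b)) = inl a \<otimes>\<^bsub>tensor K A B\<^esub> inr b"
  unfolding inl_def inr_def
  using ring_hom_mult[OF tensor_class_hom, of "frag_of (a, \<one>\<^bsub>B\<^esub>)" "frag_of (\<one>\<^bsub>A\<^esub>, b)"] assms
  by (simp add: DirProd_def)

lemma tensor_rel_add:
  assumes "u \<in> carrier (pre_tensor A B)" "v \<in> carrier (pre_tensor A B)" "w \<in> carrier (pre_tensor A B)"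
    "u - v - w \<in> tensor_rels K A B"
  shows "tensor_class u = tensor_class v \<oplus>\<^bsub>tensor K A B\<^esub> tensor_class w"
proof -
  note cl = ring_hom_closed[OF tensor_class_hom]
  have uv: "u - v \<in> carrier (pre_tensor A B)" using assms keys_diff[of u v] by auto
  have "\<zero>\<^bsub>tensor K A B\<^esub> = tensor_class u \<ominus>\<^bsub>tensor K A B\<^esub> tensor_class v \<ominus>\<^bsub>tensor K A B\<^esub> tensor_class w"
    using tensor_class_rel[OF assms(4)] tensor_class_diff[OF uv assms(3)] tensor_class_diff[OF assms(1,2)] by simp
  then show ?thesis
    using cl[OF assms(1)] cl[OF assms(2)] cl[OF assms(3)]
    by (metis T.minus_eq_zero_iff T.minus_eq_iff T.minus_closed)
qed

lemma inl_hom: "inl \<in> ring_hom A (tensor K A B)"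
proof (rule ring_hom_memI)
  fix a a' assume a: "a \<in> carrier A" "a' \<in> carrier A"
  show "inl a \<in> carrier (tensor K A B)" using ring_hom_closed[OF tensor_class_hom] a by (simp add: inl_def)
  show "inl (a \<otimes>\<^bsub>A\<^esub> a') = inl a \<otimes>\<^bsub>tensor K A B\<^esub> inl a'"
    using ring_hom_mult[OF tensor_class_hom, of "frag_of (a, \<one>\<^bsub>B\<^esub>)" "frag_of (a', \<one>\<^bsub>B\<^esub>)"] a
    by (simp add: DirProd_def inl_def)
  show "inl (a \<oplus>\<^bsub>A\<^esub> a') = inl a \<oplus>\<^bsub>tensor K A B\<^esub> inl a'"
    unfolding inl_def by (rule tensor_rel_add) (use a in \<open>auto simp: tensor_rels_def\<close>)
qed (use ring_hom_one[OF tensor_class_hom] in \<open>simp add: inl_def\<close>)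

lemma inr_hom: "inr \<in> ring_hom B (tensor K A B)"
proof (rule ring_hom_memI)
  fix a a' assume a: "a \<in> carrier B" "a' \<in> carrier B"
  show "inr a \<in> carrier (tensor K A B)" using ring_hom_closed[OF tensor_class_hom] a by (simp add: inr_def)
  show "inr (a \<otimes>\<^bsub>B\<^esub> a') = inr a \<otimes>\<^bsub>tensor K A B\<^esub> inr a'"
    using ring_hom_mult[OF tensor_class_hom, of "frag_of (\<one>\<^bsub>A\<^esub>, a)" "frag_of (\<one>\<^bsub>A\<^esub>, a')"] a
    by (simp add: DirProd_def inr_def)
  show "inr (a \<oplus>\<^bsub>B\<^esub> a') = inr a \<oplus>\<^bsub>tensor K A B\<^esub> inr a'"
    unfolding inr_def by (rule tensor_rel_add) (use a in \<open>auto simp: tensor_rels_def\<close>)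
qed (use ring_hom_one[OF tensor_class_hom] in \<open>simp add: inr_def\<close>)

lemma inl_inr_scalar:
  assumes "c \<in> carrier K"
  shows "inl (c \<odot>\<^bsub>A\<^esub> \<one>\<^bsub>A\<^esub>) = inr (c \<odot>\<^bsub>B\<^esub> \<one>\<^bsub>B\<^esub>)"
proof -
  let ?u = "frag_of (c \<odot>\<^bsub>A\<^esub> \<one>\<^bsub>A\<^esub>, \<one>\<^bsub>B\<^esub>)" and ?v = "frag_of (\<one>\<^bsub>A\<^esub>, c \<odot>\<^bsub>B\<^esub> \<one>\<^bsub>B\<^esub>)"
  have cl: "?u \<in> carrier (pre_tensor A B)" "?v \<in> carrier (pre_tensor A B)" using assms by auto
  have "?u - ?v \<in> tensor_rels K A B" using assms unfolding tensor_rels_def by blast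
  then have "tensor_class ?u \<ominus>\<^bsub>tensor K A B\<^esub> tensor_class ?v = \<zero>\<^bsub>tensor K A B\<^esub>"
    using tensor_class_rel tensor_class_diff[OF cl] by metis
  then show ?thesis
    using T.minus_eq_zero_iff ring_hom_closed[OF tensor_class_hom cl(1)] ring_hom_closed[OF tensor_class_hom cl(2)]
    by (simp add: inl_def inr_def)
qed

text \<open>Expresses the structure map along which the Ext-modules are restricted to
  \<open>K\<close>.\<close>

lemma tensor_unit_map:
  assumes "c \<in> carrier K"
  shows "unit_map (tensor K A B) c = inl (c \<odot>\<^bsub>A\<^esub> \<one>\<^bsub>A\<^esub>)"
proof -
  interpret L: lin_subgroup TI "pre_tensor A B" by (rule ideal_lin_subgroup[OF tensor_ideal])
  let ?u = "frag_of (c \<odot>\<^bsub>A\<^esub> \<one>\<^bsub>A\<^esub>, \<one>\<^bsub>B\<^esub>)" and ?P = "pre_tensor A B"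
  have u: "?u \<in> carrier ?P" using assms by auto
  have "\<one>\<^bsub>tensor K A B\<^esub> = TI +>\<^bsub>?P\<^esub> \<one>\<^bsub>?P\<^esub>" using ring_hom_one[OF tensor_class_hom] by (simp add: tensor_class_def)
  moreover have "(\<Union>x\<in>TI +>\<^bsub>?P\<^esub> \<one>\<^bsub>?P\<^esub>. TI +>\<^bsub>?P\<^esub> (c \<odot>\<^bsub>?P\<^esub> x)) = TI +>\<^bsub>?P\<^esub> (c \<odot>\<^bsub>?P\<^esub> \<one>\<^bsub>?P\<^esub>)"
  proof (rule L.lin_quot_smult)
    have e: "c \<odot>\<^bsub>?P\<^esub> x = ?u \<otimes>\<^bsub>?P\<^esub> x" for x by simp
    fix x assume x: "x \<in> carrier ?P"
    show "c \<odot>\<^bsub>?P\<^esub> x \<in> carrier ?P" unfolding e by (rule PT.m_closed[OF u x])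
    fix y assume y: "y \<in> carrier ?P" and xy: "x \<ominus>\<^bsub>?P\<^esub> y \<in> TI"
    have "?u \<otimes>\<^bsub>?P\<^esub> x \<ominus>\<^bsub>?P\<^esub> ?u \<otimes>\<^bsub>?P\<^esub> y = ?u \<otimes>\<^bsub>?P\<^esub> (x \<ominus>\<^bsub>?P\<^esub> y)"
      unfolding PT.minus_eq using u x y
      by (simp only: PT.r_distr[OF x PT.a_inv_closed[OF y] u] PT.r_minus[OF u y])
    then show "c \<odot>\<^bsub>?P\<^esub> x \<ominus>\<^bsub>?P\<^esub> c \<odot>\<^bsub>?P\<^esub> y \<in> TI"
      unfolding e using ideal.I_l_closed[OF tensor_ideal xy u] by metis
  qed (rule PT.one_closed)
  moreover have "c \<odot>\<^bsub>?P\<^esub> \<one>\<^bsub>?P\<^esub> = ?u" using assms by (simp add: DirProd_def)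
  ultimately show ?thesis unfolding unit_map_def inl_def tensor_class_def
    by (simp add: tensor_def lin_quot_def)
qed

text \<open>Follows \<open>frag_induction\<close>, hence the difference step; the class of zero is
  covered by the tensor of two zeros.\<close>

lemma tensor_induct:
  assumes u: "u \<in> carrier (tensor K A B)"
    and base: "\<And>a b. a \<in> carrier A \<Longrightarrow> b \<in> carrier B \<Longrightarrow> Q (inl a \<otimes>\<^bsub>tensor K A B\<^esub> inr b)"
    and diff: "\<And>v w. v \<in> carrier (tensor K A B) \<Longrightarrow> w \<in> carrier (tensor K A B) \<Longrightarrow> Q v \<Longrightarrow> Q w \<Longrightarrow>
      Q (v \<ominus>\<^bsub>tensor K A B\<^esub> w)"
  shows "Q u"
proof -
  obtain x where x: "x \<in> carrier (pre_tensor A B)" "u = tensor_class x"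
    using u by (auto simp: tensor_def lin_quot_carrier tensor_class_def)
  have z: "Q \<zero>\<^bsub>tensor K A B\<^esub>"
    using base[OF A.zero_closed B.zero_closed] ring_hom_closed[OF inr_hom B.zero_closed]
      ring_hom_zero[OF inl_hom A.ring_axioms T.ring_axioms] by simp
  have "Poly_Mapping.keys x \<subseteq> carrier A \<times> carrier B" using x by simp
  then have "Poly_Mapping.keys x \<subseteq> carrier A \<times> carrier B \<and> Q (tensor_class x)"
  proof (induction x rule: frag_induction)
    case zero
    then show ?case using z ring_hom_zero[OF tensor_class_hom PT.ring_axioms T.ring_axioms] by simp
  next
    case (one p)
    then show ?case using base tensor_class_of by auto
  next
    case (diff a b)
    then have "Poly_Mapping.keys (a - b) \<subseteq> carrier A \<times> carrier B" using keys_diff[of a b] by blast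
    then show ?case using diff assms(3) tensor_class_diff ring_hom_closed[OF tensor_class_hom] by simp
  qed
  then show ?thesis using x by simp
qed

text \<open>The source of homomorphisms out of the enveloping algebra, both the multiplication map
  and the map back to \<open>A[Y]/(f(Y))\<close>. The additive extension kills the generators of the
  ideal, and its kernel is an ideal.\<close>

lemma tensor_universal:
  assumes C: "cring C" and \<alpha>: "\<alpha> \<in> ring_hom A C" and \<beta>: "\<beta> \<in> ring_hom B C"
    and \<alpha>\<beta>: "\<And>c. c \<in> carrier K \<Longrightarrow> \<alpha> (c \<odot>\<^bsub>A\<^esub> \<one>\<^bsub>A\<^esub>) = \<beta> (c \<odot>\<^bsub>B\<^esub> \<one>\<^bsub>B\<^esub>)"
  defines "T \<equiv> quot_map (frag_lin C (\<lambda>p. \<alpha> (fst p) \<otimes>\<^bsub>C\<^esub> \<beta> (snd p)))"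
  shows "T \<in> ring_hom (tensor K A B) C"
    and "a \<in> carrier A \<Longrightarrow> T (inl a) = \<alpha> a" and "b \<in> carrier B \<Longrightarrow> T (inr b) = \<beta> b"
proof -
  interpret C: cring C by fact
  let ?T = "frag_lin C (\<lambda>p. \<alpha> (fst p) \<otimes>\<^bsub>C\<^esub> \<beta> (snd p))" and ?P = "pre_tensor A B"
  note T = frag_lin_ring_hom[OF A.cring_axioms B.cring_axioms C \<alpha> \<beta>]
  note ac = ring_hom_closed[OF \<alpha>] and bc = ring_hom_closed[OF \<beta>]
  interpret h: ring_hom_ring ?P C ?T by (intro ring_hom_ringI2 PT.ring_axioms C.ring_axioms T(1))
  have smA: "c \<odot>\<^bsub>A\<^esub> a = (c \<odot>\<^bsub>A\<^esub> \<one>\<^bsub>A\<^esub>) \<otimes>\<^bsub>A\<^esub> a" if "c \<in> carrier K" "a \<in> carrier A" for c a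
    using algebra.smult_assoc2[OF A that(1) A.one_closed that(2)] that by simp
  have smB: "c \<odot>\<^bsub>B\<^esub> b = (c \<odot>\<^bsub>B\<^esub> \<one>\<^bsub>B\<^esub>) \<otimes>\<^bsub>B\<^esub> b" if "c \<in> carrier K" "b \<in> carrier B" for c b
    using algebra.smult_assoc2[OF B that(1) B.one_closed that(2)] that by simp
  have rel: "?T r = \<zero>\<^bsub>C\<^esub>" if "r \<in> tensor_rels K A B" for r
    using that unfolding tensor_rels_def
  proof (elim UnE CollectE exE conjE)
    fix a a' b assume "r = frag_of (a \<oplus>\<^bsub>A\<^esub> a', b) - frag_of (a, b) - frag_of (a', b)"
      and m: "a \<in> carrier A" "a' \<in> carrier A" "b \<in> carrier B"
    moreover have "frag_of (a \<oplus>\<^bsub>A\<^esub> a', b) - frag_of (a, b) \<in> carrier ?P"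
      using m keys_diff[of "frag_of (a \<oplus>\<^bsub>A\<^esub> a', b)" "frag_of (a, b)"] by auto
    ultimately show ?thesis using ac bc
      by (simp add: T(2,3) ring_hom_add[OF \<alpha>] C.l_distr a_minus_def C.a_ac C.r_neg C.r_neg1 C.r_neg2 del: pre_tensor_sel(2-))
  next
    fix a b b' assume "r = frag_of (a, b \<oplus>\<^bsub>B\<^esub> b') - frag_of (a, b) - frag_of (a, b')"
      and m: "a \<in> carrier A" "b \<in> carrier B" "b' \<in> carrier B"
    moreover have "frag_of (a, b \<oplus>\<^bsub>B\<^esub> b') - frag_of (a, b) \<in> carrier ?P"
      using m keys_diff[of "frag_of (a, b \<oplus>\<^bsub>B\<^esub> b')" "frag_of (a, b)"] by auto
    ultimately show ?thesis using ac bc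
      by (simp add: T(2,3) ring_hom_add[OF \<beta>] C.r_distr a_minus_def C.a_ac C.r_neg C.r_neg1 C.r_neg2 del: pre_tensor_sel(2-))
  next
    fix c a b assume r: "r = frag_of (c \<odot>\<^bsub>A\<^esub> a, b) - frag_of (a, c \<odot>\<^bsub>B\<^esub> b)"
      and m: "c \<in> carrier K" "a \<in> carrier A" "b \<in> carrier B"
    have "\<alpha> (c \<odot>\<^bsub>A\<^esub> a) = \<alpha> (c \<odot>\<^bsub>A\<^esub> \<one>\<^bsub>A\<^esub>) \<otimes>\<^bsub>C\<^esub> \<alpha> a"
      using smA[OF m(1,2)] m ring_hom_mult[OF \<alpha>, of "c \<odot>\<^bsub>A\<^esub> \<one>\<^bsub>A\<^esub>" a] by simp
    moreover have "\<beta> (c \<odot>\<^bsub>B\<^esub> b) = \<alpha> (c \<odot>\<^bsub>A\<^esub> \<one>\<^bsub>A\<^esub>) \<otimes>\<^bsub>C\<^esub> \<beta> b"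
      using smB[OF m(1,3)] m ring_hom_mult[OF \<beta>, of "c \<odot>\<^bsub>B\<^esub> \<one>\<^bsub>B\<^esub>" b] \<alpha>\<beta> by simp
    ultimately show ?thesis using m ac bc unfolding r
      by (simp add: T(2,3) C.m_ac C.minus_eq_zero_iff del: pre_tensor_sel(2-))
  qed
  have "TI \<subseteq> a_kernel ?P C ?T"
  proof (rule PT.genideal_minimal[OF h.kernel_is_ideal] , rule subsetI)
    fix r assume r: "r \<in> tensor_rels K A B"
    then have "r \<in> carrier ?P" using tensor_rels_closed by blast
    then show "r \<in> a_kernel ?P C ?T" using rel[OF r] unfolding a_kernel_def' by blast
  qed
  then have z: "?T x = \<zero>\<^bsub>C\<^esub>" if "x \<in> TI" for x using that unfolding a_kernel_def' by blast
  show "T \<in> ring_hom (tensor K A B) C"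
    unfolding T_def tensor_def by (rule quot_map_hom[OF PT.cring_axioms tensor_ideal C.ring_axioms T(1) z])
  have q: "T (tensor_class x) = ?T x" if "x \<in> carrier ?P" for x
    unfolding T_def tensor_class_def
    by (rule quot_map_coset[OF PT.cring_axioms tensor_ideal C.ring_axioms T(1) z that])
  show "T (inl a) = \<alpha> a" if "a \<in> carrier A"
    using q[of "frag_of (a, \<one>\<^bsub>B\<^esub>)"] T(2)[OF that B.one_closed] that ring_hom_one[OF \<beta>] ac by (simp add: inl_def)
  show "T (inr b) = \<beta> b" if "b \<in> carrier B"
    using q[of "frag_of (\<one>\<^bsub>A\<^esub>, b)"] T(2)[OF A.one_closed that] that ring_hom_one[OF \<alpha>] bc by (simp add: inr_def)
qed

end

text \<open>Keeps the index 1 in monomials and divided derivatives from being rewritten to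
  \<open>Suc 0\<close>.\<close>

declare One_nat_def [simp del]

section \<open>The algebras attached to a polynomial\<close>

lemma ideal_submodule:
  assumes P: "algebra K P" and I: "ideal I P"
  shows "submodule I K P"
proof -
  interpret PC: cring P by (rule algebra.M_cring[OF P])
  interpret PM: module K P by (rule algebra.module[OF P])
  have one: "\<one>\<^bsub>P\<^esub> \<in> carrier P" by (rule PC.one_closed)
  show ?thesis
  proof (rule PM.submoduleI)
    show "a \<odot>\<^bsub>P\<^esub> x \<in> I" if "a \<in> carrier K" "x \<in> I" for a x
    proof -
      have x: "x \<in> carrier P" using ideal.Icarr[OF I that(2)] .
      have "a \<odot>\<^bsub>P\<^esub> x = (a \<odot>\<^bsub>P\<^esub> \<one>\<^bsub>P\<^esub>) \<otimes>\<^bsub>P\<^esub> x"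
        using algebra.smult_assoc2[OF P that(1) one x] PC.l_one[OF x] by simp
      then show ?thesis
        using ideal.I_l_closed[OF I that(2), of "a \<odot>\<^bsub>P\<^esub> \<one>\<^bsub>P\<^esub>"] PM.smult_closed[OF that(1) one] by simp
    qed
  qed (use ideal.Icarr[OF I] additive_subgroup.zero_closed[OF ideal.axioms(1)[OF I]]
      additive_subgroup.a_inv_closed[OF ideal.axioms(1)[OF I]]
      additive_subgroup.a_closed[OF ideal.axioms(1)[OF I]] PC.abelian_group_axioms in auto)
qed

lemma lin_quot_algebra:
  assumes P: "algebra K P" and I: "ideal I P"
  shows "algebra K (lin_quot P I)"
proof -
  interpret PC: cring P by (rule algebra.M_cring[OF P])
  interpret PM: module K P by (rule algebra.module[OF P])
  interpret L: module K "lin_quot P I" by (rule lin_quot_module[OF PM.module_axioms ideal_submodule[OF assms]])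
  note s = lin_quot_module_smult[OF PM.module_axioms ideal_submodule[OF assms]]
  note q = ring_hom_mult[OF lin_quot_proj[OF PC.cring_axioms I]]
  show ?thesis
  proof (rule algebra.intro[OF L.module_axioms lin_quot_cring[OF PC.cring_axioms I]], rule algebra_axioms.intro)
    fix a x y assume a: "a \<in> carrier K" and "x \<in> carrier (lin_quot P I)" "y \<in> carrier (lin_quot P I)"
    then obtain u v where uv: "u \<in> carrier P" "v \<in> carrier P" "x = I +>\<^bsub>P\<^esub> u" "y = I +>\<^bsub>P\<^esub> v"
      by (auto simp: lin_quot_carrier)
    show "(a \<odot>\<^bsub>lin_quot P I\<^esub> x) \<otimes>\<^bsub>lin_quot P I\<^esub> y = a \<odot>\<^bsub>lin_quot P I\<^esub> (x \<otimes>\<^bsub>lin_quot P I\<^esub> y)"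
      unfolding uv(3,4) s[OF a uv(1)] q[OF PM.smult_closed[OF a uv(1)] uv(2), symmetric]
        q[OF uv(1,2), symmetric] s[OF a PC.m_closed[OF uv(1,2)]]
      using algebra.smult_assoc2[OF P a uv(1,2)] by simp
  qed
qed

locale polynomial_quotient =
  fixes K :: "('k, 'z) ring_scheme" and f :: "nat \<Rightarrow> 'k"
  assumes K_cring: "cring K" and f_closed: "f \<in> carrier (UP K)"
begin

abbreviation "P \<equiv> UP K"
abbreviation "I \<equiv> ideal_A K f"
abbreviation "I' \<equiv> ideal_A' K f"
abbreviation "A \<equiv> alg_A K f"
abbreviation "A' \<equiv> alg_A' K f"
abbreviation "f' \<equiv> poly_deriv K f"
abbreviation "g2 \<equiv> second_divided_deriv K f"
definition q where "q p = I +>\<^bsub>P\<^esub> p"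
definition q' where "q' p = I' +>\<^bsub>P\<^esub> p"
abbreviation "px \<equiv> monom P \<one>\<^bsub>K\<^esub> 1"
definition qx where "qx = q px"

sublocale U: UP_cring K P by (rule UP_cringI[OF K_cring])

lemma P_algebra: "algebra K P" by (rule U.UP_algebra)

lemma deriv_closed [simp]: "f' \<in> carrier P"
proof -
  have "bound \<zero>\<^bsub>K\<^esub> (deg K f) f'"
    using U.deg_aboveD[OF _ f_closed] by (intro bound.intro) (simp add: poly_deriv_def)
  moreover have "f' n \<in> carrier K" for n
    using U.coeff_closed[OF f_closed] by (simp add: poly_deriv_def U.R.add.nat_pow_closed)
  ultimately show ?thesis unfolding UP_carrier by (intro mem_upI) blast+
qed

lemma f_in_P [simp]: "f \<in> carrier P" by (rule f_closed)

lemma I_ideal: "ideal I P" by (rule U.P.genideal_ideal) simp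
lemma I'_ideal: "ideal I' P" by (rule U.P.genideal_ideal) simp

lemma I_iff: "p \<in> I \<longleftrightarrow> (\<exists>u\<in>carrier P. p = u \<otimes>\<^bsub>P\<^esub> f)"
  by (rule U.P.mem_genideal_single) simp

lemma I_sub: "I \<subseteq> I'"
  by (rule U.P.genideal_minimal[OF I'_ideal]) (use U.P.genideal_self[of "{f, f'}"] in auto)

lemma A_cring: "cring A" unfolding alg_A_def by (rule lin_quot_cring[OF U.UP_cring I_ideal])
lemma A'_cring: "cring A'" unfolding alg_A'_def by (rule lin_quot_cring[OF U.UP_cring I'_ideal])

sublocale A: cring A by (rule A_cring)
sublocale A': cring A' by (rule A'_cring)

lemma A_algebra: "algebra K A" unfolding alg_A_def by (rule lin_quot_algebra[OF P_algebra I_ideal])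
lemma A'_algebra: "algebra K A'" unfolding alg_A'_def by (rule lin_quot_algebra[OF P_algebra I'_ideal])

lemma q_hom: "q \<in> ring_hom P A"
  using lin_quot_proj[OF U.UP_cring I_ideal] unfolding alg_A_def q_def[abs_def] .
lemma q'_hom: "q' \<in> ring_hom P A'"
  using lin_quot_proj[OF U.UP_cring I'_ideal] unfolding alg_A'_def q'_def[abs_def] .

sublocale q: ring_hom_ring P A q
  by (intro ring_hom_ringI2 U.P.ring_axioms A.ring_axioms q_hom)
sublocale q': ring_hom_ring P A' q'
  by (intro ring_hom_ringI2 U.P.ring_axioms A'.ring_axioms q'_hom)

interpretation LI: lin_subgroup I P by (rule ideal_lin_subgroup[OF I_ideal])
interpretation LI': lin_subgroup I' P by (rule ideal_lin_subgroup[OF I'_ideal])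

lemma A_cases: assumes "a \<in> carrier A" obtains p where "p \<in> carrier P" "a = q p"
  using assms by (auto simp: alg_A_def lin_quot_carrier q_def)
lemma A'_cases: assumes "a \<in> carrier A'" obtains p where "p \<in> carrier P" "a = q' p"
  using assms by (auto simp: alg_A'_def lin_quot_carrier q'_def)

lemma q_zero_iff: "p \<in> carrier P \<Longrightarrow> q p = \<zero>\<^bsub>A\<^esub> \<longleftrightarrow> p \<in> I"
  using LI.lin_quot_eq_zero_iff by (simp add: alg_A_def q_def)
lemma q'_zero_iff: "p \<in> carrier P \<Longrightarrow> q' p = \<zero>\<^bsub>A'\<^esub> \<longleftrightarrow> p \<in> I'"
  using LI'.lin_quot_eq_zero_iff by (simp add: alg_A'_def q'_def)

lemma q_f [simp]: "q f = \<zero>\<^bsub>A\<^esub>"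
  using q_zero_iff[of f] U.P.genideal_self[of "{f}"] by simp
lemma q'_f [simp]: "q' f = \<zero>\<^bsub>A'\<^esub>" and q'_f' [simp]: "q' f' = \<zero>\<^bsub>A'\<^esub>"
  using q'_zero_iff[of f] q'_zero_iff[of f'] U.P.genideal_self[of "{f, f'}"] by simp_all

lemma q_smult: "c \<in> carrier K \<Longrightarrow> p \<in> carrier P \<Longrightarrow> c \<odot>\<^bsub>A\<^esub> q p = q (c \<odot>\<^bsub>P\<^esub> p)"
  unfolding alg_A_def q_def by (rule lin_quot_module_smult[OF algebra.module[OF P_algebra] ideal_submodule[OF P_algebra I_ideal]])
lemma q'_smult: "c \<in> carrier K \<Longrightarrow> p \<in> carrier P \<Longrightarrow> c \<odot>\<^bsub>A'\<^esub> q' p = q' (c \<odot>\<^bsub>P\<^esub> p)"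
  unfolding alg_A'_def q'_def by (rule lin_quot_module_smult[OF algebra.module[OF P_algebra] ideal_submodule[OF P_algebra I'_ideal]])

lemma proj_q [simp]:
  assumes "p \<in> carrier P"
  shows "proj_A' K f (q p) = q' p"
proof -
  have "I' +>\<^bsub>P\<^esub> x = I' +>\<^bsub>P\<^esub> p" if x: "x \<in> I +>\<^bsub>P\<^esub> p" for x
  proof -
    have xP: "x \<in> carrier P" by (rule LI.a_elemrcos_carrier[OF assms x])
    have "x \<ominus>\<^bsub>P\<^esub> p \<in> I" using LI.a_rcos_module[OF assms xP] x by (simp add: U.P.minus_eq)
    then show ?thesis using LI'.coset_eq_iff[OF xP assms] I_sub by blast
  qed
  then show ?thesis using LI.a_rcos_self[OF assms] unfolding proj_A'_def q_def q'_def by blast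
qed

lemma proj_hom: "proj_A' K f \<in> ring_hom A A'"
proof (rule ring_hom_memI)
  fix a b assume "a \<in> carrier A" "b \<in> carrier A"
  then obtain u v where uv: "u \<in> carrier P" "v \<in> carrier P" "a = q u" "b = q v" by (metis A_cases)
  show "proj_A' K f a \<in> carrier A'" using uv by simp
  show "proj_A' K f (a \<otimes>\<^bsub>A\<^esub> b) = proj_A' K f a \<otimes>\<^bsub>A'\<^esub> proj_A' K f b"
    using uv by (simp flip: q.hom_mult q'.hom_mult)
  show "proj_A' K f (a \<oplus>\<^bsub>A\<^esub> b) = proj_A' K f a \<oplus>\<^bsub>A'\<^esub> proj_A' K f b"
    using uv by (simp flip: q.hom_add q'.hom_add)
next
  show "proj_A' K f \<one>\<^bsub>A\<^esub> = \<one>\<^bsub>A'\<^esub>" using proj_q[OF U.P.one_closed] by simp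
qed

sublocale pr: ring_hom_ring A A' "proj_A' K f"
  by (intro ring_hom_ringI2 A.ring_axioms A'.ring_axioms proj_hom)

lemma proj_smult: "c \<in> carrier K \<Longrightarrow> a \<in> carrier A \<Longrightarrow> proj_A' K f (c \<odot>\<^bsub>A\<^esub> a) = c \<odot>\<^bsub>A'\<^esub> proj_A' K f a"
  by (elim A_cases) (simp add: q_smult q'_smult)

lemma proj_surj: "b \<in> carrier A' \<Longrightarrow> \<exists>a\<in>carrier A. proj_A' K f a = b"
  by (elim A'_cases) (metis proj_q q.hom_closed)

text \<open>Modulo \<open>f\<close>, the ideal generated by \<open>f\<close> and its derivative is
  generated by the derivative alone.\<close>

lemma proj_zero_iff:
  assumes "a \<in> carrier A"
  shows "proj_A' K f a = \<zero>\<^bsub>A'\<^esub> \<longleftrightarrow> (\<exists>v\<in>carrier A. a = q f' \<otimes>\<^bsub>A\<^esub> v)"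
proof
  obtain p where p: "p \<in> carrier P" "a = q p" using assms by (rule A_cases)
  assume "proj_A' K f a = \<zero>\<^bsub>A'\<^esub>"
  then have "p \<in> I'" using p q'_zero_iff by simp
  then obtain u v where "u \<in> carrier P" "v \<in> carrier P" "p = u \<otimes>\<^bsub>P\<^esub> f \<oplus>\<^bsub>P\<^esub> v \<otimes>\<^bsub>P\<^esub> f'"
    using U.P.mem_genideal_pair[of f f' p] by auto
  then have "a = q f' \<otimes>\<^bsub>A\<^esub> q v" "q v \<in> carrier A" using p by (simp_all add: A.m_comm)
  then show "\<exists>v\<in>carrier A. a = q f' \<otimes>\<^bsub>A\<^esub> v" by blast
next
  assume "\<exists>v\<in>carrier A. a = q f' \<otimes>\<^bsub>A\<^esub> v"
  then show "proj_A' K f a = \<zero>\<^bsub>A'\<^esub>" by auto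
qed

lemma theta_iff: "a \<in> theta K f \<longleftrightarrow> a \<in> carrier A \<and> a \<otimes>\<^bsub>A\<^esub> q f' = \<zero>\<^bsub>A\<^esub>"
  by (simp add: theta_def q_def)

text \<open>Two representatives differ by a combination of \<open>f\<close> and its derivative, and
  \<open>a\<close> kills the class of the derivative.\<close>

lemma theta_act_q:
  assumes p: "p \<in> carrier P" and a: "a \<in> theta K f"
  shows "theta_act K f (q' p) a = q p \<otimes>\<^bsub>A\<^esub> a"
proof -
  have "q x \<otimes>\<^bsub>A\<^esub> a = q p \<otimes>\<^bsub>A\<^esub> a" if x: "x \<in> q' p" for x
  proof -
    have x': "x \<in> I' +>\<^bsub>P\<^esub> p" using x by (simp add: q'_def)
    have xP: "x \<in> carrier P" by (rule LI'.a_elemrcos_carrier[OF p x'])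
    have "x \<ominus>\<^bsub>P\<^esub> p \<in> I'" using LI'.a_rcos_module[OF p xP] x' by (simp add: U.P.minus_eq)
    then obtain u v where uv: "u \<in> carrier P" "v \<in> carrier P" "x \<ominus>\<^bsub>P\<^esub> p = u \<otimes>\<^bsub>P\<^esub> f \<oplus>\<^bsub>P\<^esub> v \<otimes>\<^bsub>P\<^esub> f'"
      using U.P.mem_genideal_pair[of f f' "x \<ominus>\<^bsub>P\<^esub> p"] by auto
    then have "x = p \<oplus>\<^bsub>P\<^esub> (u \<otimes>\<^bsub>P\<^esub> f \<oplus>\<^bsub>P\<^esub> v \<otimes>\<^bsub>P\<^esub> f')" using U.P.minus_eq_iff[OF xP p] by simp
    then have "q x = q p \<oplus>\<^bsub>A\<^esub> q v \<otimes>\<^bsub>A\<^esub> q f'" using uv p by simp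
    moreover have "q f' \<otimes>\<^bsub>A\<^esub> a = \<zero>\<^bsub>A\<^esub>" using a by (simp add: theta_iff A.m_comm)
    ultimately show ?thesis using uv p a by (simp add: theta_iff A.l_distr A.m_assoc)
  qed
  moreover have "p \<in> q' p" unfolding q'_def by (rule LI'.a_rcos_self[OF p])
  ultimately show ?thesis unfolding theta_act_def q_def[symmetric] by blast
qed

lemma theta_act_proj:
  assumes "a \<in> carrier A" "b \<in> theta K f"
  shows "theta_act K f (proj_A' K f a) b = a \<otimes>\<^bsub>A\<^esub> b"
  using assms by (elim A_cases) (simp add: theta_act_q)

subsection \<open>Taylor expansion\<close>

abbreviation "PP \<equiv> UP P"
abbreviation "dx \<equiv> monom PP \<one>\<^bsub>P\<^esub> 1"

sublocale W: UP_cring P PP by (rule UP_cringI[OF U.UP_cring])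

definition const2 where "const2 c = monom PP (monom P c 0) 0"

lemma const2_hom: "const2 \<in> ring_hom K PP"
  using ring_hom_trans[OF U.const_ring_hom W.const_ring_hom] by (simp add: comp_def const2_def[abs_def])

abbreviation "x_dx \<equiv> monom PP px 0 \<oplus>\<^bsub>PP\<^esub> dx"

lemma taylor_eval: "taylor K p = eval K PP const2 x_dx p"
  by (simp add: taylor_def const2_def[abs_def])

lemma taylor_hom: "taylor K \<in> ring_hom P PP"
  and taylor_const: "c \<in> carrier K \<Longrightarrow> taylor K (monom P c 0) = const2 c"
  and taylor_x: "taylor K px = x_dx"
  unfolding taylor_eval[abs_def]
  using UP_eval_hom[OF K_cring W.UP_cring const2_hom, of x_dx] by simp_all

sublocale ty: ring_hom_ring P PP "taylor K"
  by (intro ring_hom_ringI2 U.P.ring_axioms W.P.ring_axioms taylor_hom)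

text \<open>The divided derivative of order \<open>n\<close>, obtained from the Taylor
  expansion.\<close>

definition dd where "dd n p = coeff PP (taylor K p) n"

lemma dd_closed [simp]: "p \<in> carrier P \<Longrightarrow> dd n p \<in> carrier P"
  by (simp add: dd_def)

lemma dd_add: "p \<in> carrier P \<Longrightarrow> r \<in> carrier P \<Longrightarrow> dd n (p \<oplus>\<^bsub>P\<^esub> r) = dd n p \<oplus>\<^bsub>P\<^esub> dd n r"
  by (simp add: dd_def)

text \<open>The Leibniz rules: Taylor expansion is a ring homomorphism, and these are the first
  coefficients of a Cauchy product.\<close>

lemma dd_mult:
  assumes "p \<in> carrier P" "r \<in> carrier P"
  shows "dd 0 (p \<otimes>\<^bsub>P\<^esub> r) = dd 0 p \<otimes>\<^bsub>P\<^esub> dd 0 r"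
    and "dd 1 (p \<otimes>\<^bsub>P\<^esub> r) = dd 0 p \<otimes>\<^bsub>P\<^esub> dd 1 r \<oplus>\<^bsub>P\<^esub> dd 1 p \<otimes>\<^bsub>P\<^esub> dd 0 r"
    and "dd 2 (p \<otimes>\<^bsub>P\<^esub> r) = dd 0 p \<otimes>\<^bsub>P\<^esub> dd 2 r \<oplus>\<^bsub>P\<^esub> dd 1 p \<otimes>\<^bsub>P\<^esub> dd 1 r \<oplus>\<^bsub>P\<^esub> dd 2 p \<otimes>\<^bsub>P\<^esub> dd 0 r"
  using assms by (simp_all add: dd_def numeral_2_eq_2 One_nat_def Pi_def U.P.a_ac)

lemma dd_const:
  assumes "c \<in> carrier K"
  shows "dd n (monom P c 0) = (if n = 0 then monom P c 0 else \<zero>\<^bsub>P\<^esub>)"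
  using assms by (simp add: dd_def taylor_const const2_def)

lemma dd_x: "dd n px = (if n = 0 then px else if n = 1 then \<one>\<^bsub>P\<^esub> else \<zero>\<^bsub>P\<^esub>)"
  by (simp add: dd_def taylor_x)

text \<open>Setting \<open>dx\<close> to zero is a ring endomorphism of \<open>K[x]\<close> fixing
  the constants and \<open>x\<close>.\<close>

lemma dd_zero: assumes "p \<in> carrier P" shows "dd 0 p = p"
proof (rule UP_hom_eqI[OF K_cring U.UP_cring _ _ _ _ assms, of _ "\<lambda>p. p"])
  show "dd 0 \<in> ring_hom P P"
    by (rule ring_hom_memI) (use dd_const[of "\<one>\<^bsub>K\<^esub>" 0] in \<open>simp_all add: dd_mult dd_add\<close>)
  show "(\<lambda>p. p) \<in> ring_hom P P" by (rule ring_hom_memI) simp_all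
qed (simp_all add: dd_x dd_const)

lemma dd_one: assumes "p \<in> carrier P" shows "dd 1 p = poly_deriv K p"
proof -
  \<comment> \<open>The Leibniz rule for \<open>x\<close> times a power of \<open>x\<close> gives
    the recursion of the ordinary derivative.\<close>
  have mon: "coeff P (dd 1 (monom P a n)) i = (if n = Suc i then add_pow K n a else \<zero>\<^bsub>K\<^esub>)"
    if a: "a \<in> carrier K" for a n i
  proof (induction n arbitrary: i)
    case 0
    then show ?case using dd_const[OF a, of 1] by simp
  next
    case (Suc n)
    have m: "monom P a (Suc n) = px \<otimes>\<^bsub>P\<^esub> monom P a n"
      using U.monom_mult[of "\<one>\<^bsub>K\<^esub>" a 1 n] a by (simp add: One_nat_def)
    have e: "dd 1 (monom P a (Suc n)) = px \<otimes>\<^bsub>P\<^esub> dd 1 (monom P a n) \<oplus>\<^bsub>P\<^esub> monom P a n"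
      unfolding m using a by (simp add: dd_mult(2) dd_x dd_zero)
    show ?case
      unfolding e using a Suc U.coeff_X_mult[of "dd 1 (monom P a n)" i]
      by (cases i) (auto simp: U.R.add.nat_pow_closed simp del: U.coeff_mult)
  qed
  have "(\<forall>i. coeff P (dd 1 p) i = add_pow K (Suc i) (coeff P p (Suc i))) \<and> p \<in> carrier P"
  proof (rule U.UP_induct[OF assms])
    fix p r assume "p \<in> carrier P" "r \<in> carrier P"
      "(\<forall>i. coeff P (dd 1 p) i = add_pow K (Suc i) (coeff P p (Suc i))) \<and> p \<in> carrier P"
      "(\<forall>i. coeff P (dd 1 r) i = add_pow K (Suc i) (coeff P r (Suc i))) \<and> r \<in> carrier P"
    then show "(\<forall>i. coeff P (dd 1 (p \<oplus>\<^bsub>P\<^esub> r)) i = add_pow K (Suc i) (coeff P (p \<oplus>\<^bsub>P\<^esub> r) (Suc i))) \<and> p \<oplus>\<^bsub>P\<^esub> r \<in> carrier P"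
      by (simp add: dd_add U.R.add.nat_pow_distrib del: U.R.add.nat_pow_Suc)
  next
    fix a n assume a: "a \<in> carrier K"
    then show "(\<forall>i. coeff P (dd 1 (monom P a n)) i = add_pow K (Suc i) (coeff P (monom P a n) (Suc i))) \<and> monom P a n \<in> carrier P"
      using mon[OF a, of n] by auto
  qed
  then have c: "coeff P (dd 1 p) i = poly_deriv K p i" for i by (simp add: poly_deriv_def)
  have "dd 1 p \<in> up K" using dd_closed[OF assms, of 1] by (simp only: UP_carrier)
  then show ?thesis using c by (simp add: UP_coeff fun_eq_iff)
qed

lemma dd_two: "dd 2 p = second_divided_deriv K p"
  by (simp add: dd_def second_divided_deriv_def)

lemma g2_closed [simp]: "g2 \<in> carrier P"
  using dd_closed[OF f_closed, of 2] by (simp add: dd_two)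

text \<open>On monomials both sides obey the same recursion: multiplication by \<open>x\<close> and
  addition of twice the first derivative.\<close>

lemma dd_dd:
  assumes "p \<in> carrier P"
  shows "dd 1 (dd 1 p) = dd 2 p \<oplus>\<^bsub>P\<^esub> dd 2 p"
proof -
  have "dd 1 (dd 1 p) = dd 2 p \<oplus>\<^bsub>P\<^esub> dd 2 p \<and> p \<in> carrier P"
  proof (rule U.UP_induct[OF assms])
    fix p r assume "p \<in> carrier P" "r \<in> carrier P"
      "dd 1 (dd 1 p) = dd 2 p \<oplus>\<^bsub>P\<^esub> dd 2 p \<and> p \<in> carrier P" "dd 1 (dd 1 r) = dd 2 r \<oplus>\<^bsub>P\<^esub> dd 2 r \<and> r \<in> carrier P"
    then show "dd 1 (dd 1 (p \<oplus>\<^bsub>P\<^esub> r)) = dd 2 (p \<oplus>\<^bsub>P\<^esub> r) \<oplus>\<^bsub>P\<^esub> dd 2 (p \<oplus>\<^bsub>P\<^esub> r) \<and> p \<oplus>\<^bsub>P\<^esub> r \<in> carrier P"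
      by (simp add: dd_add U.P.a_ac)
  next
    fix a n assume a: "a \<in> carrier K"
    show "dd 1 (dd 1 (monom P a n)) = dd 2 (monom P a n) \<oplus>\<^bsub>P\<^esub> dd 2 (monom P a n) \<and> monom P a n \<in> carrier P"
    proof (induction n)
      case 0
      have "dd 1 \<zero>\<^bsub>P\<^esub> = \<zero>\<^bsub>P\<^esub>" using dd_const[of "\<zero>\<^bsub>K\<^esub>" 1] by simp
      then show ?case using dd_const[OF a, of 1] dd_const[OF a, of 2] a by simp
    next
      case (Suc n)
      let ?m = "monom P a n"
      have m: "monom P a (Suc n) = px \<otimes>\<^bsub>P\<^esub> ?m" using U.monom_mult[of "\<one>\<^bsub>K\<^esub>" a 1 n] a by (simp add: One_nat_def)
      have d1: "dd 1 (monom P a (Suc n)) = px \<otimes>\<^bsub>P\<^esub> dd 1 ?m \<oplus>\<^bsub>P\<^esub> ?m"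
        unfolding m using a by (simp add: dd_mult(2) dd_x dd_zero)
      have "dd 1 (dd 1 (monom P a (Suc n))) = px \<otimes>\<^bsub>P\<^esub> dd 1 (dd 1 ?m) \<oplus>\<^bsub>P\<^esub> dd 1 ?m \<oplus>\<^bsub>P\<^esub> dd 1 ?m"
        unfolding d1 using a by (simp add: dd_add dd_mult(2) dd_x dd_zero)
      moreover have "dd 2 (monom P a (Suc n)) = px \<otimes>\<^bsub>P\<^esub> dd 2 ?m \<oplus>\<^bsub>P\<^esub> dd 1 ?m"
        unfolding m using a by (simp add: dd_mult(3) dd_x dd_zero)
      ultimately show ?case using Suc a by (simp add: U.P.r_distr U.P.a_ac)
    qed
  qed
  then show ?thesis ..
qed

text \<open>Differentiating \<open>a f' = u f\<close> once shows that \<open>a\<close> kills the second derivative modulo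
  \<open>(f, f')\<close>.\<close>

lemma theta_two_torsion:
  assumes a: "a \<in> theta K f"
  shows "proj_A' K f (a \<otimes>\<^bsub>A\<^esub> q g2) \<oplus>\<^bsub>A'\<^esub> proj_A' K f (a \<otimes>\<^bsub>A\<^esub> q g2) = \<zero>\<^bsub>A'\<^esub>"
proof -
  obtain p where p: "p \<in> carrier P" "a = q p" using a by (auto simp: theta_iff elim: A_cases)
  have "q (p \<otimes>\<^bsub>P\<^esub> f') = \<zero>\<^bsub>A\<^esub>" using a p by (simp add: theta_iff)
  then obtain u where u: "u \<in> carrier P" "p \<otimes>\<^bsub>P\<^esub> f' = u \<otimes>\<^bsub>P\<^esub> f"
    using q_zero_iff[of "p \<otimes>\<^bsub>P\<^esub> f'"] p I_iff by auto
  \<comment> \<open>The derivative of \<open>f'\<close> is \<open>g2\<close> plus \<open>g2\<close>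
    by \<open>dd_dd\<close>.\<close>
  have "dd 1 (p \<otimes>\<^bsub>P\<^esub> f') = p \<otimes>\<^bsub>P\<^esub> (g2 \<oplus>\<^bsub>P\<^esub> g2) \<oplus>\<^bsub>P\<^esub> dd 1 p \<otimes>\<^bsub>P\<^esub> f'"
    using p dd_dd[OF f_closed] dd_one[OF f_closed] by (simp add: dd_mult(2) dd_zero dd_two)
  moreover have "dd 1 (u \<otimes>\<^bsub>P\<^esub> f) = u \<otimes>\<^bsub>P\<^esub> f' \<oplus>\<^bsub>P\<^esub> dd 1 u \<otimes>\<^bsub>P\<^esub> f"
    using u dd_one[OF f_closed] by (simp add: dd_mult(2) dd_zero)
  ultimately have "q' (p \<otimes>\<^bsub>P\<^esub> (g2 \<oplus>\<^bsub>P\<^esub> g2) \<oplus>\<^bsub>P\<^esub> dd 1 p \<otimes>\<^bsub>P\<^esub> f') = q' (u \<otimes>\<^bsub>P\<^esub> f' \<oplus>\<^bsub>P\<^esub> dd 1 u \<otimes>\<^bsub>P\<^esub> f)"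
    using u by simp
  then have "q' p \<otimes>\<^bsub>A'\<^esub> (q' g2 \<oplus>\<^bsub>A'\<^esub> q' g2) = \<zero>\<^bsub>A'\<^esub>" using p u by simp
  then show ?thesis using p by (simp add: A'.r_distr)
qed

end

section \<open>The enveloping algebra\<close>

locale hypersurface = polynomial_quotient +
  assumes depth: "depth_ge_two K (content_ideal K f)"
begin

abbreviation "Q \<equiv> UP A"
abbreviation "Y \<equiv> monom Q \<one>\<^bsub>A\<^esub> 1"
abbreviation "C a \<equiv> monom Q a 0"

sublocale V: UP_cring A Q by (rule UP_cringI[OF A_cring])

lemma qx_closed [simp]: "qx \<in> carrier A" by (simp add: qx_def)

definition H where "H = Y \<ominus>\<^bsub>Q\<^esub> C qx"

lemma H_closed [simp]: "H \<in> carrier Q" by (simp add: H_def)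

lemma qC_hom: "(\<lambda>p. C (q p)) \<in> ring_hom P Q"
  using ring_hom_trans[OF q_hom V.const_ring_hom] by (simp add: comp_def)

lemma qc_hom: "(\<lambda>c. C (q (monom P c 0))) \<in> ring_hom K Q"
  using ring_hom_trans[OF U.const_ring_hom qC_hom] by (simp add: comp_def)

text \<open>Substitution of \<open>Y\<close> for \<open>x\<close>, so that \<open>\<kappa> f\<close>
  is \<open>f(Y)\<close> in \<open>A[Y]\<close>; unrelated to the homotopy of the same name.
  \<Theta> substitutes \<open>Y - x\<close> for \<open>dx\<close>.\<close>

definition \<kappa> where "\<kappa> = eval K Q (\<lambda>c. C (q (monom P c 0))) Y"
definition \<Theta> where "\<Theta> = eval P Q (\<lambda>p. C (q p)) H"

lemma \<kappa>_hom: "\<kappa> \<in> ring_hom P Q"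
  and \<kappa>_const: "c \<in> carrier K \<Longrightarrow> \<kappa> (monom P c 0) = C (q (monom P c 0))"
  and \<kappa>_x: "\<kappa> px = Y"
  unfolding \<kappa>_def using UP_eval_hom[OF K_cring V.UP_cring qc_hom, of Y] by simp_all

lemma \<Theta>_hom: "\<Theta> \<in> ring_hom PP Q"
  and \<Theta>_const: "p \<in> carrier P \<Longrightarrow> \<Theta> (monom PP p 0) = C (q p)"
  and \<Theta>_dx: "\<Theta> dx = H"
  unfolding \<Theta>_def using UP_eval_hom[OF U.UP_cring V.UP_cring qC_hom, of H] by simp_all

sublocale \<kappa>: ring_hom_ring P Q \<kappa>
  by (intro ring_hom_ringI2 U.P.ring_axioms V.P.ring_axioms \<kappa>_hom)
sublocale \<Theta>: ring_hom_ring PP Q \<Theta>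
  by (intro ring_hom_ringI2 W.P.ring_axioms V.P.ring_axioms \<Theta>_hom)

text \<open>Both sides are ring homomorphisms on \<open>K[x]\<close> taking \<open>x\<close> to
  \<open>x + (Y - x) = Y\<close>.\<close>

lemma \<Theta>_taylor:
  assumes "p \<in> carrier P"
  shows "\<Theta> (taylor K p) = \<kappa> p"
proof (rule UP_hom_eqI[OF K_cring V.UP_cring _ \<kappa>_hom _ _ assms])
  show "(\<lambda>p. \<Theta> (taylor K p)) \<in> ring_hom P Q"
    using ring_hom_trans[OF taylor_hom \<Theta>_hom] by (simp add: comp_def)
  have "C qx \<oplus>\<^bsub>Q\<^esub> H = Y" unfolding H_def using V.P.minus_eq_iff[of Y "C qx" H] by (simp add: H_def)
  then show "\<Theta> (taylor K px) = \<kappa> px"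
    by (simp add: taylor_x \<kappa>_x \<Theta>_const \<Theta>_dx qx_def[symmetric])
  show "\<Theta> (taylor K (monom P c 0)) = \<kappa> (monom P c 0)" if "c \<in> carrier K" for c
    using that by (simp add: taylor_const const2_def \<Theta>_const \<kappa>_const)
qed

lemma taylor_decomposition:
  "\<exists>w\<in>carrier PP. taylor K f = monom PP f 0 \<oplus>\<^bsub>PP\<^esub> dx \<otimes>\<^bsub>PP\<^esub> (monom PP f' 0 \<oplus>\<^bsub>PP\<^esub> dx \<otimes>\<^bsub>PP\<^esub> (monom PP g2 0 \<oplus>\<^bsub>PP\<^esub> dx \<otimes>\<^bsub>PP\<^esub> w))"
proof -
  have t: "taylor K f \<in> carrier PP" by simp
  obtain r1 where r1: "r1 \<in> carrier PP" "taylor K f = monom PP (coeff PP (taylor K f) 0) 0 \<oplus>\<^bsub>PP\<^esub> dx \<otimes>\<^bsub>PP\<^esub> r1"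
    "\<And>n. coeff PP r1 n = coeff PP (taylor K f) (Suc n)" using W.UP_shift[OF t] by metis
  obtain r2 where r2: "r2 \<in> carrier PP" "r1 = monom PP (coeff PP r1 0) 0 \<oplus>\<^bsub>PP\<^esub> dx \<otimes>\<^bsub>PP\<^esub> r2"
    "\<And>n. coeff PP r2 n = coeff PP r1 (Suc n)" using W.UP_shift[OF r1(1)] by metis
  obtain r3 where r3: "r3 \<in> carrier PP" "r2 = monom PP (coeff PP r2 0) 0 \<oplus>\<^bsub>PP\<^esub> dx \<otimes>\<^bsub>PP\<^esub> r3"
    using W.UP_shift[OF r2(1)] by metis
  have c: "coeff PP (taylor K f) 0 = f" "coeff PP r1 0 = f'" "coeff PP r2 0 = g2"
    using dd_zero[OF f_closed] dd_one[OF f_closed] dd_two[of f]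
    by (simp_all add: r1(3) r2(3) dd_def One_nat_def numeral_2_eq_2)
  show ?thesis using r1(2) r2(2) r3 unfolding c by metis
qed

text \<open>The remainder of the expansion of \<open>f(Y)\<close> in powers of \<open>H\<close>
  beyond the second order. Later it always carries a factor \<open>H\<close>, which the
  multiplication map kills, so its value does not matter.\<close>

definition tl where "tl = (SOME w. w \<in> carrier Q \<and> \<kappa> f = H \<otimes>\<^bsub>Q\<^esub> (C (q f') \<oplus>\<^bsub>Q\<^esub> H \<otimes>\<^bsub>Q\<^esub> (C (q g2) \<oplus>\<^bsub>Q\<^esub> H \<otimes>\<^bsub>Q\<^esub> w)))"

lemma tl_closed [simp]: "tl \<in> carrier Q"
  and \<kappa>_f: "\<kappa> f = H \<otimes>\<^bsub>Q\<^esub> (C (q f') \<oplus>\<^bsub>Q\<^esub> H \<otimes>\<^bsub>Q\<^esub> (C (q g2) \<oplus>\<^bsub>Q\<^esub> H \<otimes>\<^bsub>Q\<^esub> tl))"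
proof -
  obtain w where w: "w \<in> carrier PP" "taylor K f = monom PP f 0 \<oplus>\<^bsub>PP\<^esub> dx \<otimes>\<^bsub>PP\<^esub> (monom PP f' 0 \<oplus>\<^bsub>PP\<^esub> dx \<otimes>\<^bsub>PP\<^esub> (monom PP g2 0 \<oplus>\<^bsub>PP\<^esub> dx \<otimes>\<^bsub>PP\<^esub> w))"
    using taylor_decomposition by blast
  \<comment> \<open>The constant term of the expansion is the class of \<open>f\<close> in
    \<open>A\<close>, which is zero.\<close>
  have "\<kappa> f = H \<otimes>\<^bsub>Q\<^esub> (C (q f') \<oplus>\<^bsub>Q\<^esub> H \<otimes>\<^bsub>Q\<^esub> (C (q g2) \<oplus>\<^bsub>Q\<^esub> H \<otimes>\<^bsub>Q\<^esub> \<Theta> w))"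
    unfolding \<Theta>_taylor[OF f_closed, symmetric] w(2) using w(1) by (simp add: \<Theta>_const \<Theta>_dx)
  then have "\<exists>w. w \<in> carrier Q \<and> \<kappa> f = H \<otimes>\<^bsub>Q\<^esub> (C (q f') \<oplus>\<^bsub>Q\<^esub> H \<otimes>\<^bsub>Q\<^esub> (C (q g2) \<oplus>\<^bsub>Q\<^esub> H \<otimes>\<^bsub>Q\<^esub> w))"
    using w(1) by (intro exI[of _ "\<Theta> w"]) simp
  from someI_ex[OF this, folded tl_def] show "tl \<in> carrier Q"
    "\<kappa> f = H \<otimes>\<^bsub>Q\<^esub> (C (q f') \<oplus>\<^bsub>Q\<^esub> H \<otimes>\<^bsub>Q\<^esub> (C (q g2) \<oplus>\<^bsub>Q\<^esub> H \<otimes>\<^bsub>Q\<^esub> tl))" by blast+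
qed

definition \<Delta> where "\<Delta> = C (q f') \<oplus>\<^bsub>Q\<^esub> H \<otimes>\<^bsub>Q\<^esub> (C (q g2) \<oplus>\<^bsub>Q\<^esub> H \<otimes>\<^bsub>Q\<^esub> tl)"

lemma \<Delta>_closed [simp]: "\<Delta> \<in> carrier Q" by (simp add: \<Delta>_def)
lemma \<kappa>_f_\<Delta>: "\<kappa> f = H \<otimes>\<^bsub>Q\<^esub> \<Delta>" unfolding \<Delta>_def by (rule \<kappa>_f)

text \<open>Shows that the coefficients of \<open>f(Y)\<close> generate the image of the content
  ideal, as McCoy's criterion over \<open>A\<close> requires.\<close>

lemma coeff_\<kappa>:
  assumes "p \<in> carrier P"
  shows "coeff Q (\<kappa> p) i = q (monom P (coeff P p i) 0)"
proof -
  have "(\<forall>i. coeff Q (\<kappa> p) i = q (monom P (coeff P p i) 0)) \<and> p \<in> carrier P"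
  proof (rule U.UP_induct[OF assms])
    fix p r assume "p \<in> carrier P" "r \<in> carrier P"
      "(\<forall>i. coeff Q (\<kappa> p) i = q (monom P (coeff P p i) 0)) \<and> p \<in> carrier P"
      "(\<forall>i. coeff Q (\<kappa> r) i = q (monom P (coeff P r i) 0)) \<and> r \<in> carrier P"
    then show "(\<forall>i. coeff Q (\<kappa> (p \<oplus>\<^bsub>P\<^esub> r)) i = q (monom P (coeff P (p \<oplus>\<^bsub>P\<^esub> r) i) 0)) \<and> p \<oplus>\<^bsub>P\<^esub> r \<in> carrier P"
      by (simp del: q.hom_add add: q.hom_add[symmetric])
  next
    fix a n assume a: "a \<in> carrier K"
    have "\<kappa> (monom P a n) = monom Q (q (monom P a 0)) n"
    proof (induction n)
      case (Suc n)
      have "monom P a (Suc n) = px \<otimes>\<^bsub>P\<^esub> monom P a n"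
        using U.monom_mult[of "\<one>\<^bsub>K\<^esub>" a 1 n] a by (simp add: One_nat_def)
      moreover have "monom Q (q (monom P a 0)) (Suc n) = Y \<otimes>\<^bsub>Q\<^esub> monom Q (q (monom P a 0)) n"
        using V.monom_mult[of "\<one>\<^bsub>A\<^esub>" "q (monom P a 0)" 1 n] a by (simp add: One_nat_def)
      ultimately show ?case using Suc a by (simp add: \<kappa>_x)
    qed (simp add: a \<kappa>_const)
    then show "(\<forall>i. coeff Q (\<kappa> (monom P a n)) i = q (monom P (coeff P (monom P a n) i) 0)) \<and> monom P a n \<in> carrier P"
      using a by simp
  qed
  then show ?thesis by blast
qed

text \<open>By McCoy over \<open>A\<close> it suffices to treat a class \<open>q p\<close> killed by
  all coefficients of \<open>f\<close>. Then the content ideal carries \<open>p\<close> into the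
  multiples of \<open>f\<close>, and \<open>quotient_annihilator\<close> puts \<open>p\<close>
  itself there.\<close>

lemma \<kappa>_f_regular:
  assumes "g \<in> carrier Q" "\<kappa> f \<otimes>\<^bsub>Q\<^esub> g = \<zero>\<^bsub>Q\<^esub>"
  shows "g = \<zero>\<^bsub>Q\<^esub>"
proof (rule V.mccoy[OF _ _ assms])
  fix a assume a: "a \<in> carrier A" "\<And>i. a \<otimes>\<^bsub>A\<^esub> coeff Q (\<kappa> f) i = \<zero>\<^bsub>A\<^esub>"
  obtain p where p: "p \<in> carrier P" "a = q p" using a(1) by (rule A_cases)
  have "\<exists>u\<in>carrier P. coeff P f i \<odot>\<^bsub>P\<^esub> p = f \<otimes>\<^bsub>P\<^esub> u" for i
  proof -
    let ?m = "monom P (coeff P f i) 0"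
    have "q (p \<otimes>\<^bsub>P\<^esub> ?m) = \<zero>\<^bsub>A\<^esub>" using a(2)[of i] p coeff_\<kappa>[OF f_closed, of i] by simp
    then obtain u where "u \<in> carrier P" "p \<otimes>\<^bsub>P\<^esub> ?m = u \<otimes>\<^bsub>P\<^esub> f"
      using q_zero_iff[of "p \<otimes>\<^bsub>P\<^esub> ?m"] p I_iff by auto
    moreover have "coeff P f i \<odot>\<^bsub>P\<^esub> p = ?m \<otimes>\<^bsub>P\<^esub> p"
      using U.monom_mult_is_smult[of "coeff P f i" p] p by simp
    ultimately show ?thesis using p by (auto simp: U.P.m_comm intro!: bexI[of _ u])
  qed
  then obtain u where "u \<in> carrier P" "p = f \<otimes>\<^bsub>P\<^esub> u"
    using U.quotient_annihilator[OF f_closed depth p(1)] by blast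
  then show "a = \<zero>\<^bsub>A\<^esub>" using p by simp
qed simp

text \<open>The coefficient of \<open>Y\<close> in \<open>H\<close> is one, so McCoy's condition is
  immediate.\<close>

lemma H_regular:
  assumes "g \<in> carrier Q" "H \<otimes>\<^bsub>Q\<^esub> g = \<zero>\<^bsub>Q\<^esub>"
  shows "g = \<zero>\<^bsub>Q\<^esub>"
proof (rule V.mccoy[OF H_closed _ assms])
  fix a assume a: "a \<in> carrier A" "\<And>i. a \<otimes>\<^bsub>A\<^esub> coeff Q H i = \<zero>\<^bsub>A\<^esub>"
  have "coeff Q H 1 = \<one>\<^bsub>A\<^esub>" by (simp add: H_def V.coeff_minus a_minus_def)
  then show "a = \<zero>\<^bsub>A\<^esub>" using a(1) a(2)[of 1] by simp
qed

text \<open>\<Delta> divides the nonzerodivisor \<open>f(Y)\<close>.\<close>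

lemma \<Delta>_regular:
  assumes "g \<in> carrier Q" "\<Delta> \<otimes>\<^bsub>Q\<^esub> g = \<zero>\<^bsub>Q\<^esub>"
  shows "g = \<zero>\<^bsub>Q\<^esub>"
  by (rule \<kappa>_f_regular) (use assms in \<open>simp_all add: \<kappa>_f_\<Delta> V.P.m_assoc\<close>)

lemma cancel:
  assumes "r \<in> carrier Q" "\<And>g. g \<in> carrier Q \<Longrightarrow> r \<otimes>\<^bsub>Q\<^esub> g = \<zero>\<^bsub>Q\<^esub> \<Longrightarrow> g = \<zero>\<^bsub>Q\<^esub>"
    and "g \<in> carrier Q" "h \<in> carrier Q" "r \<otimes>\<^bsub>Q\<^esub> g = r \<otimes>\<^bsub>Q\<^esub> h"
  shows "g = h"
proof -
  have "r \<otimes>\<^bsub>Q\<^esub> (g \<ominus>\<^bsub>Q\<^esub> h) = \<zero>\<^bsub>Q\<^esub>"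
    using assms(1,3-5) by (simp add: a_minus_def V.P.r_distr V.P.r_minus V.P.r_neg)
  then have "g \<ominus>\<^bsub>Q\<^esub> h = \<zero>\<^bsub>Q\<^esub>" using assms(2)[of "g \<ominus>\<^bsub>Q\<^esub> h"] assms(3,4) by blast
  then show ?thesis using V.P.minus_eq_zero_iff[OF assms(3,4)] by blast
qed

section \<open>The enveloping algebra as a quotient of \<open>A[Y]\<close>\<close>

abbreviation "Aev \<equiv> tensor K A A"
abbreviation "il \<equiv> inl K A A"
abbreviation "ir \<equiv> inr K A A"

lemma Aev_cring: "cring Aev" by (rule tensor_cring[OF A_algebra A_algebra])
sublocale Aev: cring Aev by (rule Aev_cring)

sublocale il: ring_hom_ring A Aev il
  by (intro ring_hom_ringI2 A.ring_axioms Aev.ring_axioms inl_hom[OF A_algebra A_algebra])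
sublocale ir: ring_hom_ring A Aev ir
  by (intro ring_hom_ringI2 A.ring_axioms Aev.ring_axioms inr_hom[OF A_algebra A_algebra])

text \<open>Coefficients go to the left factor and \<open>Y\<close> to \<open>x\<close> in the right
  factor; the kernel is generated by \<open>f(Y)\<close>.\<close>

definition \<Phi> where "\<Phi> = eval A Aev il (ir qx)"

lemma \<Phi>_hom: "\<Phi> \<in> ring_hom Q Aev"
  and \<Phi>_const [simp]: "a \<in> carrier A \<Longrightarrow> \<Phi> (C a) = il a"
  and \<Phi>_Y: "\<Phi> Y = ir qx"
  unfolding \<Phi>_def using UP_eval_hom[OF A_cring Aev_cring inl_hom[OF A_algebra A_algebra], of "ir qx"] by simp_all

sublocale \<Phi>: ring_hom_ring Q Aev \<Phi>
  by (intro ring_hom_ringI2 V.P.ring_axioms Aev.ring_axioms \<Phi>_hom)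

lemma scalar_A:
  assumes "c \<in> carrier K"
  shows "c \<odot>\<^bsub>A\<^esub> \<one>\<^bsub>A\<^esub> = q (monom P c 0)"
proof -
  have "c \<odot>\<^bsub>P\<^esub> \<one>\<^bsub>P\<^esub> = monom P c 0"
    using U.monom_mult_smult[of c "\<one>\<^bsub>K\<^esub>" 0] assms by simp
  then show ?thesis using q_smult[OF assms U.P.one_closed] by simp
qed

lemma \<Phi>_\<kappa>:
  assumes "p \<in> carrier P"
  shows "\<Phi> (\<kappa> p) = ir (q p)"
proof (rule UP_hom_eqI[OF K_cring Aev_cring _ _ _ _ assms])
  show "(\<lambda>p. \<Phi> (\<kappa> p)) \<in> ring_hom P Aev" using ring_hom_trans[OF \<kappa>_hom \<Phi>_hom] by (simp add: comp_def)
  show "(\<lambda>p. ir (q p)) \<in> ring_hom P Aev"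
    using ring_hom_trans[OF q_hom inr_hom[OF A_algebra A_algebra]] by (simp add: comp_def)
  show "\<Phi> (\<kappa> px) = ir (q px)" by (simp add: \<kappa>_x \<Phi>_Y qx_def)
  show "\<Phi> (\<kappa> (monom P c 0)) = ir (q (monom P c 0))" if "c \<in> carrier K" for c
    using inl_inr_scalar[OF A_algebra A_algebra that] that by (simp add: \<kappa>_const scalar_A)
qed

text \<open>The tensor of \<open>a\<close> with the class of \<open>p\<close> is the image of
  \<open>a\<close> times \<open>p(Y)\<close>.\<close>

lemma \<Phi>_surj:
  assumes "u \<in> carrier Aev"
  shows "\<exists>g\<in>carrier Q. u = \<Phi> g"
proof (rule tensor_induct[OF A_algebra A_algebra assms])
  fix a b assume a: "a \<in> carrier A" and "b \<in> carrier A"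
  then obtain p where p: "p \<in> carrier P" "b = q p" by (metis A_cases)
  have "il a \<otimes>\<^bsub>Aev\<^esub> ir b = \<Phi> (C a \<otimes>\<^bsub>Q\<^esub> \<kappa> p)" using a p by (simp add: \<Phi>_\<kappa>)
  then show "\<exists>g\<in>carrier Q. il a \<otimes>\<^bsub>Aev\<^esub> ir b = \<Phi> g" using a p by (metis V.P.m_closed V.monom_closed \<kappa>.hom_closed)
next
  fix v w assume "\<exists>g\<in>carrier Q. v = \<Phi> g" "\<exists>g\<in>carrier Q. w = \<Phi> g"
  then obtain g g' where "g \<in> carrier Q" "v = \<Phi> g" "g' \<in> carrier Q" "w = \<Phi> g'" by blast
  then show "\<exists>g\<in>carrier Q. v \<ominus>\<^bsub>Aev\<^esub> w = \<Phi> g"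
    using ring_hom_minus(2)[OF V.P.ring_axioms Aev.ring_axioms \<Phi>_hom, of g g'] by (metis V.P.minus_closed)
qed

text \<open>The kernel is found by mapping \<open>A \<otimes> A\<close> back to \<open>A[Y]/(f(Y))\<close>.\<close>

lemma \<Phi>_kernel:
  assumes g: "g \<in> carrier Q" "\<Phi> g = \<zero>\<^bsub>Aev\<^esub>"
  shows "\<exists>w\<in>carrier Q. g = w \<otimes>\<^bsub>Q\<^esub> \<kappa> f"
proof -
  define J where "J = Idl\<^bsub>Q\<^esub> {\<kappa> f}"
  define S where "S = lin_quot Q J"
  define c where "c = (\<lambda>g. J +>\<^bsub>Q\<^esub> g)"
  have J: "ideal J Q" unfolding J_def by (rule V.P.genideal_ideal) simp
  have S: "cring S" unfolding S_def by (rule lin_quot_cring[OF V.UP_cring J])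
  interpret S: cring S by (rule S)
  have c: "c \<in> ring_hom Q S" unfolding S_def c_def by (rule lin_quot_proj[OF V.UP_cring J])
  interpret LJ: lin_subgroup J Q by (rule ideal_lin_subgroup[OF J])
  have cz: "c g = \<zero>\<^bsub>S\<^esub> \<longleftrightarrow> g \<in> J" if "g \<in> carrier Q" for g
    unfolding c_def S_def by (rule LJ.lin_quot_eq_zero_iff[OF that])
  have ceq: "c g = c g' \<longleftrightarrow> g \<ominus>\<^bsub>Q\<^esub> g' \<in> J" if "g \<in> carrier Q" "g' \<in> carrier Q" for g g'
    unfolding c_def by (rule LJ.coset_eq_iff[OF that])
  interpret c: ring_hom_ring Q S c by (intro ring_hom_ringI2 V.P.ring_axioms S.ring_axioms c)
  have \<alpha>: "(\<lambda>a. c (C a)) \<in> ring_hom A S"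
    using ring_hom_trans[OF V.const_ring_hom c] by (simp add: comp_def)
  have c\<kappa>: "(\<lambda>p. c (\<kappa> p)) \<in> ring_hom P S"
    using ring_hom_trans[OF \<kappa>_hom c] by (simp add: comp_def)
  have cf: "c (\<kappa> f) = \<zero>\<^bsub>S\<^esub>"
    using cz[of "\<kappa> f"] V.P.genideal_self[of "{\<kappa> f}"] unfolding J_def by simp
  \<comment> \<open>Makes \<open>q p \<mapsto> c (\<kappa> p)\<close> well defined on
    \<open>A\<close>; it becomes the map on the right tensor factor.\<close>
  have z: "c (\<kappa> x) = \<zero>\<^bsub>S\<^esub>" if x: "x \<in> I" for x
  proof -
    obtain u where u: "u \<in> carrier P" "x = u \<otimes>\<^bsub>P\<^esub> f" using x I_iff by blast
    then have "c (\<kappa> x) = c (\<kappa> u) \<otimes>\<^bsub>S\<^esub> c (\<kappa> f)"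
      using c.hom_mult[of "\<kappa> u" "\<kappa> f"] by simp
    then show ?thesis using cf c.hom_closed[of "\<kappa> u"] u S.r_null by simp
  qed
  let ?\<beta> = "quot_map (\<lambda>p. c (\<kappa> p))"
  have \<beta>: "?\<beta> \<in> ring_hom A S"
    unfolding alg_A_def by (rule quot_map_hom[OF U.UP_cring I_ideal S.ring_axioms c\<kappa> z])
  have \<beta>q: "?\<beta> (q p) = c (\<kappa> p)" if "p \<in> carrier P" for p
    unfolding q_def by (rule quot_map_coset[OF U.UP_cring I_ideal S.ring_axioms c\<kappa> z that])
  have \<alpha>\<beta>: "c (C (k \<odot>\<^bsub>A\<^esub> \<one>\<^bsub>A\<^esub>)) = ?\<beta> (k \<odot>\<^bsub>A\<^esub> \<one>\<^bsub>A\<^esub>)" if "k \<in> carrier K" for k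
    using that by (simp add: scalar_A \<beta>q \<kappa>_const)
  \<comment> \<open>Sends \<open>a\<close> in the left factor to the class of the constant
    \<open>a\<close>, and \<open>x\<close> in the right factor to the class of \<open>Y\<close>;
    composed with \<Phi> it is the projection \<open>c\<close>.\<close>
  let ?\<Psi> = "quot_map (frag_lin S (\<lambda>p. c (C (fst p)) \<otimes>\<^bsub>S\<^esub> ?\<beta> (snd p)))"
  have T: "?\<Psi> \<in> ring_hom Aev S"
    by (rule tensor_universal(1)[OF A_algebra A_algebra S \<alpha> \<beta>]) (rule \<alpha>\<beta>)
  have Tl: "?\<Psi> (il a) = c (C a)" if "a \<in> carrier A" for a
    by (rule tensor_universal(2)[OF A_algebra A_algebra S \<alpha> \<beta> _ that]) (rule \<alpha>\<beta>)
  have Tr: "?\<Psi> (ir a) = ?\<beta> a" if "a \<in> carrier A" for a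
    by (rule tensor_universal(3)[OF A_algebra A_algebra S \<alpha> \<beta> _ that]) (rule \<alpha>\<beta>)
  have "?\<Psi> (\<Phi> g) = c g"
  proof (rule UP_hom_eqI[OF A_cring S _ c _ _ g(1)])
    show "(\<lambda>g. ?\<Psi> (\<Phi> g)) \<in> ring_hom Q S"
      using ring_hom_trans[OF \<Phi>_hom T] by (simp add: comp_def)
    show "?\<Psi> (\<Phi> Y) = c Y" using Tr[OF qx_closed] \<beta>q[of px] by (simp add: \<Phi>_Y qx_def \<kappa>_x)
    show "?\<Psi> (\<Phi> (C a)) = c (C a)" if "a \<in> carrier A" for a using Tl[OF that] that by simp
  qed
  then have "c g = \<zero>\<^bsub>S\<^esub>"
    using g(2) ring_hom_zero[OF T Aev.ring_axioms S.ring_axioms] by simp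
  then show ?thesis using cz[OF g(1)] V.P.mem_genideal_single[of "\<kappa> f" g] unfolding J_def by simp
qed

definition hv where "hv = \<Phi> H"
definition Dv where "Dv = \<Phi> \<Delta>"

lemma hv_closed [simp]: "hv \<in> carrier Aev" by (simp add: hv_def)
lemma Dv_closed [simp]: "Dv \<in> carrier Aev" by (simp add: Dv_def)

lemma hv_Dv: "hv \<otimes>\<^bsub>Aev\<^esub> Dv = \<zero>\<^bsub>Aev\<^esub>"
  using \<Phi>_\<kappa>[OF f_closed] by (simp add: hv_def Dv_def \<kappa>_f_\<Delta>)

text \<open>A lift \<open>g\<close> of \<open>u\<close> satisfies
  \<open>H g = w f(Y) = w H \<Delta>\<close> for some \<open>w\<close>, and the nonzerodivisor
  \<open>H\<close> cancels.\<close>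

lemma ann_hv:
  assumes u: "u \<in> carrier Aev" "hv \<otimes>\<^bsub>Aev\<^esub> u = \<zero>\<^bsub>Aev\<^esub>"
  shows "\<exists>s\<in>carrier Aev. u = Dv \<otimes>\<^bsub>Aev\<^esub> s"
proof -
  obtain g where g: "g \<in> carrier Q" "u = \<Phi> g" using \<Phi>_surj[OF u(1)] by blast
  then have "\<Phi> (H \<otimes>\<^bsub>Q\<^esub> g) = \<zero>\<^bsub>Aev\<^esub>" using u(2) by (simp add: hv_def)
  then obtain w where w: "w \<in> carrier Q" "H \<otimes>\<^bsub>Q\<^esub> g = w \<otimes>\<^bsub>Q\<^esub> \<kappa> f" using \<Phi>_kernel g by (metis V.P.m_closed H_closed)
  then have "g = \<Delta> \<otimes>\<^bsub>Q\<^esub> w"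
    using g by - (rule cancel[OF H_closed H_regular], simp_all add: \<kappa>_f_\<Delta> V.P.m_ac)
  then show ?thesis using g w by (auto simp: Dv_def)
qed

lemma ann_Dv:
  assumes u: "u \<in> carrier Aev" "Dv \<otimes>\<^bsub>Aev\<^esub> u = \<zero>\<^bsub>Aev\<^esub>"
  shows "\<exists>s\<in>carrier Aev. u = hv \<otimes>\<^bsub>Aev\<^esub> s"
proof -
  obtain g where g: "g \<in> carrier Q" "u = \<Phi> g" using \<Phi>_surj[OF u(1)] by blast
  then have "\<Phi> (\<Delta> \<otimes>\<^bsub>Q\<^esub> g) = \<zero>\<^bsub>Aev\<^esub>" using u(2) by (simp add: Dv_def)
  then obtain w where w: "w \<in> carrier Q" "\<Delta> \<otimes>\<^bsub>Q\<^esub> g = w \<otimes>\<^bsub>Q\<^esub> \<kappa> f" using \<Phi>_kernel g by (metis V.P.m_closed \<Delta>_closed)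
  then have "g = H \<otimes>\<^bsub>Q\<^esub> w"
    using g by - (rule cancel[OF \<Delta>_closed \<Delta>_regular], simp_all add: \<kappa>_f_\<Delta> V.P.m_ac)
  then show ?thesis using g w by (auto simp: hv_def)
qed

section \<open>The multiplication map and the periodic resolution of \<open>A\<close>\<close>

definition \<mu> where "\<mu> = quot_map (mult_map A)"

lemma id_hom: "(\<lambda>a. a) \<in> ring_hom A A" by (rule ring_hom_memI) simp_all

lemma \<mu>_hom: "\<mu> \<in> ring_hom Aev A"
  and \<mu>_il [simp]: "a \<in> carrier A \<Longrightarrow> \<mu> (il a) = a"
  and \<mu>_ir [simp]: "a \<in> carrier A \<Longrightarrow> \<mu> (ir a) = a"
proof -
  have "mult_map A = frag_lin A (\<lambda>p. fst p \<otimes>\<^bsub>A\<^esub> snd p)"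
    by (simp add: mult_map_def[abs_def] frag_lin_def[abs_def])
  then show "\<mu> \<in> ring_hom Aev A" "a \<in> carrier A \<Longrightarrow> \<mu> (il a) = a" "a \<in> carrier A \<Longrightarrow> \<mu> (ir a) = a"
    using tensor_universal[OF A_algebra A_algebra A_cring id_hom id_hom] by (simp_all add: \<mu>_def)
qed

sublocale \<mu>: ring_hom_ring Aev A \<mu>
  by (intro ring_hom_ringI2 Aev.ring_axioms A.ring_axioms \<mu>_hom)

abbreviation "M \<equiv> diag_module A"

lemma M_sel [simp]: "carrier M = carrier A" "monoid.mult M = monoid.mult A" "\<one>\<^bsub>M\<^esub> = \<one>\<^bsub>A\<^esub>"
  "\<zero>\<^bsub>M\<^esub> = \<zero>\<^bsub>A\<^esub>" "ring.add M = ring.add A" "u \<odot>\<^bsub>M\<^esub> a = \<mu> u \<otimes>\<^bsub>A\<^esub> a"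
  by (simp_all add: diag_module_def \<mu>_def quot_map_def)

lemma M_cring': "cring M" by (rule cring_cong[OF A_cring]) simp_all

lemma M_algebra: "algebra Aev M"
  by (rule algebraI[OF Aev_cring M_cring']) (simp_all add: A.l_distr A.r_distr A.m_assoc)

lemma \<mu>_hv [simp]: "\<mu> hv = \<zero>\<^bsub>A\<^esub>"
proof -
  have "hv = ir qx \<ominus>\<^bsub>Aev\<^esub> il qx"
    unfolding hv_def H_def using ring_hom_minus(2)[OF V.P.ring_axioms Aev.ring_axioms \<Phi>_hom, of Y "C qx"] by (simp add: \<Phi>_Y)
  then show ?thesis using ring_hom_minus(2)[OF Aev.ring_axioms A.ring_axioms \<mu>_hom, of "ir qx" "il qx"]
    by (simp add: A.minus_eq_zero_iff)
qed

text \<open>Modulo \<open>H\<close> the variable \<open>Y\<close> equals \<open>x\<close>, so every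
  \<open>g\<close> in \<open>A[Y]\<close> is congruent to the constant
  \<open>\<mu> (\<Phi> g)\<close>.\<close>

lemma \<mu>_kernel:
  assumes u: "u \<in> carrier Aev" "\<mu> u = \<zero>\<^bsub>A\<^esub>"
  shows "\<exists>s\<in>carrier Aev. u = hv \<otimes>\<^bsub>Aev\<^esub> s"
proof -
  obtain g where g: "g \<in> carrier Q" "u = \<Phi> g" using \<Phi>_surj[OF u(1)] by blast
  define J where "J = Idl\<^bsub>Q\<^esub> {H}"
  define S where "S = lin_quot Q J"
  define c where "c = (\<lambda>g. J +>\<^bsub>Q\<^esub> g)"
  have J: "ideal J Q" unfolding J_def by (rule V.P.genideal_ideal) simp
  have S: "cring S" unfolding S_def by (rule lin_quot_cring[OF V.UP_cring J])
  have c: "c \<in> ring_hom Q S" unfolding S_def c_def by (rule lin_quot_proj[OF V.UP_cring J])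
  interpret LJ: lin_subgroup J Q by (rule ideal_lin_subgroup[OF J])
  have cz: "c g = \<zero>\<^bsub>S\<^esub> \<longleftrightarrow> g \<in> J" if "g \<in> carrier Q" for g
    unfolding c_def S_def by (rule LJ.lin_quot_eq_zero_iff[OF that])
  have ceq: "c g = c g' \<longleftrightarrow> g \<ominus>\<^bsub>Q\<^esub> g' \<in> J" if "g \<in> carrier Q" "g' \<in> carrier Q" for g g'
    unfolding c_def by (rule LJ.coset_eq_iff[OF that])
  have "c (C (\<mu> (\<Phi> g))) = c g"
  proof (rule UP_hom_eqI[OF A_cring S _ c _ _ g(1)])
    show "(\<lambda>g. c (C (\<mu> (\<Phi> g)))) \<in> ring_hom Q S"
      using ring_hom_trans[OF ring_hom_trans[OF ring_hom_trans[OF \<Phi>_hom \<mu>_hom] V.const_ring_hom] c]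
      by (simp add: comp_def)
    have "Y \<ominus>\<^bsub>Q\<^esub> C qx \<in> J" using V.P.genideal_self[of "{H}"] unfolding J_def H_def by simp
    then show "c (C (\<mu> (\<Phi> Y))) = c Y"
      using ceq[of Y "C qx"] by (simp add: \<Phi>_Y)
  qed simp
  then have "c g = c (C \<zero>\<^bsub>A\<^esub>)" using u g by simp
  then have "g \<ominus>\<^bsub>Q\<^esub> C \<zero>\<^bsub>A\<^esub> \<in> J" using ceq[of g "C \<zero>\<^bsub>A\<^esub>"] g by (simp del: V.monom_zero)
  then have "g \<in> J" using g by (simp add: a_minus_def)
  then obtain w where "w \<in> carrier Q" "g = w \<otimes>\<^bsub>Q\<^esub> H" using V.P.mem_genideal_single[of H g] unfolding J_def by auto
  then show ?thesis using g by (auto simp: hv_def Aev.m_comm)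
qed

sublocale per: periodic_algebra Aev M hv Dv
proof (intro periodic_algebra.intro M_algebra periodic_algebra_axioms.intro)
  show "\<exists>r\<in>carrier Aev. m = r \<odot>\<^bsub>M\<^esub> \<one>\<^bsub>M\<^esub>" if "m \<in> carrier M" for m
    by (rule bexI[of _ "il m"]) (use that in simp_all)
qed (use hv_Dv ann_hv ann_Dv \<mu>_kernel in simp_all)

lemma \<mu>_Dv [simp]: "\<mu> Dv = q f'"
  unfolding Dv_def \<Delta>_def by (simp flip: hv_def)

text \<open>Supplies the division demanded by \<open>ev_comp_odd\<close>: \<open>a\<close> kills the
  leading term of the expansion of \<Delta>, leaving a multiple of \<open>hv\<close> whose cofactor
  is sent by \<mu> to \<open>a\<close> times the second divided derivative.\<close>

lemma theta_lift:
  assumes a: "a \<in> theta K f"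
  shows "\<exists>b\<in>carrier Aev. il a \<otimes>\<^bsub>Aev\<^esub> Dv = hv \<otimes>\<^bsub>Aev\<^esub> b \<and> \<mu> b = a \<otimes>\<^bsub>A\<^esub> q g2"
proof -
  have aA: "a \<in> carrier A" "a \<otimes>\<^bsub>A\<^esub> q f' = \<zero>\<^bsub>A\<^esub>" using a by (simp_all add: theta_iff)
  let ?b = "il a \<otimes>\<^bsub>Aev\<^esub> (il (q g2) \<oplus>\<^bsub>Aev\<^esub> hv \<otimes>\<^bsub>Aev\<^esub> \<Phi> tl)"
  have "Dv = il (q f') \<oplus>\<^bsub>Aev\<^esub> hv \<otimes>\<^bsub>Aev\<^esub> (il (q g2) \<oplus>\<^bsub>Aev\<^esub> hv \<otimes>\<^bsub>Aev\<^esub> \<Phi> tl)"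
    unfolding Dv_def \<Delta>_def by (simp flip: hv_def)
  then have "il a \<otimes>\<^bsub>Aev\<^esub> Dv = il (a \<otimes>\<^bsub>A\<^esub> q f') \<oplus>\<^bsub>Aev\<^esub> hv \<otimes>\<^bsub>Aev\<^esub> ?b"
    using aA(1) by (simp add: Aev.r_distr Aev.m_ac)
  then have "il a \<otimes>\<^bsub>Aev\<^esub> Dv = hv \<otimes>\<^bsub>Aev\<^esub> ?b" using aA by simp
  moreover have "\<mu> ?b = a \<otimes>\<^bsub>A\<^esub> q g2" using aA(1) by simp
  ultimately show ?thesis using aA(1) by (intro bexI[of _ ?b]) simp_all
qed

end

section \<open>The Ext-algebra\<close>

lemma graded_sum_sel [simp]:
  "carrier (graded_sum G \<mu> u) = {x. (\<forall>n. x n \<in> carrier (G n)) \<and> finite {n. x n \<noteq> \<zero>\<^bsub>G n\<^esub>}}"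
  "monoid.mult (graded_sum G \<mu> u) = (\<lambda>x y n. \<Oplus>\<^bsub>G n\<^esub>i\<in>{..n}. \<mu> i (n - i) (x i) (y (n - i)))"
  "\<one>\<^bsub>graded_sum G \<mu> u\<^esub> = (\<lambda>n. if n = 0 then u else \<zero>\<^bsub>G n\<^esub>)"
  "\<zero>\<^bsub>graded_sum G \<mu> u\<^esub> = (\<lambda>n. \<zero>\<^bsub>G n\<^esub>)"
  "ring.add (graded_sum G \<mu> u) = (\<lambda>x y n. x n \<oplus>\<^bsub>G n\<^esub> y n)"
  "smult (graded_sum G \<mu> u) = (\<lambda>r x n. r \<odot>\<^bsub>G n\<^esub> x n)"
  by (simp_all add: graded_sum_def)

lemma restrict_scalars_sel [simp]:
  "carrier (restrict_scalars \<phi> M) = carrier M" "monoid.mult (restrict_scalars \<phi> M) = monoid.mult M"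
  "\<one>\<^bsub>restrict_scalars \<phi> M\<^esub> = \<one>\<^bsub>M\<^esub>" "\<zero>\<^bsub>restrict_scalars \<phi> M\<^esub> = \<zero>\<^bsub>M\<^esub>"
  "ring.add (restrict_scalars \<phi> M) = ring.add M" "smult (restrict_scalars \<phi> M) = (\<lambda>c x. \<phi> c \<odot>\<^bsub>M\<^esub> x)"
  by (simp_all add: restrict_scalars_def)

lemma fibre_product_sel [simp]:
  "z \<in> carrier (fibre_product A B p q) \<longleftrightarrow> fst z \<in> carrier A \<and> snd z \<in> carrier B \<and> p (fst z) = q (snd z)"
  "z \<otimes>\<^bsub>fibre_product A B p q\<^esub> w = (fst z \<otimes>\<^bsub>A\<^esub> fst w, snd z \<otimes>\<^bsub>B\<^esub> snd w)"
  "z \<oplus>\<^bsub>fibre_product A B p q\<^esub> w = (fst z \<oplus>\<^bsub>A\<^esub> fst w, snd z \<oplus>\<^bsub>B\<^esub> snd w)"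
  "\<one>\<^bsub>fibre_product A B p q\<^esub> = (\<one>\<^bsub>A\<^esub>, \<one>\<^bsub>B\<^esub>)"
  "c \<odot>\<^bsub>fibre_product A B p q\<^esub> z = (c \<odot>\<^bsub>A\<^esub> fst z, c \<odot>\<^bsub>B\<^esub> snd z)"
  by (auto simp: fibre_product_def RDirProd_def DirProd_def monoid.defs split_beta mem_Times_iff)

text \<open>The sign in \<open>graded_commutative\<close> is a negative in the graded sum, which has
  to be computed componentwise.\<close>

lemma graded_sum_abelian_group:
  assumes G: "\<And>n. abelian_group (G n)"
  shows "abelian_group (graded_sum G \<mu> u)"
    and "x \<in> carrier (graded_sum G \<mu> u) \<Longrightarrow> \<ominus>\<^bsub>graded_sum G \<mu> u\<^esub> x = (\<lambda>n. \<ominus>\<^bsub>G n\<^esub> x n)"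
proof -
  interpret G: abelian_group "G n" for n by (rule G)
  have fin: "finite {n. x n \<oplus>\<^bsub>G n\<^esub> y n \<noteq> \<zero>\<^bsub>G n\<^esub>}"
    if "finite {n. x n \<noteq> \<zero>\<^bsub>G n\<^esub>}" "finite {n. y n \<noteq> \<zero>\<^bsub>G n\<^esub>}" for x y
    by (rule finite_subset[OF _ finite_UnI[OF that]]) auto
  have mz: "\<ominus>\<^bsub>G n\<^esub> \<zero>\<^bsub>G n\<^esub> = \<zero>\<^bsub>G n\<^esub>" for n by (rule G.minus_equality) simp_all
  have fin': "finite {n. \<ominus>\<^bsub>G n\<^esub> x n \<noteq> \<zero>\<^bsub>G n\<^esub>}" if "finite {n. x n \<noteq> \<zero>\<^bsub>G n\<^esub>}" for x
    by (rule finite_subset[OF _ that]) (auto simp: mz)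
  have inv: "(\<lambda>n. \<ominus>\<^bsub>G n\<^esub> x n) \<in> carrier (graded_sum G \<mu> u)"
    "(\<lambda>n. \<ominus>\<^bsub>G n\<^esub> x n) \<oplus>\<^bsub>graded_sum G \<mu> u\<^esub> x = \<zero>\<^bsub>graded_sum G \<mu> u\<^esub>"
    if "x \<in> carrier (graded_sum G \<mu> u)" for x
    using that fin' by (auto simp: G.l_neg)
  show ag: "abelian_group (graded_sum G \<mu> u)"
  proof (rule abelian_groupI)
    fix x y z assume "x \<in> carrier (graded_sum G \<mu> u)" "y \<in> carrier (graded_sum G \<mu> u)" "z \<in> carrier (graded_sum G \<mu> u)"
    then show "x \<oplus>\<^bsub>graded_sum G \<mu> u\<^esub> y \<oplus>\<^bsub>graded_sum G \<mu> u\<^esub> z = x \<oplus>\<^bsub>graded_sum G \<mu> u\<^esub> (y \<oplus>\<^bsub>graded_sum G \<mu> u\<^esub> z)"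
      by (simp add: G.a_assoc)
  next
    fix x y assume "x \<in> carrier (graded_sum G \<mu> u)" "y \<in> carrier (graded_sum G \<mu> u)"
    then show "x \<oplus>\<^bsub>graded_sum G \<mu> u\<^esub> y = y \<oplus>\<^bsub>graded_sum G \<mu> u\<^esub> x" by (simp add: G.a_comm)
  next
    fix x assume x: "x \<in> carrier (graded_sum G \<mu> u)"
    show "\<exists>y\<in>carrier (graded_sum G \<mu> u). y \<oplus>\<^bsub>graded_sum G \<mu> u\<^esub> x = \<zero>\<^bsub>graded_sum G \<mu> u\<^esub>"
      using inv[OF x] by blast
  qed (auto simp: fin)
  show "x \<in> carrier (graded_sum G \<mu> u) \<Longrightarrow> \<ominus>\<^bsub>graded_sum G \<mu> u\<^esub> x = (\<lambda>n. \<ominus>\<^bsub>G n\<^esub> x n)"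
    by (rule abelian_group.minus_equality[OF ag inv(2) _ inv(1)])
qed

lemma a_inv_cong:
  assumes "carrier S = carrier R" "\<zero>\<^bsub>S\<^esub> = \<zero>\<^bsub>R\<^esub>" "ring.add S = ring.add R"
  shows "\<ominus>\<^bsub>S\<^esub> x = \<ominus>\<^bsub>R\<^esub> x"
  by (simp add: a_inv_def m_inv_def assms)

lemma finsum_hom:
  assumes G: "abelian_group G" and H: "abelian_group H" and fin: "finite S"
    and hc: "\<And>x. x \<in> carrier G \<Longrightarrow> h x \<in> carrier H" and h0: "h \<zero>\<^bsub>G\<^esub> = \<zero>\<^bsub>H\<^esub>"
    and ha: "\<And>x y. x \<in> carrier G \<Longrightarrow> y \<in> carrier G \<Longrightarrow> h (x \<oplus>\<^bsub>G\<^esub> y) = h x \<oplus>\<^bsub>H\<^esub> h y"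
    and g: "g \<in> S \<rightarrow> carrier G"
  shows "h (finsum G g S) = finsum H (\<lambda>i. h (g i)) S"
proof -
  interpret G: abelian_group G by fact
  interpret H: abelian_group H by fact
  show ?thesis using fin g
  proof (induction S)
    case (insert i S)
    then have "g i \<in> carrier G" "g \<in> S \<rightarrow> carrier G" by auto
    moreover from this have "(\<lambda>i. h (g i)) \<in> S \<rightarrow> carrier H" using hc by auto
    ultimately show ?case using insert by (simp add: ha hc)
  qed (simp add: h0)
qed

context hypersurface
begin

section \<open>Values of Ext classes and of their products\<close>

abbreviation "\<pi> \<equiv> proj_A' K f"
abbreviation "Z n \<equiv> cocyc Aev M M (int n)"
abbreviation "cl n \<phi> \<equiv> ext_class Aev M M n \<phi>"
abbreviation "Xt n \<equiv> Ext Aev M M n"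
abbreviation "cmp j \<phi> \<psi> \<equiv> cochain_comp (std_res Aev M) (int j) \<phi> \<psi>"
abbreviation "T n \<equiv> theta_comp K f n"

lemma M_mod: "module Aev M" by (rule algebra.module[OF M_algebra])

lemma M_minus [simp]: "\<ominus>\<^bsub>M\<^esub> a = \<ominus>\<^bsub>A\<^esub> a" "a \<ominus>\<^bsub>M\<^esub> b = a \<ominus>\<^bsub>A\<^esub> b"
  using a_inv_cong[of M A] by (simp_all add: a_minus_def)

lemma ev_closed [simp]: "\<phi> \<in> Z n \<Longrightarrow> per.ev (int n) \<phi> \<in> carrier A"
  using per.ev_closed[of \<phi> "int n"] by (simp add: cocycles_def)

lemma ev_lin: "lin_map Aev (cocyc_mod Aev M M n) M (per.ev n)"
  by (rule lin_mapI) (use per.ev_closed per.ev_add per.ev_smult in \<open>auto simp: cocycles_def\<close>)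

lemma ev_diff:
  assumes "\<phi> \<in> Z n" "\<psi> \<in> Z n"
  shows "per.ev (int n) (\<phi> \<ominus>\<^bsub>cocyc_mod Aev M M (int n)\<^esub> \<psi>) = per.ev (int n) \<phi> \<ominus>\<^bsub>A\<^esub> per.ev (int n) \<psi>"
  using lin_map_minus(2)[OF cocyc_module[OF M_mod M_mod] M_mod ev_lin, of \<phi> "int n" \<psi>] assms by simp

text \<open>\<open>Dv\<close> acts on \<open>A\<close> as the derivative of \<open>f\<close>, and
  the multiples of the derivative are the kernel of the projection to \<open>A'\<close>.\<close>

lemma null_iff:
  assumes "a \<in> carrier A"
  shows "per.null (int n) a \<longleftrightarrow> (if even n \<and> n \<noteq> 0 then \<pi> a = \<zero>\<^bsub>A'\<^esub> else a = \<zero>\<^bsub>A\<^esub>)"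
proof (cases "even n \<and> n \<noteq> 0")
  case True
  then show ?thesis using per.null_even[of "int n" a] proj_zero_iff[OF assms] by simp
next
  case False
  then consider "n = 0" | "odd n" by blast
  then show ?thesis
  proof cases
    case 1
    then show ?thesis by (simp add: per.null_def)
  next
    case 2
    then show ?thesis using per.null_odd[of "int n" a] by simp
  qed
qed

lemma cl_eq_iff:
  assumes "\<phi> \<in> Z n" "\<psi> \<in> Z n"
  shows "cl n \<phi> = cl n \<psi> \<longleftrightarrow> per.null (int n) (per.ev (int n) \<phi> \<ominus>\<^bsub>A\<^esub> per.ev (int n) \<psi>)"
proof -
  interpret Zm: module Aev "cocyc_mod Aev M M (int n)" by (rule cocyc_module[OF M_mod M_mod])
  let ?d = "\<phi> \<ominus>\<^bsub>cocyc_mod Aev M M (int n)\<^esub> \<psi>"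
  have d: "?d \<in> Z n" using Zm.M.minus_closed[of \<phi> \<psi>] assms by simp
  have "?d \<in> cobd Aev M M (int n) \<longleftrightarrow> per.null (int n) (per.ev (int n) ?d)"
    using per.ev_coboundary[of ?d "int n"] per.coboundary_if_null[OF _ d] by auto
  then show ?thesis using ext_class_eq_iff[OF M_mod M_mod assms] ev_diff[OF assms] by simp
qed

text \<open>In degree 0 this keeps only the image in \<open>A'\<close>, so classes there are
  separated by \<open>per.ev 0\<close> instead.\<close>

definition val where "val n \<phi> = (if even n then \<pi> (per.ev (int n) \<phi>) else per.ev (int n) \<phi>)"

lemma T_carrier: "carrier (T n) = (if even n then carrier A' else theta K f)"
  and T_zero: "\<zero>\<^bsub>T n\<^esub> = (if even n then \<zero>\<^bsub>A'\<^esub> else \<zero>\<^bsub>A\<^esub>)"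
  and T_add: "ring.add (T n) = (if even n then ring.add A' else ring.add A)"
  and T_smult: "smult (T n) = (if even n then smult A' else smult A)"
  by (simp_all add: theta_comp_def)

lemma theta_closed: "a \<in> theta K f \<Longrightarrow> a \<in> carrier A" by (simp add: theta_iff)

lemma T_abelian_group: "abelian_group (T n)"
proof (cases "even n")
  case True
  then show ?thesis using A'.abelian_group_axioms by (simp add: theta_comp_def)
next
  case False
  have "abelian_group (A\<lparr>carrier := theta K f\<rparr>)"
  proof (rule abelian_groupI)
    fix a assume a: "a \<in> carrier (A\<lparr>carrier := theta K f\<rparr>)"
    then show "\<exists>b\<in>carrier (A\<lparr>carrier := theta K f\<rparr>). b \<oplus>\<^bsub>A\<lparr>carrier := theta K f\<rparr>\<^esub> a = \<zero>\<^bsub>A\<lparr>carrier := theta K f\<rparr>\<^esub>"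
      by (intro bexI[of _ "\<ominus>\<^bsub>A\<^esub> a"]) (simp_all add: theta_iff A.l_neg A.l_minus)
  qed (simp_all add: theta_iff A.l_distr A.a_ac)
  then show ?thesis using False by (simp add: theta_comp_def)
qed

lemma val_odd: "odd n \<Longrightarrow> \<phi> \<in> Z n \<Longrightarrow> per.ev (int n) \<phi> \<in> theta K f"
  using per.D_kills[of \<phi> "int n"] by (simp add: theta_iff A.m_comm)

lemma val_closed: "\<phi> \<in> Z n \<Longrightarrow> val n \<phi> \<in> carrier (T n)"
  using val_odd by (simp add: val_def T_carrier)

lemma val_eq_iff:
  assumes "\<phi> \<in> Z n" "\<psi> \<in> Z n" "n \<noteq> 0"
  shows "val n \<phi> = val n \<psi> \<longleftrightarrow> cl n \<phi> = cl n \<psi>"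
  using cl_eq_iff[OF assms(1,2)] assms null_iff[of "per.ev (int n) \<phi> \<ominus>\<^bsub>A\<^esub> per.ev (int n) \<psi>" n]
    ring_hom_minus(2)[OF A.ring_axioms A'.ring_axioms proj_hom, of "per.ev (int n) \<phi>" "per.ev (int n) \<psi>"]
  by (auto simp: val_def A.minus_eq_zero_iff A'.minus_eq_zero_iff)

lemma ev_zero_eq_iff:
  assumes "\<phi> \<in> Z 0" "\<psi> \<in> Z 0"
  shows "per.ev 0 \<phi> = per.ev 0 \<psi> \<longleftrightarrow> cl 0 \<phi> = cl 0 \<psi>"
  using cl_eq_iff[OF assms] ev_closed[OF assms(1)] ev_closed[OF assms(2)]
  by (simp add: per.null_def A.minus_eq_zero_iff)

lemma val_surj:
  assumes "b \<in> carrier (T n)"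
  shows "\<exists>\<phi>\<in>Z n. val n \<phi> = b"
proof -
  obtain a where a: "a \<in> carrier A" "b = (if even n then \<pi> a else a)" "odd n \<Longrightarrow> a \<in> theta K f"
    using assms proj_surj theta_closed by (auto simp: T_carrier split: if_splits)
  \<comment> \<open>For even \<open>n\<close> the operator is \<open>hv\<close>, which is zero on
    \<open>A\<close>; for odd \<open>n\<close> it is \<open>Dv\<close>, which acts as the derivative
    and kills \<open>theta K f\<close>.\<close>
  have "per.x (int n + 1) \<odot>\<^bsub>M\<^esub> a = \<zero>\<^bsub>M\<^esub>"
    using a(1) a(3) by (auto simp: per.x_def theta_iff A.m_comm)
  then obtain \<phi> where \<phi>: "\<phi> \<in> Z n" "per.null (int n) (per.ev (int n) \<phi> \<ominus>\<^bsub>A\<^esub> a)"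
    using per.ev_surj[of "int n" a] a(1) by auto
  let ?v = "per.ev (int n) \<phi>"
  have v: "?v \<in> carrier A" using \<phi>(1) by simp
  have d: "if even n \<and> n \<noteq> 0 then \<pi> (?v \<ominus>\<^bsub>A\<^esub> a) = \<zero>\<^bsub>A'\<^esub> else ?v \<ominus>\<^bsub>A\<^esub> a = \<zero>\<^bsub>A\<^esub>"
    using null_iff[of "?v \<ominus>\<^bsub>A\<^esub> a" n] \<phi>(2) v a(1) by simp
  have "val n \<phi> = b"
  proof (cases "even n \<and> n \<noteq> 0")
    case True
    then have "\<pi> ?v \<ominus>\<^bsub>A'\<^esub> \<pi> a = \<zero>\<^bsub>A'\<^esub>"
      using d ring_hom_minus(2)[OF A.ring_axioms A'.ring_axioms proj_hom v a(1)] by simp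
    then have "\<pi> ?v = \<pi> a" 
      using A'.minus_eq_zero_iff[OF pr.hom_closed[OF v] pr.hom_closed[OF a(1)]] by blast
    then show ?thesis using True a(2) by (simp add: val_def)
  next
    case False
    then have "?v = a" using d A.minus_eq_zero_iff[OF v a(1)] by simp
    then show ?thesis using a(2) by (simp add: val_def)
  qed
  then show ?thesis using \<phi>(1) by blast
qed

lemma ev_zero_surj:
  assumes "a \<in> carrier A"
  shows "\<exists>\<phi>\<in>Z 0. per.ev 0 \<phi> = a"
proof -
  obtain \<phi> where "\<phi> \<in> Z 0" "per.null 0 (per.ev 0 \<phi> \<ominus>\<^bsub>A\<^esub> a)"
    using per.ev_surj[of 0 a] assms by (auto simp: per.x_def)
  then show ?thesis using assms ev_closed[of \<phi> 0] by (auto simp: per.null_def A.minus_eq_zero_iff)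
qed

lemma cmp_closed: "\<phi> \<in> Z i \<Longrightarrow> \<psi> \<in> Z j \<Longrightarrow> cmp j \<phi> \<psi> \<in> Z (i + j)"
  using cochain_comp_cocycle[OF M_mod, of \<phi> "int i" \<psi> "int j"] by simp

lemma ev_zero_cmp:
  assumes "\<phi> \<in> Z 0" "\<psi> \<in> Z 0"
  shows "per.ev 0 (cmp 0 \<phi> \<psi>) = per.ev 0 \<phi> \<otimes>\<^bsub>A\<^esub> per.ev 0 \<psi>"
  using per.ev_comp[of \<phi> 0 \<psi> 0] assms ev_closed[OF assms(1)] ev_closed[OF assms(2)] by (auto simp: per.null_def)

text \<open>In odd degrees the resolution produces the square with the opposite sign; this does not matter
  because it is killed by two.\<close>

lemma val_cmp:
  assumes \<phi>: "\<phi> \<in> Z i" and \<psi>: "\<psi> \<in> Z j"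
  shows "val (i + j) (cmp j \<phi> \<psi>) = theta_mult K f i j (val i \<phi>) (val j \<psi>)"
proof -
  let ?a = "per.ev (int i) \<phi>" and ?b = "per.ev (int j) \<psi>"
  have ab: "?a \<in> carrier A" "?b \<in> carrier A" using assms by simp_all
  have npi: "\<pi> m = \<zero>\<^bsub>A'\<^esub>" if "per.null (int n) m" "even n" for m n
    using null_iff[of m n] per.null_closed[OF that(1)] that by (auto split: if_splits)
  show ?thesis
  proof (cases "even i \<or> even j")
    case True
    obtain m where m: "per.null (int (i + j)) m" "per.ev (int (i + j)) (cmp j \<phi> \<psi>) = ?a \<otimes>\<^bsub>A\<^esub> ?b \<oplus>\<^bsub>A\<^esub> m"
      using per.ev_comp[OF \<phi> \<psi>] True by auto
    have mA: "m \<in> carrier A" using per.null_closed[OF m(1)] by simp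
    show ?thesis
    proof (cases "even (i + j)")
      case e: True
      then have "even i" "even j" using True by auto
      then show ?thesis using m(2) npi[OF m(1) e] ab mA by (simp add: val_def theta_mult_def)
    next
      case o: False
      then have "m = \<zero>\<^bsub>A\<^esub>" using null_iff[OF mA, of "i + j"] m(1) by auto
      then have v: "val (i + j) (cmp j \<phi> \<psi>) = ?a \<otimes>\<^bsub>A\<^esub> ?b" using m(2) o ab by (simp add: val_def)
      show ?thesis
      proof (cases "even i")
        case True
        then have "odd j" using o by simp
        then show ?thesis using v True theta_act_proj[OF ab(1) val_odd[OF _ \<psi>]]
          by (simp add: val_def theta_mult_def)
      next
        case False
        then have "even j" using True by simp
        then show ?thesis using v False theta_act_proj[OF ab(2) val_odd[OF False \<phi>]] ab
          by (simp add: val_def theta_mult_def A.m_comm)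
      qed
    qed
  next
    case False
    then have o: "odd i" "odd j" by auto
    have bt: "?b \<in> theta K f" by (rule val_odd[OF o(2) \<psi>])
    \<comment> \<open>The lift of \<open>?b\<close> to the left factor is one admissible choice of
      scalar in \<open>ev_comp_odd\<close>.\<close>
    obtain c where c: "c \<in> carrier Aev" "il ?b \<otimes>\<^bsub>Aev\<^esub> Dv = hv \<otimes>\<^bsub>Aev\<^esub> c" "\<mu> c = ?b \<otimes>\<^bsub>A\<^esub> q g2"
      using theta_lift[OF bt] by blast
    obtain m where m: "per.null (int (i + j)) m"
      "per.ev (int (i + j)) (cmp j \<phi> \<psi>) = ?a \<otimes>\<^bsub>A\<^esub> (\<ominus>\<^bsub>A\<^esub> (?b \<otimes>\<^bsub>A\<^esub> q g2)) \<oplus>\<^bsub>A\<^esub> m"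
      using per.ev_comp_odd[OF \<phi> \<psi> _ _ _ _ _ _ c(1,2)] o ab c(3) by auto
    have mA: "m \<in> carrier A" using per.null_closed[OF m(1)] by simp
    have e: "even (i + j)" using o by simp
    let ?t = "\<pi> ((?a \<otimes>\<^bsub>A\<^esub> ?b) \<otimes>\<^bsub>A\<^esub> q g2)"
    have abt: "?a \<otimes>\<^bsub>A\<^esub> ?b \<in> theta K f" using bt ab by (simp add: theta_iff A.m_assoc)
    have "\<ominus>\<^bsub>A'\<^esub> ?t = ?t"
      using theta_two_torsion[OF abt] ab by (intro A'.minus_equality) simp_all
    moreover have "\<pi> (?a \<otimes>\<^bsub>A\<^esub> (\<ominus>\<^bsub>A\<^esub> (?b \<otimes>\<^bsub>A\<^esub> q g2)) \<oplus>\<^bsub>A\<^esub> m) = \<ominus>\<^bsub>A'\<^esub> ?t"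
      using npi[OF m(1) e] ab mA by (simp add: A.r_minus A.m_assoc A'.m_assoc A'.r_minus)
    ultimately have "val (i + j) (cmp j \<phi> \<psi>) = ?t" using m(2) e by (simp add: val_def)
    then show ?thesis using o ab by (simp add: val_def theta_mult_def f2_def q'_def[symmetric])
  qed
qed

definition idc :: "int \<Rightarrow> _" where "idc = (\<lambda>i. \<lambda>x\<in>carrier (sres Aev M i). x)"

lemma idc: "idc \<in> Z 0" "per.ev 0 idc = \<one>\<^bsub>A\<^esub>"
proof -
  interpret F: module Aev per.F by (rule per.F_module)
  have c: "idc \<in> carrier (hcpx Aev M M 0)"
    unfolding idc_def by (rule hom_cpx_restrictI[OF M_mod]) (simp add: per.id_lin)
  have "res_bd Aev (idc i w) = sgn_ring Aev 0 \<odot>\<^bsub>per.F\<^esub> idc (i - 1) (res_bd Aev w)"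
    if w: "w \<in> carrier (sres Aev M i)" for i w
    using w lin_map_closed[OF per.bd_lin w] subsetD[OF sres_sub lin_map_closed[OF per.bd_lin w]]
    by (simp add: idc_def sgn_ring_def)
  then show "idc \<in> Z 0" using cocycles_iff[OF M_mod M_mod, of idc 0] c by simp
  show "per.ev 0 idc = \<one>\<^bsub>A\<^esub>" by (simp add: per.ev_def idc_def)
qed

interpretation Xt: module Aev "Xt n" for n by (rule Ext_module[OF M_mod M_mod])
interpretation Tn: abelian_group "T n" for n by (rule T_abelian_group)

lemma Ex_cases: assumes "U \<in> carrier (Xt n)" obtains \<phi> where "\<phi> \<in> Z n" "U = cl n \<phi>"
  using assms Ext_carrier[OF M_mod M_mod, of n] by blast

text \<open>By \<open>e_cl\<close> the choice of representative is immaterial. In degree 0 the full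
  information is in \<open>e0\<close>, of which \<open>e 0\<close> is the image in
  \<open>A'\<close>.\<close>

definition e where "e n U = val n (SOME \<phi>. \<phi> \<in> U)"
definition e0 where "e0 U = per.ev 0 (SOME \<phi>. \<phi> \<in> U)"

lemma e_cl [simp]:
  assumes "\<phi> \<in> Z n"
  shows "e n (cl n \<phi>) = val n \<phi>"
proof -
  let ?\<psi> = "SOME \<psi>. \<psi> \<in> cl n \<phi>"
  have "?\<psi> \<in> cl n \<phi>" by (rule someI[where P = "\<lambda>\<psi>. \<psi> \<in> _", OF ext_class_self[OF M_mod M_mod assms]])
  from ext_class_elem[OF M_mod M_mod assms this] have \<psi>: "?\<psi> \<in> Z n" "cl n ?\<psi> = cl n \<phi>" by auto
  show ?thesis
  proof (cases "n = 0")
    case True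
    then show ?thesis using ev_zero_eq_iff[of ?\<psi> \<phi>] \<psi> assms by (simp add: e_def val_def)
  next
    case False
    then show ?thesis using val_eq_iff[OF \<psi>(1) assms False] \<psi>(2) by (simp add: e_def)
  qed
qed

lemma e0_cl [simp]:
  assumes "\<phi> \<in> Z 0"
  shows "e0 (cl 0 \<phi>) = per.ev 0 \<phi>"
proof -
  let ?\<psi> = "SOME \<psi>. \<psi> \<in> cl 0 \<phi>"
  have "?\<psi> \<in> cl 0 \<phi>" by (rule someI[where P = "\<lambda>\<psi>. \<psi> \<in> _", OF ext_class_self[OF M_mod M_mod assms]])
  from ext_class_elem[OF M_mod M_mod assms this] have "?\<psi> \<in> Z 0" "cl 0 ?\<psi> = cl 0 \<phi>" by auto
  then show ?thesis using ev_zero_eq_iff[of ?\<psi> \<phi>] assms by (simp add: e0_def)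
qed

lemma e_closed [simp]: "U \<in> carrier (Xt n) \<Longrightarrow> e n U \<in> carrier (T n)"
  by (elim Ex_cases) (simp add: val_closed)
lemma e0_closed [simp]: "U \<in> carrier (Xt 0) \<Longrightarrow> e0 U \<in> carrier A"
  by (elim Ex_cases) (use ev_closed[of _ 0] in simp)
lemma e_e0: "U \<in> carrier (Xt 0) \<Longrightarrow> e 0 U = \<pi> (e0 U)"
  by (elim Ex_cases) (simp add: val_def)

lemma e_inj: "U \<in> carrier (Xt n) \<Longrightarrow> V \<in> carrier (Xt n) \<Longrightarrow> n \<noteq> 0 \<Longrightarrow> e n U = e n V \<Longrightarrow> U = V"
  by (elim Ex_cases) (simp add: val_eq_iff)
lemma e0_inj: "U \<in> carrier (Xt 0) \<Longrightarrow> V \<in> carrier (Xt 0) \<Longrightarrow> e0 U = e0 V \<Longrightarrow> U = V"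
  by (elim Ex_cases) (simp add: ev_zero_eq_iff)
lemma e_surj: "b \<in> carrier (T n) \<Longrightarrow> \<exists>U\<in>carrier (Xt n). e n U = b"
  using val_surj[of b n] Ext_carrier[OF M_mod M_mod, of n] by auto
lemma e0_surj: "a \<in> carrier A \<Longrightarrow> \<exists>U\<in>carrier (Xt 0). e0 U = a"
  using ev_zero_surj[of a] Ext_carrier[OF M_mod M_mod, of 0] by auto

lemma Z_add: "\<phi> \<in> Z n \<Longrightarrow> \<psi> \<in> Z n \<Longrightarrow> \<phi> \<oplus>\<^bsub>hcpx Aev M M (int n)\<^esub> \<psi> \<in> Z n"
  using module.submoduleE(5)[OF hom_cpx_module[OF M_mod M_mod] cocycles_submodule[OF M_mod M_mod]] .
lemma Z_smult: "r \<in> carrier Aev \<Longrightarrow> \<phi> \<in> Z n \<Longrightarrow> r \<odot>\<^bsub>hcpx Aev M M (int n)\<^esub> \<phi> \<in> Z n"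
  using module.submoduleE(4)[OF hom_cpx_module[OF M_mod M_mod] cocycles_submodule[OF M_mod M_mod]] .

lemma Z_ev_add:
  assumes "\<phi> \<in> Z n" "\<psi> \<in> Z n"
  shows "per.ev (int n) (\<phi> \<oplus>\<^bsub>hcpx Aev M M (int n)\<^esub> \<psi>) = per.ev (int n) \<phi> \<oplus>\<^bsub>A\<^esub> per.ev (int n) \<psi>"
  using lin_map_add[OF ev_lin, of \<phi> "int n" \<psi>] assms by simp
lemma Z_ev_smult:
  assumes "\<phi> \<in> Z n" "r \<in> carrier Aev"
  shows "per.ev (int n) (r \<odot>\<^bsub>hcpx Aev M M (int n)\<^esub> \<phi>) = \<mu> r \<otimes>\<^bsub>A\<^esub> per.ev (int n) \<phi>"
  using lin_map_smult[OF ev_lin assms(2), of \<phi> "int n"] assms by simp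

lemma e_add: "U \<in> carrier (Xt n) \<Longrightarrow> V \<in> carrier (Xt n) \<Longrightarrow> e n (U \<oplus>\<^bsub>Xt n\<^esub> V) = e n U \<oplus>\<^bsub>T n\<^esub> e n V"
  by (elim Ex_cases) (simp add: Ext_add[OF M_mod M_mod] Z_add, simp add: val_def Z_ev_add T_add)
lemma e0_add: "U \<in> carrier (Xt 0) \<Longrightarrow> V \<in> carrier (Xt 0) \<Longrightarrow> e0 (U \<oplus>\<^bsub>Xt 0\<^esub> V) = e0 U \<oplus>\<^bsub>A\<^esub> e0 V"
  by (elim Ex_cases) (use Z_add[where n = 0] Z_ev_add[where n = 0] in \<open>simp add: Ext_add[OF M_mod M_mod]\<close>)

lemma unit_map_closed [simp]: "c \<in> carrier K \<Longrightarrow> unit_map Aev c \<in> carrier Aev"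
  and \<mu>_unit_map [simp]: "c \<in> carrier K \<Longrightarrow> \<mu> (unit_map Aev c) = c \<odot>\<^bsub>A\<^esub> \<one>\<^bsub>A\<^esub>"
  using module.smult_closed[OF algebra.module[OF A_algebra], of c "\<one>\<^bsub>A\<^esub>"]
  by (simp_all add: tensor_unit_map[OF A_algebra A_algebra])

lemma A_smult: "c \<in> carrier K \<Longrightarrow> a \<in> carrier A \<Longrightarrow> (c \<odot>\<^bsub>A\<^esub> \<one>\<^bsub>A\<^esub>) \<otimes>\<^bsub>A\<^esub> a = c \<odot>\<^bsub>A\<^esub> a"
  using algebra.smult_assoc2[OF A_algebra, of c "\<one>\<^bsub>A\<^esub>" a] by simp
lemma A'_smult: "c \<in> carrier K \<Longrightarrow> a \<in> carrier A' \<Longrightarrow> (c \<odot>\<^bsub>A'\<^esub> \<one>\<^bsub>A'\<^esub>) \<otimes>\<^bsub>A'\<^esub> a = c \<odot>\<^bsub>A'\<^esub> a"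
  using algebra.smult_assoc2[OF A'_algebra, of c "\<one>\<^bsub>A'\<^esub>" a] by simp

lemma e_smult:
  "c \<in> carrier K \<Longrightarrow> U \<in> carrier (Xt n) \<Longrightarrow> e n (unit_map Aev c \<odot>\<^bsub>Xt n\<^esub> U) = c \<odot>\<^bsub>T n\<^esub> e n U"
  by (elim Ex_cases) (simp add: Ext_smult[OF M_mod M_mod] Z_smult,
    simp add: val_def Z_ev_smult T_smult A_smult proj_smult)
lemma e0_smult:
  "c \<in> carrier K \<Longrightarrow> U \<in> carrier (Xt 0) \<Longrightarrow> e0 (unit_map Aev c \<odot>\<^bsub>Xt 0\<^esub> U) = c \<odot>\<^bsub>A\<^esub> e0 U"
  by (elim Ex_cases) (use Z_smult[where n = 0] Z_ev_smult[where n = 0] ev_closed[where n = 0] in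
    \<open>simp add: Ext_smult[OF M_mod M_mod] A_smult\<close>)

lemma e_zero [simp]: "e n \<zero>\<^bsub>Xt n\<^esub> = \<zero>\<^bsub>T n\<^esub>"
  using e_add[of "\<zero>\<^bsub>Xt n\<^esub>" n "\<zero>\<^bsub>Xt n\<^esub>"] e_closed[of "\<zero>\<^bsub>Xt n\<^esub>" n] by simp
lemma e0_zero [simp]: "e0 \<zero>\<^bsub>Xt 0\<^esub> = \<zero>\<^bsub>A\<^esub>"
  using e0_add[of "\<zero>\<^bsub>Xt 0\<^esub>" "\<zero>\<^bsub>Xt 0\<^esub>"] e0_closed[of "\<zero>\<^bsub>Xt 0\<^esub>"] by simp

lemma e_zero_iff: "U \<in> carrier (Xt n) \<Longrightarrow> n \<noteq> 0 \<Longrightarrow> e n U = \<zero>\<^bsub>T n\<^esub> \<longleftrightarrow> U = \<zero>\<^bsub>Xt n\<^esub>"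
  using e_inj[of U n "\<zero>\<^bsub>Xt n\<^esub>"] by auto
lemma e0_zero_iff: "U \<in> carrier (Xt 0) \<Longrightarrow> e0 U = \<zero>\<^bsub>A\<^esub> \<longleftrightarrow> U = \<zero>\<^bsub>Xt 0\<^esub>"
  using e0_inj[of U "\<zero>\<^bsub>Xt 0\<^esub>"] by auto

abbreviation "ym \<equiv> yoneda_mult Aev M"

text \<open>The union in \<open>yoneda_mult\<close> runs over all representatives. They yield one
  class because values determine classes and the value of a composite depends only on the values of
  its factors; in total degree 0 the values in \<open>A\<close> are used.\<close>

lemma ym_cl:
  assumes \<phi>: "\<phi> \<in> Z i" and \<psi>: "\<psi> \<in> Z j"
  shows "ym i j (cl i \<phi>) (cl j \<psi>) = cl (i + j) (cmp j \<phi> \<psi>)"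
proof -
  have "cl (i + j) (cmp j \<phi>' \<psi>') = cl (i + j) (cmp j \<phi> \<psi>)" if "\<phi>' \<in> cl i \<phi>" "\<psi>' \<in> cl j \<psi>" for \<phi>' \<psi>'
  proof -
    note \<phi>' = ext_class_elem[OF M_mod M_mod \<phi> that(1)] and \<psi>' = ext_class_elem[OF M_mod M_mod \<psi> that(2)]
    show ?thesis
    proof (cases "i + j = 0")
      case True
      then have ij: "i = 0" "j = 0" by auto
      have "per.ev 0 \<phi>' = per.ev 0 \<phi>" "per.ev 0 \<psi>' = per.ev 0 \<psi>"
        using ev_zero_eq_iff \<phi> \<psi> \<phi>' \<psi>' unfolding ij by blast+
      then show ?thesis
        using ev_zero_eq_iff[OF cmp_closed[of \<phi>' 0 \<psi>' 0, unfolded add_0] cmp_closed[of \<phi> 0 \<psi> 0, unfolded add_0]]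
          ev_zero_cmp \<phi> \<psi> \<phi>' \<psi>' unfolding ij by simp
    next
      case False
      have "val i \<phi>' = val i \<phi>" "val j \<psi>' = val j \<psi>"
        using e_cl[OF \<phi>] e_cl[OF \<phi>'(1)] e_cl[OF \<psi>] e_cl[OF \<psi>'(1)] \<phi>'(2) \<psi>'(2) by simp_all
      then show ?thesis
        using val_eq_iff[OF cmp_closed[OF \<phi>'(1) \<psi>'(1)] cmp_closed[OF \<phi> \<psi>] False]
          val_cmp[OF \<phi> \<psi>] val_cmp[OF \<phi>'(1) \<psi>'(1)] by simp
    qed
  qed
  moreover have "\<phi> \<in> cl i \<phi>" "\<psi> \<in> cl j \<psi>" using ext_class_self[OF M_mod M_mod] \<phi> \<psi> by auto
  ultimately show ?thesis unfolding yoneda_mult_def ext_class_def[symmetric] by blast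
qed

lemma ym_closed: "U \<in> carrier (Xt i) \<Longrightarrow> V \<in> carrier (Xt j) \<Longrightarrow> ym i j U V \<in> carrier (Xt (i + j))"
  by (elim Ex_cases) (simp add: ym_cl Ext_carrier[OF M_mod M_mod] cmp_closed del: of_nat_add)

lemma e_ym: "U \<in> carrier (Xt i) \<Longrightarrow> V \<in> carrier (Xt j) \<Longrightarrow> e (i + j) (ym i j U V) = theta_mult K f i j (e i U) (e j V)"
  by (elim Ex_cases) (simp add: ym_cl cmp_closed val_cmp del: of_nat_add)

lemma e0_ym: "U \<in> carrier (Xt 0) \<Longrightarrow> V \<in> carrier (Xt 0) \<Longrightarrow> e0 (ym 0 0 U V) = e0 U \<otimes>\<^bsub>A\<^esub> e0 V"
  by (elim Ex_cases) (use ym_cl[where i = 0 and j = 0] cmp_closed[where i = 0 and j = 0] ev_zero_cmp in simp)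

lemma yone: "yoneda_one Aev M = cl 0 idc"
  by (simp add: yoneda_one_def ext_class_def idc_def)

lemma yone_closed: "yoneda_one Aev M \<in> carrier (Xt 0)"
  unfolding yone using idc(1) Ext_carrier[OF M_mod M_mod, of 0] by simp

lemma e0_one: "e0 (yoneda_one Aev M) = \<one>\<^bsub>A\<^esub>"
  unfolding yone using idc by simp

abbreviation "EA \<equiv> Ext_algebra Aev M"

lemma EA_carrier: "carrier EA = {x. (\<forall>n. x n \<in> carrier (Xt n)) \<and> finite {n. x n \<noteq> \<zero>\<^bsub>Xt n\<^esub>}}"
  by (simp add: Ext_algebra_def)

lemma EA_mult: "(x \<otimes>\<^bsub>EA\<^esub> y) n = (\<Oplus>\<^bsub>Xt n\<^esub>i\<in>{..n}. ym i (n - i) (x i) (y (n - i)))"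
  by (simp add: Ext_algebra_def)

lemma EA_one: "\<one>\<^bsub>EA\<^esub> = (\<lambda>n. if n = 0 then yoneda_one Aev M else \<zero>\<^bsub>Xt n\<^esub>)"
  and EA_add: "x \<oplus>\<^bsub>EA\<^esub> y = (\<lambda>n. x n \<oplus>\<^bsub>Xt n\<^esub> y n)"
  and EA_smult: "r \<odot>\<^bsub>EA\<^esub> x = (\<lambda>n. r \<odot>\<^bsub>Xt n\<^esub> x n)"
  by (simp_all add: Ext_algebra_def)

lemma ym_closed':
  assumes "x \<in> carrier EA" "y \<in> carrier EA"
  shows "(\<lambda>i. ym i (n - i) (x i) (y (n - i))) \<in> {..n} \<rightarrow> carrier (Xt n)"
proof
  fix i assume "i \<in> {..n}"
  then show "ym i (n - i) (x i) (y (n - i)) \<in> carrier (Xt n)"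
    using ym_closed[of "x i" i "y (n - i)" "n - i"] assms by (simp add: EA_carrier)
qed

lemma e_mult:
  assumes "x \<in> carrier EA" "y \<in> carrier EA"
  shows "e n ((x \<otimes>\<^bsub>EA\<^esub> y) n) = (\<Oplus>\<^bsub>T n\<^esub>i\<in>{..n}. theta_mult K f i (n - i) (e i (x i)) (e (n - i) (y (n - i))))"
proof -
  have "e n ((x \<otimes>\<^bsub>EA\<^esub> y) n) = (\<Oplus>\<^bsub>T n\<^esub>i\<in>{..n}. e n (ym i (n - i) (x i) (y (n - i))))"
    unfolding EA_mult
    by (rule finsum_hom[OF Xt.abelian_group_axioms Tn.abelian_group_axioms _ _ _ _ ym_closed'[OF assms]])
       (simp_all add: e_add)
  also have "\<dots> = (\<Oplus>\<^bsub>T n\<^esub>i\<in>{..n}. theta_mult K f i (n - i) (e i (x i)) (e (n - i) (y (n - i))))"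
  proof (rule Tn.finsum_cong')
    have *: "e n (ym i (n - i) (x i) (y (n - i))) = theta_mult K f i (n - i) (e i (x i)) (e (n - i) (y (n - i)))"
      if "i \<in> {..n}" for i
      using e_ym[of "x i" i "y (n - i)" "n - i"] that assms by (simp add: EA_carrier)
    show "e n (ym i (n - i) (x i) (y (n - i))) = theta_mult K f i (n - i) (e i (x i)) (e (n - i) (y (n - i)))"
      if "i \<in> {..n}" for i by (rule *[OF that])
    show "(\<lambda>i. theta_mult K f i (n - i) (e i (x i)) (e (n - i) (y (n - i)))) \<in> {..n} \<rightarrow> carrier (T n)"
    proof
      fix i assume i: "i \<in> {..n}"
      show "theta_mult K f i (n - i) (e i (x i)) (e (n - i) (y (n - i))) \<in> carrier (T n)"
        unfolding *[OF i, symmetric] using ym_closed'[OF assms, of n] i by (intro e_closed) (auto simp: Pi_iff)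
    qed
  qed simp
  finally show ?thesis .
qed

lemma e0_mult:
  assumes "x \<in> carrier EA" "y \<in> carrier EA"
  shows "e0 ((x \<otimes>\<^bsub>EA\<^esub> y) 0) = e0 (x 0) \<otimes>\<^bsub>A\<^esub> e0 (y 0)"
  using assms ym_closed[of "x 0" 0 "y 0" 0] e0_ym by (simp add: EA_mult EA_carrier)

end

context hypersurface
begin

interpretation Xt: module Aev "Xt n" for n by (rule Ext_module[OF M_mod M_mod])
interpretation Tn: abelian_group "T n" for n by (rule T_abelian_group)

section \<open>The isomorphism with the fibre product\<close>

abbreviation "E \<equiv> restrict_scalars (unit_map Aev) EA"
abbreviation "B \<equiv> theta_alg K f"
abbreviation "FB \<equiv> fibre_product A B \<pi> (\<lambda>b. b 0)"

text \<open>Degree 0 appears twice, as an element of \<open>A\<close> and through its image in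
  \<open>A'\<close>; this is the compatibility required in the fibre product.\<close>

definition ext_iso where "ext_iso x = (e0 (x 0), \<lambda>n. e n (x n))"

lemma B_carrier: "carrier B = {b. (\<forall>n. b n \<in> carrier (T n)) \<and> finite {n. b n \<noteq> \<zero>\<^bsub>T n\<^esub>}}"
  by (simp add: theta_alg_def)

lemma part_closed:
  assumes "x \<in> Ext_part Aev M n"
  shows "x \<in> carrier EA"
proof -
  have x: "x n \<in> carrier (Xt n)" "\<And>m. m \<noteq> n \<Longrightarrow> x m = \<zero>\<^bsub>Xt m\<^esub>"
    using assms by (auto simp: Ext_part_def graded_part_def)
  have "x m \<in> carrier (Xt m)" for m using x by (cases "m = n") auto
  moreover have "finite {m. x m \<noteq> \<zero>\<^bsub>Xt m\<^esub>}"
    by (rule finite_subset[of _ "{n}"]) (use x(2) in auto)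
  ultimately show ?thesis by (simp add: EA_carrier)
qed

lemma ext_iso_closed:
  assumes "x \<in> carrier EA"
  shows "ext_iso x \<in> carrier FB"
proof -
  have x: "x n \<in> carrier (Xt n)" for n using assms by (simp add: EA_carrier)
  have "finite {n. e n (x n) \<noteq> \<zero>\<^bsub>T n\<^esub>}"
    by (rule finite_subset[of _ "{n. x n \<noteq> \<zero>\<^bsub>Xt n\<^esub>}"]) (use assms in \<open>auto simp: EA_carrier\<close>)
  then show ?thesis using x e_e0[OF x] by (simp add: ext_iso_def B_carrier)
qed

lemma ext_iso_inj:
  assumes "x \<in> carrier EA" "y \<in> carrier EA" "ext_iso x = ext_iso y"
  shows "x = y"
proof
  fix n
  have x: "x n \<in> carrier (Xt n)" and y: "y n \<in> carrier (Xt n)" for n using assms by (simp_all add: EA_carrier)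
  have 0: "e0 (x 0) = e0 (y 0)" and n: "e n (x n) = e n (y n)"
    using assms(3) by (simp_all add: ext_iso_def fun_eq_iff)
  show "x n = y n"
    by (cases "n = 0") (use e0_inj[OF x y 0] e_inj[OF x y _ n] in auto)
qed

text \<open>In degree 0 the preimage is chosen through \<open>e0\<close>, and the gluing condition
  then makes \<open>e 0\<close> right as well. Serves both the full algebra and the even
  part.\<close>

lemma ext_lift:
  assumes a: "a \<in> carrier A" and b: "\<And>n. b n \<in> carrier (T n)" and fin: "finite {n. b n \<noteq> \<zero>\<^bsub>T n\<^esub>}"
    and ab: "\<pi> a = b 0"
  shows "\<exists>x\<in>carrier EA. e0 (x 0) = a \<and> (\<forall>n. e n (x n) = b n)"
proof -
  have "\<exists>U\<in>carrier (Xt n). (n = 0 \<longrightarrow> e0 U = a) \<and> e n U = b n" for n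
  proof (cases "n = 0")
    case True
    then show ?thesis using e0_surj[OF a] e_e0 ab by auto
  next
    case False
    then show ?thesis using e_surj[OF b] by auto
  qed
  then obtain x where x: "\<And>n. x n \<in> carrier (Xt n)" "e0 (x 0) = a" "\<And>n. e n (x n) = b n" by metis
  \<comment> \<open>Degree 0 is added because \<open>x 0\<close> may be nonzero although its image
    \<open>b 0\<close> vanishes.\<close>
  have "{n. x n \<noteq> \<zero>\<^bsub>Xt n\<^esub>} \<subseteq> insert 0 {n. b n \<noteq> \<zero>\<^bsub>T n\<^esub>}"
    using x(3) e_zero_iff[OF x(1)] by (metis (mono_tags, lifting) insertI1 insertI2 mem_Collect_eq subsetI)
  then have "finite {n. x n \<noteq> \<zero>\<^bsub>Xt n\<^esub>}" by (rule finite_subset) (use fin in simp)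
  then show ?thesis using x by (intro bexI[of _ x]) (simp_all add: EA_carrier)
qed

lemma ext_iso_surj:
  assumes "z \<in> carrier FB"
  shows "\<exists>x\<in>carrier EA. ext_iso x = z"
proof -
  obtain x where "x \<in> carrier EA" "e0 (x 0) = fst z" "\<forall>n. e n (x n) = snd z n"
    using ext_lift[of "fst z" "snd z"] assms by (auto simp: B_carrier)
  then show ?thesis by (intro bexI[of _ x]) (simp_all add: ext_iso_def prod_eq_iff)
qed

lemma ext_iso_part:
  "ext_iso ` Ext_part Aev M n = fibre_part A B \<pi> (\<lambda>b. b 0) (theta_part K f) n"
proof (intro equalityI subsetI)
  fix z assume "z \<in> ext_iso ` Ext_part Aev M n"
  then obtain x where x: "x \<in> Ext_part Aev M n" "z = ext_iso x" by blast
  have c: "x m \<in> carrier (Xt m)" for m using part_closed[OF x(1)] by (simp add: EA_carrier)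
  have 0: "x m = \<zero>\<^bsub>Xt m\<^esub>" if "m \<noteq> n" for m using x(1) that by (simp add: Ext_part_def graded_part_def)
  show "z \<in> fibre_part A B \<pi> (\<lambda>b. b 0) (theta_part K f) n"
    using ext_iso_closed[OF part_closed[OF x(1)]] c 0
    by (auto simp: fibre_part_def theta_part_def graded_part_def x(2) ext_iso_def simp del: fibre_product_sel)
next
  fix z assume z: "z \<in> fibre_part A B \<pi> (\<lambda>b. b 0) (theta_part K f) n"
  then have "z \<in> carrier FB" unfolding fibre_part_def by blast
  then obtain x where x: "x \<in> carrier EA" "ext_iso x = z" using ext_iso_surj by blast
  have c: "x m \<in> carrier (Xt m)" for m using x(1) by (simp add: EA_carrier)
  have "x m = \<zero>\<^bsub>Xt m\<^esub>" if m: "m \<noteq> n" for m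
  \<comment> \<open>In degree 0 vanishing has to be read off from the first component, since
    \<open>e 0\<close> alone does not determine the class.\<close>
  proof (cases "m = 0")
    case True
    then have "e0 (x 0) = \<zero>\<^bsub>A\<^esub>" using z m x(2) by (auto simp: fibre_part_def ext_iso_def)
    then show ?thesis using e0_zero_iff[OF c] True by simp
  next
    case False
    have "e m (x m) = \<zero>\<^bsub>T m\<^esub>" using z m x(2) by (auto simp: fibre_part_def theta_part_def graded_part_def ext_iso_def)
    then show ?thesis using e_zero_iff[OF c False] by simp
  qed
  then have "x \<in> Ext_part Aev M n" using c by (simp add: Ext_part_def graded_part_def)
  then show "z \<in> ext_iso ` Ext_part Aev M n" using x(2) by blast
qed

lemma ext_iso_hom: "ext_iso \<in> ring_hom E FB"
proof (rule ring_hom_memI)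
  fix x y assume xy: "x \<in> carrier E" "y \<in> carrier E"
  then have x: "x n \<in> carrier (Xt n)" and y: "y n \<in> carrier (Xt n)" for n by (simp_all add: EA_carrier)
  show "ext_iso x \<in> carrier FB" using ext_iso_closed xy by simp
  show "ext_iso (x \<otimes>\<^bsub>E\<^esub> y) = ext_iso x \<otimes>\<^bsub>FB\<^esub> ext_iso y"
    using xy by (simp add: ext_iso_def e0_mult e_mult theta_alg_def)
  show "ext_iso (x \<oplus>\<^bsub>E\<^esub> y) = ext_iso x \<oplus>\<^bsub>FB\<^esub> ext_iso y"
    using x y by (simp add: ext_iso_def EA_add e_add e0_add theta_alg_def)
next
  have "e 0 (yoneda_one Aev M) = \<one>\<^bsub>A'\<^esub>" using e_e0[OF yone_closed] by (simp add: e0_one)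
  then show "ext_iso \<one>\<^bsub>E\<^esub> = \<one>\<^bsub>FB\<^esub>"
    by (simp add: ext_iso_def EA_one e0_one theta_alg_def fun_eq_iff)
qed

lemma ext_algebra_iso:
  "graded_algebra_iso K E (Ext_part Aev M) FB (fibre_part A B \<pi> (\<lambda>b. b 0) (theta_part K f)) ext_iso"
  unfolding graded_algebra_iso_def ring_iso_def
proof (intro conjI allI ballI CollectI)
  show "ext_iso \<in> ring_hom E FB" by (rule ext_iso_hom)
  show "bij_betw ext_iso (carrier E) (carrier FB)"
    unfolding bij_betw_def inj_on_def using ext_iso_inj ext_iso_closed ext_iso_surj by (simp del: fibre_product_sel) blast
  show "ext_iso (c \<odot>\<^bsub>E\<^esub> x) = c \<odot>\<^bsub>FB\<^esub> ext_iso x" if "c \<in> carrier K" "x \<in> carrier E" for c x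
    using that by (simp add: ext_iso_def EA_smult EA_carrier e_smult e0_smult theta_alg_def)
qed (rule ext_iso_part)

section \<open>Products of homogeneous elements and graded commutativity\<close>

lemma ym_zero:
  "V \<in> carrier (Xt j) \<Longrightarrow> ym i j \<zero>\<^bsub>Xt i\<^esub> V = \<zero>\<^bsub>Xt (i + j)\<^esub>"
  "U \<in> carrier (Xt i) \<Longrightarrow> ym i j U \<zero>\<^bsub>Xt j\<^esub> = \<zero>\<^bsub>Xt (i + j)\<^esub>"
proof -
  have ta: "theta_act K f \<zero>\<^bsub>A'\<^esub> b = \<zero>\<^bsub>A\<^esub>" if "b \<in> theta K f" for b
    using theta_act_proj[OF A.zero_closed that] theta_closed[OF that] by simp
  have ta': "theta_act K f b \<zero>\<^bsub>A\<^esub> = \<zero>\<^bsub>A\<^esub>" if b: "b \<in> carrier A'" for b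
  proof -
    obtain a where "a \<in> carrier A" "\<pi> a = b" using proj_surj[OF b] by blast
    then show ?thesis using theta_act_proj[of a "\<zero>\<^bsub>A\<^esub>"] by (auto simp: theta_iff)
  qed
  have f2: "f2 K f \<in> carrier A'" using q'.hom_closed[OF g2_closed] by (simp add: f2_def q'_def)
  have tm: "theta_mult K f i j \<zero>\<^bsub>T i\<^esub> b = \<zero>\<^bsub>T (i + j)\<^esub>" if "b \<in> carrier (T j)" for b
    using that ta ta' theta_closed f2 by (auto simp: theta_mult_def T_zero T_carrier)
  have tm': "theta_mult K f i j b \<zero>\<^bsub>T j\<^esub> = \<zero>\<^bsub>T (i + j)\<^esub>" if "b \<in> carrier (T i)" for b
    using that ta ta' theta_closed f2 by (auto simp: theta_mult_def T_zero T_carrier)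
  \<comment> \<open>Vanishing of a product is tested on its values, by \<open>e0\<close> in total
    degree 0 and by \<open>e\<close> elsewhere.\<close>
  have key: "W = \<zero>\<^bsub>Xt (i + j)\<^esub>"
    if "W \<in> carrier (Xt (i + j))" "e (i + j) W = \<zero>\<^bsub>T (i + j)\<^esub>" "i + j = 0 \<Longrightarrow> e0 W = \<zero>\<^bsub>A\<^esub>" for W
    using that e_zero_iff[of W "i + j"] e0_zero_iff[of W] by (cases "i + j = 0") auto
  show "ym i j \<zero>\<^bsub>Xt i\<^esub> V = \<zero>\<^bsub>Xt (i + j)\<^esub>" if V: "V \<in> carrier (Xt j)"
  proof (rule key)
    show "e0 (ym i j \<zero>\<^bsub>Xt i\<^esub> V) = \<zero>\<^bsub>A\<^esub>" if "i + j = 0"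
      using that V e0_ym[of "\<zero>\<^bsub>Xt 0\<^esub>" V] by simp
  qed (use V ym_closed e_ym[of "\<zero>\<^bsub>Xt i\<^esub>" i V j] tm in simp_all)
  show "ym i j U \<zero>\<^bsub>Xt j\<^esub> = \<zero>\<^bsub>Xt (i + j)\<^esub>" if U: "U \<in> carrier (Xt i)"
  proof (rule key)
    show "e0 (ym i j U \<zero>\<^bsub>Xt j\<^esub>) = \<zero>\<^bsub>A\<^esub>" if "i + j = 0"
      using that U e0_ym[of U "\<zero>\<^bsub>Xt 0\<^esub>"] by simp
  qed (use U ym_closed e_ym[of U i "\<zero>\<^bsub>Xt j\<^esub>" j] tm' in simp_all)
qed

lemma part_mult:
  assumes x: "x \<in> Ext_part Aev M m" and y: "y \<in> Ext_part Aev M n"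
  shows "(x \<otimes>\<^bsub>EA\<^esub> y) k = (if k = m + n then ym m n (x m) (y n) else \<zero>\<^bsub>Xt k\<^esub>)"
proof -
  have xy: "x i \<in> carrier (Xt i)" "y i \<in> carrier (Xt i)" for i
    using part_closed[OF x] part_closed[OF y] by (simp_all add: EA_carrier)
  have x0: "x i = \<zero>\<^bsub>Xt i\<^esub>" if "i \<noteq> m" for i using x that by (simp add: Ext_part_def graded_part_def)
  have y0: "y i = \<zero>\<^bsub>Xt i\<^esub>" if "i \<noteq> n" for i using y that by (simp add: Ext_part_def graded_part_def)
  have z: "ym i (k - i) (x i) (y (k - i)) = (if i = m \<and> k = m + n then ym m n (x m) (y n) else \<zero>\<^bsub>Xt k\<^esub>)"
    if ik: "i \<le> k" for i
  proof (cases "i = m \<and> k = m + n")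
    case False
    then consider "i \<noteq> m" | "k - i \<noteq> n" using ik by fastforce
    then have "ym i (k - i) (x i) (y (k - i)) = \<zero>\<^bsub>Xt k\<^esub>"
    proof cases
      case 1
      then show ?thesis using ym_zero(1)[of "y (k - i)" "k - i" i] xy x0[of i] ik by simp
    next
      case 2
      then show ?thesis using ym_zero(2)[of "x i" i "k - i"] xy y0[of "k - i"] ik by simp
    qed
    then show ?thesis using False by auto
  qed auto
  have "(x \<otimes>\<^bsub>EA\<^esub> y) k = (\<Oplus>\<^bsub>Xt k\<^esub>i\<in>{..k}. if m = i then (if k = m + n then ym m n (x m) (y n) else \<zero>\<^bsub>Xt k\<^esub>) else \<zero>\<^bsub>Xt k\<^esub>)"
    unfolding EA_mult
    by (rule Xt.M.finsum_cong') (use z ym_closed[OF xy, of m n] in \<open>auto split: if_splits\<close>)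
  also have "\<dots> = (if k = m + n then ym m n (x m) (y n) else \<zero>\<^bsub>Xt k\<^esub>)"
  proof (cases "k = m + n")
    case True
    then show ?thesis
      using Xt.M.finsum_singleton[of m "{..k}" "\<lambda>_. ym m n (x m) (y n)" k] ym_closed[OF xy, of m n] by simp
  qed simp
  finally show ?thesis .
qed

lemma theta_mult_comm:
  assumes "a \<in> carrier (T m)" "b \<in> carrier (T n)"
  shows "theta_mult K f m n a b = theta_mult K f n m b a"
  using assms theta_closed by (auto simp: theta_mult_def T_carrier A.m_comm A'.m_comm)

text \<open>The values multiply commutatively even in odd degrees. Graded commutativity still holds
  because \<open>theta_two_torsion\<close> makes a product of two odd classes its own
  negative.\<close>

lemma ym_comm:
  assumes U: "U \<in> carrier (Xt m)" and V: "V \<in> carrier (Xt n)"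
  shows "ym m n U V = ym n m V U" and "odd m \<Longrightarrow> odd n \<Longrightarrow> \<ominus>\<^bsub>Xt (m + n)\<^esub> ym n m V U = ym n m V U"
proof -
  have c: "ym m n U V \<in> carrier (Xt (m + n))" "ym n m V U \<in> carrier (Xt (m + n))"
    using ym_closed[OF U V] ym_closed[OF V U] by (simp_all add: add.commute)
  have eq: "e (m + n) (ym m n U V) = e (m + n) (ym n m V U)"
    using e_ym[OF U V] e_ym[OF V U] theta_mult_comm[of "e m U" m "e n V" n] U V by (simp add: add.commute)
  show "ym m n U V = ym n m V U"
  proof (cases "m + n = 0")
    case True
    then have mn: "m = 0" "n = 0" by auto
    have "e0 (ym 0 0 U V) = e0 (ym 0 0 V U)"
      using e0_ym[of U V] e0_ym[of V U] U V unfolding mn by (simp add: A.m_comm)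
    then show ?thesis using e0_inj c unfolding mn by simp
  next
    case False
    then show ?thesis using e_inj[OF c False eq] by simp
  qed
  show "\<ominus>\<^bsub>Xt (m + n)\<^esub> ym n m V U = ym n m V U" if o: "odd m" "odd n"
  proof -
    let ?W = "ym n m V U" and ?a = "e m U" and ?b = "e n V"
    have t: "?a \<in> theta K f" "?b \<in> theta K f" using e_closed[OF U] e_closed[OF V] o by (simp_all add: T_carrier)
    have ab: "?a \<in> carrier A" "?b \<in> carrier A" using t theta_closed by auto
    have "e (m + n) ?W = \<pi> ((?b \<otimes>\<^bsub>A\<^esub> ?a) \<otimes>\<^bsub>A\<^esub> q g2)"
      using e_ym[OF V U] o ab by (simp add: theta_mult_def f2_def q'_def[symmetric] add.commute)
    moreover have "?b \<otimes>\<^bsub>A\<^esub> ?a \<in> theta K f" using t ab by (simp add: theta_iff A.m_assoc)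
    ultimately have "e (m + n) (?W \<oplus>\<^bsub>Xt (m + n)\<^esub> ?W) = \<zero>\<^bsub>T (m + n)\<^esub>"
      using theta_two_torsion[of "?b \<otimes>\<^bsub>A\<^esub> ?a"] o c(2) by (simp add: e_add T_add T_zero)
    moreover have "m + n \<noteq> 0" using o by auto
    ultimately have "?W \<oplus>\<^bsub>Xt (m + n)\<^esub> ?W = \<zero>\<^bsub>Xt (m + n)\<^esub>" using e_zero_iff c(2) by simp
    then show ?thesis using c(2) by (intro Xt.M.minus_equality)
  qed
qed

lemma ext_graded_commutative: "graded_commutative E (Ext_part Aev M)"
  unfolding graded_commutative_def
proof (intro allI ballI)
  fix m n x y assume x: "x \<in> Ext_part Aev M m" and y: "y \<in> Ext_part Aev M n"
  have c: "x m \<in> carrier (Xt m)" "y n \<in> carrier (Xt n)" using x y by (simp_all add: Ext_part_def graded_part_def)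
  note comm = ym_comm[OF c]
  have yx: "(y \<otimes>\<^bsub>EA\<^esub> x) = (\<lambda>k. if k = m + n then ym n m (y n) (x m) else \<zero>\<^bsub>Xt k\<^esub>)"
    using part_mult[OF y x] by (auto simp: fun_eq_iff add.commute)
  have eq: "x \<otimes>\<^bsub>EA\<^esub> y = y \<otimes>\<^bsub>EA\<^esub> x"
    unfolding yx using part_mult[OF x y] comm(1) by (auto simp: fun_eq_iff)
  have "\<ominus>\<^bsub>E\<^esub> (y \<otimes>\<^bsub>E\<^esub> x) = y \<otimes>\<^bsub>E\<^esub> x" if o: "odd m" "odd n"
  proof -
    let ?z = "y \<otimes>\<^bsub>EA\<^esub> x"
    have cl: "ym n m (y n) (x m) \<in> carrier (Xt (m + n))" using ym_closed[OF c(2,1)] by (simp add: add.commute)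
    have "finite {k. ?z k \<noteq> \<zero>\<^bsub>Xt k\<^esub>}" unfolding yx by (rule finite_subset[of _ "{m + n}"]) auto
    then have z: "?z \<in> carrier EA" using cl unfolding EA_carrier by (simp add: yx)
    have "\<ominus>\<^bsub>E\<^esub> ?z = \<ominus>\<^bsub>EA\<^esub> ?z" by (rule a_inv_cong) simp_all
    also have "\<dots> = (\<lambda>k. \<ominus>\<^bsub>Xt k\<^esub> ?z k)"
      using graded_sum_abelian_group(2)[of Xt, OF Xt.abelian_group_axioms] z unfolding Ext_algebra_def by blast
    also have "\<dots> = ?z"
    proof
      fix k
      have "\<ominus>\<^bsub>Xt k\<^esub> \<zero>\<^bsub>Xt k\<^esub> = \<zero>\<^bsub>Xt k\<^esub>" by (rule Xt.M.minus_equality) simp_all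
      then show "\<ominus>\<^bsub>Xt k\<^esub> ?z k = ?z k" using comm(2)[OF o] by (simp add: yx)
    qed
    finally show ?thesis by simp
  qed
  then show "x \<otimes>\<^bsub>E\<^esub> y = (if odd m \<and> odd n then \<ominus>\<^bsub>E\<^esub> (y \<otimes>\<^bsub>E\<^esub> x) else y \<otimes>\<^bsub>E\<^esub> x)"
    using eq by simp
qed

section \<open>The even part and the polynomial ring over \<open>A'\<close>\<close>

abbreviation "E_even \<equiv> restrict_scalars (unit_map Aev) (Ext_even_algebra Aev M)"
abbreviation "S \<equiv> poly_A' K f"
abbreviation "deg0_S \<equiv> (\<lambda>p. coeff (UP A') p 0)"
abbreviation "FS \<equiv> fibre_product A S \<pi> deg0_S"

definition even_iso where "even_iso x = (e0 (x 0), \<lambda>i. e (2 * i) (x (2 * i)))"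

lemma S_sel:
  "carrier S = up A'" "p \<in> up A' \<Longrightarrow> r \<in> up A' \<Longrightarrow> p \<otimes>\<^bsub>S\<^esub> r = (\<lambda>n. \<Oplus>\<^bsub>A'\<^esub>i\<in>{..n}. p i \<otimes>\<^bsub>A'\<^esub> r (n - i))"
  "p \<in> up A' \<Longrightarrow> r \<in> up A' \<Longrightarrow> p \<oplus>\<^bsub>S\<^esub> r = (\<lambda>n. p n \<oplus>\<^bsub>A'\<^esub> r n)"
  "\<one>\<^bsub>S\<^esub> = (\<lambda>i. if i = 0 then \<one>\<^bsub>A'\<^esub> else \<zero>\<^bsub>A'\<^esub>)"
  by (simp_all add: poly_A'_def UP_def)

lemma S_smult:
  assumes "c \<in> carrier K" "p \<in> up A'"
  shows "c \<odot>\<^bsub>S\<^esub> p = (\<lambda>i. c \<odot>\<^bsub>A'\<^esub> p i)"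
proof -
  have "unit_map A' c \<in> carrier A'"
    using module.smult_closed[OF algebra.module[OF A'_algebra] assms(1) A'.one_closed] by (simp add: unit_map_def)
  then have "c \<odot>\<^bsub>S\<^esub> p = (\<lambda>i. unit_map A' c \<otimes>\<^bsub>A'\<^esub> p i)" using assms(2) by (simp add: poly_A'_def UP_def)
  moreover have "p i \<in> carrier A'" for i using assms(2) by (rule mem_upD)
  ultimately show ?thesis using A'_smult[OF assms(1)] by (simp add: unit_map_def)
qed

lemma T_even [simp]: "T (2 * i) = A'"
  by (simp add: theta_comp_def)

lemma even_carrier: "carrier E_even = {x \<in> carrier EA. \<forall>n. odd n \<longrightarrow> x n = \<zero>\<^bsub>Xt n\<^esub>}"
  by (simp add: Ext_even_algebra_def)

lemma even_poly:
  assumes "x \<in> carrier EA"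
  shows "(\<lambda>i. e (2 * i) (x (2 * i))) \<in> up A'"
proof (rule mem_upI)
  have x: "x n \<in> carrier (Xt n)" for n using assms by (simp add: EA_carrier)
  show "e (2 * n) (x (2 * n)) \<in> carrier A'" for n using e_closed[OF x, of "2 * n"] by simp
  obtain N where N: "\<forall>n\<in>{n. x n \<noteq> \<zero>\<^bsub>Xt n\<^esub>}. n \<le> N"
    using assms finite_nat_set_iff_bounded_le by (auto simp: EA_carrier)
  have "e (2 * n) (x (2 * n)) = \<zero>\<^bsub>A'\<^esub>" if "n > N" for n
  proof -
    have "x (2 * n) = \<zero>\<^bsub>Xt (2 * n)\<^esub>" using N that by force
    then show ?thesis using e_zero[of "2 * n"] by simp
  qed
  then show "\<exists>n. bound \<zero>\<^bsub>A'\<^esub> n (\<lambda>i. e (2 * i) (x (2 * i)))" by (auto intro: bound.intro)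
qed

lemma even_iso_closed:
  assumes "x \<in> carrier EA"
  shows "even_iso x \<in> carrier FS"
proof -
  have x: "x n \<in> carrier (Xt n)" for n using assms by (simp add: EA_carrier)
  show ?thesis using x[of 0] e_e0[OF x] even_poly[OF assms] by (simp add: even_iso_def S_sel UP_coeff)
qed

lemma even_iso_inj:
  assumes "x \<in> carrier E_even" "y \<in> carrier E_even" "even_iso x = even_iso y"
  shows "x = y"
proof (rule ext)
  fix n :: nat
  have x: "x n \<in> carrier (Xt n)" and y: "y n \<in> carrier (Xt n)" for n
    using assms unfolding even_carrier by (simp_all add: EA_carrier)
  have 0: "e0 (x 0) = e0 (y 0)" and n: "e (2 * i) (x (2 * i)) = e (2 * i) (y (2 * i))" for i
    using assms(3) by (simp_all add: even_iso_def fun_eq_iff)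
  consider "odd n" | "n = 0" | i where "n = 2 * i" "n \<noteq> 0" by (metis evenE)
  then show "x n = y n"
  proof cases
    case 1
    then show ?thesis using assms(1,2) unfolding even_carrier by simp
  next
    case 2
    then show ?thesis using e0_inj[OF x y 0] by simp
  next
    case 3
    then show ?thesis using e_inj[OF x y, of "2 * i"] n[of i] by simp
  qed
qed

lemma even_iso_surj:
  assumes z: "z \<in> carrier FS"
  shows "\<exists>x\<in>carrier E_even. even_iso x = z"
proof -
  have p: "snd z \<in> up A'" and a: "fst z \<in> carrier A" and az: "\<pi> (fst z) = snd z 0"
    using z by (auto simp: S_sel UP_coeff)
  \<comment> \<open>The coefficients are spread over the even degrees and filled up with zero, so
    that \<open>ext_lift\<close> applies.\<close>
  define b where "b n = (if even n then snd z (n div 2) else \<zero>\<^bsub>T n\<^esub>)" for n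
  obtain N where N: "bound \<zero>\<^bsub>A'\<^esub> N (snd z)" using p by blast
  have b0: "b n = \<zero>\<^bsub>T n\<^esub>" if "n > 2 * N" for n
    using bound.bound[OF N, of "n div 2"] that by (auto simp: b_def T_zero)
  have "{n. b n \<noteq> \<zero>\<^bsub>T n\<^esub>} \<subseteq> {..2 * N}"
  proof
    fix n assume "n \<in> {n. b n \<noteq> \<zero>\<^bsub>T n\<^esub>}"
    then show "n \<in> {..2 * N}" using b0[of n] by (cases "n > 2 * N") auto
  qed
  then have "finite {n. b n \<noteq> \<zero>\<^bsub>T n\<^esub>}" by (rule finite_subset) simp
  moreover have "b n \<in> carrier (T n)" for n
    using mem_upD[OF p, of "n div 2"] Tn.zero_closed[of n] by (auto simp: b_def T_carrier)
  ultimately obtain x where x: "x \<in> carrier EA" "e0 (x 0) = fst z" "\<And>n. e n (x n) = b n"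
    using ext_lift[of "fst z" b] a az by (auto simp: b_def)
  have "x n = \<zero>\<^bsub>Xt n\<^esub>" if o: "odd n" for n
  proof -
    have "n \<noteq> 0" using o by (cases n) auto
    then show ?thesis using e_zero_iff[of "x n" n] x(1) x(3)[of n] o by (simp add: EA_carrier b_def)
  qed
  then have "x \<in> carrier E_even" using x(1) unfolding even_carrier by simp
  moreover have "even_iso x = z" using x(2,3) by (simp add: even_iso_def prod_eq_iff b_def fun_eq_iff)
  ultimately show ?thesis by blast
qed

text \<open>In the convolution the terms of odd index vanish with the odd components; the index
  \<open>2 * i\<close> of the rest turns it into a Cauchy product of polynomials.\<close>

lemma even_mult:
  assumes x: "x \<in> carrier E_even" and y: "y \<in> carrier E_even"
  shows "e (2 * n) ((x \<otimes>\<^bsub>EA\<^esub> y) (2 * n)) =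
    (\<Oplus>\<^bsub>A'\<^esub>i\<in>{..n}. e (2 * i) (x (2 * i)) \<otimes>\<^bsub>A'\<^esub> e (2 * (n - i)) (y (2 * (n - i))))"
proof -
  let ?g = "\<lambda>i. theta_mult K f i (2 * n - i) (e i (x i)) (e (2 * n - i) (y (2 * n - i)))"
  have xE: "x \<in> carrier EA" "y \<in> carrier EA" and x0: "\<And>n. odd n \<Longrightarrow> x n = \<zero>\<^bsub>Xt n\<^esub>"
    using x y unfolding even_carrier by auto
  have c: "e i (x i) \<in> carrier (T i)" "e i (y i) \<in> carrier (T i)" for i
    using xE by (simp_all add: EA_carrier)
  have f2: "f2 K f \<in> carrier A'" using q'.hom_closed[OF g2_closed] by (simp add: f2_def q'_def)
  have odd0: "?g i = \<zero>\<^bsub>A'\<^esub>" if "i \<le> 2 * n" "odd i" for i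
  proof -
    have o: "odd (2 * n - i)" using that by simp
    have "e (2 * n - i) (y (2 * n - i)) \<in> carrier A" using c(2)[of "2 * n - i"] o theta_closed by (simp add: T_carrier)
    moreover have "e i (x i) = \<zero>\<^bsub>A\<^esub>" using x0[OF that(2)] that(2) by (simp add: T_zero)
    ultimately show ?thesis using that(2) o f2 by (simp add: theta_mult_def)
  qed
  have ev: "?g (2 * i) = e (2 * i) (x (2 * i)) \<otimes>\<^bsub>A'\<^esub> e (2 * (n - i)) (y (2 * (n - i)))" for i
    by (simp add: theta_mult_def diff_mult_distrib2)
  have evc: "?g (2 * i) \<in> carrier A'" for i
    unfolding ev using c(1)[of "2 * i"] c(2)[of "2 * (n - i)"] by simp
  have gc: "?g i \<in> carrier A'" if "i \<le> 2 * n" for i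
    using evc[of "i div 2"] odd0[OF that] by (cases "even i") simp_all
  have "e (2 * n) ((x \<otimes>\<^bsub>EA\<^esub> y) (2 * n)) = (\<Oplus>\<^bsub>A'\<^esub>i\<in>{..2 * n}. ?g i)"
    using e_mult[OF xE, of "2 * n"] by simp
  also have "\<dots> = (\<Oplus>\<^bsub>A'\<^esub>i\<in>(\<lambda>i. 2 * i) ` {..n}. ?g i)"
  proof (rule A'.add.finprod_mono_neutral_cong_left[symmetric])
    show "?g i = \<zero>\<^bsub>A'\<^esub>" if i: "i \<in> {..2 * n} - (\<lambda>i. 2 * i) ` {..n}" for i
    proof (rule odd0)
      show "i \<le> 2 * n" using i by simp
      show "odd i"
      proof
        assume "even i"
        then obtain j where "i = 2 * j" by blast
        then show False using i by auto
      qed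
    qed
  qed (use gc in auto)
  also have "\<dots> = (\<Oplus>\<^bsub>A'\<^esub>i\<in>{..n}. ?g (2 * i))"
    by (rule A'.finsum_reindex) (use gc in \<open>auto simp: inj_on_def\<close>)
  finally show ?thesis unfolding ev .
qed

lemma even_iso_hom: "even_iso \<in> ring_hom E_even FS"
proof (rule ring_hom_memI)
  fix x y assume xy: "x \<in> carrier E_even" "y \<in> carrier E_even"
  then have xE: "x \<in> carrier EA" "y \<in> carrier EA" unfolding even_carrier by auto
  then have x: "x n \<in> carrier (Xt n)" and y: "y n \<in> carrier (Xt n)" for n by (simp_all add: EA_carrier)
  note u = even_poly[OF xE(1)] even_poly[OF xE(2)]
  show "even_iso x \<in> carrier FS" by (rule even_iso_closed[OF xE(1)])
  have m: "x \<otimes>\<^bsub>E_even\<^esub> y = x \<otimes>\<^bsub>EA\<^esub> y" "x \<oplus>\<^bsub>E_even\<^esub> y = x \<oplus>\<^bsub>EA\<^esub> y" by (simp_all add: Ext_even_algebra_def)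
  show "even_iso (x \<otimes>\<^bsub>E_even\<^esub> y) = even_iso x \<otimes>\<^bsub>FS\<^esub> even_iso y"
    unfolding m even_iso_def using e0_mult[OF xE] even_mult[OF xy] by (simp add: S_sel(2)[OF u])
  show "even_iso (x \<oplus>\<^bsub>E_even\<^esub> y) = even_iso x \<oplus>\<^bsub>FS\<^esub> even_iso y"
    unfolding m even_iso_def using x y e_add[OF x y, of "2 * i" for i]
    by (simp add: S_sel(3)[OF u] EA_add e0_add e_add)
next
  have "e 0 (yoneda_one Aev M) = \<one>\<^bsub>A'\<^esub>" using e_e0[OF yone_closed] by (simp add: e0_one)
  moreover have "\<one>\<^bsub>E_even\<^esub> = \<one>\<^bsub>EA\<^esub>" by (simp add: Ext_even_algebra_def)
  ultimately show "even_iso \<one>\<^bsub>E_even\<^esub> = \<one>\<^bsub>FS\<^esub>"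
    by (simp add: even_iso_def EA_one e0_one S_sel fun_eq_iff)
qed

lemma even_iso_part:
  "even_iso ` Ext_part Aev M (2 * i) = fibre_part A S \<pi> deg0_S (poly_A'_part K f) i"
proof (intro equalityI subsetI)
  have mon: "monom (UP A') a i = (\<lambda>j. if j = i then a else \<zero>\<^bsub>A'\<^esub>)" if "a \<in> carrier A'" for a
    using that by (auto simp: UP_def)
  fix z assume "z \<in> even_iso ` Ext_part Aev M (2 * i)"
  then obtain x where x: "x \<in> Ext_part Aev M (2 * i)" "z = even_iso x" by blast
  have c: "x m \<in> carrier (Xt m)" for m using part_closed[OF x(1)] by (simp add: EA_carrier)
  have 0: "x m = \<zero>\<^bsub>Xt m\<^esub>" if "m \<noteq> 2 * i" for m using x(1) that by (simp add: Ext_part_def graded_part_def)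
  have a: "e (2 * i) (x (2 * i)) \<in> carrier A'" using e_closed[OF c, of "2 * i"] by simp
  have "e (2 * j) (x (2 * j)) = \<zero>\<^bsub>A'\<^esub>" if "j \<noteq> i" for j using 0[of "2 * j"] that e_zero[of "2 * j"] by simp
  then have "snd z = monom (UP A') (e (2 * i) (x (2 * i))) i"
    unfolding mon[OF a] x(2) by (simp add: even_iso_def fun_eq_iff)
  moreover have "fst z = \<zero>\<^bsub>A\<^esub>" if "i \<noteq> 0" using 0[of 0] that by (simp add: x(2) even_iso_def)
  ultimately show "z \<in> fibre_part A S \<pi> deg0_S (poly_A'_part K f) i"
    using even_iso_closed[OF part_closed[OF x(1)]] a unfolding x(2)[symmetric] fibre_part_def poly_A'_part_def by blast
next
  have mon: "monom (UP A') a i = (\<lambda>j. if j = i then a else \<zero>\<^bsub>A'\<^esub>)" if "a \<in> carrier A'" for a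
    using that by (auto simp: UP_def)
  fix z assume z: "z \<in> fibre_part A S \<pi> deg0_S (poly_A'_part K f) i"
  then have "z \<in> carrier FS" unfolding fibre_part_def by blast
  then obtain x where x: "x \<in> carrier E_even" "even_iso x = z" using even_iso_surj by blast
  have c: "x m \<in> carrier (Xt m)" for m using x(1) unfolding even_carrier by (simp add: EA_carrier)
  have "x m = \<zero>\<^bsub>Xt m\<^esub>" if m: "m \<noteq> 2 * i" for m
  proof (cases "odd m \<or> m = 0")
    case True
    have "e0 (x 0) = \<zero>\<^bsub>A\<^esub>" if "m = 0" using z m x(2) that by (auto simp: fibre_part_def even_iso_def)
    then show ?thesis using e0_zero_iff[OF c] True x(1) unfolding even_carrier by auto
  next
    case False
    then obtain j where j: "m = 2 * j" by blast
    obtain a where a: "a \<in> carrier A'" "snd z = monom (UP A') a i" using z by (auto simp: fibre_part_def poly_A'_part_def)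
    have "e m (x m) = snd z j" using x(2) j by (auto simp: even_iso_def)
    then have "e m (x m) = \<zero>\<^bsub>T m\<^esub>" using a(2) mon[OF a(1)] m j by auto
    then show ?thesis using e_zero_iff[OF c] False by simp
  qed
  then have "x \<in> Ext_part Aev M (2 * i)" using c by (simp add: Ext_part_def graded_part_def)
  then show "z \<in> even_iso ` Ext_part Aev M (2 * i)" using x(2) by blast
qed

lemma even_algebra_iso:
  "graded_algebra_iso K E_even (\<lambda>i. Ext_part Aev M (2 * i)) FS (fibre_part A S \<pi> deg0_S (poly_A'_part K f)) even_iso"
  unfolding graded_algebra_iso_def ring_iso_def
proof (intro conjI allI ballI CollectI)
  show "even_iso \<in> ring_hom E_even FS" by (rule even_iso_hom)
  have "even_iso x \<in> carrier FS" if "x \<in> carrier E_even" for x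
    using that even_iso_closed unfolding even_carrier by blast
  then show "bij_betw even_iso (carrier E_even) (carrier FS)"
    unfolding bij_betw_def inj_on_def using even_iso_inj even_iso_surj by blast
  fix c x assume cx: "c \<in> carrier K" "x \<in> carrier E_even"
  then have xE: "x \<in> carrier EA" unfolding even_carrier by auto
  then have x: "x n \<in> carrier (Xt n)" for n by (simp add: EA_carrier)
  have m: "c \<odot>\<^bsub>E_even\<^esub> x = (\<lambda>n. unit_map Aev c \<odot>\<^bsub>Xt n\<^esub> x n)"
    by (simp add: Ext_even_algebra_def EA_smult)
  show "even_iso (c \<odot>\<^bsub>E_even\<^esub> x) = c \<odot>\<^bsub>FS\<^esub> even_iso x"
    unfolding m using cx(1) x e_smult[OF cx(1) x] e0_smult[OF cx(1) x] by (simp add: even_iso_def S_smult[OF cx(1) even_poly[OF xE]])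
qed (rule even_iso_part)

end

theorem theorem8p10:
  fixes K :: "('k, 'z) ring_scheme" and f :: "nat \<Rightarrow> 'k"
  assumes "cring K"
    and "f \<in> carrier (UP K)"
    and "depth_ge_two K (content_ideal K f)"
  shows
    "let A = alg_A K f;
         Aev = tensor K A A;
         M = diag_module A;
         E = restrict_scalars (unit_map Aev) (Ext_algebra Aev M);
         E_even = restrict_scalars (unit_map Aev) (Ext_even_algebra Aev M);
         \<pi> = proj_A' K f;
         B = theta_alg K f;
         deg0_B = (\<lambda>b. b 0);
         S = poly_A' K f;
         deg0_S = (\<lambda>p. coeff (UP (alg_A' K f)) p 0)
     in graded_commutative E (Ext_part Aev M) \<and>
        (\<exists>h. graded_algebra_iso K
               E (Ext_part Aev M)
               (fibre_product A B \<pi> deg0_B) (fibre_part A B \<pi> deg0_B (theta_part K f)) h) \<and>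
        (\<exists>h. graded_algebra_iso K
               E_even (\<lambda>i. Ext_part Aev M (2 * i))
               (fibre_product A S \<pi> deg0_S) (fibre_part A S \<pi> deg0_S (poly_A'_part K f)) h)"
proof -
  interpret hypersurface K f
    by (intro hypersurface.intro polynomial_quotient.intro hypersurface_axioms.intro assms)
  show ?thesis
    unfolding Let_def using ext_graded_commutative ext_algebra_iso even_algebra_iso by blast
qed

end
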